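(* Let $A=\bigoplus_{i=1}^n M_{a_i}(\mathbb{C})$ be a finite-dimensional $C^*$-algebra (with $n,a_1,\dots,a_n\in\mathbb{N}$, all positive), and let $\vec s=[s_1,\dots,s_n]$ be a trace vector on $A$ all of whose components are rational: each $s_i$ is a positive rational number and $\sum_{i=1}^n a_i s_i=1$. Let $R$ be the hyperfinite $II_1$ factor with canonical trace $\tau$. Then there exists a unital $*$-endomorphism $\Phi$ of $R$ such that for every integer $k\ge 1$ the relative commutant $\Phi^k(R)'\cap R$ is isomorphic, as a $*$-algebra, to the $k$-fold tensor power $\otimes^k A$. Moreover the canonical trace $\tau$ extends the trace on $A$ given by $\vec s$; that is, the isomorphism $\Phi(R)'\cap R\cong A$ can be chosen so that the restriction of $\tau$ corresponds to the trace on $A$ given by $\vec s$.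
   Context: For $A=\bigoplus_{i=1}^n M_{a_i}(\mathbb{C})$, a trace vector $\vec s=[s_1,\dots,s_n]$ with $\sum_i a_i s_i=1$ determines the normalized faithful trace on $A$ given by $\bigoplus_i x_i\mapsto \sum_i s_i\,\mathrm{Tr}(x_i)$, where $\mathrm{Tr}$ is the unnormalized matrix trace (so $s_i$ is the trace of a minimal projection of the $i$-th summand). The canonical trace $\tau$ of a $II_1$ factor is its unique normalized faithful normal trace. For a subalgebra $N\subset R$, $N'\cap R$ is the set of elements of $R$ commuting with $N$; $\Phi^k$ is the $k$-fold composition of $\Phi$. *)

theory Defs
  imports
    "HOL-Analysis.Inner_Product"
    "HOL-Algebra.QuotRing"
    "Jordan_Normal_Form.Schur_Decomposition"
begin

section \<open>Algebras with involution over the complex numbers\<close>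

record 'a star_algebra = "(complex, 'a) module" +
  star :: "'a \<Rightarrow> 'a"

definition star_hom ::
  "('a, 'm) star_algebra_scheme \<Rightarrow> ('b, 'n) star_algebra_scheme \<Rightarrow> ('a \<Rightarrow> 'b) set" where
  "star_hom A B = {h \<in> Ring.ring_hom A B.
     (\<forall>c. \<forall>x\<in>carrier A. h (c \<odot>\<^bsub>A\<^esub> x) = c \<odot>\<^bsub>B\<^esub> h x) \<and>
     (\<forall>x\<in>carrier A. h (star A x) = star B (h x))}"

text \<open>Homomorphisms are unital, since those in \<^const>\<open>Ring.ring_hom\<close> are.\<close>

definition star_iso ::
  "('a, 'm) star_algebra_scheme \<Rightarrow> ('b, 'n) star_algebra_scheme \<Rightarrow> ('a \<Rightarrow> 'b) set" where
  "star_iso A B = {h \<in> star_hom A B. bij_betw h (carrier A) (carrier B)}"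

definition star_isomorphic ::
  "('a, 'm) star_algebra_scheme \<Rightarrow> ('b, 'n) star_algebra_scheme \<Rightarrow> bool" where
  "star_isomorphic A B \<longleftrightarrow> star_iso A B \<noteq> {}"


subsection \<open>Quotients and tensor powers\<close>

text \<open>The quotient ring \<^term>\<open>A Quot I\<close> with the induced scalar multiplication and involution,
  for an ideal closed under the involution of the algebra.\<close>

definition star_quot :: "('a, 'm) star_algebra_scheme \<Rightarrow> 'a set \<Rightarrow> 'a set star_algebra" where
  "star_quot A I =
     \<lparr>carrier = carrier (A Quot I), monoid.mult = monoid.mult (A Quot I), one = one (A Quot I),
      zero = zero (A Quot I), add = add (A Quot I),
      module.smult = (\<lambda>c X. \<Union>x\<in>X. I +>\<^bsub>A\<^esub> (c \<odot>\<^bsub>A\<^esub> x)),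
      star = (\<lambda>X. \<Union>x\<in>X. I +>\<^bsub>A\<^esub> star A x)\<rparr>"

text \<open>
  The free complex vector space on the set of \<open>k\<close>-tuples (lists of length \<open>k\<close>) of elements
  of \<open>A\<close>, with product and involution extending the componentwise ones on tuples.
  Elements are the finitely supported coefficient functions.
\<close>

definition free_power :: "nat \<Rightarrow> ('a, 'm) star_algebra_scheme \<Rightarrow> ('a list \<Rightarrow> complex) star_algebra" where
  "free_power k A =
     \<lparr>carrier = {f. finite {u. f u \<noteq> 0} \<and> (\<forall>u. f u \<noteq> 0 \<longrightarrow> length u = k \<and> set u \<subseteq> carrier A)},
      monoid.mult = (\<lambda>f g w. \<Sum>(u, v) \<in> {(u, v). f u \<noteq> 0 \<and> g v \<noteq> 0 \<and> map2 (monoid.mult A) u v = w}. f u * g v),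
      one = (\<lambda>w. if w = replicate k \<one>\<^bsub>A\<^esub> then 1 else 0),
      zero = (\<lambda>w. 0),
      add = (\<lambda>f g w. f w + g w),
      module.smult = (\<lambda>c f w. c * f w),
      star = (\<lambda>f w. \<Sum>u \<in> {u. f u \<noteq> 0 \<and> map (star A) u = w}. cnj (f u))\<rparr>"

definition free_gen :: "'a list \<Rightarrow> 'a list \<Rightarrow> complex" where
  "free_gen u = (\<lambda>w. if w = u then 1 else 0)"

definition multilinear_relations ::
  "nat \<Rightarrow> ('a, 'm) star_algebra_scheme \<Rightarrow> ('a list \<Rightarrow> complex) set" where
  "multilinear_relations k A =
     {(\<lambda>w. free_gen (u[j := x \<oplus>\<^bsub>A\<^esub> y]) w - free_gen (u[j := x]) w - free_gen (u[j := y]) w) | u j x y.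
        length u = k \<and> set u \<subseteq> carrier A \<and> j < k \<and> x \<in> carrier A \<and> y \<in> carrier A} \<union>
     {(\<lambda>w. free_gen (u[j := c \<odot>\<^bsub>A\<^esub> x]) w - c * free_gen (u[j := x]) w) | u j c x.
        length u = k \<and> set u \<subseteq> carrier A \<and> j < k \<and> x \<in> carrier A}"

text \<open>
  The \<open>k\<close>-fold algebraic tensor power.  In an algebra \<open>A\<close>, a generator times a relation is again a relation, so
  the ideal generated by the relations is their linear span, and the quotient is
  the usual tensor product of vector spaces; the coset of \<^term>\<open>free_gen [x\<^sub>1, x\<^sub>2]\<close> is the
  elementary tensor of \<open>x\<^sub>1\<close> and \<open>x\<^sub>2\<close>.
\<close>

definition tensor_power ::
  "nat \<Rightarrow> ('a, 'm) star_algebra_scheme \<Rightarrow> ('a list \<Rightarrow> complex) set star_algebra" where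
  "tensor_power k A =
     star_quot (free_power k A) (genideal (free_power k A) (multilinear_relations k A))"


subsection \<open>Direct sums of full matrix algebras\<close>

definition multimatrix_algebra :: "nat \<Rightarrow> (nat \<Rightarrow> nat) \<Rightarrow> (nat \<Rightarrow> complex mat) star_algebra" where
  "multimatrix_algebra n a =
     \<lparr>carrier = (\<Pi>\<^sub>E i\<in>{..<n}. carrier_mat (a i) (a i)),
      monoid.mult = (\<lambda>x y. \<lambda>i\<in>{..<n}. x i * y i),
      one = (\<lambda>i\<in>{..<n}. 1\<^sub>m (a i)),
      zero = (\<lambda>i\<in>{..<n}. 0\<^sub>m (a i) (a i)),
      add = (\<lambda>x y. \<lambda>i\<in>{..<n}. x i + y i),
      module.smult = (\<lambda>c x. \<lambda>i\<in>{..<n}. c \<cdot>\<^sub>m x i),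
      star = (\<lambda>x. \<lambda>i\<in>{..<n}. mat_adjoint (x i))\<rparr>"

definition mat_trace :: "complex mat \<Rightarrow> complex" where
  "mat_trace x = (\<Sum>i<dim_row x. x $$ (i, i))"

definition is_trace_vector :: "nat \<Rightarrow> (nat \<Rightarrow> nat) \<Rightarrow> (nat \<Rightarrow> real) \<Rightarrow> bool" where
  "is_trace_vector n a s \<longleftrightarrow> (\<forall>i<n. s i > 0) \<and> (\<Sum>i<n. real (a i) * s i) = 1"

definition multimatrix_trace :: "nat \<Rightarrow> (nat \<Rightarrow> real) \<Rightarrow> (nat \<Rightarrow> complex mat) \<Rightarrow> complex" where
  "multimatrix_trace n s x = (\<Sum>i<n. complex_of_real (s i) * mat_trace (x i))"


section \<open>Operators on complex Hilbert spaces\<close>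

text \<open>The inner product is antilinear in the first argument; the norm is the one inherited from
  \<^class>\<open>real_inner\<close>, i.e. the square root of \<open>Re (cinner x x)\<close>.\<close>

class complex_hilbert_space = real_inner + complete_space +
  fixes scaleC :: "complex \<Rightarrow> 'a \<Rightarrow> 'a" (infixr \<open>*\<^sub>C\<close> 75)
    and cinner :: "'a \<Rightarrow> 'a \<Rightarrow> complex"
  assumes scaleC_add_right: "c *\<^sub>C (x + y) = c *\<^sub>C x + c *\<^sub>C y"
    and scaleC_add_left: "(c + d) *\<^sub>C x = c *\<^sub>C x + d *\<^sub>C x"
    and scaleC_scaleC: "c *\<^sub>C (d *\<^sub>C x) = (c * d) *\<^sub>C x"
    and scaleR_scaleC: "scaleR r x = complex_of_real r *\<^sub>C x"
    and cinner_commute: "cinner x y = cnj (cinner y x)"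
    and cinner_add_right: "cinner x (y + z) = cinner x y + cinner x z"
    and cinner_scaleC_right: "cinner x (c *\<^sub>C y) = c * cinner x y"
    and inner_eq_Re_cinner: "inner x y = Re (cinner x y)"

instantiation complex :: complex_hilbert_space
begin

definition scaleC_complex :: "complex \<Rightarrow> complex \<Rightarrow> complex" where
  "scaleC_complex c x = c * x"

definition cinner_complex :: "complex \<Rightarrow> complex \<Rightarrow> complex" where
  "cinner_complex x y = cnj x * y"

instance
  by standard
    (simp_all add: scaleC_complex_def cinner_complex_def inner_complex_def algebra_simps
      scaleR_conv_of_real)

end

definition bounded_operators :: "('h::complex_hilbert_space \<Rightarrow> 'h) set" where
  "bounded_operators = {T. bounded_linear T \<and> (\<forall>c x. T (c *\<^sub>C x) = c *\<^sub>C T x)}"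

definition op_adjoint :: "('h::complex_hilbert_space \<Rightarrow> 'h) \<Rightarrow> 'h \<Rightarrow> 'h" where
  "op_adjoint T = (THE S. S \<in> bounded_operators \<and> (\<forall>x y. cinner (S x) y = cinner x (T y)))"

definition operator_algebra :: "('h::complex_hilbert_space \<Rightarrow> 'h) set \<Rightarrow> ('h \<Rightarrow> 'h) star_algebra" where
  "operator_algebra M =
     \<lparr>carrier = M, monoid.mult = (\<circ>), one = id, zero = (\<lambda>v. 0), add = (\<lambda>S T v. S v + T v),
      module.smult = (\<lambda>c T v. c *\<^sub>C T v), star = op_adjoint\<rparr>"

definition relative_commutant ::
  "('h::complex_hilbert_space \<Rightarrow> 'h) set \<Rightarrow> ('h \<Rightarrow> 'h) set \<Rightarrow> ('h \<Rightarrow> 'h) set" where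
  "relative_commutant N M = {x \<in> M. \<forall>y\<in>N. x \<circ> y = y \<circ> x}"

abbreviation commutant :: "('h::complex_hilbert_space \<Rightarrow> 'h) set \<Rightarrow> ('h \<Rightarrow> 'h) set" where
  "commutant N \<equiv> relative_commutant N bounded_operators"


subsection \<open>Von Neumann algebras and factors\<close>

definition von_neumann_algebra :: "('h::complex_hilbert_space \<Rightarrow> 'h) set \<Rightarrow> bool" where
  "von_neumann_algebra M \<longleftrightarrow>
     M \<subseteq> bounded_operators \<and> (\<forall>x\<in>M. op_adjoint x \<in> M) \<and> commutant (commutant M) = M"

text \<open>The condition \<^term>\<open>id \<noteq> (\<lambda>v. 0)\<close> excludes the zero algebra on the zero space.\<close>

definition factor :: "('h::complex_hilbert_space \<Rightarrow> 'h) set \<Rightarrow> bool" where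
  "factor M \<longleftrightarrow> von_neumann_algebra M \<and> (id :: 'h \<Rightarrow> 'h) \<noteq> (\<lambda>v. 0) \<and>
     relative_commutant M M = {(\<lambda>v. c *\<^sub>C v) | c. True}"

definition projections :: "('h::complex_hilbert_space \<Rightarrow> 'h) set \<Rightarrow> ('h \<Rightarrow> 'h) set" where
  "projections M = {p \<in> M. op_adjoint p = p \<and> p \<circ> p = p}"

definition minimal_projection ::
  "('h::complex_hilbert_space \<Rightarrow> 'h) set \<Rightarrow> ('h \<Rightarrow> 'h) \<Rightarrow> bool" where
  "minimal_projection M p \<longleftrightarrow> p \<in> projections M \<and> p \<noteq> (\<lambda>v. 0) \<and>
     (\<forall>q\<in>projections M. p \<circ> q = q \<longrightarrow> q = (\<lambda>v. 0) \<or> q = p)"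

text \<open>A factor is of type \<open>II\<^sub>1\<close> if it has no minimal projections (it is not of type I) and its unit
  is a finite projection, i.e. every isometry in it is unitary.\<close>

definition II1_factor :: "('h::complex_hilbert_space \<Rightarrow> 'h) set \<Rightarrow> bool" where
  "II1_factor M \<longleftrightarrow> factor M \<and> (\<nexists>p. minimal_projection M p) \<and>
     (\<forall>v\<in>M. op_adjoint v \<circ> v = id \<longrightarrow> v \<circ> op_adjoint v = id)"

definition finite_dim_star_subalgebra :: "('h::complex_hilbert_space \<Rightarrow> 'h) set \<Rightarrow> bool" where
  "finite_dim_star_subalgebra F \<longleftrightarrow>
     F \<subseteq> bounded_operators \<and> id \<in> F \<and>
     (\<forall>x\<in>F. \<forall>y\<in>F. x \<circ> y \<in> F \<and> (\<lambda>v. x v + y v) \<in> F) \<and>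
     (\<forall>x\<in>F. op_adjoint x \<in> F \<and> (\<forall>c. (\<lambda>v. c *\<^sub>C x v) \<in> F)) \<and>
     (\<exists>B. finite B \<and> B \<subseteq> F \<and> (\<forall>x\<in>F. \<exists>c. x = (\<lambda>v. \<Sum>b\<in>B. c b *\<^sub>C b v)))"

text \<open>Hyperfiniteness in the sense of Murray and von Neumann.  By the bicommutant theorem, the
  double commutant of the union is its weak operator closure.\<close>

definition hyperfinite :: "('h::complex_hilbert_space \<Rightarrow> 'h) set \<Rightarrow> bool" where
  "hyperfinite M \<longleftrightarrow>
     (\<exists>F :: nat \<Rightarrow> ('h \<Rightarrow> 'h) set. (\<forall>m. finite_dim_star_subalgebra (F m)) \<and>
        (\<forall>m. F m \<subseteq> F (Suc m)) \<and> M = commutant (commutant (\<Union>m. F m)))"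


subsection \<open>Traces\<close>

definition self_adjoint_elements :: "('h::complex_hilbert_space \<Rightarrow> 'h) set \<Rightarrow> ('h \<Rightarrow> 'h) set" where
  "self_adjoint_elements M = {x \<in> M. op_adjoint x = x}"

definition op_le :: "('h::complex_hilbert_space \<Rightarrow> 'h) \<Rightarrow> ('h \<Rightarrow> 'h) \<Rightarrow> bool" where
  "op_le x y \<longleftrightarrow> (\<forall>v. Re (cinner v (x v)) \<le> Re (cinner v (y v)))"

definition is_supremum_in ::
  "('h::complex_hilbert_space \<Rightarrow> 'h) set \<Rightarrow> ('h \<Rightarrow> 'h) set \<Rightarrow> ('h \<Rightarrow> 'h) \<Rightarrow> bool" where
  "is_supremum_in M D x \<longleftrightarrow> x \<in> self_adjoint_elements M \<and> (\<forall>d\<in>D. op_le d x) \<and>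
     (\<forall>y\<in>self_adjoint_elements M. (\<forall>d\<in>D. op_le d y) \<longrightarrow> op_le x y)"

definition normal_functional ::
  "('h::complex_hilbert_space \<Rightarrow> 'h) set \<Rightarrow> (('h \<Rightarrow> 'h) \<Rightarrow> complex) \<Rightarrow> bool" where
  "normal_functional M \<tau> \<longleftrightarrow>
     (\<forall>D x. D \<noteq> {} \<and> D \<subseteq> self_adjoint_elements M \<and>
        (\<forall>d\<in>D. \<forall>e\<in>D. \<exists>f\<in>D. op_le d f \<and> op_le e f) \<and> is_supremum_in M D x \<longrightarrow>
        Re (\<tau> x) = (SUP d\<in>D. Re (\<tau> d)))"

text \<open>Normalized faithful normal traces; only the values on \<open>M\<close> matter.  On a factor of type
  \<open>II\<^sub>1\<close> there is exactly one, its canonical trace.\<close>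

definition canonical_trace ::
  "('h::complex_hilbert_space \<Rightarrow> 'h) set \<Rightarrow> (('h \<Rightarrow> 'h) \<Rightarrow> complex) \<Rightarrow> bool" where
  "canonical_trace M \<tau> \<longleftrightarrow>
     (\<forall>x\<in>M. \<forall>y\<in>M. \<tau> (\<lambda>v. x v + y v) = \<tau> x + \<tau> y) \<and>
     (\<forall>c. \<forall>x\<in>M. \<tau> (\<lambda>v. c *\<^sub>C x v) = c * \<tau> x) \<and>
     (\<forall>x\<in>M. \<forall>y\<in>M. \<tau> (x \<circ> y) = \<tau> (y \<circ> x)) \<and>
     (\<forall>x\<in>M. Im (\<tau> (op_adjoint x \<circ> x)) = 0 \<and> Re (\<tau> (op_adjoint x \<circ> x)) \<ge> 0) \<and>
     \<tau> id = 1 \<and>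
     (\<forall>x\<in>M. \<tau> (op_adjoint x \<circ> x) = 0 \<longrightarrow> x = (\<lambda>v. 0)) \<and>
     normal_functional M \<tau>"

end

theory Submission
  imports Defs "HOL-Analysis.Elementary_Normed_Spaces" "HOL-Analysis.Convex" "HOL-Library.Countable_Set"
begin

text \<open>
  \<open>R\<close> is generated by commuting systems of matrix units \<open>E t\<close> of prescribed sizes \<open>d t\<close>, and every family
  \<open>G\<close> in \<open>R\<close> of the same sizes is the image of \<open>E\<close> under an endomorphism. Let \<open>s i = p i / q\<close> and let one
  size be \<open>q = (\<Sum>i<n. a i * p i)\<close>; there \<open>A\<close> embeds with multiplicities \<open>p i\<close>. The other sizes are chosen
  such that replacing \<open>q\<close> by \<open>p i\<close> only permutes them, so the corner of a minimal projection of the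
  \<open>i\<close>-th summand contains a copy of \<open>R\<close>. \<open>\<Phi>\<close> is the diagonal sum of these copies, amplified \<open>a i\<close> times.
  The relative commutant has no blocks between distinct summands because the permutations spread infinitely
  many positions of size 2 differently; hence it is \<open>A\<close>, and \<open>\<Phi>\<^sup>k(R)' \<inter> R\<close> is spanned by
  \<open>A \<Phi>(A) \<dots> \<Phi>\<^sup>k\<^sup>-\<^sup>1(A)\<close>.\<close>

text \<open>\<open>R\<close> is known only by its defining properties, so matrix units of prescribed
  sizes must be found inside it. This follows Murray and von Neumann: finite-dimensional subalgebras
  approximate in the 2-norm, and since projections of every trace exist, their blocks can be recut
  at small cost into equal pieces, whose number may be any sufficiently large integer. This freedom
  of sizes is where rationality enters. A minimal projection of the \<open>i\<close>-th summand has
  trace \<open>p i / q\<close>, and its corner carries size \<open>p i\<close> where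
  \<open>R\<close> carries \<open>q\<close>; with infinitely many positions of the sizes
  \<open>p i\<close> and \<open>q\<close>, a shift as in Hilbert's hotel restores the list.
  Positions of size 2 carry symmetries of trace zero. An image of such a symmetry involves different
  positions in different summands, and far out these become independent of any fixed element; an
  element of the relative commutant joining two summands would intertwine them, which forces its
  2-norm to be zero. The tensor power is a quotient of a free object: the relations reduce its
  generators to words in matrix units, and the values of these words are independent in
  \<open>R\<close>.\<close>

notation LIMSEQ (infix "---->" 60) and iff (infixr "<->" 25)

lemmas diff_distribs = left_diff_distrib right_diff_distrib
lemmas sum_distribs = sum_distrib_left sum_distrib_right

section \<open>Complex Hilbert spaces\<close>

lemma scaleC_one [simp]: "1 *\<^sub>C x = x" using scaleR_scaleC[of 1 x] by simp

lemma scaleC_zero_left [simp]: "0 *\<^sub>C x = 0" using scaleR_scaleC[of 0 x] by simp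

lemma scaleC_zero_right [simp]: "c *\<^sub>C (0::'h::complex_hilbert_space) = 0" using scaleC_add_right[of c "0::'h" 0] by simp

lemma scaleC_minus_right [simp]: "c *\<^sub>C (- x) = - (c *\<^sub>C x)"
 using scaleC_add_right[of c x "- x"] by (simp add: eq_neg_iff_add_eq_0 add.commute)

lemma scaleC_minus_left: "(- c) *\<^sub>C x = - (c *\<^sub>C x)" using scaleC_add_left[of c "- c" x] by (simp add: eq_neg_iff_add_eq_0 add.commute)

lemma scaleC_diff_right: "c *\<^sub>C (x - y) = c *\<^sub>C x - c *\<^sub>C y" using scaleC_add_right[of c x "- y"] by simp

lemma cinner_add_left:
 "cinner (x + y) z = cinner x z + cinner y z" by (metis cinner_add_right cinner_commute complex_cnj_add)

lemma cinner_scaleC_left: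
 "cinner (c *\<^sub>C x) z = cnj c * cinner x z" by (metis cinner_scaleC_right cinner_commute complex_cnj_mult)

lemma cinner_zero [simp]: "cinner (x::'h::complex_hilbert_space) 0 = 0" "cinner 0 (x::'h) = 0"
 using cinner_scaleC_right[of x 0 0] cinner_scaleC_left[of 0 0 x] by simp_all

lemma cinner_minus_right [simp]: "cinner x (- y) = - cinner x y" using cinner_scaleC_right[of x "- 1" y] by (simp add: scaleC_minus_left)

lemma cinner_minus_left [simp]: "cinner (- x) y = - cinner x y" using cinner_scaleC_left[of "- 1" x y] by (simp add: scaleC_minus_left)

lemma cinner_diff_right: "cinner x (y - z) = cinner x y - cinner x z" using cinner_add_right[of x y "- z"] by simp

lemma cinner_diff_left: "cinner (x - y) z = cinner x z - cinner y z" using cinner_add_left[of x "- y" z] by simp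

lemma cinner_self: "cinner x x = of_real ((norm x)\<^sup>2)"
proof -
 have "Im (cinner x x) = 0" using cinner_commute[of x x] by (metis Im_complex_of_real complex_cnj_cancel_iff Reals_cnj_iff complex_is_Real_iff)
 moreover have "Re (cinner x x) = (norm x)\<^sup>2" by (simp add: inner_eq_Re_cinner[symmetric] power2_norm_eq_inner)
 ultimately show ?thesis by (simp add: complex_eq_iff)
qed

lemma Re_cinner_self: "Re (cinner x x) = (norm x)\<^sup>2" by (simp add: cinner_self)

lemma norm_scaleC: "norm (c *\<^sub>C x) = cmod c * norm x"
proof -
 have "of_real ((norm (c *\<^sub>C x))\<^sup>2) = (c * cnj c) * of_real ((norm x)\<^sup>2)"
  by (simp only: cinner_self[symmetric] cinner_scaleC_left cinner_scaleC_right) simp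
 also have "... = of_real ((cmod c * norm x)\<^sup>2)" by (simp add: complex_mult_cnj cmod_power2[symmetric] power_mult_distrib)
 finally have "(norm (c *\<^sub>C x))\<^sup>2 = (cmod c * norm x)\<^sup>2" by (simp only: of_real_eq_iff)
 thus ?thesis by (simp add: power2_eq_iff_nonneg)
qed

lemma cinner_bound: "cmod (cinner x y) <= norm x * norm y"
proof -
 define c where "c = cnj (sgn (cinner x y))"
 have c: "cmod c <= 1" by (simp add: c_def norm_sgn)
 have "cinner x (c *\<^sub>C y) = of_real (cmod (cinner x y))"
 proof (cases "cinner x y = 0")
  case False
  hence "cnj (sgn (cinner x y)) * cinner x y = of_real (cmod (cinner x y))"
   by (simp add: sgn_eq complex_norm_square[symmetric] mult.commute power2_eq_square)
  thus ?thesis by (simp add: cinner_scaleC_right c_def)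
 qed (simp add: cinner_scaleC_right)
 hence "cmod (cinner x y) = inner x (c *\<^sub>C y)" by (simp add: inner_eq_Re_cinner)
 also have "... <= norm x * norm (c *\<^sub>C y)" by (rule norm_cauchy_schwarz)
 also have "... <= norm x * norm y" using c by (simp add: norm_scaleC mult_left_mono mult_left_le_one_le)
 finally show ?thesis .
qed

lemma bounded_bilinear_cinner: "bounded_bilinear (cinner :: 'h::complex_hilbert_space => _)"
 by standard (auto simp: cinner_add_left cinner_add_right scaleR_scaleC cinner_scaleC_left
   cinner_scaleC_right scaleC_complex_def intro!: exI[of _ 1] cinner_bound)

lemmas tendsto_cinner = bounded_bilinear.tendsto[OF bounded_bilinear_cinner]

lemma tendsto_scaleC:
 "(f \<longlongrightarrow> a) F ==> ((%x. c *\<^sub>C (f x :: 'h::complex_hilbert_space)) \<longlongrightarrow> c *\<^sub>C a) F"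
proof -
 have "bounded_linear (%x::'h. c *\<^sub>C x)" by (rule bounded_linear_intro[where K = "cmod c"])
   (simp_all add: scaleC_add_right scaleR_scaleC scaleC_scaleC norm_scaleC mult.commute)
 thus "(f \<longlongrightarrow> a) F ==> ?thesis" by (rule bounded_linear.tendsto)
qed

lemma cinner_eqI: "(!!z. cinner x z = cinner y z) ==> x = (y::'h::complex_hilbert_space)"
proof -
 assume "!!z. cinner x z = cinner y z"
 hence "cinner (x - y) (x - y) = 0" by (simp add: cinner_diff_left)
 thus ?thesis by (simp add: cinner_self)
qed

section \<open>The Riesz representation theorem on closures of subspaces\<close>

definition complex_subspace :: "(nat => 'h::complex_hilbert_space) set => bool" where
 "complex_subspace S <-> (%k. 0) : S & (ALL u:S. ALL v:S. (%k. u k + v k) : S) &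
   (ALL c. ALL u:S. (%k. c *\<^sub>C u k) : S)"

text \<open>
  Families of vectors stand for elements of the \<open>K\<close>-fold direct sum of the Hilbert space, whose
  dimension cannot be put into a type.  The representing vector is the minimum of
  \<open>\<parallel>u\<parallel>\<^sup>2 - 2 Re (f u)\<close> over the closure of \<open>S\<close>.
\<close>

lemma riesz_family:
 fixes S :: "(nat => 'h::complex_hilbert_space) set" and f :: "(nat => 'h) => complex" assumes S: "complex_subspace S"
  and fadd: "!!u v. u : S ==> v : S ==> f (%k. u k + v k) = f u + f v" and fscale: "!!c u. u : S ==> f (%k. c *\<^sub>C u k) = c * f u"
  and bound: "!!u. u : S ==> (cmod (f u))\<^sup>2 <= C * (SUM k<K. (norm (u k))\<^sup>2)"
 shows "EX z X. (ALL n. X n : S) & (ALL k<K. (%n. X n k) ----> z k) &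
  (ALL u:S. f u = (SUM k<K. cinner (z k) (u k)))"
proof -
 have S0: "(%k. 0) : S" and Sadd: "!!u v. u : S ==> v : S ==> (%k. u k + v k) : S" and Sscale: "!!c u. u : S ==> (%k. c *\<^sub>C u k) : S"
  using S by (auto simp: complex_subspace_def)
 define N where "N u = (SUM k<K. (norm (u k :: 'h))\<^sup>2)" for u
 define g where "g u = N u - 2 * Re (f u)" for u
 have N0: "N u >= 0" for u by (simp add: N_def sum_nonneg)
 \<comment> \<open>By the bound and the inequality between geometric and arithmetic mean,
   \<open>cmod (f u)\<close> is at most \<open>(|C| + N u) / 2\<close>, so the infimum below is
   finite.\<close>
 have low: "g u >= - \<bar>C\<bar>" if "u : S" for u
 proof -
  have "(cmod (f u))\<^sup>2 <= \<bar>C\<bar> * N u" using bound[OF that] N0[of u] by (metis (no_types) N_def abs_ge_self mult_right_mono order_trans)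
  also have "... <= ((\<bar>C\<bar> + N u) / 2)\<^sup>2"
   using sum_squares_ge_zero[of "\<bar>C\<bar> - N u" 0] by (simp add: power2_eq_square field_simps)
  finally have "cmod (f u) <= (\<bar>C\<bar> + N u) / 2"
   using N0[of u] by (meson abs_ge_zero add_nonneg_nonneg divide_nonneg_pos power2_le_imp_le zero_less_numeral)
  thus ?thesis using complex_Re_le_cmod[of "f u"] by (simp add: g_def)
 qed
 define m where "m = Inf (g ` S)"
 have bdd: "bdd_below (g ` S)" using low by (auto simp: bdd_below_def)
 have mle: "m <= g u" if "u : S" for u unfolding m_def by (intro cInf_lower imageI that bdd)
 have "EX u:S. g u < m + 1 / real (Suc n)" for n
 proof -
  have "Inf (g ` S) < m + 1 / real (Suc n)" by (simp add: m_def)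
  moreover have "g ` S ~= {}" using S0 by blast
  ultimately show ?thesis by (subst (asm) cInf_less_iff) (use bdd in auto)
 qed
 then obtain X where XS: "!!n. X n : S" and Xm: "!!n. g (X n) < m + 1 / real (Suc n)" by metis
 have expand: "g (%k. u k + c *\<^sub>C v k) = g u + (cmod c)\<^sup>2 * N v + 2 * Re (c * ((SUM k<K. cinner (u k) (v k)) - f v))"
  if "u : S" "v : S" for u v c
 proof -
  have "(norm (x + c *\<^sub>C y))\<^sup>2 = (norm x)\<^sup>2 + (cmod c)\<^sup>2 * (norm y)\<^sup>2 + 2 * Re (c * cinner x y)" for x y :: 'h
  proof -
   have "cinner (x + c *\<^sub>C y) (x + c *\<^sub>C y) = cinner x x + (c * cinner x y + cnj (c * cinner x y)) + cnj c * c * cinner y y"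
    by (simp add: cinner_add_left cinner_add_right cinner_scaleC_left cinner_scaleC_right cinner_commute[of y x] algebra_simps)
   hence "Re (cinner (x + c *\<^sub>C y) (x + c *\<^sub>C y)) = Re (cinner x x) + Re (cnj c * c * cinner y y) + 2 * Re (c * cinner x y)"
    by (simp only: plus_complex.sel complex_cnj) simp
   moreover have "cnj c * c * cinner y y = of_real ((cmod c)\<^sup>2 * (norm y)\<^sup>2)"
    using complex_norm_square[of c] by (simp add: cinner_self mult.commute[of "cnj c"])
   ultimately show ?thesis by (simp add: Re_cinner_self)
  qed
  hence "N (%k. u k + c *\<^sub>C v k) = N u + (cmod c)\<^sup>2 * N v + 2 * Re (c * (SUM k<K. cinner (u k) (v k)))"
   by (simp add: N_def sum.distrib sum_distrib_left)
  moreover have "f (%k. u k + c *\<^sub>C v k) = f u + c * f v" using that by (simp add: fadd fscale Sscale)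
  ultimately show ?thesis by (simp add: g_def algebra_simps)
 qed
 \<comment> \<open>The midpoint of two near-minimizers has value at least \<open>m\<close>; the
   parallelogram identity \<open>N u / 2 = g (X i) + g (X j) - 2 * mid\<close> then bounds their
   distance.\<close>
 have close: "N (%k. X i k - X j k) <= 2 * (1 / real (Suc i) + 1 / real (Suc j))" for i j
 proof -
  define u where "u = (%k. X i k - X j k)"
  have eq: "u = (%k. X i k + (-1) *\<^sub>C X j k)" by (simp add: u_def scaleC_minus_left)
  have uS: "u : S" unfolding eq by (intro Sadd Sscale XS)
  have e: "(1/2) *\<^sub>C u k + (1/2) *\<^sub>C u k = u k" for k by (simp add: scaleC_add_left[symmetric])
  have Xi: "X i = (%k. X j k + 1 *\<^sub>C u k)" by (simp add: u_def)
  define mid where "mid = g (%k. X j k + (1/2) *\<^sub>C u k)"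
  define p q where "p = 1 / real (Suc i)" and "q = 1 / real (Suc j)"
  define r where "r = Re ((SUM k<K. cinner (X j k) (u k)) - f u)"
  have "g (X i) = g (X j) + N u + 2 * r" unfolding r_def using expand[OF XS[of j] uS, of 1] Xi by simp
  moreover have "mid = g (X j) + (1/4) * N u + r" unfolding r_def mid_def using expand[OF XS[of j] uS, of "1/2"] by (simp add: power2_eq_square)
  moreover have "m <= mid" unfolding mid_def by (intro mle Sadd Sscale XS uS)
  moreover have "g (X i) < m + p" "g (X j) < m + q" unfolding p_def q_def by (rule Xm)+
  ultimately have "N u <= 2 * (p + q)" by argo
  thus ?thesis by (simp add: u_def p_def q_def)
 qed
 have "EX z. (%n. X n k) ----> z" if k: "k < K" for k
 proof -
  have "Cauchy (%n. X n k)"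
  proof (rule metric_CauchyI)
   fix e :: real assume e: "e > 0"
   obtain M where M: "1 / real (Suc M) < e\<^sup>2 / 4" using nat_approx_posE[of "e\<^sup>2 / 4"] e by auto
   have "dist (X i k) (X j k) < e" if ij: "i >= M" "j >= M" for i j
   proof -
    have "(norm (X i k - X j k))\<^sup>2 <= N (%k. X i k - X j k)"
     unfolding N_def by (rule member_le_sum[where f = "%k. (norm (X i k - X j k))\<^sup>2"]) (use k in auto)
    also have "... <= 2 * (1 / real (Suc i) + 1 / real (Suc j))" by (rule close)
    also have "... <= 2 * (1 / real (Suc M) + 1 / real (Suc M))" using ij by (intro mult_left_mono add_mono divide_left_mono) auto
    also have "... < e\<^sup>2" using M by simp
    finally show ?thesis using e by (simp add: dist_norm power2_less_imp_less)
   qed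
   thus "EX M. ALL m>=M. ALL n>=M. dist (X m k) (X n k) < e" by blast
  qed
  thus ?thesis by (simp add: Cauchy_convergent_iff convergent_def)
 qed
 then obtain z where z: "!!k. k < K ==> (%n. X n k) ----> z k" by metis
 have glim: "(%n. g (X n)) ----> m"
 proof (rule tendsto_sandwich[where f = "%_. m" and h = "%n. m + 1 / real (Suc n)"])
  show "(%n. m + 1 / real (Suc n)) ----> m" using tendsto_add[OF tendsto_const[of m] LIMSEQ_inverse_real_of_nat] by (simp add: inverse_eq_divide)
 qed (use mle[OF XS] less_imp_le[OF Xm] in "simp_all only: eventually_sequentially, blast+")
 have pos: "0 <= (cmod c)\<^sup>2 * N v + 2 * Re (c * ((SUM k<K. cinner (z k) (v k)) - f v))"
  if v: "v : S" for v c
 proof -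
  have "m <= g (X n) + ((cmod c)\<^sup>2 * N v + 2 * Re (c * ((SUM k<K. cinner (X n k) (v k)) - f v)))" for n
   using expand[OF XS[of n] v, of c] mle[OF Sadd[OF XS[of n] Sscale[OF v, of c]]] by simp
  moreover have "(%n. g (X n) + ((cmod c)\<^sup>2 * N v + 2 * Re (c * ((SUM k<K. cinner (X n k) (v k)) - f v))))
   ----> m + ((cmod c)\<^sup>2 * N v + 2 * Re (c * ((SUM k<K. cinner (z k) (v k)) - f v)))" by (intro tendsto_intros glim tendsto_cinner z) auto
  ultimately have "m <= m + ((cmod c)\<^sup>2 * N v + 2 * Re (c * ((SUM k<K. cinner (z k) (v k)) - f v)))" by (intro LIMSEQ_le_const) auto
  thus ?thesis by simp
 qed
 \<comment> \<open>The minimizer is varied along \<open>v\<close> with coefficient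
   \<open>- of_real t * cnj d\<close>. The choice of \<open>t\<close> gives
   \<open>t * N v < 1\<close>, so the quadratic term cannot compensate the linear one unless
   \<open>d = 0\<close>.\<close>
 have "f v = (SUM k<K. cinner (z k) (v k))" if v: "v : S" for v
 proof -
  define d where "d = (SUM k<K. cinner (z k) (v k)) - f v"
  define t where "t = 1 / (N v + 1)"
  have t: "t > 0" "t * N v < 1" using N0[of v] by (auto simp: t_def field_simps)
  have "0 <= (cmod (- of_real t * cnj d))\<^sup>2 * N v + 2 * Re (- of_real t * cnj d * d)" unfolding d_def by (rule pos[OF v])
  also have "... = t\<^sup>2 * (cmod d)\<^sup>2 * N v - 2 * t * (cmod d)\<^sup>2"
  proof -
   have "cnj d * d = of_real ((cmod d)\<^sup>2)" using complex_norm_square[of d] by (simp add: mult.commute)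
   hence "- of_real t * cnj d * d = of_real (- t * (cmod d)\<^sup>2)" by (simp add: mult.assoc)
   hence "Re (- of_real t * cnj d * d) = - t * (cmod d)\<^sup>2" by (simp only: Re_complex_of_real)
   moreover have "(cmod (- of_real t * cnj d))\<^sup>2 = t\<^sup>2 * (cmod d)\<^sup>2" using t by (simp add: norm_mult power_mult_distrib)
   ultimately show ?thesis by simp
  qed
  also have "... = t * (cmod d)\<^sup>2 * (t * N v - 2)" by (simp add: algebra_simps power2_eq_square)
  finally have "0 <= t * (cmod d)\<^sup>2 * (t * N v - 2)" .
  hence "(cmod d)\<^sup>2 <= 0" using t by (auto simp: zero_le_mult_iff mult_le_0_iff not_less)
  thus ?thesis by (simp add: d_def)
 qed
 with XS z show ?thesis by blast
qed

lemma riesz: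
 fixes S :: "'h::complex_hilbert_space set" and f :: "'h => complex"
 assumes "0 : S" "!!u v. u : S ==> v : S ==> u + v : S" "!!c u. u : S ==> c *\<^sub>C u : S" and "!!u v. u : S ==> v : S ==> f (u + v) = f u + f v"
  and "!!c u. u : S ==> f (c *\<^sub>C u) = c * f u" and bound: "!!u. u : S ==> cmod (f u) <= C * norm u"
 obtains z where "z : closure S" "!!u. u : S ==> f u = cinner z u"
proof -
 let ?S = "(%v _. v) ` S"
 have "(cmod (f u))\<^sup>2 <= C\<^sup>2 * (norm u)\<^sup>2" if "u : S" for u
  using power_mono[OF bound[OF that], of 2] by (simp add: power_mult_distrib)
 hence bd: "!!u. u : ?S ==> (cmod (f (u 0)))\<^sup>2 <= C\<^sup>2 * (SUM k<Suc 0. (norm (u k))\<^sup>2)" by auto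
 have S: "complex_subspace ?S" using assms(1-3) by (auto simp: complex_subspace_def image_iff)
 have add: "!!u v. u : ?S ==> v : ?S ==> f (u 0 + v 0) = f (u 0) + f (v 0)"
  and scale: "!!c u. u : ?S ==> f (c *\<^sub>C u 0) = c * f (u 0)" using assms(4,5) by auto
 have "EX z X. (ALL n. X n : ?S) & (ALL k<Suc 0. (%n. X n k) ----> z k) &
   (ALL u:?S. f (u 0) = (SUM k<Suc 0. cinner (z k) (u k)))" by (rule riesz_family[where f = "%u. f (u 0)" and C = "C\<^sup>2"]) (fact S add scale bd)+
 then obtain z X where *: "(ALL n. X n : ?S) & (ALL k<Suc 0. (%n. X n k) ----> z k) &
   (ALL u:?S. f (u 0) = (SUM k<Suc 0. cinner (z k) (u k)))" by (elim exE)
 hence "X n : ?S" for n by blast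
 hence "X n 0 : S" for n by (metis (no_types, lifting) imageE)
 moreover have "(%n. X n 0) ----> z 0" using * by blast
 moreover have "f u = cinner (z 0) u" if "u : S" for u using bspec[of ?S _ "%_. u", OF conjunct2[OF conjunct2[OF *]]] that by simp
 ultimately show ?thesis by (intro that[of "z 0"]) (auto simp: closure_sequential intro!: exI[of _ "%n. X n 0"])
qed

section \<open>The algebra of bounded operators\<close>

lemma bounded_operatorsI: assumes "!!v w. T (v + w) = T v + T w" "!!c v. T (c *\<^sub>C v) = c *\<^sub>C T v"
  "!!v. norm (T v) <= C * norm (v::'h::complex_hilbert_space)" shows "T : bounded_operators" unfolding bounded_operators_def
 by (auto intro!: bounded_linear_intro[where K = C] simp: assms scaleR_scaleC mult.commute)

text \<open>Operators form a type of their own so that sums, products and real linear independence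
  come from the type classes; \<open>app\<close> leads back to the functions of the theorem.\<close>

typedef (overloaded) ('h::complex_hilbert_space) bop = "bounded_operators :: ('h => 'h) set"
 morphisms app Bop by (rule exI[of _ "%x. 0"]) (rule bounded_operatorsI[where C = 0], auto)

setup_lifting type_definition_bop

lemma bounded_linear_app: "bounded_linear (app x)" using app[of x] by (simp add: bounded_operators_def)

lemma app_scaleC [simp]: "app x (c *\<^sub>C v) = c *\<^sub>C app x v" using app[of x] by (simp add: bounded_operators_def)

lemma app_add [simp]: "app x (v + w) = app x v + app x w" by (rule linear_simps[OF bounded_linear_app])

lemma app_diff [simp]: "app x (v - w) = app x v - app x w" by (rule linear_simps[OF bounded_linear_app])

lemma app_minus [simp]: "app x (- v) = - app x v" by (rule linear_simps[OF bounded_linear_app])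

lemma app_zero [simp]: "app x 0 = 0" by (rule linear_simps[OF bounded_linear_app])

lemma app_sum: "app x (SUM i:A. f i) = (SUM i:A. app x (f i))" by (induction A rule: infinite_finite_induct) simp_all

lemmas tendsto_app = bounded_linear.tendsto[OF bounded_linear_app]

text \<open>An upper bound for the operator norm; the norm itself is never formed.\<close>

definition opbound :: "'h::complex_hilbert_space bop => real => bool" where
 "opbound x C <-> C >= 0 & (ALL v. norm (app x v) <= C * norm v)"

lemma opbound_ex: obtains C where "C > 0" "opbound x C"
proof -
 obtain K where "K > 0" "!!v. norm (app x v) <= norm v * K" using bounded_linear.pos_bounded[OF bounded_linear_app] by blast
 with that[of K] show thesis by (simp add: opbound_def mult.commute)
qed

lemma opboundD: "opbound x C ==> norm (app x v) <= C * norm v" by (simp add: opbound_def)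

lemma bop_ex: assumes "!!v w. T (v + w) = T v + T w" "!!c v. T (c *\<^sub>C v) = c *\<^sub>C T v"
  "!!v. norm (T v) <= C * norm (v::'h::complex_hilbert_space)"
 obtains x where "app x = T" using bounded_operatorsI[OF assms] Bop_inverse by blast

lemma bop_eqI: "(!!v. app x v = app y v) ==> x = y" by (metis app_inject ext)

instantiation bop :: (complex_hilbert_space) "{ring, monoid_mult, real_vector}"
begin

lift_definition zero_bop :: "'a bop" is "%v. 0" by (rule bounded_operatorsI[where C = 0]) auto

lift_definition one_bop :: "'a bop" is "%v. v" by (rule bounded_operatorsI[where C = 1]) auto

lift_definition plus_bop :: "'a bop => 'a bop => 'a bop" is "%S T v. S v + T v"
 by (simp add: bounded_operators_def bounded_linear_add scaleC_add_right)

lift_definition minus_bop :: "'a bop => 'a bop => 'a bop" is "%S T v. S v - T v"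
 by (simp add: bounded_operators_def bounded_linear_sub scaleC_diff_right)

lift_definition uminus_bop :: "'a bop => 'a bop" is "%S v. - S v" by (simp add: bounded_operators_def bounded_linear_minus)

lift_definition times_bop :: "'a bop => 'a bop => 'a bop" is "%S T v. S (T v)" by (simp add: bounded_operators_def bounded_linear_compose)

lift_definition scaleR_bop :: "real => 'a bop => 'a bop" is "%r S v. r *\<^sub>R S v"
proof -
 fix r :: real and S :: "'a => 'a" assume "S : bounded_operators"
 hence "bounded_linear (%v. r *\<^sub>R S v)" "ALL c x. S (c *\<^sub>C x) = c *\<^sub>C S x"
  by (auto simp: bounded_operators_def intro: bounded_linear_const_scaleR)
 thus "(%v. r *\<^sub>R S v) : bounded_operators" by (simp add: bounded_operators_def) (simp add: scaleR_scaleC scaleC_scaleC mult.commute)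
qed

instance
proof
 fix a b c :: "'a bop" and r s :: real
 have lin: "app x (v + w) = app x v + app x w" for x :: "'a bop" and v w by simp
 show "a * (b + c) = a * b + a * c" by (rule bop_eqI) (simp add: times_bop.rep_eq plus_bop.rep_eq)
qed (transfer; simp add: fun_eq_iff algebra_simps)+

end

lemma app_ring [simp]:
 "app 0 v = 0" "app 1 v = v" "app (x + y) v = app x v + app y v" "app (x - y) v = app x v - app y v"
 "app (- x) v = - app x v" "app (x * y) v = app x (app y v)" "app (r *\<^sub>R x) v = r *\<^sub>R app x v" by (transfer; simp)+

lemma app_sum_left: "app (SUM i:A. f i) v = (SUM i:A. app (f i) v)" by (induction A rule: infinite_finite_induct) simp_all

lift_definition csc :: "complex => 'h::complex_hilbert_space bop => 'h bop" is "%c T v. c *\<^sub>C T v"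
proof -
 fix c and T :: "'h => 'h" assume T: "T : bounded_operators"
 then obtain x where x: "T = app x" by (metis Bop_inverse)
 obtain C where C: "opbound x C" using opbound_ex by blast
 show "(%v. c *\<^sub>C T v) : bounded_operators"
 proof (rule bounded_operatorsI[where C = "cmod c * C"])
  fix v show "norm (c *\<^sub>C T v) <= cmod c * C * norm v"
   using mult_left_mono[OF opboundD[OF C, of v], of "cmod c"] by (simp add: norm_scaleC x mult.assoc)
 qed (simp_all add: x scaleC_add_right scaleC_scaleC mult.commute)
qed

lemma app_csc [simp]: "app (csc c x) v = c *\<^sub>C app x v" by transfer simp

lemma csc_add_right: "csc c (x + y) = csc c x + csc c y" and csc_add_left: "csc (c + d) x = csc c x + csc d x"
 and csc_diff_right: "csc c (x - y) = csc c x - csc c y" and csc_csc [simp]: "csc c (csc d x) = csc (c * d) x" and csc_one [simp]: "csc 1 x = x"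
 and csc_zero [simp]: "csc 0 x = 0" "csc c 0 = 0" and csc_minus [simp]: "csc c (- x) = - csc c x"
 and csc_mult_left [simp]: "csc c x * y = csc c (x * y)" and csc_mult_right [simp]: "x * csc c y = csc c (x * y)"
 and scaleR_csc: "r *\<^sub>R x = csc (of_real r) x"
 by (rule bop_eqI; simp add: scaleC_add_right scaleC_add_left scaleC_diff_right scaleC_scaleC scaleR_scaleC)+

lemma csc_minus_left: "csc (- c) x = - csc c x" by (rule bop_eqI) (simp add: scaleC_minus_left)

lemma csc_diff_left: "csc (c - d) x = csc c x - csc d x" using csc_add_left[of c "- d" x] by (simp add: csc_minus_left)

lemma csc_sum: "csc c (SUM i:A. f i) = (SUM i:A. csc c (f i))" by (induction A rule: infinite_finite_induct) (simp_all add: csc_add_right)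

lemma csc_sum_left: "csc (SUM i:A. f i) x = (SUM i:A. csc (f i) x)" by (induction A rule: infinite_finite_induct) (simp_all add: csc_add_left)

lemma csc_cancel: "c ~= 0 ==> csc c x = csc c y <-> x = y" by (metis csc_csc csc_one left_inverse)

subsection \<open>Adjoints\<close>

text \<open>Riesz yields \<open>S v\<close> for each \<open>v\<close>. The bound for
  \<open>S\<close> comes from inserting \<open>w = S v\<close> into the Riesz identity.\<close>

lemma adjoint_ex:
 "EX S. ALL v w. cinner (app S v) w = cinner v (app x w)"
proof -
 obtain C where C: "C >= 0" "!!v. norm (app x v) <= C * norm v" using opbound_ex[of x] by (metis opbound_def)
 have "EX z. ALL w. cinner v (app x w) = cinner z w" for v
 proof -
  have "cmod (cinner v (app x w)) <= (norm v * C) * norm w" for w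
   using cinner_bound[of v "app x w"] mult_left_mono[OF C(2)[of w], of "norm v"] by (simp add: mult.assoc)
  thus ?thesis by (rule riesz[of UNIV "%w. cinner v (app x w)", rotated -2])
    (auto simp: cinner_add_right cinner_scaleC_right)
 qed
 then obtain S where S: "!!v w. cinner v (app x w) = cinner (S v) w" by metis
 have "norm (S v) <= C * norm v" for v
 proof -
  have "(norm (S v))\<^sup>2 = cmod (cinner v (app x (S v)))" by (simp add: S cinner_self norm_power)
  also have "... <= norm v * norm (app x (S v))" by (rule cinner_bound)
  also have "... <= norm v * (C * norm (S v))" by (intro mult_left_mono C) simp
  finally have "norm (S v) * norm (S v) <= (C * norm v) * norm (S v)" by (simp add: power2_eq_square ac_simps)
  thus ?thesis using C(1) by (cases "S v = 0") (auto simp: mult_le_cancel_right)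
 qed
 moreover have "S (v + w) = S v + S w" for v w by (rule cinner_eqI) (simp add: S[symmetric] cinner_add_left)
 moreover have "S (c *\<^sub>C v) = c *\<^sub>C S v" for c v by (rule cinner_eqI) (simp add: S[symmetric] cinner_scaleC_left)
 ultimately obtain T where "app T = S" using bop_ex by metis
 hence "ALL v w. cinner (app T v) w = cinner v (app x w)" by (simp add: S)
 thus ?thesis by blast
qed

definition adj :: "'h::complex_hilbert_space bop => 'h bop" ("_\<dagger>" [1000] 1000) where
 "adj x = Bop (op_adjoint (app x))"

lemma app_adj: "app (x\<dagger>) = op_adjoint (app x)" and cinner_adj: "cinner (app (x\<dagger>) v) w = cinner v (app x w)"
proof -
 obtain S where S: "!!v w. cinner (app S v) w = cinner v (app x w)" using adjoint_ex by blast
 have "op_adjoint (app x) = app S" unfolding op_adjoint_def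
 proof (rule the_equality)
  fix T assume "T : bounded_operators & (ALL v w. cinner (T v) w = cinner v (app x w))"
  hence "cinner (T v) w = cinner (app S v) w" for v w by (simp add: S)
  hence "T v = app S v" for v by (rule cinner_eqI)
  thus "T = app S" by blast
 qed (use S app in auto)
 hence "x\<dagger> = S" by (simp add: adj_def app_inverse)
 thus "app (x\<dagger>) = op_adjoint (app x)" "cinner (app (x\<dagger>) v) w = cinner v (app x w)" by (simp_all add: S `op_adjoint (app x) = app S`)
qed

lemma cinner_adj_right: "cinner v (app (x\<dagger>) w) = cinner (app x v) w" by (metis cinner_adj cinner_commute)

lemma adj_eqI: "(!!v w. cinner (app y v) w = cinner v (app x w)) ==> x\<dagger> = y" by (rule bop_eqI, rule cinner_eqI) (simp add: cinner_adj)

lemma adj_adj [simp]: "x\<dagger>\<dagger> = x" by (rule adj_eqI) (simp add: cinner_adj_right)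

lemma adj_ring [simp]:
 "(0::'h::complex_hilbert_space bop)\<dagger> = 0" "(1::'h bop)\<dagger> = 1" "(x + y :: 'h bop)\<dagger> = x\<dagger> + y\<dagger>"
 "(x - y)\<dagger> = x\<dagger> - y\<dagger>" "(- x)\<dagger> = - x\<dagger>" "(x * y)\<dagger> = y\<dagger> * x\<dagger>" "(csc c x)\<dagger> = csc (cnj c) (x\<dagger>)"
 by (rule adj_eqI; simp add: cinner_adj cinner_add_left cinner_add_right cinner_diff_left
   cinner_diff_right cinner_scaleC_left cinner_scaleC_right)+

lemma adj_sum: "(SUM i:A. f i)\<dagger> = (SUM i:A. (f i)\<dagger>)" by (induction A rule: infinite_finite_induct) simp_all

lemma adj_scaleR [simp]: "(r *\<^sub>R x)\<dagger> = r *\<^sub>R (x\<dagger>)" by (simp add: scaleR_csc)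

lemma adj_mult_self_eq_0: "x\<dagger> * x = 0 <-> x = 0"
proof
 assume *: "x\<dagger> * x = 0"
 show "x = 0"
 proof (rule bop_eqI)
  fix v
  have "cinner (app x v) (app x v) = cinner v (app (x\<dagger> * x) v)" by (simp add: cinner_adj_right)
  thus "app x v = app 0 v" by (simp add: * cinner_self)
 qed
qed simp

subsection \<open>Positivity\<close>

definition psd :: "'h::complex_hilbert_space bop => bool" where
 "psd x <-> x\<dagger> = x & (ALL v. Re (cinner v (app x v)) >= 0)"

lemma psd_adj: "psd x ==> x\<dagger> = x" and psdD: "psd x ==> Re (cinner v (app x v)) >= 0" by (auto simp: psd_def)

lemma psd_0 [simp]: "psd 0" and psd_1 [simp]: "psd 1" by (auto simp: psd_def Re_cinner_self)

lemma psd_add: "psd x ==> psd y ==> psd (x + y)" by (auto simp: psd_def cinner_add_right)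

lemma psd_scaleR: "psd x ==> r >= 0 ==> psd (r *\<^sub>R x)" by (auto simp: psd_def scaleR_scaleC cinner_scaleC_right)

lemma psd_sandwich: "psd x ==> psd (y\<dagger> * x * y)" by (auto simp: psd_def cinner_adj_right mult.assoc)

lemma psd_sandwich': "psd x ==> y\<dagger> = y ==> psd (y * x * y)" using psd_sandwich[of x y] by simp

lemma psd_square: "psd (x\<dagger> * x)" using psd_sandwich[of 1 x] by simp

lemma psd_sum: "(!!i. i : A ==> psd (f i)) ==> psd (SUM i:A. f i)" by (induction A rule: infinite_finite_induct) (auto intro: psd_add)

text \<open>The quadratic form of \<open>x\<close> vanishes. At the vector \<open>v + x v\<close>
  its two cross terms both equal the squared norm of \<open>x v\<close>.\<close>

lemma psd_antisym: assumes "psd x" "psd (- x)" shows "x = 0"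
proof (rule bop_eqI)
 fix v
 have 0: "Re (cinner w (app x w)) = 0" for w using psdD[OF assms(1), of w] psdD[OF assms(2), of w] by simp
 have "cinner v (app x (app x v)) = cinner (app x v) (app x v)" using cinner_adj[of x v "app x v"] psd_adj[OF assms(1)] by simp
 hence "2 * Re (cinner (app x v) (app x v)) = Re (cinner (v + app x v) (app x (v + app x v)))"
  using 0[of v] 0[of "app x v"] by (simp add: cinner_add_left cinner_add_right)
 also have "... = 0" by (rule 0)
 finally show "app x v = app 0 v" by (simp add: Re_cinner_self)
qed

text \<open>The form in which norm bounds enter algebraic computations: positivity survives
  sandwiching and passes to the trace.\<close>

lemma opbound_psd: "opbound x C <-> C >= 0 & psd (C\<^sup>2 *\<^sub>R 1 - x\<dagger> * x)"
proof -
 have "Re (cinner v (app (C\<^sup>2 *\<^sub>R 1 - x\<dagger> * x) v)) = (C * norm v)\<^sup>2 - (norm (app x v))\<^sup>2" for v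
  by (simp add: cinner_diff_right scaleR_scaleC cinner_scaleC_right cinner_adj_right cinner_self power_mult_distrib)
 hence "psd (C\<^sup>2 *\<^sub>R 1 - x\<dagger> * x) <-> (ALL v. (norm (app x v))\<^sup>2 <= (C * norm v)\<^sup>2)" by (simp add: psd_def)
 thus ?thesis by (auto simp: opbound_def intro: power_mono dest: power2_le_imp_le)
qed

text \<open>A sum of two sandwiches of positive elements. An argument by commuting roots would be
  circular, since the construction of square roots rests on this lemma through
  \<open>psd_contraction\<close>.\<close>

lemma psd_diff_square: assumes "psd b" "psd (1 - b)" shows "psd (b - b * b)"
proof -
 have "b - b * b = b * (1 - b) * b + (1 - b) * b * (1 - b)" by (simp add: algebra_simps)
 thus ?thesis using assms by (auto intro!: psd_add psd_sandwich' simp: psd_adj)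
qed

lemma psd_contraction_norm: assumes "psd b" "psd (1 - b)" shows "(norm (app b v))\<^sup>2 <= Re (cinner v (app b v))"
proof -
 have "cinner (app b v) (app b v) = cinner v (app (b * b) v)" using psd_adj[OF assms(1)] cinner_adj[of b v "app b v"] by simp
 thus ?thesis using psdD[OF psd_diff_square[OF assms], of v] by (simp add: cinner_diff_right Re_cinner_self[symmetric])
qed

lemma psd_contraction: assumes "psd b" "psd (1 - b)" shows "opbound b 1"
proof -
 have "1 - b\<dagger> * b = (b - b * b) + (1 - b)" using psd_adj[OF assms(1)] by simp
 hence "psd (1 - b\<dagger> * b)" by (simp only: psd_add psd_diff_square assms)
 thus ?thesis by (simp add: opbound_psd)
qed

lemma opbound_add: "opbound x C ==> opbound y D ==> opbound (x + y) (C + D)"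
 unfolding opbound_def by (auto simp: distrib_right intro: norm_triangle_le add_mono)

lemma opbound_mult: assumes "opbound x C" "opbound y D" shows "opbound (x * y) (C * D)"
proof -
 have "norm (app x (app y v)) <= C * (D * norm v)" for v
  using opboundD[OF assms(1), of "app y v"] mult_left_mono[OF opboundD[OF assms(2), of v], of C] assms(1)
  by (auto simp: opbound_def intro: order_trans)
 thus ?thesis using assms by (simp add: opbound_def mult.assoc)
qed

lemma opbound_csc: assumes "opbound x C" shows "opbound (csc c x) (cmod c * C)"
 using assms by (auto simp: opbound_def norm_scaleC mult.assoc intro!: mult_left_mono)

lemma opbound_scaleR: "opbound x C ==> r >= 0 ==> opbound (r *\<^sub>R x) (r * C)" using opbound_csc[of x C "of_real r"] by (simp add: scaleR_csc)

lemma opbound_mono: "opbound x C ==> C <= D ==> opbound x D" unfolding opbound_def by (meson mult_right_mono norm_ge_zero order_trans)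

lemma opbound_adj: assumes "opbound x C" shows "opbound (x\<dagger>) C"
proof -
 have "norm (app (x\<dagger>) v) <= C * norm v" for v
 proof -
  have "(norm (app (x\<dagger>) v))\<^sup>2 = cmod (cinner v (app x (app (x\<dagger>) v)))"
   by (simp add: cinner_adj[symmetric] cinner_self norm_power)
  also have "... <= norm v * norm (app x (app (x\<dagger>) v))" by (rule cinner_bound)
  also have "... <= norm v * (C * norm (app (x\<dagger>) v))" by (intro mult_left_mono opboundD assms) simp
  finally have "norm (app (x\<dagger>) v) * norm (app (x\<dagger>) v) <= (C * norm v) * norm (app (x\<dagger>) v)"
   by (simp add: power2_eq_square ac_simps)
  thus ?thesis using assms by (cases "app (x\<dagger>) v = 0") (auto simp: mult_le_cancel_right opbound_def)
 qed
 thus ?thesis using assms by (simp add: opbound_def)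
qed

lemma opbound_selfadj: assumes "opbound x C" "x\<dagger> = x" shows "psd (C *\<^sub>R 1 - x)" "psd (C *\<^sub>R 1 + x)"
proof -
 have b: "\<bar>Re (cinner v (app x v))\<bar> <= C * (norm v)\<^sup>2" for v
 proof -
  have "\<bar>Re (cinner v (app x v))\<bar> <= norm v * norm (app x v)"
   using cinner_bound[of v "app x v"] abs_Re_le_cmod[of "cinner v (app x v)"] by linarith
  also have "... <= norm v * (C * norm v)" by (rule mult_left_mono[OF opboundD[OF assms(1)]]) simp
  finally show ?thesis by (simp add: power2_eq_square ac_simps)
 qed
 have e: "Re (cinner v (app (C *\<^sub>R 1 - x) v)) = C * (norm v)\<^sup>2 - Re (cinner v (app x v))"
  "Re (cinner v (app (C *\<^sub>R 1 + x) v)) = C * (norm v)\<^sup>2 + Re (cinner v (app x v))" for v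
  by (simp_all add: cinner_diff_right cinner_add_right scaleR_scaleC cinner_scaleC_right Re_cinner_self)
 have "0 <= Re (cinner v (app (C *\<^sub>R 1 - x) v))" "0 <= Re (cinner v (app (C *\<^sub>R 1 + x) v))" for v unfolding e using b[of v] by linarith+
 thus "psd (C *\<^sub>R 1 - x)" "psd (C *\<^sub>R 1 + x)" unfolding psd_def using assms(2) by auto
qed

subsection \<open>Strong limits\<close>

text \<open>The common bound is part of the notion because it makes products of convergent sequences
  converge.\<close>

definition slim :: "(nat => 'h::complex_hilbert_space bop) => 'h bop => bool" where
 "slim X x <-> (EX C. ALL n. opbound (X n) C) & (ALL v. (%n. app (X n) v) ----> app x v)"

lemma slimD: "slim X x ==> (%n. app (X n) v) ----> app x v" by (simp add: slim_def)

lemma slim_const: "slim (%n. x) x" using opbound_ex[of x] unfolding slim_def by (metis tendsto_const)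

lemma slim_unique: "slim X x ==> slim X y ==> x = y" by (meson LIMSEQ_unique bop_eqI slimD)

lemma slim_Suc: "slim X x ==> slim (%n. X (Suc n)) x" unfolding slim_def by (auto intro: LIMSEQ_Suc)

lemma slim_shift: "slim X x ==> slim (%n. X (n + k)) x" unfolding slim_def by (auto intro: LIMSEQ_ignore_initial_segment)

lemma slim_add: assumes "slim X x" "slim Y y" shows "slim (%n. X n + Y n) (x + y)"
proof -
 obtain C D where "ALL n. opbound (X n) C" "ALL n. opbound (Y n) D" using assms by (auto simp: slim_def)
 hence "ALL n. opbound (X n + Y n) (C + D)" by (auto intro: opbound_add)
 thus ?thesis using assms by (auto simp: slim_def intro: tendsto_add)
qed

lemma slim_csc: assumes "slim X x" shows "slim (%n. csc c (X n)) (csc c x)"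
proof -
 obtain C where "ALL n. opbound (X n) C" using assms by (auto simp: slim_def)
 hence "ALL n. opbound (csc c (X n)) (cmod c * C)" by (auto intro: opbound_csc)
 thus ?thesis using assms by (auto simp: slim_def intro: tendsto_scaleC)
qed

lemma slim_scaleR: "slim X x ==> slim (%n. r *\<^sub>R X n) (r *\<^sub>R x)" by (simp add: scaleR_csc slim_csc)

lemma slim_minus: "slim X x ==> slim (%n. - X n) (- x)" using slim_csc[of X x "- 1"] by (simp add: csc_minus_left)

lemma slim_diff: "slim X x ==> slim Y y ==> slim (%n. X n - Y n) (x - y)" using slim_add[of X x "%n. - Y n" "- y"] by (simp add: slim_minus)

lemma slim_mult: assumes X: "slim X x" and Y: "slim Y y" shows "slim (%n. X n * Y n) (x * y)"
proof -
 obtain C D where C: "ALL n. opbound (X n) C" and D: "ALL n. opbound (Y n) D" using X Y by (auto simp: slim_def)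
 hence "ALL n. opbound (X n * Y n) (C * D)" by (auto intro: opbound_mult)
 moreover have "(%n. app (X n * Y n) v) ----> app (x * y) v" for v
 proof -
  have "(%n. app (X n) (app (Y n) v - app y v)) ----> 0"
  proof (rule Lim_null_comparison[where g = "%n. C * norm (app (Y n) v - app y v)"])
   show "\<forall>\<^sub>F n in sequentially. norm (app (X n) (app (Y n) v - app y v)) <= C * norm (app (Y n) v - app y v)"
    by (rule always_eventually) (use C opboundD in blast)
   have "(%n. norm (app (Y n) v - app y v)) ----> 0" using slimD[OF Y, of v] by (simp add: LIM_zero_iff tendsto_norm_zero)
   thus "(%n. C * norm (app (Y n) v - app y v)) ----> 0" by (rule tendsto_mult_right_zero)
  qed
  from tendsto_add[OF this slimD[OF X, of "app y v"]] show ?thesis by simp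
 qed
 ultimately show ?thesis unfolding slim_def by blast
qed

lemma slim_opbound: assumes "slim X x" "!!n. opbound (X n) C" shows "opbound x C"
proof -
 have "norm (app x v) <= C * norm v" for v by (rule LIMSEQ_le_const2[OF tendsto_norm[OF slimD[OF assms(1), of v]]])
   (use assms(2) opboundD in blast)
 thus ?thesis using assms(2)[of 0] by (simp add: opbound_def)
qed

lemma slim_cinner: "slim X x ==> slim Y y ==> (%n. cinner (app (X n) v) (app (Y n) w)) ----> cinner (app x v) (app y w)"
 by (intro tendsto_cinner slimD)

lemma slim_adj_eq: assumes "slim X x" "slim Y y" "!!n. (X n)\<dagger> = Y n" shows "x\<dagger> = y"
proof (rule adj_eqI)
 fix v w
 have "(%n. cinner v (app (X n) w)) ----> cinner v (app x w)" using assms(1) by (intro tendsto_cinner slimD) auto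
 moreover have "cinner v (app (X n) w) = cinner (app (Y n) v) w" for n by (simp add: cinner_adj[symmetric] assms(3))
 ultimately have "(%n. cinner (app (Y n) v) w) ----> cinner v (app x w)" by simp
 moreover have "(%n. cinner (app (Y n) v) w) ----> cinner (app y v) w" using assms(2) by (intro tendsto_cinner slimD) auto
 ultimately show "cinner (app y v) w = cinner v (app x w)" using LIMSEQ_unique by blast
qed

lemma slim_psd: assumes "slim X x" "!!n. psd (X n)" shows "psd x"
proof -
 have "x\<dagger> = x" by (rule slim_adj_eq[OF assms(1,1)]) (simp add: psd_adj assms)
 moreover have "0 <= Re (cinner v (app x v))" for v
 proof (rule LIMSEQ_le_const)
  show "(%n. Re (cinner v (app (X n) v))) ----> Re (cinner v (app x v))" by (intro tendsto_Re tendsto_cinner slimD assms(1)) simp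
 qed (use assms(2) psdD in blast)
 ultimately show ?thesis by (simp add: psd_def)
qed

lemma slim_ex: assumes "!!n. opbound (X n) C" "!!v. convergent (%n. app (X n) v)" shows "EX x. slim X x"
proof -
 obtain T where T: "!!v. (%n. app (X n) v) ----> T v" using assms(2) unfolding convergent_def by metis
 have "T (v + w) = T v + T w" for v w using tendsto_add[OF T[of v] T[of w]] T[of "v + w"] by (simp add: LIMSEQ_unique)
 moreover have "T (c *\<^sub>C v) = c *\<^sub>C T v" for c v using tendsto_scaleC[OF T[of v]] T[of "c *\<^sub>C v"] by (simp add: LIMSEQ_unique)
 moreover have "norm (T v) <= C * norm v" for v by (rule LIMSEQ_le_const2[OF tendsto_norm[OF T[of v]]]) (use assms(1) opboundD in blast)
 ultimately obtain x where "app x = T" using bop_ex by metis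
 thus ?thesis using T assms(1) unfolding slim_def by metis
qed

text \<open>Reduces convergence of vectors to convergence of numbers; \<open>q\<close> will be the
  values of a quadratic form along a monotone sequence.\<close>

lemma convergent_square_bound:
 fixes f :: "nat => 'h::complex_hilbert_space" assumes q: "convergent q" and f: "!!m n. m >= n ==> (norm (f m - f n))\<^sup>2 <= q m - (q n :: real)"
 shows "convergent f"
proof -
 have "Cauchy f"
 proof (rule CauchyI)
  fix e :: real assume e: "e > 0"
  then obtain M where M: "!!m n. m >= M ==> n >= M ==> norm (q m - q n) < e\<^sup>2"
   using CauchyD[of q "e\<^sup>2"] q by (auto simp: Cauchy_convergent_iff)
  have "(norm (f m - f n))\<^sup>2 < e\<^sup>2" if "m >= M" "n >= M" for m n
   using f[of m n] f[of n m] M[OF that] by (cases "m >= n") (auto simp: norm_minus_commute)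
  thus "EX M. ALL m>=M. ALL n>=M. norm (f m - f n) < e" using e by (meson power2_less_imp_less less_imp_le)
 qed
 thus ?thesis by (simp add: Cauchy_convergent_iff)
qed

text \<open>A difference \<open>X m - X n\<close> lies between 0 and 1, so the squared norm of its
  value at \<open>v\<close> is at most its quadratic form there, and the forms converge by
  monotonicity.\<close>

lemma monotone_slim: assumes mono: "!!n. psd (X (Suc n) - X n)" and X: "!!n. psd (X n)" "!!n. psd (1 - X n)"
 obtains x where "slim X x" "psd x" "psd (1 - x)" "!!n. psd (x - X n)"
proof -
 have diff: "psd (X m - X n)" if "m >= n" for m n using that
 proof (induction m rule: dec_induct)
  case (step m)
  thus ?case using psd_add[OF mono[of m] step.IH] by simp
 qed simp
 have bd: "opbound (X n) 1" for n by (rule psd_contraction) (use X in auto)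
 have conv: "convergent (%n. app (X n) v)" for v
 proof -
  define q where "q n = Re (cinner v (app (X n) v))" for n
  have key: "(norm (app (X m) v - app (X n) v))\<^sup>2 <= q m - q n" if "m >= n" for m n
  proof -
   have "psd (1 - (X m - X n))" using psd_add[OF X(2)[of m] X(1)[of n]] by (simp add: algebra_simps)
   from psd_contraction_norm[OF diff[OF that] this, of v] show ?thesis by (simp add: q_def cinner_diff_right)
  qed
  have "incseq q" using psdD[OF mono, of v] by (intro incseq_SucI) (simp add: q_def cinner_diff_right)
  moreover have "q n <= (norm v)\<^sup>2" for n using psdD[OF X(2)[of n], of v] by (simp add: q_def cinner_diff_right Re_cinner_self)
  ultimately have "convergent q" using incseq_convergent[of q] convergentI by metis
  thus ?thesis by (rule convergent_square_bound) (rule key)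
 qed
 obtain x where x: "slim X x" using slim_ex[OF bd conv] by blast
 moreover have "psd x" by (rule slim_psd[OF x X(1)])
 moreover have "psd (1 - x)" by (rule slim_psd[OF slim_diff[OF slim_const x] X(2)])
 moreover have "psd (x - X n)" for n by (rule slim_psd[OF slim_diff[OF slim_shift[OF x, of n] slim_const]]) (simp add: diff)
 ultimately show thesis by (rule that)
qed

subsection \<open>Strongly closed star-subalgebras\<close>

definition star_alg :: "'h::complex_hilbert_space bop set => bool" where
 "star_alg S <-> 1 : S & (ALL x:S. ALL y:S. x + y : S & x * y : S) & (ALL x:S. x\<dagger> : S & (ALL c. csc c x : S))"

text \<open>Square roots, polar parts and spectral projections are limits of bounded sequences and
  hence stay in every algebra of this kind: in \<open>R\<close>, in commutants and in
  finite-dimensional subalgebras of \<open>R\<close>.\<close>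

definition salg :: "'h::complex_hilbert_space bop set => bool" where
 "salg S <-> star_alg S & (ALL X x. (ALL n. X n : S) --> slim X x --> x : S)"

lemma star_algD: assumes "star_alg S" shows "1 : S" "0 : S" "x : S ==> y : S ==> x + y : S" "x : S ==> y : S ==> x * y : S"
  "x : S ==> x\<dagger> : S" "x : S ==> csc c x : S" "x : S ==> - x : S"
  "x : S ==> y : S ==> x - y : S" "x : S ==> r *\<^sub>R x : S"
proof -
 have add: "!!x y. x : S ==> y : S ==> x + y : S" and csc: "!!c x. x : S ==> csc c x : S" and one: "1 : S" using assms by (auto simp: star_alg_def)
 show "0 : S" using csc[OF one, of 0] by simp
 show min: "x : S ==> - x : S" for x using csc[of x "- 1"] by (simp add: csc_minus_left)
 show "x : S ==> y : S ==> x - y : S" using add[of x "- y"] min by simp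
 show "x : S ==> r *\<^sub>R x : S" using csc by (simp add: scaleR_csc)
qed (use assms in "auto simp: star_alg_def")

lemma star_alg_sum: "star_alg S ==> (!!i. i : A ==> f i : S) ==> (SUM i:A. f i) : S"
 by (induction A rule: infinite_finite_induct) (auto simp: star_algD)

lemma salgD: "salg S ==> star_alg S" "salg S ==> (!!n. X n : S) ==> slim X x ==> x : S" by (auto simp: salg_def)

lemma salg_commutant: assumes "!!c. c : M ==> c\<dagger> : M" shows "salg {x. ALL c:M. x * c = c * x}"
proof -
 have mult: "(x * y) * c = c * (x * y)" if "x * c = c * x" "y * c = c * y" for x y c :: "'a bop" using that by (metis mult.assoc)
 have adj: "x\<dagger> * c = c * x\<dagger>" if "ALL c:M. x * c = c * x" "c : M" for x c
 proof -
  have "(x * c\<dagger>)\<dagger> = (c\<dagger> * x)\<dagger>" using that assms by metis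
  thus ?thesis by simp
 qed
 have lim: "x * c = c * x" if "ALL n. X n * c = c * X n" "slim X x" for X x c
 proof -
  have "slim (%n. X n * c) (x * c)" "slim (%n. c * X n) (c * x)" by (intro slim_mult that slim_const)+
  thus ?thesis using that by (auto intro: slim_unique)
 qed
 show ?thesis unfolding salg_def star_alg_def mem_Collect_eq
 proof (intro conjI ballI allI impI)
  fix X x c assume "ALL n. ALL c:M. X n * c = c * X n" "slim X x" "c : M"
  thus "x * c = c * x" using lim[of X c x] by blast
 qed (use mult adj in "simp_all add: distrib_left distrib_right")
qed

lemma salg_commute1: "b\<dagger> = b ==> salg {x. x * b = b * x}" using salg_commutant[of "{b}"] by simp

lemma salg_Int: "salg S ==> salg T ==> salg (S \<inter> T)" unfolding salg_def star_alg_def by simp blast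

subsection \<open>Square roots\<close>

text \<open>Polynomials in \<open>a\<close> with nonnegative coefficients. They commute, are closed
  under products, and are positive for positive \<open>a\<close>, because every power of
  \<open>a\<close> is a sandwich of \<open>1\<close> or of \<open>a\<close>.\<close>

inductive_set power_cone :: "'h::complex_hilbert_space bop => 'h bop set" for a where
 pow: "a ^ k : power_cone a"
| add: "x : power_cone a ==> y : power_cone a ==> x + y : power_cone a"
| scale: "x : power_cone a ==> r >= 0 ==> r *\<^sub>R x : power_cone a"

lemma bop_scaleR_mult [simp]:
 "(r *\<^sub>R x) * y = r *\<^sub>R (x * y)" "x * (r *\<^sub>R y) = r *\<^sub>R (x * (y::'h::complex_hilbert_space bop))"
 by (simp_all add: scaleR_csc)

lemma power_cone_mult: "x : power_cone a ==> y : power_cone a ==> x * y : power_cone a & x * y = y * x"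
proof (induction x rule: power_cone.induct)
 case (pow k)
 thus ?case
 proof (induction y rule: power_cone.induct)
  case (pow l)
  thus ?case by (metis add.commute power_add power_cone.pow)
 qed (auto simp: distrib_left distrib_right intro: power_cone.intros)
qed (auto simp: distrib_left distrib_right intro: power_cone.intros)

lemma power_cone_psd: assumes "psd a" "x : power_cone a" shows "psd x" using assms(2)
proof (induction rule: power_cone.induct)
 case (pow k)
 have adj: "(a ^ j)\<dagger> = a ^ j" for j by (induction j) (simp_all add: psd_adj[OF assms(1)] power_commutes)
 obtain j where "k = j + j | k = j + 1 + j" by (metis (no_types) add.commute add.left_commute mult_2 oddE evenE)
 thus ?case
 proof
  assume "k = j + 1 + j"
  hence "a ^ k = a ^ j * a * a ^ j" by (simp only: power_add power_one_right)
  thus ?thesis using psd_sandwich'[OF assms(1) adj[of j]] by simp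
 next
  assume "k = j + j"
  hence "a ^ k = a ^ j * 1 * a ^ j" by (simp add: power_add)
  thus ?thesis using psd_sandwich'[OF psd_1 adj[of j]] by simp
 qed
qed (auto intro: psd_add psd_scaleR)

text \<open>Visser's iteration \<open>r \<mapsto> (a + r\<^sup>2) / 2\<close> increases to \<open>1 - sqrt (1 - a)\<close>.\<close>

lemma sqrt_one_minus: assumes S: "salg S" "a : S" and a: "psd a" "psd (1 - a)" shows "EX b:S. psd b & b * b = 1 - a"
proof -
 define r where "r = rec_nat 0 (%_ r. (1/2::real) *\<^sub>R (a + r * r))"
 have r0: "r 0 = 0" and rS: "!!n. r (Suc n) = (1/2::real) *\<^sub>R (a + r n * r n)" by (simp_all add: r_def)
 \<comment> \<open>Each increment is half the product of the previous increment with
   \<open>r (Suc n) + r n\<close>, so it stays in the cone; this gives monotonicity.\<close>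
 have cone: "r n : power_cone a & r (Suc n) - r n : power_cone a" for n
 proof (induction n)
  case 0
  show ?case using power_cone.scale[OF power_cone.pow[of a 1], of "1/2"] power_cone.scale[OF power_cone.pow[of a 1], of 0] by (simp add: r0 rS)
 next
  case (Suc n)
  have 1: "r (Suc n) : power_cone a" using Suc power_cone.add[of "r n" a "r (Suc n) - r n"] by simp
  have "r (Suc n) * r n = r n * r (Suc n)" using power_cone_mult 1 Suc by blast
  hence "r (Suc n) * r (Suc n) - r n * r n = (r (Suc n) - r n) * (r (Suc n) + r n)" by (simp add: algebra_simps)
  moreover have "(r (Suc n) - r n) * (r (Suc n) + r n) : power_cone a" using power_cone_mult power_cone.add 1 Suc by blast
  moreover have "r (Suc (Suc n)) - r (Suc n) = (1/2::real) *\<^sub>R (r (Suc n) * r (Suc n) - r n * r n)"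
   unfolding rS[of "Suc n"] by (subst (3) rS) (simp add: scaleR_diff_right[symmetric])
  ultimately have "r (Suc (Suc n)) - r (Suc n) : power_cone a" by (simp add: power_cone.scale)
  with 1 show ?case by blast
 qed
 have rpsd: "psd (r n)" for n using cone power_cone_psd[OF a(1)] by blast
 have one: "psd (1 - r n)" for n
 proof (induction n)
  case (Suc n)
  have "psd (1 - r n * r n)" using psd_contraction[OF rpsd Suc] psd_adj[OF rpsd] by (simp add: opbound_psd)
  moreover have "(1/2::real) *\<^sub>R ((1 - a) + (1 - r n * r n)) = (1/2::real) *\<^sub>R (2 *\<^sub>R 1 - (a + r n * r n))" by (simp add: scaleR_2)
  hence "(1/2::real) *\<^sub>R ((1 - a) + (1 - r n * r n)) = 1 - r (Suc n)" by (simp add: rS scaleR_diff_right)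
  ultimately show ?case using psd_scaleR[OF psd_add[OF a(2)], of "1 - r n * r n" "1/2"] by simp
 qed (simp add: r0)
 obtain x where x: "slim r x" "psd x" "psd (1 - x)" by (rule monotone_slim[of r]) (use power_cone_psd[OF a(1)] cone rpsd one in auto)
 have "r n : S" for n by (induction n) (auto simp: r0 rS star_algD[OF salgD(1)[OF S(1)]] S(2))
 hence xS: "x : S" using salgD(2)[OF S(1)] x(1) by blast
 have "slim (%n. r (Suc n)) ((1/2::real) *\<^sub>R (a + x * x))" unfolding rS by (intro slim_scaleR slim_add slim_const slim_mult x)
 hence "x = (1/2::real) *\<^sub>R (a + x * x)" using slim_unique slim_Suc[OF x(1)] by blast
 hence "2 *\<^sub>R x = 2 *\<^sub>R ((1/2::real) *\<^sub>R (a + x * x))" by (rule arg_cong)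
 hence "2 *\<^sub>R x = a + x * x" by simp
 hence "(1 - x) * (1 - x) = 1 - a" by (simp add: algebra_simps scaleR_2)
 moreover have "1 - x : S" using star_algD(1,8)[OF salgD(1)[OF S(1)]] xS by simp
 ultimately show ?thesis using x(3) by (intro bexI[of _ "1 - x"]) simp_all
qed

text \<open>Division by a norm bound \<open>C\<close> brings \<open>c\<close> into the range of
  \<open>sqrt_one_minus\<close>.\<close>

lemma psd_sqrt: assumes S: "salg S" "c : S" and c: "psd c"
 obtains b where "b : S" "b\<dagger> = b" "b * b = c"
proof -
 obtain C where C: "C > 0" "opbound c C" by (rule opbound_ex)
 define a where "a = 1 - (1/C) *\<^sub>R c"
 have "a = (1/C) *\<^sub>R (C *\<^sub>R 1 - c)" using C by (simp add: a_def scaleR_diff_right)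
 hence "psd a" using C opbound_selfadj[OF C(2) psd_adj[OF c]] by (simp add: psd_scaleR)
 moreover have "1 - a = (1/C) *\<^sub>R c" by (simp add: a_def)
 moreover have "psd (1 - a)" using C c by (simp add: a_def psd_scaleR)
 moreover have "a : S" unfolding a_def using S(2) by (intro star_algD[OF salgD(1)[OF S(1)]])
 ultimately obtain b where b: "b : S" "psd b" "b * b = (1/C) *\<^sub>R c" using sqrt_one_minus[OF S(1)] by metis
 have "(sqrt C *\<^sub>R b) * (sqrt C *\<^sub>R b) = c" using C b by simp
 moreover have "sqrt C *\<^sub>R b : S" using b star_algD(9)[OF salgD(1)[OF S(1)]] by blast
 moreover have "(sqrt C *\<^sub>R b)\<dagger> = sqrt C *\<^sub>R b" by (simp add: psd_adj[OF b(2)])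
 ultimately show thesis using that by blast
qed

text \<open>A square root \<open>c\<close> of \<open>a\<close> can be taken in the commutant of
  \<open>b\<close>, and then \<open>a * b = c * b * c\<close>.\<close>

lemma psd_mult_commute: assumes "psd a" "psd b" "a * b = b * a" shows "psd (a * b)"
proof -
 have "a : {x. x * b = b * x}" using assms by simp
 then obtain c where c: "c * b = b * c" "c\<dagger> = c" "c * c = a" using psd_sqrt[OF salg_commute1[OF psd_adj[OF assms(2)]] _ assms(1)] by blast
 have "a * b = c * b * c" by (metis c(1,3) mult.assoc)
 thus ?thesis using psd_sandwich'[OF assms(2) c(2)] by simp
qed

subsection \<open>Polar decomposition\<close>

lemma slim_mult_left: "slim X x ==> slim (%n. c * X n) (c * x)" by (intro slim_mult slim_const)

lemma slim_mult_right: "slim X x ==> slim (%n. X n * c) (x * c)" by (intro slim_mult slim_const)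

lemma slim_zero: "slim X x ==> (!!n. X n = 0) ==> x = 0" using slim_unique[of X x 0] slim_const[of 0] by (metis (no_types, lifting) ext)

text \<open>What later steps use of the partial isometry \<open>v\<close> of \<open>y\<close>. The
  positivity clause gives, after taking traces, the distance between \<open>y\<close> and
  \<open>v\<close>; the clause over \<open>S\<close> places \<open>v\<close> in every closed algebra
  containing \<open>y\<close>; the annihilator clauses say that \<open>v\<close> has the supports of
  \<open>y\<close>; the last clause makes \<open>v\<close> the sign of a self-adjoint
  \<open>y\<close>.\<close>

definition polar_part :: "'h::complex_hilbert_space bop => 'h bop => bool" where
 "polar_part y v <-> (v\<dagger> * v) * (v\<dagger> * v) = v\<dagger> * v & y * (v\<dagger> * v) = y & v * (v\<dagger> * v) = v &
   psd (v\<dagger> * v - y\<dagger> * y - (v - y)\<dagger> * (v - y)) &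
   (ALL S. salg S --> y : S --> v : S) & (ALL c. c * y = 0 --> c * v = 0) &
   (ALL b. y * b = 0 --> v * b = 0) & (y\<dagger> = y --> v\<dagger> = v & psd (y * v))"

lemma polar_partD: assumes "polar_part y v"
 shows "(v\<dagger> * v) * (v\<dagger> * v) = v\<dagger> * v" "y * (v\<dagger> * v) = y" "v * (v\<dagger> * v) = v"
  "psd (v\<dagger> * v - y\<dagger> * y - (v - y)\<dagger> * (v - y))"
  "salg S ==> y : S ==> v : S" "c * y = 0 ==> c * v = 0" "y * b = 0 ==> v * b = 0"
  "y\<dagger> = y ==> v\<dagger> = v" "y\<dagger> = y ==> psd (y * v)" using assms unfolding polar_part_def by blast+

text \<open>
  With \<open>h = sqrt (y\<^sup>\<dagger> y)\<close>, the partial isometry \<open>v\<close> is the limit of \<open>y (1 + b + \<dots> + b\<^sup>n)\<close> for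
  \<open>b = 1 - h\<close>.
\<close>

lemma polar:
 fixes y :: "'h::complex_hilbert_space bop" assumes y1: "psd (1 - y\<dagger> * y)" shows "EX v. polar_part y v"
proof -
 define a where "a = y\<dagger> * y"
 have a: "psd a" "psd (1 - a)" using psd_square[of y] y1 by (auto simp: a_def)
 \<comment> \<open>The smallest closed algebra containing \<open>a\<close>. A root taken there lies
   in all such algebras at once, as the quantified clause of \<open>polar_part\<close>
   requires.\<close>
 define T where "T = {x. ALL S. salg S --> a : S --> x : S}"
 note [simp] = star_algD salgD(1)
 have "star_alg T" unfolding star_alg_def[of T] by (simp add: T_def)
 moreover have "x : T" if "ALL n. X n : T" "slim X x" for X x using that salgD(2) unfolding T_def by blast
 ultimately have T: "salg T" by (simp add: salg_def[of T])
 have "1 - a : T" by (simp add: T_def)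
 from sqrt_one_minus[OF T this] a obtain h where h: "psd h" "h * h = a" and "h : T" by auto
 hence hS: "salg S ==> a : S ==> h : S" for S by (simp add: T_def)
 note hh = h(2) and h = h(1)
 have "opbound h 1" using a h by (simp add: opbound_psd psd_adj hh)
 hence b: "psd (1 - h)" using opbound_selfadj(1)[of h 1] h by (simp add: psd_adj)
 define r where "r n = (SUM k<n. (1 - h) ^ k)" for n
 define t where "t n = 1 - (1 - h) ^ n" for n
 \<comment> \<open>Geometric sum: \<open>y * r n\<close> approximates the quotient of
   \<open>y\<close> by \<open>h\<close>, and \<open>h * r n\<close> increases to the support
   projection of \<open>h\<close>.\<close>
 have hr: "h * r n = t n" for n unfolding t_def r_def by (induction n) (simp_all add: distrib_left algebra_simps)
 have com: "c * r n = r n * c" if "c * h = h * c" for c n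
 proof -
  have "c * (1 - h) ^ k = (1 - h) ^ k * c" for k using power_commuting_commutes[of "1 - h" c k] that by (simp add: algebra_simps)
  thus ?thesis by (simp add: r_def sum_distribs)
 qed
 have rS: "r n : S" if S: "salg S" "a : S" for S n
 proof -
  have "(1 - h) ^ k : S" for k by (induction k) (simp_all add: hS S)
  thus ?thesis unfolding r_def by (simp add: star_alg_sum S)
 qed
 have pw: "psd ((1 - h) ^ k)" for k by (rule power_cone_psd[OF b power_cone.pow])
 have r: "psd (r n)" for n unfolding r_def by (intro psd_sum pw)
 have t: "psd (t n)" for n unfolding hr[symmetric] by (rule psd_mult_commute[OF h r com]) simp
 have "t (Suc n) - t n = h * (1 - h) ^ n" "h * (1 - h) ^ n = (1 - h) ^ n * h" for n
  using power_commuting_commutes[of "1 - h" h n] by (simp_all add: t_def algebra_simps)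
 hence "psd (t (Suc n) - t n)" for n using psd_mult_commute[OF h pw[of n]] by simp
 then obtain e where e: "slim t e" "psd e" by (rule monotone_slim[of t]) (simp_all add: t, simp add: t_def pw)
 have "slim (%n. (1 - h) * (1 - t n)) ((1 - h) * (1 - e))" by (intro slim_mult slim_diff slim_const e)
 hence "(1 - h) * (1 - e) = 1 - e" using slim_unique slim_diff[OF slim_const slim_Suc[OF e(1)], of 1] by (simp add: t_def)
 hence he: "h * (1 - e) = 0" by (simp add: algebra_simps)
 have t0: "t n * z = 0" if "h * z = 0" for z n using that com[of h n] by (simp add: mult.assoc flip: hr)
 have e0: "e * z = 0" if "h * z = 0" for z by (rule slim_zero[OF slim_mult_right[OF e(1)] t0[OF that]])
 have ee: "e * e = e" using e0[OF he] by (simp add: algebra_simps)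
 \<comment> \<open>\<open>y\<close> and \<open>h\<close> have the same inner products, so
   convergence of \<open>y * r n\<close> reduces to that of \<open>t n = h * r n\<close>.\<close>
 have yc: "cinner (app y u) (app y z) = cinner (app h u) (app h z)" for u z
 proof -
  have "cinner (app x u) (app x z) = cinner u (app (x\<dagger> * x) z)" for x by (simp add: cinner_adj_right)
  thus ?thesis by (simp add: psd_adj[OF h] hh del: app_ring flip: a_def)
 qed
 have yn: "norm (app y u) = norm (app h u)" for u using yc[of u u] by (simp add: cinner_self flip: of_real_power)
 define v where "v n = y * r n" for n
 have vt: "app h (app (r n) x) = app (t n) x" for n x by (simp flip: hr)
 have nrm: "norm (app (v m) x - app (v n) x) = norm (app (t m) x - app (t n) x)" for m n x
  using yn[of "app (r m) x - app (r n) x"] by (simp add: v_def vt)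
 have "opbound (v n) 1" for n using psd_contraction[OF t] pw yn by (simp add: opbound_def v_def vt t_def)
 moreover have "convergent (%n. app (v n) x)" for x
  using LIMSEQ_imp_Cauchy[OF slimD[OF e(1), of x]] unfolding Cauchy_convergent_iff[symmetric] Cauchy_def dist_norm nrm .
 ultimately obtain w where w: "slim v w" using slim_ex[of v] by blast
 have wc: "cinner (app w u) (app w z) = cinner (app e u) (app e z)" for u z
  using slim_cinner[OF w w, of u z] LIMSEQ_unique[OF slim_cinner[OF e(1,1), of u z]] by (simp add: v_def yc vt)
 have we: "w\<dagger> * w = e"
 proof -
  have "w\<dagger> * w = e\<dagger> * e" by (rule bop_eqI, rule cinner_eqI) (simp add: cinner_adj wc)
  thus ?thesis by (simp add: psd_adj e ee)
 qed
 have y0: "y * z = 0 <-> h * z = 0" for z using adj_mult_self_eq_0[of "y * z"] adj_mult_self_eq_0[of "h * z"] hh psd_adj[OF h]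
  by (simp add: a_def mult.assoc) (simp flip: mult.assoc)
 have ye: "y * e = y" using y0[of "1 - e"] he by (simp add: algebra_simps)
 have kill': "w * z = 0" if "y * z = 0" for z
  using e0[of z] that adj_mult_self_eq_0[of "w * z"] by (simp add: y0 we mult.assoc) (simp add: we flip: mult.assoc)
 have wy: "w * h = y"
 proof -
  have "v n * h = y * t n" for n using com[of h n] by (simp add: v_def mult.assoc flip: hr)
  thus ?thesis using slim_unique[OF slim_mult_right[OF w, of h]] slim_mult_left[OF e(1), of y] ye by simp
 qed
 have wwe: "w * e = w" using kill'[of "1 - e"] ye by (simp add: algebra_simps)
 have eh: "e * h = h" using he adj_ring(6)[of h e] psd_adj[OF h] psd_adj[OF e(2)] by (simp add: right_diff_distrib)
 have "polar_part y w" unfolding polar_part_def we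
 proof (intro conjI allI impI)
  have "w\<dagger> * y = h" using eh we by (simp add: mult.assoc flip: wy) (simp add: we flip: mult.assoc)
  moreover from this have "y\<dagger> * w = h" using psd_adj[OF h] by (metis adj_ring(6) adj_adj)
  ultimately have "e - y\<dagger> * y - (w - y)\<dagger> * (w - y) = (h - h * h) + (h - h * h)" by (simp add: diff_distribs we hh a_def)
  thus "psd (e - y\<dagger> * y - (w - y)\<dagger> * (w - y))" by (simp only: psd_add psd_diff_square[OF h b])
  show "w : S" if S: "salg S" "y : S" for S
  proof (rule salgD(2)[OF S(1) _ w])
   show "v n : S" for n by (simp add: v_def rS a_def S)
  qed
  show "c * w = 0" if "c * y = 0" for c by (rule slim_zero[OF slim_mult_left[OF w]]) (simp add: v_def that flip: mult.assoc)
 next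
  assume y: "y\<dagger> = y"
  have "h * y = y * h" using hS[OF salg_commute1[OF y]] by (simp add: a_def y mult.assoc)
  thus "w\<dagger> = w" by (intro slim_adj_eq[OF w w]) (simp add: v_def psd_adj[OF r] y com)
  have "y * v n = h * t n" for n by (simp add: v_def hh a_def y flip: hr mult.assoc)
  moreover have "psd (h * t n)" for n using com[of h n, OF refl, symmetric] by (intro psd_mult_commute[OF h t]) (simp add: mult.assoc flip: hr)
  ultimately show "psd (y * w)" by (intro slim_psd[OF slim_mult_left[OF w]]) simp
 qed (use ee ye wwe kill' in blast)+
 thus ?thesis by blast
qed

section \<open>Projections and spectral projections\<close>

definition projn :: "'h::complex_hilbert_space bop => bool" where
 "projn p <-> p\<dagger> = p & p * p = p"

lemma projnD: "projn p ==> p\<dagger> = p" "projn p ==> p * p = p" by (auto simp: projn_def)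

lemma projn_psd: "projn p ==> psd p" using psd_square[of p] by (simp add: projn_def)

lemma projn_compl: "projn p ==> projn (1 - p)" by (simp add: projn_def algebra_simps)

lemma projn_0 [simp]: "projn 0" and projn_1 [simp]: "projn 1" by (simp_all add: projn_def)

lemma projn_diff: "projn p ==> projn q ==> p * q = q ==> projn (p - q)" by (auto simp: projn_def algebra_simps) (metis adj_ring(6) diff_self)

lemma projn_add: "projn p ==> projn q ==> p * q = 0 ==> projn (p + q)" by (auto simp: projn_def algebra_simps) (metis adj_ring(1,6) add_0)

text \<open>After rescaling, the polar part \<open>v\<close> of \<open>y\<close> is self-adjoint
  with \<open>v * (v * v) = v\<close>, that is, the sign of \<open>y\<close>;
  \<open>p = (v + v * v) / 2\<close> is its eigenprojection for 1, the projection of the strictly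
  positive part. The last two facts keep \<open>p\<close> in any closed algebra and any corner
  containing \<open>y\<close>.\<close>

lemma spectral_projection:
 fixes y :: "'h::complex_hilbert_space bop" assumes y: "y\<dagger> = y"
 obtains p where "projn p" "y * p = p * y" "psd (y * p)" "psd (- (y * (1 - p)))"
  "y * p = 0 ==> p = 0" "!!S. salg S ==> y : S ==> p : S"
  "!!q. y * q = y ==> q * y = y ==> p * q = p & q * p = p"
proof -
 obtain C where C: "C > 0" "opbound y C" by (rule opbound_ex)
 define x where "x = (1/C) *\<^sub>R y"
 have "opbound x 1" using opbound_scaleR[OF C(2), of "1/C"] C by (simp add: x_def)
 hence x1: "psd (1 - x\<dagger> * x)" by (simp add: opbound_psd)
 have xa: "x\<dagger> = x" by (simp add: x_def y)
 have yx: "y = C *\<^sub>R x" using C by (simp add: x_def)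
 obtain v where pv: "polar_part x v" using polar[OF x1] by blast
 note v = polar_partD(1-3)[OF pv] polar_partD(5-7)[OF pv] polar_partD(8,9)[OF pv xa]
 have xvv: "x * (v * v) = x" and vvv: "v * (v * v) = v" using v(2,3,7) by simp_all
 define p where "p = (1/2::real) *\<^sub>R (v + v * v)"
 have "x * v = v * x" using v(4)[OF salg_commute1[OF xa]] by simp
 hence xp: "x * p = p * x" unfolding p_def by (simp add: algebra_simps) (metis mult.assoc)
 have half: "(1/2::real) *\<^sub>R z + (1/2::real) *\<^sub>R z = z" for z :: "'h bop" by (simp flip: scaleR_left_distrib)
 have "(v + v * v) * (v + v * v) = 2 *\<^sub>R (v + v * v)" by (simp add: algebra_simps vvv scaleR_2 mult.assoc)
 hence pp: "p * p = p" unfolding p_def by simp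
 have p: "projn p" unfolding projn_def using v(7) pp by (simp add: p_def)
 have vp: "v * p = p" by (simp add: p_def algebra_simps vvv)
 have xp2: "x * p = (1/2::real) *\<^sub>R (x * v + x)" by (simp add: p_def algebra_simps xvv)
 have "psd (p * (x * v) * p)" by (rule psd_sandwich'[OF v(8)]) (simp add: projnD[OF p])
 moreover have "p * (x * v) * p = x * p" by (metis mult.assoc vp xp pp)
 ultimately have P1: "psd (x * p)" by simp
 have "psd ((1 - p) * (x * v) * (1 - p))" by (rule psd_sandwich'[OF v(8)]) (simp add: projnD[OF projn_compl[OF p]] projnD[OF p])
 moreover have "(1 - p) * (x * v) * (1 - p) = - (x * (1 - p))"
 proof -
  have "(x * v) * (1 - p) = x * v - x * p" by (simp add: algebra_simps vp)
  also have "... = x * p - x" using half[of "x * v"] half[of x] unfolding xp2 by (simp add: scaleR_add_right algebra_simps)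
  finally have *: "(x * v) * (1 - p) = x * p - x" .
  hence "(1 - p) * (x * v) * (1 - p) = (1 - p) * (x * p - x)" by (simp only: mult.assoc)
  also have "... = - (x * (1 - p))" by (simp add: algebra_simps xp pp) (metis mult.assoc pp xp)
  finally show ?thesis .
 qed
 ultimately have P2: "psd (- (x * (1 - p)))" by simp
 show thesis
 proof (rule that[OF p])
  show "y * p = p * y" using xp by (simp add: yx)
  show "psd (y * p)" using psd_scaleR[OF P1, of C] C by (simp add: yx)
  show "psd (- (y * (1 - p)))" using psd_scaleR[OF P2, of C] C by (simp add: yx)
  show "p = 0" if "y * p = 0"
  proof -
   have "x * p = 0" using that C by (simp add: yx)
   hence "x * v + x = 0" unfolding xp2 by simp
   hence "x * (v + 1) = 0" by (simp add: distrib_left)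
   hence "v * (v + 1) = 0" by (rule v(6))
   thus ?thesis by (simp add: p_def algebra_simps)
  qed
  show "p : S" if S: "salg S" "y : S" for S
  proof -
   note S' = star_algD[OF salgD(1)[OF S(1)]]
   have "v : S" using v(4)[OF S(1)] S' S(2) by (simp add: x_def)
   thus ?thesis unfolding p_def by (intro S')
  qed
  show "p * q = p & q * p = p" if "y * q = y" "q * y = y" for q
  proof -
   have "x * (q - 1) = 0" "(q - 1) * x = 0" using that C by (simp_all add: x_def algebra_simps)
   hence "v * (q - 1) = 0" "(q - 1) * v = 0" using v by blast+
   hence "v * q = v" "q * v = v" by (simp_all add: algebra_simps)
   thus ?thesis by (simp add: p_def algebra_simps) (metis mult.assoc)
  qed
 qed
qed

subsection \<open>Orthogonal projections and the bicommutant theorem\<close>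

text \<open>\<open>z\<close> is the orthogonal projection of \<open>w\<close> onto the closure of
  \<open>S\<close> in the sum of \<open>K\<close> copies; entries from \<open>K\<close> on are
  unconstrained.\<close>

definition orth_proj :: "nat => (nat => 'h::complex_hilbert_space) set => (nat => 'h) => (nat => 'h) => bool" where
 "orth_proj K S w z <-> (EX X. (ALL n. X n : S) & (ALL k<K. (%n. X n k) ----> z k)) &
   (ALL u:S. (SUM k<K. cinner (z k - w k) (u k)) = 0)"

lemma orth_proj_ex: assumes S: "complex_subspace S" shows "EX z. orth_proj K S w z"
proof -
 have "(cmod (SUM k<K. cinner (w k) (u k)))\<^sup>2 <= (SUM k<K. (norm (w k))\<^sup>2) * (SUM k<K. (norm (u k))\<^sup>2)" for u
 proof -
  have "cmod (SUM k<K. cinner (w k) (u k)) <= (SUM k<K. norm (w k) * norm (u k))" by (intro sum_norm_le cinner_bound)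
  hence "(cmod (SUM k<K. cinner (w k) (u k)))\<^sup>2 <= (SUM k<K. norm (w k) * norm (u k))\<^sup>2" by (intro power_mono) auto
  also have "... <= (SUM k<K. (norm (w k))\<^sup>2) * (SUM k<K. (norm (u k))\<^sup>2)" by (rule Cauchy_Schwarz_ineq_sum)
  finally show ?thesis .
 qed
 hence "EX z X. (ALL n. X n : S) & (ALL k<K. (%n. X n k) ----> z k) &
  (ALL u:S. (SUM k<K. cinner (w k) (u k)) = (SUM k<K. cinner (z k) (u k)))" by (intro riesz_family[where C = "SUM k<K. (norm (w k))\<^sup>2"] S)
   (simp_all add: cinner_add_right cinner_scaleC_right sum.distrib sum_distrib_left)
 then obtain z X where "ALL n. X n : S" "ALL k<K. (%n. X n k) ----> z k"
  "ALL u:S. (SUM k<K. cinner (w k) (u k)) = (SUM k<K. cinner (z k) (u k))" by (elim exE conjE)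
 hence "orth_proj K S w z" unfolding orth_proj_def by (auto simp: cinner_diff_left sum_subtractf)
 thus ?thesis by blast
qed

lemma orth_proj_add: assumes S: "complex_subspace S" and "orth_proj K S w z" "orth_proj K S w' z'"
 shows "orth_proj K S (%k. w k + w' k) (%k. z k + z' k)"
proof -
 obtain X Y where "ALL n. X n : S" "ALL k<K. (%n. X n k) ----> z k" "ALL n. Y n : S" "ALL k<K. (%n. Y n k) ----> z' k"
  using assms(2,3) by (auto simp: orth_proj_def)
 hence "EX Z. (ALL n. Z n : S) & (ALL k<K. (%n. Z n k) ----> z k + z' k)"
  using S by (intro exI[of _ "%n k. X n k + Y n k"]) (auto simp: complex_subspace_def intro!: tendsto_add)
 moreover have "(SUM k<K. cinner (z k + z' k - (w k + w' k)) (u k)) = 0" if "u : S" for u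
 proof -
  have "(SUM k<K. cinner (z k + z' k - (w k + w' k)) (u k))
   = (SUM k<K. cinner (z k - w k) (u k)) + (SUM k<K. cinner (z' k - w' k) (u k))"
   unfolding sum.distrib[symmetric] by (intro sum.cong refl) (simp add: cinner_diff_left cinner_add_left)
  thus ?thesis using assms(2,3) that by (simp add: orth_proj_def)
 qed
 ultimately show ?thesis unfolding orth_proj_def by blast
qed

lemma orth_proj_scale: assumes S: "complex_subspace S" and "orth_proj K S w z" shows "orth_proj K S (%k. c *\<^sub>C w k) (%k. c *\<^sub>C z k)"
proof -
 obtain X where "ALL n. X n : S" "ALL k<K. (%n. X n k) ----> z k" using assms(2) by (auto simp: orth_proj_def)
 hence "EX Z. (ALL n. Z n : S) & (ALL k<K. (%n. Z n k) ----> c *\<^sub>C z k)"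
  using S by (intro exI[of _ "%n k. c *\<^sub>C X n k"]) (auto simp: complex_subspace_def intro!: tendsto_scaleC)
 moreover have "(SUM k<K. cinner (c *\<^sub>C z k - c *\<^sub>C w k) (u k)) = 0" if "u : S" for u
 proof -
  have "(SUM k<K. cinner (c *\<^sub>C z k - c *\<^sub>C w k) (u k)) = cnj c * (SUM k<K. cinner (z k - w k) (u k))"
   unfolding sum_distrib_left by (intro sum.cong refl) (simp add: scaleC_diff_right[symmetric] cinner_scaleC_left)
  thus ?thesis using assms(2) that by (simp add: orth_proj_def)
 qed
 ultimately show ?thesis unfolding orth_proj_def by blast
qed

lemma orth_proj_bound: assumes "orth_proj K S w z" shows "(SUM k<K. (norm (z k))\<^sup>2) <= (SUM k<K. (norm (w k))\<^sup>2)"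
proof -
 obtain X where X: "ALL n. X n : S" "ALL k<K. (%n. X n k) ----> z k" using assms(1) by (auto simp: orth_proj_def)
 have "(%n. SUM k<K. cinner (z k - w k) (X n k)) ----> (SUM k<K. cinner (z k - w k) (z k))"
  using X(2) by (intro tendsto_sum tendsto_cinner tendsto_const) auto
 moreover have "(SUM k<K. cinner (z k - w k) (X n k)) = 0" for n using assms X(1) by (auto simp: orth_proj_def)
 ultimately have 0: "(SUM k<K. cinner (z k - w k) (z k)) = 0" by (simp add: LIMSEQ_const_iff)
 have "(SUM k<K. (norm (w k))\<^sup>2) = (SUM k<K. (norm (z k))\<^sup>2 + (norm (z k - w k))\<^sup>2 - 2 * Re (cinner (z k - w k) (z k)))"
  by (intro sum.cong refl) (simp add: power2_norm_eq_inner inner_eq_Re_cinner[symmetric] inner_diff_left inner_diff_right inner_commute)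
 also have "... = (SUM k<K. (norm (z k))\<^sup>2) + (SUM k<K. (norm (z k - w k))\<^sup>2) - 2 * Re (SUM k<K. cinner (z k - w k) (z k))"
  by (simp add: sum.distrib sum_subtractf sum_distrib_left)
 finally show ?thesis by (simp add: 0 sum_nonneg)
qed

lemma orth_proj_unique: assumes S: "complex_subspace S" and "orth_proj K S w z" "orth_proj K S w z'" "k < K" shows "z k = z' k"
proof -
 have "orth_proj K S (%k. w k + (-1) *\<^sub>C w k) (%k. z k + (-1) *\<^sub>C z' k)" by (intro orth_proj_add orth_proj_scale assms)
 from orth_proj_bound[OF this] have "(SUM k<K. (norm (z k - z' k))\<^sup>2) <= 0" by (simp add: scaleC_minus_left)
 hence "(SUM k<K. (norm (z k - z' k))\<^sup>2) = 0" by (simp add: antisym sum_nonneg)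
 thus ?thesis using assms(4) by (simp add: sum_nonneg_eq_0_iff)
qed

lemma orth_proj_mem: "u : S ==> orth_proj K S u u" unfolding orth_proj_def by (auto intro!: exI[of _ "%n. u"])

lemma orth_proj_app: assumes "orth_proj K S w z" and "!!u. u : S ==> (%k. app T (u k)) : S" "!!u. u : S ==> (%k. app (T\<dagger>) (u k)) : S"
 shows "orth_proj K S (%k. app T (w k)) (%k. app T (z k))"
proof -
 obtain X where "ALL n. X n : S" "ALL k<K. (%n. X n k) ----> z k" using assms(1) by (auto simp: orth_proj_def)
 hence "EX Z. (ALL n. Z n : S) & (ALL k<K. (%n. Z n k) ----> app T (z k))"
  using assms(2) by (intro exI[of _ "%n k. app T (X n k)"]) (auto intro!: tendsto_app)
 moreover have "(SUM k<K. cinner (app T (z k) - app T (w k)) (u k)) = 0" if "u : S" for u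
 proof -
  have "(SUM k<K. cinner (app T (z k) - app T (w k)) (u k)) = (SUM k<K. cinner (z k - w k) (app (T\<dagger>) (u k)))" by (simp add: cinner_adj_right)
  thus ?thesis using assms(1) assms(3)[OF that] by (auto simp: orth_proj_def)
 qed
 ultimately show ?thesis unfolding orth_proj_def by blast
qed

text \<open>The projection onto the closure of \<open>S\<close> as a \<open>K\<close> by
  \<open>K\<close> matrix of operators. An operator that acts diagonally and leaves \<open>S\<close>
  invariant together with its adjoint commutes with the projection, which means entry by entry that
  it commutes with \<open>p k l\<close>.\<close>

lemma orth_proj_matrix: assumes S: "complex_subspace (S :: (nat => 'h::complex_hilbert_space) set)"
 shows "EX p. (ALL w. orth_proj K S w (%k. SUM l<K. app (p k l) (w l))) &
  (ALL T k l. k < K --> l < K --> (ALL u:S. (%k. app T (u k)) : S) --> (ALL u:S. (%k. app (T\<dagger>) (u k)) : S) -->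
    T * p k l = p k l * T)"
proof -
 obtain Z where Z: "!!w. orth_proj K S w (Z w)" using orth_proj_ex[OF S] by metis
 define d where "d l v = (%m. if m = l then v else (0::'h))" for l :: nat and v
 have dadd: "d l (v + w) = (%m. d l v m + d l w m)" and dscale: "d l (c *\<^sub>C v) = (%m. c *\<^sub>C d l v m)"
  and dapp: "d l (app T v) = (%m. app T (d l v m))" for l v w c T by (auto simp: d_def)
 have Zadd: "Z (%k. w k + w' k) k = Z w k + Z w' k" if "k < K" for w w' k using orth_proj_unique[OF S Z orth_proj_add[OF S Z Z] that] .
 have Zscale: "Z (%k. c *\<^sub>C w k) k = c *\<^sub>C Z w k" if "k < K" for c w k using orth_proj_unique[OF S Z orth_proj_scale[OF S Z] that] .
 have "EX x. app x = (%v. Z (d l v) k)" if k: "k < K" "l < K" for k l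
 proof -
  have "norm (Z (d l v) k) <= 1 * norm v" for v
  proof -
   have "(norm (Z (d l v) k))\<^sup>2 <= (SUM k<K. (norm (Z (d l v) k))\<^sup>2)"
    by (rule member_le_sum[where f = "%k. (norm (Z (d l v) k))\<^sup>2"]) (use k in auto)
   also have "... <= (SUM k<K. (norm (d l v k))\<^sup>2)" by (rule orth_proj_bound[OF Z])
   also have "... = (SUM m<K. if m = l then (norm v)\<^sup>2 else 0)" by (intro sum.cong) (auto simp: d_def)
   also have "... = (norm v)\<^sup>2" using k by simp
   finally show ?thesis by (simp add: power2_le_iff_abs_le)
  qed
  hence norm: "norm (Z (d l v) k) <= 1 * norm v" for v by simp
  have add: "Z (d l (v + w)) k = Z (d l v) k + Z (d l w) k" for v w unfolding dadd by (rule Zadd[OF k(1)])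
  have scale: "Z (d l (c *\<^sub>C v)) k = c *\<^sub>C Z (d l v) k" for c v unfolding dscale by (rule Zscale[OF k(1)])
  show ?thesis by (rule bop_ex[OF add scale norm]) blast
 qed
 then obtain p where p: "!!k l v. k < K ==> l < K ==> app (p k l) v = Z (d l v) k" by metis
 have Zsum: "Z (%m. SUM l:A. f l m) k = (SUM l:A. Z (f l) k)" if "finite A" "k < K" for A k and f :: "nat => nat => 'h" using that(1)
 proof (induction A rule: finite_induct)
  case empty
  show ?case using Zscale[OF that(2), of 0 "%_. 0"] by simp
 next
  case (insert l A)
  thus ?case using Zadd[OF that(2), of "f l" "%m. SUM l:A. f l m"] by simp
 qed
 have Zcut: "Z w k = Z w' k" if "k < K" "!!k. k < K ==> w k = w' k" for w w' k
 proof -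
  have "orth_proj K S w' (Z w)" using Z[of w] that(2) by (simp add: orth_proj_def)
  thus ?thesis using orth_proj_unique[OF S _ Z that(1)] by blast
 qed
 have "Z w k = (SUM l<K. app (p k l) (w l))" if "k < K" for w k
 proof -
  have "Z w k = Z (%m. SUM l<K. d l (w l) m) k" by (rule Zcut[OF that]) (simp add: d_def)
  thus ?thesis using that by (simp add: Zsum p)
 qed
 hence "orth_proj K S w (%k. SUM l<K. app (p k l) (w l))" for w using Z[of w] by (simp add: orth_proj_def)
 moreover have "T * p k l = p k l * T"
  if "k < K" "l < K" "ALL u:S. (%k. app T (u k)) : S" "ALL u:S. (%k. app (T\<dagger>) (u k)) : S" for T k l
 proof (rule bop_eqI)
  fix v
  have "app T (Z (d l v) k) = Z (%m. app T (d l v m)) k" using orth_proj_unique[OF S orth_proj_app[OF Z] Z that(1)] that by blast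
  thus "app (T * p k l) v = app (p k l * T) v" using that by (simp add: p dapp)
 qed
 ultimately show ?thesis by blast
qed

text \<open>The families \<open>y (\<xi> k)\<close> with \<open>y\<close> in \<open>F\<close> form
  an invariant subspace of the direct sum. The entries of its projection commute with
  \<open>F\<close>, hence with \<open>x\<close>. As \<open>1 : F\<close>, the projection fixes the
  family \<open>\<xi>\<close>, and therefore also its image under \<open>x\<close>.\<close>

theorem amplified_bicommutant: assumes F: "star_alg F" and x: "!!c. (!!y. y : F ==> c * y = y * c) ==> c * x = x * c" and e: "e > 0"
 shows "EX y:F. (SUM k<(K::nat). (norm (app (x - y) (\<xi> k)))\<^sup>2) < e"
proof -
 define S where "S = (%y k. app y (\<xi> k)) ` F"
 have S: "complex_subspace S" unfolding complex_subspace_def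
 proof (intro conjI ballI allI)
  show "(%k. 0) : S" unfolding S_def by (rule image_eqI[of _ _ 0]) (auto simp: star_algD[OF F])
  fix u assume "u : S"
  then obtain y where y: "y : F" "u = (%k. app y (\<xi> k))" by (auto simp: S_def)
  show "(%k. c *\<^sub>C u k) : S" for c unfolding S_def by (rule image_eqI[of _ _ "csc c y"]) (auto simp: y star_algD[OF F])
  fix v assume "v : S"
  then obtain z where z: "z : F" "v = (%k. app z (\<xi> k))" by (auto simp: S_def)
  show "(%k. u k + v k) : S" unfolding S_def by (rule image_eqI[of _ _ "y + z"]) (auto simp: y z star_algD[OF F])
 qed
 have inv: "(%k. app T (u k)) : S" if T: "T : F" and "u : S" for T u
 proof -
  obtain y where y: "y : F" "u = (%k. app y (\<xi> k))" using `u : S` by (auto simp: S_def)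
  show ?thesis unfolding S_def by (rule image_eqI[of _ _ "T * y"]) (auto simp: y T star_algD[OF F])
 qed
 obtain p where p: "!!w. orth_proj K S w (%k. SUM l<K. app (p k l) (w l))"
  and com: "ALL T k l. k < K --> l < K --> (ALL u:S. (%k. app T (u k)) : S) --> (ALL u:S. (%k. app (T\<dagger>) (u k)) : S) -->
    T * p k l = p k l * T" using orth_proj_matrix[OF S] by blast
 have px: "p k l * x = x * p k l" if "k < K" "l < K" for k l
 proof (rule x)
  fix y assume y: "y : F"
  hence "y\<dagger> : F" by (rule star_algD(5)[OF F])
  hence "ALL u:S. (%k. app y (u k)) : S" "ALL u:S. (%k. app (y\<dagger>) (u k)) : S" using y inv by auto
  thus "p k l * y = y * p k l" using com that by simp
 qed
 have \<xi>: "(%k. app 1 (\<xi> k)) : S" unfolding S_def using star_algD(1)[OF F] by blast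
 have p\<xi>: "(SUM l<K. app (p k l) (\<xi> l)) = \<xi> k" if "k < K" for k using orth_proj_unique[OF S p orth_proj_mem[OF \<xi>] that] by simp
 have "(SUM l<K. app (p k l) (app x (\<xi> l))) = app x (\<xi> k)" if k: "k < K" for k
 proof -
  have "(SUM l<K. app (p k l) (app x (\<xi> l))) = (SUM l<K. app (p k l * x) (\<xi> l))" by simp
  also have "... = (SUM l<K. app (x * p k l) (\<xi> l))" by (intro sum.cong refl) (simp only: px k lessThan_iff)
  also have "... = app x (SUM l<K. app (p k l) (\<xi> l))" by (simp add: app_sum)
  finally show ?thesis by (simp only: p\<xi>[OF k])
 qed
 then obtain X where X: "ALL n. X n : S" "ALL k<K. (%n. X n k) ----> app x (\<xi> k)" using p[of "%k. app x (\<xi> k)"] by (auto simp: orth_proj_def)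
 have "(%n. SUM k<K. (norm (app x (\<xi> k) - X n k))\<^sup>2) ----> (SUM k<K. (norm (app x (\<xi> k) - app x (\<xi> k)))\<^sup>2)"
  using X(2) by (intro tendsto_sum tendsto_power tendsto_norm tendsto_diff tendsto_const) auto
 hence "(%n. SUM k<K. (norm (app x (\<xi> k) - X n k))\<^sup>2) ----> 0" by simp
 hence "\<forall>\<^sub>F n in sequentially. (SUM k<K. (norm (app x (\<xi> k) - X n k))\<^sup>2) < e" using e by (rule order_tendstoD(2))
 then obtain n where n: "(SUM k<K. (norm (app x (\<xi> k) - X n k))\<^sup>2) < e" by (auto simp: eventually_sequentially)
 have "X n : (%y k. app y (\<xi> k)) ` F" using X(1) by (simp add: S_def)
 then obtain y where "X n = (%k. app y (\<xi> k))" "y : F" by (rule imageE)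
 with n show ?thesis by (intro bexI[of _ y]) auto
qed

text \<open>The case of a single copy. As \<open>S\<close> need not be closed, the values lie in its
  closure.\<close>

lemma subspace_projection:
 fixes S :: "'h::complex_hilbert_space set" assumes S: "0 : S" "!!u v. u : S ==> v : S ==> u + v : S" "!!c u. u : S ==> c *\<^sub>C u : S"
 obtains P where "!!v. app P v : closure S" "!!v. v : S ==> app P v = v"
  "!!T. (!!v. v : S ==> app T v : S) ==> (!!v. v : S ==> app (T\<dagger>) v : S) ==> T * P = P * T"
proof -
 let ?S = "(%v (_::nat). v) ` S"
 have sub: "complex_subspace ?S" using S by (auto simp: complex_subspace_def image_iff)
 obtain p where p: "!!w. orth_proj 1 ?S w (%k. SUM l<1. app (p k l) (w l))"
  and com: "ALL T k l. k < 1 --> l < 1 --> (ALL u:?S. (%k. app T (u k)) : ?S) --> (ALL u:?S. (%k. app (T\<dagger>) (u k)) : ?S) -->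
    T * p k l = p k (l::nat) * T" using orth_proj_matrix[OF sub, of 1] by blast
 show thesis
 proof (rule that[of "p 0 0"])
  fix v
  obtain X where X: "ALL n. X n : ?S" "(%n. X n 0) ----> app (p 0 0) v"
   using p[of "%_. v"] unfolding orth_proj_def One_nat_def lessThan_Suc lessThan_0 by auto
  hence "X n 0 : S" for n by (metis imageE)
  with X(2) show "app (p 0 0) v : closure S" unfolding closure_sequential by (intro exI[of _ "%n. X n 0"]) auto
 next
  fix v assume "v : S"
  hence "(%_. v) : ?S" by blast
  from orth_proj_unique[OF sub p orth_proj_mem[OF this], of 0]
  show "app (p 0 0) v = v" by simp
 next
  fix T assume "!!v. v : S ==> app T v : S" "!!v. v : S ==> app (T\<dagger>) v : S"
  hence "ALL u:?S. (%k. app T (u k)) : ?S" "ALL u:?S. (%k. app (T\<dagger>) (u k)) : ?S" by auto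
  thus "T * p 0 0 = p 0 0 * T" using com by simp
 qed
qed

section \<open>Finite factors with a trace\<close>

text \<open>The interface between the operator-algebraic hypotheses and the argument. Normality is
  stated for increasing sequences of projections, since the maximality arguments below run along
  sequences.\<close>

locale tracial_factor =
 fixes R :: "'h::complex_hilbert_space bop set" and tr :: "'h bop => complex" assumes R_adj: "x : R ==> x\<dagger> : R"
  and R_bicommutant: "(!!c. (!!y. y : R ==> c * y = y * c) ==> c * x = x * c) ==> x : R"
  and R_center: "z : R ==> (!!y. y : R ==> z * y = y * z) ==> EX c. z = csc c 1"
  and R_diffuse: "p : R ==> projn p ==> p ~= 0 ==> EX q:R. projn q & p * q = q & q ~= 0 & q ~= p"
  and tr_add: "x : R ==> y : R ==> tr (x + y) = tr x + tr y" and tr_csc: "x : R ==> tr (csc c x) = c * tr x"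
  and tr_comm: "x : R ==> y : R ==> tr (x * y) = tr (y * x)"
  and tr_pos: "x : R ==> Im (tr (x\<dagger> * x)) = 0" "x : R ==> Re (tr (x\<dagger> * x)) >= 0" and tr_one: "tr 1 = 1"
  and tr_faithful: "x : R ==> tr (x\<dagger> * x) = 0 ==> x = 0"
  and tr_normal: "(!!n. P n : R) ==> (!!n. projn (P n)) ==> (!!n. psd (P (Suc n) - P n)) ==> slim P p ==>
   p : R ==> (%n. tr (P n)) ----> tr p"
begin

lemma R_salg: "salg R"
proof -
 define M where "M = {c. ALL y:R. c * y = y * c}"
 have adj: "c\<dagger> : M" if "c : M" for c unfolding M_def
 proof (intro CollectI ballI)
  fix y assume "y : R"
  hence "(c * y\<dagger>)\<dagger> = (y\<dagger> * c)\<dagger>" using that R_adj by (simp add: M_def)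
  thus "c\<dagger> * y = y * c\<dagger>" by simp
 qed
 have "R = {x. ALL c:M. x * c = c * x}"
 proof (intro equalityI subsetI)
  fix x assume x: "x : {x. ALL c:M. x * c = c * x}"
  show "x : R"
  proof (rule R_bicommutant)
   fix c assume "!!y. y : R ==> c * y = y * c"
   hence "c : M" by (simp add: M_def)
   thus "c * x = x * c" using x by simp
  qed
 qed (simp add: M_def)
 thus ?thesis using salg_commutant[OF adj] by simp
qed

lemmas R_alg = salgD(1)[OF R_salg]

lemma R_slim: "(!!n. X n : R) ==> slim X x ==> x : R" using salgD(2)[OF R_salg] .

lemma R_simps [simp]:
 "1 : R" "0 : R" "x : R ==> y : R ==> x + y : R" "x : R ==> y : R ==> x * y : R"
 "x : R ==> x\<dagger> : R" "x : R ==> csc c x : R" "x : R ==> - x : R"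
 "x : R ==> y : R ==> x - y : R" "x : R ==> r *\<^sub>R x : R" using star_algD[OF R_alg] by auto

lemma R_sum [simp]: "(!!i. i : A ==> f i : R) ==> (SUM i:A. f i) : R" by (rule star_alg_sum[OF R_alg])

lemma tr_zero [simp]: "tr 0 = 0" using tr_csc[of 0 0] by simp

lemma tr_minus: "x : R ==> tr (- x) = - tr x" using tr_csc[of x "- 1"] by (simp add: csc_minus_left)

lemma tr_diff: "x : R ==> y : R ==> tr (x - y) = tr x - tr y" using tr_add[of x "- y"] by (simp add: tr_minus)

lemma tr_scaleR: "x : R ==> tr (r *\<^sub>R x) = of_real r * tr x" by (simp add: scaleR_csc tr_csc)

lemma tr_sum: "(!!i. i : A ==> f i : R) ==> tr (SUM i:A. f i) = (SUM i:A. tr (f i))" by (induction A rule: infinite_finite_induct) (auto simp: tr_add)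

lemma tr_psd: assumes "c : R" "psd c" shows "Re (tr c) >= 0" "Im (tr c) = 0"
proof -
 obtain b where "b : R" "b\<dagger> = b" "b * b = c" by (rule psd_sqrt[OF R_salg assms])
 thus "Re (tr c) >= 0" "Im (tr c) = 0" using tr_pos[of b] by auto
qed

lemma tr_psd_mono: "x : R ==> y : R ==> psd (y - x) ==> Re (tr x) <= Re (tr y)" using tr_psd(1)[of "y - x"] by (simp add: tr_diff)

lemma tr_selfadj: assumes "x : R" "x\<dagger> = x" shows "Im (tr x) = 0"
proof -
 obtain C where "C > 0" and C: "opbound x C" by (rule opbound_ex)
 have "Im (tr (C *\<^sub>R 1 - x)) = 0" by (rule tr_psd(2)) (use assms opbound_selfadj[OF C] in auto)
 thus ?thesis using assms by (simp add: tr_diff tr_scaleR tr_one)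
qed

lemma tr_adj: assumes "x : R" shows "tr (x\<dagger>) = cnj (tr x)"
proof -
 have "Im (tr (x + x\<dagger>)) = 0" "Im (tr (csc \<i> (x - x\<dagger>))) = 0"
  by (rule tr_selfadj; use assms in "simp add: csc_diff_right csc_minus_left algebra_simps")+
 thus ?thesis using assms by (simp add: tr_add tr_diff tr_csc complex_eq_iff)
qed

text \<open>The Hilbert norm of the trace, usually written \<open>||x||_2\<close>.\<close>

definition tn :: "'h bop => real" where
 "tn x = sqrt (Re (tr (x\<dagger> * x)))"

lemma tn_ge_0 [simp, intro]: "x : R ==> tn x >= 0" by (simp add: tn_def tr_pos)

lemma tn_power2: "x : R ==> (tn x)\<^sup>2 = Re (tr (x\<dagger> * x))" by (simp add: tn_def tr_pos)

lemma tr_self: "x : R ==> tr (x\<dagger> * x) = of_real ((tn x)\<^sup>2)" by (simp add: tn_power2 complex_eq_iff tr_pos)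

lemma tn_eq_0: "x : R ==> tn x = 0 <-> x = 0" using tr_self[of x] tr_faithful[of x] by (auto simp: tn_def)

lemma tn_zero [simp]: "tn 0 = 0" and tn_one [simp]: "tn 1 = 1" by (simp_all add: tn_def tr_one)

lemma tn_adj: "x : R ==> tn (x\<dagger>) = tn x" by (simp add: tn_def tr_comm[of x "x\<dagger>"])

lemma tn_csc: "x : R ==> tn (csc c x) = cmod c * tn x"
proof -
 assume x: "x : R"
 have "tr ((csc c x)\<dagger> * csc c x) = (cnj c * c) * tr (x\<dagger> * x)" using x by (simp add: tr_csc)
 also have "cnj c * c = of_real ((cmod c)\<^sup>2)" using complex_norm_square[of c] by (simp add: mult.commute)
 finally show ?thesis using x by (simp add: tn_def real_sqrt_mult del: of_real_power)
qed

lemma tn_minus: "x : R ==> tn (- x) = tn x" using tn_csc[of x "- 1"] by (simp add: csc_minus_left)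

lemma tn_scaleR: "x : R ==> tn (r *\<^sub>R x) = \<bar>r\<bar> * tn x" by (simp add: scaleR_csc tn_csc)

lemma tn_diff_commute: "x : R ==> y : R ==> tn (x - y) = tn (y - x)" using tn_minus[of "x - y"] by simp

lemma tr_cauchy_schwarz: assumes x: "x : R" and y: "y : R" shows "cmod (tr (x\<dagger> * y)) <= tn x * tn y"
proof (cases "x = 0")
 case False
 hence p: "tn x > 0" using tn_eq_0[OF x] tn_ge_0[OF x] by linarith
 define i where "i = tr (x\<dagger> * y)"
 define c where "c = i / of_real ((tn x)\<^sup>2)"
 have i': "tr (y\<dagger> * x) = cnj i" using tr_adj[of "x\<dagger> * y"] x y by (simp add: i_def)
 have cc: "c * of_real ((tn x)\<^sup>2) = i" using p by (simp add: c_def)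
 have "tr ((y - csc c x)\<dagger> * (y - csc c x)) = tr (y\<dagger> * y) - c * cnj i - cnj c * (i - c * tr (x\<dagger> * x))"
  using x y by (simp add: diff_distribs tr_diff tr_csc i_def[symmetric] i' csc_diff_right)
 also have "i - c * tr (x\<dagger> * x) = 0" using x cc by (simp add: tr_self del: of_real_power)
 also have "c * cnj i = of_real ((cmod i)\<^sup>2 / (tn x)\<^sup>2)" using complex_norm_square[of i] by (simp add: c_def)
 finally have "Re (tr ((y - csc c x)\<dagger> * (y - csc c x))) = (tn y)\<^sup>2 - (cmod i)\<^sup>2 / (tn x)\<^sup>2"
  using y by (simp add: tr_self del: of_real_power of_real_divide)
 moreover have "Re (tr ((y - csc c x)\<dagger> * (y - csc c x))) >= 0" using x y by (intro tr_pos) auto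
 ultimately have "0 <= (tn y)\<^sup>2 - (cmod i)\<^sup>2 / (tn x)\<^sup>2" by linarith
 hence "(cmod i)\<^sup>2 <= (tn x * tn y)\<^sup>2" using p by (simp add: field_simps power_mult_distrib)
 thus ?thesis unfolding i_def by (rule power2_le_imp_le) (use x y in simp)
qed simp

lemma tn_triangle: assumes x: "x : R" and y: "y : R" shows "tn (x + y) <= tn x + tn y"
proof -
 have "tr (y\<dagger> * x) = cnj (tr (x\<dagger> * y))" using tr_adj[of "x\<dagger> * y"] x y by simp
 hence "(tn (x + y))\<^sup>2 = (tn x)\<^sup>2 + (tn y)\<^sup>2 + 2 * Re (tr (x\<dagger> * y))"
  using x y by (simp add: tn_power2 distrib_left distrib_right tr_add)
 also have "... <= (tn x)\<^sup>2 + (tn y)\<^sup>2 + 2 * (tn x * tn y)"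
  using tr_cauchy_schwarz[OF x y] complex_Re_le_cmod[of "tr (x\<dagger> * y)"] by linarith
 also have "... = (tn x + tn y)\<^sup>2" by (simp add: power2_sum)
 finally show ?thesis using x y by (intro power2_le_imp_le[of "tn (x + y)"]) auto
qed

lemma tn_triangle_diff: "x : R ==> y : R ==> z : R ==> tn (x - z) <= tn (x - y) + tn (y - z)" using tn_triangle[of "x - y" "y - z"] by simp

lemma tn_diff_le: "x : R ==> y : R ==> tn (x - y) <= tn x + tn y" using tn_triangle[of x "- y"] by (simp add: tn_minus)

lemma tn_sum: "(!!i. i : A ==> f i : R) ==> tn (SUM i:A. f i) <= (SUM i:A. tn (f i))"
proof (induction A rule: infinite_finite_induct)
 case (insert i A)
 thus ?case using tn_triangle[of "f i" "SUM i:A. f i"] by simp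
qed auto

lemma tr_bound: "x : R ==> cmod (tr x) <= tn x" using tr_cauchy_schwarz[of 1 x] by simp

text \<open>\<open>y\<dagger> * (C\<^sup>2 *\<^sub>R 1 - x\<dagger> * x) * y\<close> is positive and
  so has nonnegative trace.\<close>

lemma tn_mult_left: assumes x: "x : R" "opbound x C" and y: "y : R" shows "tn (x * y) <= C * tn y"
proof -
 have "psd (y\<dagger> * (C\<^sup>2 *\<^sub>R 1 - x\<dagger> * x) * y)" using x by (intro psd_sandwich) (simp add: opbound_psd)
 hence "0 <= Re (tr (y\<dagger> * (C\<^sup>2 *\<^sub>R 1 - x\<dagger> * x) * y))" using x y by (intro tr_psd) auto
 also have "y\<dagger> * (C\<^sup>2 *\<^sub>R 1 - x\<dagger> * x) * y = C\<^sup>2 *\<^sub>R (y\<dagger> * y) - (x * y)\<dagger> * (x * y)"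
  by (simp add: diff_distribs mult.assoc)
 finally have "(tn (x * y))\<^sup>2 <= (C * tn y)\<^sup>2" using x y by (simp add: tr_diff tr_scaleR tn_power2 power_mult_distrib del: adj_ring(6))
 thus ?thesis using x y by (intro power2_le_imp_le[of "tn (x * y)"]) (auto simp: opbound_def)
qed

lemma tn_mult_right: assumes "x : R" "opbound x C" "y : R" shows "tn (y * x) <= C * tn y"
 using tn_mult_left[of "x\<dagger>" C "y\<dagger>"] tn_adj[of "y * x"] assms by (simp add: opbound_adj tn_adj)

lemma projn_opbound: "projn p ==> opbound p 1" using projn_psd[OF projn_compl[of p]] by (simp add: opbound_psd projn_def)

lemma tn_projn_left: "p : R ==> projn p ==> x : R ==> tn (p * x) <= tn x" using tn_mult_left[OF _ projn_opbound] by fastforce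

lemma tn_projn_right: "p : R ==> projn p ==> x : R ==> tn (x * p) <= tn x" using tn_mult_right[OF _ projn_opbound] by fastforce

lemma tn_projn: "p : R ==> projn p ==> (tn p)\<^sup>2 = Re (tr p)" by (simp add: tn_power2 projn_def)

lemma tr_projn: "p : R ==> projn p ==> tr p = of_real (Re (tr p))" using tr_psd(2)[of p] projn_psd[of p] by (simp add: complex_eq_iff)

lemma tr_projn_pos: "p : R ==> projn p ==> p ~= 0 ==> Re (tr p) > 0" using tn_projn[of p] tn_eq_0[of p] by (metis zero_less_power2)

lemma tr_projn_ge_0: "p : R ==> projn p ==> Re (tr p) >= 0" using tr_psd(1)[of p] projn_psd[of p] by simp

lemma tr_projn_mono: "p : R ==> q : R ==> projn p ==> projn q ==> p * q = q ==> Re (tr q) <= Re (tr p)"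
 using projn_psd[OF projn_diff[of p q]] by (intro tr_psd_mono) auto

lemma tr_projn_le_1: "p : R ==> projn p ==> Re (tr p) <= 1" using tr_projn_mono[of 1 p] by (simp add: tr_one)

end

subsection \<open>Maximality arguments\<close>

text \<open>The ordering principle of Brezis and Browder replaces Zorn's lemma: only limits of
  sequences are needed.\<close>

lemma brezis_browder:
 fixes m :: "'a => real" and rel :: "'a => 'a => bool" assumes X: "a : X" and refl: "!!x. x : X ==> rel x x"
  and trans: "!!x y z. x : X ==> y : X ==> z : X ==> rel x y ==> rel y z ==> rel x z" and mono: "!!x y. x : X ==> y : X ==> rel x y ==> m x <= m y"
  and bound: "!!x. x : X ==> m x <= B" and upper: "!!f. (!!n. f n : X) ==> (!!n. rel (f n) (f (Suc n))) ==> EX u:X. ALL n. rel (f n) u"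
 shows "EX x:X. ALL y:X. rel x y --> m y = m x"
proof -
 define s where "s x = Sup (m ` {y:X. rel x y})" for x
 have bdd: "bdd_above (m ` {y:X. rel x y})" for x using bound by (auto simp: bdd_above_def)
 have ne: "m ` {y:X. rel x y} ~= {}" if "x : X" for x using refl[OF that] that by blast
 have "EX y. y : X & rel x y & s x - 1 / real (Suc n) < m y" if "x : X" for x n
 proof -
  have "s x - 1 / real (Suc n) < Sup (m ` {y:X. rel x y})" by (simp add: s_def)
  thus ?thesis using less_cSup_iff[OF ne[OF that] bdd] by auto
 qed
 then obtain f where f: "!!n. f n : X" "!!n. rel (f n) (f (Suc n)) & s (f n) - 1 / real (Suc n) < m (f (Suc n))"
  using dependent_nat_choice[of "%n x. x : X" "%n x y. rel x y & s x - 1 / real (Suc n) < m y"] X by metis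
 obtain u where u: "u : X" "!!n. rel (f n) u" using upper[of f] f by metis
 have "m y = m u" if y: "y : X" "rel u y" for y
 proof (rule antisym)
  show "m y <= m u"
  proof (rule field_le_epsilon)
   fix e :: real assume "e > 0"
   then obtain n where n: "1 / real (Suc n) < e" using nat_approx_posE by blast
   have "m y <= s (f n)" unfolding s_def by (rule cSup_upper[OF _ bdd]) (use y trans[OF f(1) u(1) y(1) u(2) y(2)] in auto)
   also have "... <= m (f (Suc n)) + 1 / real (Suc n)" using f(2)[of n] by simp
   also have "m (f (Suc n)) <= m u" by (rule mono) (use f u in auto)
   finally show "m y <= m u + e" using n by simp
  qed
 qed (rule mono; use u y in simp)
 with u show ?thesis by blast
qed

text \<open>For partial isometries each extending the previous one: \<open>Q\<close> are their
  initial projections, whose convergence carries over to \<open>X\<close>.\<close>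

lemma slim_of_monotone: assumes X: "!!n. opbound (X n) 1" and q: "slim Q e"
  and key: "!!m n. m >= n ==> (X m - X n)\<dagger> * (X m - X n) = Q m - Q n" shows "EX x. slim X x"
proof (rule slim_ex[OF X])
 fix v
 define r where "r n = Re (cinner v (app (Q n) v))" for n
 have k: "(norm (app (X m) v - app (X n) v))\<^sup>2 = r m - r n" if "m >= n" for m n
 proof -
  have "(norm (app (X m - X n) v))\<^sup>2 = Re (cinner v (app ((X m - X n)\<dagger> * (X m - X n)) v))"
   by (simp only: app_ring(6) cinner_adj_right Re_cinner_self)
  thus ?thesis unfolding key[OF that] by (simp add: r_def cinner_diff_right)
 qed
 have "r ----> Re (cinner v (app e v))" unfolding r_def by (intro tendsto_Re tendsto_cinner slimD[OF q]) simp
 thus "convergent (%n. app (X n) v)" by (rule convergent_square_bound[of r, OF convergentI]) (simp add: k)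
qed

lemma projn_le_trans: assumes "q * p = p" "r * q = q" shows "r * p = (p :: 'a::semigroup_mult)" by (metis assms mult.assoc)

lemma projn_le_adj: "projn p ==> projn q ==> q * p = p ==> p * q = p" by (metis adj_ring(6) projnD(1))

lemma projn_seq_le: assumes "!!n. projn (P n)" "!!n. P (Suc n) * P n = P n" "m >= n" shows "P m * P n = (P n :: 'h::complex_hilbert_space bop)"
 using assms(3)
proof (induction m rule: dec_induct)
 case base
 show ?case using assms(1) projnD(2) by blast
next
 case (step m)
 show ?case by (rule projn_le_trans[OF step.IH assms(2)])
qed

lemma projn_slim: assumes P: "!!n. projn (P n)" and le: "!!n. P (Suc n) * P n = P n" shows "EX p. slim P p & projn p & (ALL n. p * P n = P n)"
proof -
 have d: "psd (P (Suc n) - P n)" for n by (intro projn_psd projn_diff P le)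
 obtain p where p: "slim P p" "psd p" by (rule monotone_slim[of P]) (use d projn_psd[OF P] projn_psd[OF projn_compl[OF P]] in auto)
 have "slim (%n. P n * P n) (p * p)" by (intro slim_mult p)
 hence "p * p = p" using p(1) P slim_unique unfolding projn_def by auto
 moreover have "p * P n = P n" for n
 proof -
  have "slim (%m. P (m + n) * P n) (p * P n)" by (intro slim_mult slim_const slim_shift p)
  moreover have "P (m + n) * P n = P n" for m by (rule projn_seq_le[of P, OF P le]) simp
  ultimately have "slim (%m. P n) (p * P n)" by simp
  thus ?thesis by (rule slim_unique[OF _ slim_const])
 qed
 ultimately show ?thesis using p psd_adj by (auto simp: projn_def)
qed

section \<open>Suprema of projections, and comparison of the trace with vector states\<close>

context tracial_factor
begin

lemma projn_sup: assumes R: "!!n. P n : R" and P: "!!n. projn (P n)" and le: "!!n. P (Suc n) * P n = P n"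
 obtains p where "p : R" "slim P p" "projn p" "!!n. p * P n = P n" "(%n. tr (P n)) ----> tr p"
proof -
 obtain p where p: "slim P p" "projn p" "ALL n. p * P n = P n" using projn_slim[of P, OF P le] by blast
 have pR: "p : R" by (rule R_slim[OF R p(1)])
 have "(%n. tr (P n)) ----> tr p" by (rule tr_normal[OF R P _ p(1) pR]) (intro projn_psd projn_diff P le)
 with p pR that show thesis by blast
qed

lemma tr_projn_eq: assumes "p : R" "q : R" "projn p" "projn q" "p * q = q" "Re (tr p) <= Re (tr q)" shows "p = q"
proof (rule ccontr)
 assume "p ~= q"
 hence "Re (tr (p - q)) > 0" using assms by (intro tr_projn_pos projn_diff) auto
 thus False using assms by (simp add: tr_diff)
qed

text \<open>Real-valued and not normalized: the trace and the functionals of vectors are compared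
  after multiplication by constants.\<close>

definition normal_state :: "('h bop => real) => bool" where
 "normal_state \<alpha> <-> (ALL x:R. ALL y:R. \<alpha> (x + y) = \<alpha> x + \<alpha> y) & (ALL r. ALL x:R. \<alpha> (r *\<^sub>R x) = r * \<alpha> x) &
   (ALL x:R. psd x --> \<alpha> x >= 0) &
   (ALL P p. (ALL n. P n : R & projn (P n) & P (Suc n) * P n = P n) --> slim P p --> (%n. \<alpha> (P n)) ----> \<alpha> p)"

lemma normal_state_tr: "c >= 0 ==> normal_state (%x. c * Re (tr x))" unfolding normal_state_def
proof (intro conjI allI ballI impI)
 fix P p assume P: "ALL n. P n : R & projn (P n) & P (Suc n) * P n = P n" "slim P p"
 hence "(%n. tr (P n)) ----> tr p" using R_slim[of P p] projn_psd[OF projn_diff] by (intro tr_normal) auto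
 thus "(%n. c * Re (tr (P n))) ----> c * Re (tr p)" by (intro tendsto_intros)
qed (simp_all add: tr_add tr_scaleR tr_psd distrib_left)

lemma normal_state_vector: "c >= 0 ==> normal_state (%x. c * Re (cinner \<xi> (app x \<xi>)))" unfolding normal_state_def
 by (auto simp: cinner_add_right scaleR_scaleC cinner_scaleC_right psdD distrib_left
   intro!: tendsto_intros tendsto_cinner slimD)

text \<open>A maximal projection \<open>p\<close> below \<open>e\<close> with \<open>\<alpha> p \<ge> \<beta> p\<close> is not \<open>e\<close>, and below its complement
  in \<open>e\<close> the functional \<open>\<beta>\<close> dominates \<open>\<alpha>\<close>.\<close>

lemma dominated_corner:
 assumes \<alpha>: "normal_state \<alpha>" and \<beta>: "normal_state \<beta>" and e: "e : R" "projn e" "\<alpha> e < \<beta> e"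
 shows "EX q:R. projn q & q ~= 0 & e * q = q & (ALL x:R. \<alpha> ((x * q)\<dagger> * (x * q)) <= \<beta> ((x * q)\<dagger> * (x * q)))"
proof -
 define \<phi> where "\<phi> x = \<beta> x - \<alpha> x" for x
 have \<phi>_add: "\<phi> (x + y) = \<phi> x + \<phi> y" if "x : R" "y : R" for x y
  using \<alpha> \<beta> that by (simp add: normal_state_def \<phi>_def)
 have \<phi>_scale: "\<phi> (r *\<^sub>R x) = r * \<phi> x" if "x : R" for r x
  using \<alpha> \<beta> that by (simp add: normal_state_def \<phi>_def right_diff_distrib)
 have \<phi>_diff: "\<phi> (x - y) = \<phi> x - \<phi> y" if "x : R" "y : R" for x y using \<phi>_add[of "x - y" y] that by simp
 have \<phi>_lim: "(%n. \<phi> (P n)) ----> \<phi> p"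
  if "!!n. P n : R" "!!n. projn (P n)" "!!n. P (Suc n) * P n = P n" "slim P p" for P p
  unfolding \<phi>_def by (intro tendsto_diff) (use that \<alpha> \<beta> in "simp_all add: normal_state_def")
 have "\<phi> 0 = 0" using \<phi>_diff[of 0 0] by simp
 define X where "X = {p:R. projn p & e * p = p & \<phi> p <= 0}"
 have "EX p:X. ALL r:X. r * p = p --> Re (tr r) = Re (tr p)"
 proof (rule brezis_browder[where a = 0 and B = 1])
  show "0 : X" by (simp add: X_def `\<phi> 0 = 0`)
  show "EX u:X. ALL n. u * f n = f n" if f: "!!n. f n : X" "!!n. f (Suc n) * f n = f n" for f
  proof -
   have f': "f n : R" "projn (f n)" "e * f n = f n" "\<phi> (f n) <= 0" for n using f(1) by (simp_all add: X_def)
   obtain p where p: "p : R" "slim f p" "projn p" "!!n. p * f n = f n" by (rule projn_sup[of f]) (use f' f in auto)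
   have "e * p = p" using slim_unique[OF slim_mult_left[OF p(2), of e]] p(2) f'(3) by simp
   moreover have "\<phi> p <= 0" by (rule LIMSEQ_le_const2[OF \<phi>_lim[OF f'(1,2) f(2) p(2)]]) (use f'(4) in blast)
   ultimately show ?thesis using p by (auto simp: X_def)
  qed
  show "x * x = x" if "x : X" for x using that by (simp add: X_def projnD)
  show "z * x = x" if "y * x = x" "z * y = y" for x y z :: "'h bop" by (rule projn_le_trans[OF that])
  show "Re (tr x) <= Re (tr y)" if "x : X" "y : X" "y * x = x" for x y using that by (intro tr_projn_mono) (auto simp: X_def)
  show "Re (tr x) <= 1" if "x : X" for x using that by (intro tr_projn_le_1) (auto simp: X_def)
 qed
 then obtain p where "p : X" and max: "ALL r:X. r * p = p --> Re (tr r) = Re (tr p)" by blast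
 hence p: "p : R" "projn p" "e * p = p" "\<phi> p <= 0" by (simp_all add: X_def)
 have pe: "p * e = p" by (rule projn_le_adj[OF p(2) e(2) p(3)])
 define q where "q = e - p"
 have q: "q : R" "projn q" "q ~= 0" "e * q = q" using p e by (auto simp: q_def projn_diff right_diff_distrib projnD \<phi>_def)
 have dom_proj: "\<phi> r >= 0" if r: "r : R" "projn r" "q * r = r" for r
 proof (rule ccontr)
  assume *: "~ ?thesis"
  have "p * q = 0" using pe p by (simp add: q_def right_diff_distrib projnD)
  hence pr: "p * r = 0" using r(3) by (metis mult.assoc mult_zero_left)
  hence rp: "r * p = 0" by (metis adj_ring(1,6) projnD(1) p(2) r(2))
  have "e * r = r" by (rule projn_le_trans[OF r(3) q(4)])
  hence "p + r : X" using p r * pr by (auto simp: X_def projn_add \<phi>_add distrib_left)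
  moreover have "(p + r) * p = p" by (simp add: distrib_right rp projnD p)
  ultimately have "Re (tr (p + r)) = Re (tr p)" using max by blast
  hence "Re (tr r) = 0" using p r by (simp add: tr_add)
  hence "r = 0" using tr_projn_pos[OF r(1,2)] by force
  thus False using * `\<phi> 0 = 0` by simp
 qed
 define Y where "Y = {y:R. psd y & psd (q - y) & q * y = y & y * q = y}"
 have low: "\<phi> y >= - \<alpha> q" if "y : Y" for y
 proof -
  have y: "y : R" "\<beta> y >= 0" "\<alpha> (q - y) >= 0" using that q \<alpha> \<beta> by (auto simp: Y_def normal_state_def)
  hence "\<alpha> (q - y + y) = \<alpha> (q - y) + \<alpha> y" using \<alpha> q unfolding normal_state_def by (meson R_simps(8))
  thus ?thesis using y by (simp add: \<phi>_def)
 qed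
 \<comment> \<open>One binary digit of \<open>y\<close>: for the spectral projection
   \<open>r\<close> of \<open>2 y - q\<close>, the element \<open>y' = 2 y - r\<close> again lies
   between 0 and \<open>q\<close>, and \<open>y\<close> is the mean of \<open>r\<close> and
   \<open>y'\<close>. Since \<open>\<phi> r >= 0\<close>, the value at \<open>y\<close> is at least
   half the value at \<open>y'\<close>.\<close>
 have step: "EX y':Y. \<phi> y >= (1/2) * \<phi> y'" if y: "y : Y" for y
 proof -
  define z where "z = 2 *\<^sub>R y - q"
  have yR: "y : R" and ya: "y\<dagger> = y" and qy: "q * y = y" "y * q = y" and yp: "psd y" "psd (q - y)" using y psd_adj by (auto simp: Y_def)
  have zR: "z : R" and za: "z\<dagger> = z" and zq: "z * q = z" "q * z = z" using yR q ya qy by (simp_all add: z_def projnD diff_distribs)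
  obtain r where r: "projn r" "z * r = r * z" "psd (z * r)" "psd (- (z * (1 - r)))"
   "z * r = 0 ==> r = 0" "!!S. salg S ==> z : S ==> r : S"
   "!!q. z * q = z ==> q * z = z ==> r * q = r & q * r = r" by (rule spectral_projection[OF za]) blast
  have rR: "r : R" by (rule r(6)[OF R_salg zR])
  have rq: "r * q = r" "q * r = r" using r(7)[OF zq] by auto
  have rr: "r * r = r" "r\<dagger> = r" using r(1) by (simp_all add: projnD)
  define y' where "y' = 2 *\<^sub>R y - r"
  have y2: "2 *\<^sub>R y = z + q" by (simp add: z_def)
  have rzr: "r * (z * r) = z * r" by (metis r(2) rr(1) mult.assoc)
  have c: "(1 - r) * z * (1 - r) = z * (1 - r)" by (simp add: diff_distribs mult.assoc rzr) (simp add: r(2))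
  have "(1 - r) * (z + q) * (1 - r) = z * (1 - r) + (q - r)" by (simp only: distrib_left distrib_right c) (simp add: diff_distribs rq rr)
  hence "y' = z * r + (1 - r) * (2 *\<^sub>R y) * (1 - r)" unfolding y'_def y2 by (simp add: right_diff_distrib)
  moreover have "psd ((1 - r) * (2 *\<^sub>R y) * (1 - r))" by (intro psd_sandwich' psd_scaleR yp) (simp_all add: rr)
  ultimately have P1: "psd y'" using r(3) by (simp only: psd_add)
  have "r * (2 *\<^sub>R (q - y)) * r = r - z * r"
  proof -
   have "2 *\<^sub>R (q - y) = q - z" by (simp add: z_def scaleR_diff_right scaleR_2)
   thus ?thesis by (simp only: diff_distribs rq rr mult.assoc rzr)
  qed
  moreover have "psd (r * (2 *\<^sub>R (q - y)) * r)" by (intro psd_sandwich' psd_scaleR yp) (simp_all add: rr)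
  ultimately have "psd ((r - z * r) + - (z * (1 - r)))" using r(4) by (simp only: psd_add)
  moreover have "(r - z * r) + - (z * (1 - r)) = q - y'" unfolding y'_def y2 by (simp add: right_diff_distrib)
  ultimately have P2: "psd (q - y')" by simp
  have y'Y: "y' : Y" using P1 P2 yR rR qy rq by (simp add: Y_def y'_def diff_distribs)
  have "\<phi> y = (1/2) * \<phi> r + (1/2) * \<phi> y'" using yR rR by (simp add: y'_def \<phi>_diff \<phi>_scale field_simps)
  moreover have "\<phi> r >= 0" by (rule dom_proj[OF rR r(1) rq(2)])
  ultimately show ?thesis using y'Y by (intro bexI[of _ y']) auto
 qed
 have "0 : Y" using q projn_psd by (simp add: Y_def)
 \<comment> \<open>The infimum \<open>m\<close> of \<open>\<phi>\<close> over \<open>Y\<close> is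
   finite by \<open>low\<close> and at least \<open>m / 2\<close> by \<open>step\<close>, hence
   nonnegative.\<close>
 have dom: "\<phi> y >= 0" if y: "y : Y" for y
 proof -
  define m where "m = Inf (\<phi> ` Y)"
  have bdd: "bdd_below (\<phi> ` Y)" using low by (auto simp: bdd_below_def)
  have "m / 2 <= m" unfolding m_def
  proof (rule cInf_greatest)
   fix t assume "t : \<phi> ` Y"
   then obtain y y' where "y : Y" "y' : Y" "t >= (1/2) * \<phi> y'" using step by blast
   moreover have "Inf (\<phi> ` Y) <= \<phi> y'" using `y' : Y` bdd by (intro cInf_lower) auto
   ultimately show "Inf (\<phi> ` Y) / 2 <= t" by simp
  qed (use `0 : Y` in blast)
  moreover have "m <= \<phi> y" unfolding m_def using y bdd by (intro cInf_lower) auto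
  ultimately show ?thesis by simp
 qed
 have "\<alpha> ((x * q)\<dagger> * (x * q)) <= \<beta> ((x * q)\<dagger> * (x * q))" if x: "x : R" for x
 proof -
  obtain C where C: "C > 0" "opbound x C" by (rule opbound_ex)
  define y where "y = (1 / C\<^sup>2) *\<^sub>R ((x * q)\<dagger> * (x * q))"
  have y: "y = (1 / C\<^sup>2) *\<^sub>R (q * (x\<dagger> * x) * q)" using q by (simp add: y_def projnD mult.assoc)
  have "(1 / C\<^sup>2) *\<^sub>R (q * (C\<^sup>2 *\<^sub>R 1 - x\<dagger> * x) * q) = q - y"
   using C q by (simp add: y diff_distribs scaleR_diff_right projnD)
  moreover have "psd ((1 / C\<^sup>2) *\<^sub>R (q * (C\<^sup>2 *\<^sub>R 1 - x\<dagger> * x) * q))"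
   using C q by (intro psd_scaleR psd_sandwich') (auto simp: opbound_psd projnD)
  moreover have "psd y" unfolding y_def by (intro psd_scaleR psd_square) simp
  moreover have "q * y = y" "y * q = y" unfolding y using q by (simp_all add: projnD mult.assoc[symmetric]) (simp add: projnD mult.assoc)
  ultimately have "y : Y" using x q by (simp add: Y_def y)
  from dom[OF this] have "0 <= \<phi> ((x * q)\<dagger> * (x * q)) / C\<^sup>2" using x q by (simp add: y_def \<phi>_scale del: adj_ring(6))
  thus ?thesis using C by (simp add: \<phi>_def zero_le_divide_iff del: adj_ring)
 qed
 with q show ?thesis by blast
qed

text \<open>\<open>dominated_corner\<close> for the trace and twice the state of a unit vector; the
  factor 2 makes the comparison at the unit strict.\<close>

lemma dominating_vector:
 obtains q \<xi> where "q : R" "projn q" "q ~= 0" "app q \<xi> = \<xi>"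
  "!!x. x : R ==> (tn (x * q))\<^sup>2 <= 2 * (norm (app x \<xi>))\<^sup>2"
proof -
 have "(1::'h bop) ~= 0" using tr_one tr_zero by fastforce
 then obtain \<xi>' where "\<xi>' ~= (0::'h)" by (metis app_ring(1,2) bop_eqI)
 define \<xi> where "\<xi> = (1 / norm \<xi>') *\<^sub>R \<xi>'"
 have \<xi>: "norm \<xi> = 1" using `\<xi>' ~= 0` by (simp add: \<xi>_def)
 obtain q where q: "q : R" "projn q" "q ~= 0"
  and dom: "!!x. x : R ==> Re (tr ((x * q)\<dagger> * (x * q))) <= 2 * Re (cinner \<xi> (app ((x * q)\<dagger> * (x * q)) \<xi>))"
  using dominated_corner[OF normal_state_tr[of 1] normal_state_vector[of 2 \<xi>], of 1] \<xi>
  by (auto simp: tr_one Re_cinner_self simp del: adj_ring app_ring(3-))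
 show thesis
 proof (rule that[OF q])
  show "app q (app q \<xi>) = app q \<xi>" using q by (simp flip: app_ring(6) add: projnD)
  show "(tn (x * q))\<^sup>2 <= 2 * (norm (app x (app q \<xi>)))\<^sup>2" if "x : R" for x using dom[OF that] that q
   by (simp only: tn_power2 R_simps app_ring(6) cinner_adj_right Re_cinner_self)
 qed
qed

end

section \<open>Vectors bounded by the trace, and limits of bounded sequences\<close>

context tracial_factor
begin

lemma tn_le_0: "x : R ==> tn x <= 0 <-> x = 0" using tn_eq_0[of x] tn_ge_0[of x] by linarith

text \<open>The reverse domination, below the projection \<open>e\<close> of
  \<open>dominating_vector\<close>; \<open>C\<close> exceeds the ratio of the two functionals at
  \<open>e\<close>. The vector \<open>q \<xi>\<close> is nonzero because \<open>tn q\<close> is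
  bounded by a multiple of its norm.\<close>

lemma bounded_vector:
 obtains z C where "z ~= 0" "C >= 0" "!!x. x : R ==> norm (app x z) <= C * tn x"
proof (rule dominating_vector)
 fix e \<xi> assume e: "e : R" "projn e" "e ~= 0" "app e \<xi> = \<xi>"
  and dom: "!!x. x : R ==> (tn (x * e))\<^sup>2 <= 2 * (norm (app x \<xi>))\<^sup>2"
 define C where "C = (norm \<xi>)\<^sup>2 / Re (tr e) + 1"
 have t: "Re (tr e) > 0" by (rule tr_projn_pos[OF e(1-3)])
 hence C: "C >= 0" "(norm \<xi>)\<^sup>2 < C * Re (tr e)" by (simp_all add: C_def field_simps)
 obtain q where q: "q : R" "projn q" "q ~= 0" "e * q = q"
  and dom': "!!x. x : R ==> Re (cinner \<xi> (app ((x * q)\<dagger> * (x * q)) \<xi>)) <= C * Re (tr ((x * q)\<dagger> * (x * q)))"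
  using dominated_corner[OF normal_state_vector[of 1 \<xi>] normal_state_tr[OF C(1)] e(1,2)] e(4) C(2)
  by (auto simp: Re_cinner_self simp del: adj_ring app_ring(3-))
 have qe: "q * e = q" by (rule projn_le_adj[OF q(2) e(2) q(4)])
 show thesis
 proof (rule that[of "app q \<xi>" "sqrt C"])
  show "app q \<xi> ~= 0" using dom[OF q(1)] qe tn_eq_0[OF q(1)] q(3) by auto
  show "norm (app x (app q \<xi>)) <= sqrt C * tn x" if x: "x : R" for x
  proof (rule power2_le_imp_le)
   have "(norm (app x (app q \<xi>)))\<^sup>2 <= C * (tn (x * q))\<^sup>2"
    using dom'[OF x] x q by (simp only: tn_power2 R_simps app_ring(6) cinner_adj_right Re_cinner_self)
   also have "... <= C * (tn x)\<^sup>2" using tn_projn_right[OF q(1,2) x] x q C by (intro mult_left_mono power_mono) auto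
   finally show "(norm (app x (app q \<xi>)))\<^sup>2 <= (sqrt C * tn x)\<^sup>2" using C by (simp add: power_mult_distrib)
  qed (use C x in simp)
 qed (use C in simp)
qed

text \<open>The projection onto the closure commutes with the commutant of \<open>R\<close>, so it
  lies in \<open>R\<close>; it also commutes with \<open>R\<close>, so it is a scalar, and the
  nonzero vector \<open>v\<close> makes this scalar 1.\<close>

lemma invariant_subspace_dense: assumes S: "0 : S" "!!u v. u : S ==> v : S ==> u + v : S" "!!c u. u : S ==> c *\<^sub>C u : S"
  and inv: "!!x v. x : R ==> v : S ==> app x v : S" and inv': "!!c v. (!!y. y : R ==> c * y = y * c) ==> v : S ==> app c v : S"
  and v: "v : S" "v ~= 0" shows "closure S = UNIV"
proof (rule subspace_projection[OF S])
 fix P assume P: "!!v. app P v : closure S" "!!v. v : S ==> app P v = v"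
  "!!T. (!!v. v : S ==> app T v : S) ==> (!!v. v : S ==> app (T\<dagger>) v : S) ==> T * P = P * T"
 have "c * P = P * c" if c: "!!y. y : R ==> c * y = y * c" for c
 proof (rule P(3))
  have "c\<dagger> * y = y * c\<dagger>" if "y : R" for y
  proof -
   have "(c * y\<dagger>)\<dagger> = (y\<dagger> * c)\<dagger>" using c that by simp
   thus ?thesis by simp
  qed
  thus "app (c\<dagger>) v : S" if "v : S" for v using inv' that by blast
  show "app c v : S" if "v : S" for v using inv' c that by blast
 qed
 hence "P : R" by (rule R_bicommutant)
 moreover have "P * y = y * P" if "y : R" for y by (rule P(3)[symmetric]) (use inv that in auto)
 ultimately obtain c where c: "P = csc c 1" using R_center by blast
 have "c *\<^sub>C v = 1 *\<^sub>C v" using P(2)[OF v(1)] by (simp add: c)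
 hence "(c - 1) *\<^sub>C v = 0" using scaleC_add_left[of "c - 1" 1 v] by simp
 hence "c = 1" using v(2) norm_scaleC[of "c - 1" v] by simp
 thus ?thesis using P(1) by (auto simp: c)
qed

text \<open>Otherwise the vectors annihilated by all \<open>q * x\<close> form a subspace invariant
  under \<open>R\<close> and its commutant. It contains a nonzero vector from the range of
  \<open>p\<close>, so it is dense, and then \<open>q = 0\<close>.\<close>

lemma factor_link: assumes p: "p : R" "p ~= 0" and q: "q : R" "q ~= 0" shows "EX x:R. q * x * p ~= 0"
proof (rule ccontr)
 assume "~ ?thesis"
 hence 0: "!!x. x : R ==> q * x * p = 0" by blast
 define S where "S = {v. ALL x:R. app (q * x) v = 0}"
 obtain v where v: "app p v ~= 0" using p(2) by (metis app_ring(1) bop_eqI)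
 have "closure S = UNIV"
 proof (rule invariant_subspace_dense)
  show "app p v : S"
  proof -
   have "app (q * x * p) v = 0" if "x : R" for x using 0[OF that] by (simp only: app_ring)
   thus ?thesis by (simp add: S_def)
  qed
  show "app x w : S" if "x : R" "w : S" for x w
  proof -
   have "app (q * (y * x)) w = 0" if "y : R" for y using `x : R` `w : S` that R_simps(4) unfolding S_def by blast
   thus ?thesis by (simp add: S_def)
  qed
  show "app c w : S" if c: "!!y. y : R ==> c * y = y * c" and "w : S" for c w
  proof -
   have "app (q * y) (app c w) = 0" if "y : R" for y
   proof -
    have "(q * y) * c = c * (q * y)" using c q that by (metis R_simps(4))
    hence "app (q * y) (app c w) = app c (app (q * y) w)" by (metis app_ring(6))
    thus ?thesis using `w : S` that by (simp add: S_def)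
   qed
   thus ?thesis by (simp add: S_def)
  qed
 qed (auto simp: S_def v)
 moreover have "app q w = 0" if "w : closure S" for w
 proof -
  obtain U where U: "!!n. U n : S" "U ----> w" using `w : closure S` by (auto simp: closure_sequential)
  have "app (q * 1) (U n) = 0" for n using U(1)[of n] R_simps(1) unfolding S_def by blast
  hence "(%n. app q (U n)) = (%n. 0)" by simp
  thus ?thesis using tendsto_app[OF U(2), of q] by (simp add: LIMSEQ_const_iff)
 qed
 ultimately have "q = 0" by (intro bop_eqI) simp
 with q(2) show False by simp
qed

lemma strongly_convergent: assumes R: "!!n. X n : R" and bd: "!!n. opbound (X n) C"
  and cauchy: "!!e. e > 0 ==> EX M. ALL m>=M. ALL n>=M. tn (X m - X n) < e" shows "EX x:R. slim X x"
proof (rule bounded_vector)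
 fix z :: 'h and D :: real
 assume z: "z ~= 0" "D >= 0" "!!x. x : R ==> norm (app x z) <= D * tn x"
 define S where "S = {v. Cauchy (%n. app (X n) v)}"
  text \<open>A vector \<open>c r z\<close> with \<open>r \<in> R\<close> and \<open>c\<close> in the commutant is in \<open>S\<close>, since \<open>c\<close> can be moved
    to the left and \<open>\<parallel>(X m - X n) r\<parallel>\<^sub>2 \<le> C \<parallel>X m - X n\<parallel>\<^sub>2\<close> by the trace property.\<close>
  define W where "W = {v. EX B>0. ALL x:R. norm (app x v) <= B * tn x}"
 have WI: "v : W" if "!!x. x : R ==> norm (app x v) <= B * tn x" for v B
 proof -
  have "norm (app x v) <= (\<bar>B\<bar> + 1) * tn x" if "x : R" for x
   using `!!x. x : R ==> norm (app x v) <= B * tn x`[OF that] mult_right_mono[of B "\<bar>B\<bar> + 1" "tn x"] that by fastforce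
  thus ?thesis unfolding W_def by (intro CollectI exI[of _ "\<bar>B\<bar> + 1"]) auto
 qed
 have WD: "EX B>0. ALL x:R. norm (app x v) <= B * tn x" if "v : W" for v using that by (simp add: W_def)
 have WS: "v : S" if "v : W" for v
 proof -
  obtain B where B: "B > 0" "!!x. x : R ==> norm (app x v) <= B * tn x" using WD `v : W` by meson
  have "Cauchy (%n. app (X n) v)"
  proof (rule CauchyI)
   fix e :: real assume "e > 0"
   then obtain M where M: "!!m n. m >= M ==> n >= M ==> tn (X m - X n) < e / B" using cauchy[of "e / B"] B(1) by auto
   have "norm (app (X m) v - app (X n) v) < e" if "m >= M" "n >= M" for m n
    using B(2)[of "X m - X n"] M[OF that] R B(1) by (simp add: pos_less_divide_eq mult.commute)
   thus "EX M. ALL m>=M. ALL n>=M. norm (app (X m) v - app (X n) v) < e" by blast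
  qed
  thus ?thesis by (simp add: S_def)
 qed
 have "closure W = UNIV"
 proof (rule invariant_subspace_dense[of W z])
  show "0 : W" by (rule WI[of _ 0]) simp
  show "u + v : W" if uv: "u : W" "v : W" for u v
  proof -
   obtain A B where "!!x. x : R ==> norm (app x u) <= A * tn x" "!!x. x : R ==> norm (app x v) <= B * tn x" using uv WD by meson
   thus ?thesis by (intro WI[of _ "A + B"]) (simp add: distrib_right norm_triangle_le add_mono)
  qed
  show "c *\<^sub>C u : W" if u: "u : W" for c u
  proof -
   obtain A where "!!x. x : R ==> norm (app x u) <= A * tn x" using u WD by meson
   thus ?thesis by (intro WI[of _ "cmod c * A"]) (simp add: norm_scaleC mult.assoc mult_left_mono)
  qed
  show "app r v : W" if r: "r : R" and v: "v : W" for r v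
  proof -
   obtain A where A: "A > 0" "!!x. x : R ==> norm (app x v) <= A * tn x" using v WD by meson
   obtain K where K: "K > 0" "opbound r K" by (rule opbound_ex)
   show ?thesis
   proof (rule WI)
    fix x assume x: "x : R"
    have "norm (app x (app r v)) <= A * tn (x * r)" using A(2)[of "x * r"] r x by simp
    also have "... <= A * (K * tn x)" using x r K A by (intro mult_left_mono tn_mult_right) auto
    finally show "norm (app x (app r v)) <= (A * K) * tn x" by (simp add: mult.assoc)
   qed
  qed
  show "app c v : W" if c: "!!y. y : R ==> c * y = y * c" and v: "v : W" for c v
  proof -
   obtain A where A: "!!x. x : R ==> norm (app x v) <= A * tn x" using v WD by meson
   obtain K where K: "K > 0" "opbound c K" by (rule opbound_ex)
   show ?thesis
   proof (rule WI)
    fix x assume x: "x : R"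
    have "app x (app c v) = app c (app x v)" using c[OF x] by (metis app_ring(6))
    hence "norm (app x (app c v)) <= K * norm (app x v)" using opboundD[OF K(2)] by simp
    also have "... <= K * (A * tn x)" using A[OF x] K by (intro mult_left_mono) auto
    finally show "norm (app x (app c v)) <= (K * A) * tn x" by (simp add: mult.assoc)
   qed
  qed
  show "z : W" by (rule WI[OF z(3)])
 qed (fact z(1))
 \<comment> \<open>Convergence on the dense set \<open>W\<close> extends to all vectors by the
   common bound \<open>C\<close>.\<close>
 have "convergent (%n. app (X n) v)" for v
 proof -
  have C0: "C >= 0" using bd[of 0] by (simp add: opbound_def)
  have "Cauchy (%n. app (X n) v)"
  proof (rule CauchyI)
   fix e :: real assume e: "e > 0"
   have "v : closure W" by (simp add: `closure W = UNIV`)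
   moreover have "e / (3 * (C + 1)) > 0" using e C0 by simp
   ultimately obtain w where w: "w : W" "dist w v < e / (3 * (C + 1))" by (auto simp: closure_approachable)
   have "Cauchy (%n. app (X n) w)" using WS[OF w(1)] by (simp add: S_def)
   from CauchyD[OF this, of "e / 3"] e
   obtain M where M: "!!m n. m >= M ==> n >= M ==> norm (app (X m) w - app (X n) w) < e / 3" by auto
   have near: "norm (app (X n) (v - w)) < e / 3" for n
   proof -
    have "norm (app (X n) (v - w)) <= C * norm (v - w)" by (rule opboundD[OF bd])
    also have "... <= (C + 1) * norm (v - w)" by (simp add: mult_right_mono)
    also have "... < e / 3" using w(2) C0 by (simp add: dist_norm norm_minus_commute field_simps)
    finally show ?thesis .
   qed
   have "norm (app (X m) v - app (X n) v) < e" if "m >= M" "n >= M" for m n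
   proof -
    have tri: "norm (a + b - c) <= norm a + norm b + norm c" for a b c :: 'h
     using norm_triangle_ineq4[of "a + b" c] norm_triangle_ineq[of a b] by linarith
    have "app (X m) v - app (X n) v = app (X m) (v - w) + (app (X m) w - app (X n) w) - app (X n) (v - w)" by simp
    hence "norm (app (X m) v - app (X n) v) <= norm (app (X m) (v - w)) + norm (app (X m) w - app (X n) w) + norm (app (X n) (v - w))"
     by (simp only: tri)
    thus ?thesis using near[of m] near[of n] M[OF that] by linarith
   qed
   thus "EX M. ALL m>=M. ALL n>=M. norm (app (X m) v - app (X n) v) < e" by blast
  qed
  thus ?thesis by (simp add: Cauchy_convergent_iff)
 qed
 then obtain x where "slim X x" using slim_ex[of X, OF bd] by blast
 thus ?thesis using R_slim[of X, OF R] by blast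
qed

end

lemma partial_isometry: assumes "projn (v\<dagger> * v)"
 shows "v * (v\<dagger> * v) = v" "projn (v * v\<dagger>)" "v\<dagger> * (v * v\<dagger>) = v\<dagger>"
proof -
 define e where "e = v\<dagger> * v"
 have e: "e\<dagger> = e" "e * e = e" using assms by (simp_all add: e_def projn_def)
 have "(v - v * e)\<dagger> * (v - v * e) = v\<dagger> * v - (v\<dagger> * v) * e - (e * (v\<dagger> * v) - e * (v\<dagger> * v) * e)"
  by (simp add: diff_distribs e(1) mult.assoc)
 also have "... = 0" by (simp add: e(2) e_def[symmetric])
 finally have ve: "v * e = v" by (simp add: adj_mult_self_eq_0 del: adj_ring)
 thus 1: "v * (v\<dagger> * v) = v" by (simp add: e_def)
 have "(v * v\<dagger>) * (v * v\<dagger>) = (v * (v\<dagger> * v)) * v\<dagger>" by (simp only: mult.assoc)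
 thus "projn (v * v\<dagger>)" by (simp only: 1) (simp add: projn_def 1)
 have "(v * (v\<dagger> * v))\<dagger> = v\<dagger>" by (simp only: 1)
 thus "v\<dagger> * (v * v\<dagger>) = v\<dagger>" by (simp add: mult.assoc)
qed

lemma projn_sum: assumes "finite A" "!!i. i : A ==> projn (g i)" "!!i j. i : A ==> j : A ==> i ~= j ==> g i * g j = 0" shows "projn (SUM i:A. g i)"
 using assms
proof (induction A rule: finite_induct)
 case (insert i A)
 have "g i * (SUM j:A. g j) = (SUM j:A. g i * g j)" by (rule sum_distrib_left)
 also have "... = 0" by (intro sum.neutral) (use insert in auto)
 finally show ?case using insert by (simp add: projn_add)
qed simp

lemma sum_projn_mult: assumes "finite A" "i : A" "g i * g i = g i" "!!j. j : A ==> j ~= i ==> g j * g i = 0"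
 shows "(SUM j:A. g j) * g i = (g i :: 'h::complex_hilbert_space bop)"
proof -
 have "(SUM j:A. g j) * g i = (SUM j:A. g j * g i)" by (rule sum_distrib_right)
 also have "... = (SUM j:A. if j = i then g i else 0)" by (intro sum.cong refl) (use assms in auto)
 finally show ?thesis using assms by simp
qed

context tracial_factor
begin

subsection \<open>Comparison of projections\<close>

text \<open>The polar part of \<open>q * x * p\<close> for a linking \<open>x\<close>. It inherits
  the left and right annihilators, which says that it leads from below \<open>p\<close> to below
  \<open>q\<close>.\<close>

lemma partial_isometry_link: assumes p: "p : R" "p ~= 0" and q: "q : R" "q ~= 0"
 shows "EX v:R. v ~= 0 & projn (v\<dagger> * v) & (ALL a. a * q = 0 --> a * v = 0) & (ALL b. p * b = 0 --> v * b = 0)"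
proof -
 obtain x where x: "x : R" "q * x * p ~= 0" using factor_link[OF p q] by blast
 obtain C where C: "C > 0" "opbound (q * x * p) C" by (rule opbound_ex)
 define y where "y = (1 / C) *\<^sub>R (q * x * p)"
 have "opbound y 1" using opbound_scaleR[OF C(2), of "1 / C"] C by (simp add: y_def)
 hence "psd (1 - y\<dagger> * y)" by (simp add: opbound_psd)
 then obtain v where pv: "polar_part y v" using polar by blast
 note v = polar_partD[OF pv]
 have yR: "y : R" using x p q by (simp add: y_def)
 have "y ~= 0" using x C by (simp add: y_def)
 hence "v ~= 0" using v(2) by auto
 moreover have "a * v = 0" if "a * q = 0" for a by (rule v(6)) (simp add: y_def mult.assoc[symmetric] that)
 moreover have "v * b = 0" if "p * b = 0" for b by (rule v(7)) (simp add: y_def mult.assoc that)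
 ultimately show ?thesis using v(1) v(5)[OF R_salg yR] by (intro bexI[of _ v]) (auto simp: projn_def)
qed

text \<open>A partial isometry from below \<open>p\<close> to below \<open>q\<close>, maximal under
  extension. If it exhausted neither side, \<open>partial_isometry_link\<close> between the
  remainders would extend it and raise the trace of its initial projection.\<close>

lemma comparison: assumes p: "p : R" "projn p" and q: "q : R" "projn q"
 shows "EX v:R. projn (v\<dagger> * v) & v * p = v & q * v = v & (v\<dagger> * v = p | v * v\<dagger> = q)"
proof -
 define X where "X = {v:R. projn (v\<dagger> * v) & v * p = v & q * v = v}"
 define rel where "rel v w <-> w * (v\<dagger> * v) = v" for v w :: "'h bop"
 have X: "v : R" "projn (v\<dagger> * v)" "v * p = v" "q * v = v" if "v : X" for v using that by (auto simp: X_def)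
 \<comment> \<open>Extension makes the initial projections increase: \<open>e * f * e = e\<close>
   forces \<open>(1 - f) * e\<close> to vanish, because its modulus squared is
   \<open>e * (1 - f) * e\<close>.\<close>
 have le: "(w\<dagger> * w) * (v\<dagger> * v) = v\<dagger> * v" if vw: "v : X" "w : X" "rel v w" for v w
 proof -
  define e where "e = v\<dagger> * v"
  define f where "f = w\<dagger> * w"
  have e: "e\<dagger> = e" "e * e = e" and f: "f\<dagger> = f" "f * f = f"
   using X(2)[OF vw(1)] X(2)[OF vw(2)] by (simp_all add: projn_def e_def f_def)
  have we: "w * e = v" using vw(3) by (simp add: rel_def e_def)
  have "e * f * e = (w * e)\<dagger> * (w * e)" by (simp add: f_def e mult.assoc)
  hence efe: "e * f * e = e" by (simp only: we e_def[symmetric])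
  have "((1 - f) * e)\<dagger> * ((1 - f) * e) = e * ((1 - f) * (1 - f)) * e" by (simp add: e f mult.assoc)
  also have "(1 - f) * (1 - f) = 1 - f" by (simp add: diff_distribs f)
  also have "e * (1 - f) * e = 0" by (simp add: diff_distribs e efe)
  finally have "(1 - f) * e = 0" by (simp only: adj_mult_self_eq_0)
  thus ?thesis by (simp add: left_diff_distrib e_def f_def)
 qed
 have trans: "rel v u" if vwu: "v : X" "w : X" "u : X" "rel v w" "rel w u" for v w u
 proof -
  have "u * (v\<dagger> * v) = u * ((w\<dagger> * w) * (v\<dagger> * v))" by (simp only: le[OF vwu(1,2,4)])
  also have "... = (u * (w\<dagger> * w)) * (v\<dagger> * v)" by (simp only: mult.assoc)
  finally show ?thesis using vwu(4,5) by (simp only: rel_def)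
 qed
 have "EX v:X. ALL w:X. rel v w --> Re (tr (w\<dagger> * w)) = Re (tr (v\<dagger> * v))"
 proof (rule brezis_browder[where a = 0 and B = 1])
  show "0 : X" by (simp add: X_def)
  show "rel v v" if "v : X" for v using partial_isometry(1)[OF X(2)[OF that]] by (simp add: rel_def)
  show "rel v u" if "v : X" "w : X" "u : X" "rel v w" "rel w u" for v w u using trans that by blast
  show "Re (tr (v\<dagger> * v)) <= Re (tr (w\<dagger> * w))" if "v : X" "w : X" "rel v w" for v w using that X le by (intro tr_projn_mono) auto
  show "Re (tr (v\<dagger> * v)) <= 1" if "v : X" for v using that X by (intro tr_projn_le_1) auto
  show "EX u:X. ALL n. rel (f n) u" if f: "!!n. f n : X" "!!n. rel (f n) (f (Suc n))" for f
  proof -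
   define E where "E n = (f n)\<dagger> * f n" for n
   have E: "projn (E n)" for n using X(2)[OF f(1)] by (simp add: E_def)
   have Ele: "E (Suc n) * E n = E n" for n using le[OF f(1) f(1) f(2)] by (simp add: E_def)
   obtain e where e: "slim E e" "projn e" "ALL n. e * E n = E n" using projn_slim[of E, OF E Ele] by blast
   have fE: "f m * E n = f n" if "m >= n" for m n using that
   proof (induction m rule: dec_induct)
    case base
    thus ?case using partial_isometry(1)[OF X(2)[OF f(1)]] by (simp add: E_def)
   next
    case (step m)
    thus ?case using trans[OF f(1) f(1) f(1), of n m "Suc m"] f(2) by (simp add: rel_def E_def)
   qed
   have "opbound (f n) 1" for n using projn_psd[OF projn_compl[OF E[of n]]] by (simp add: opbound_psd E_def)
   moreover have "(f m - f n)\<dagger> * (f m - f n) = E m - E n" if "m >= n" for m n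
   proof -
    have mn: "E m * E n = E n" by (rule projn_seq_le[of E, OF E Ele that])
    have nm: "E n * E m = E n" by (rule projn_le_adj[OF E E mn])
    have 1: "f m - f n = f m * (1 - E n)" by (simp add: right_diff_distrib fE[OF that])
    have "(f m - f n)\<dagger> * (f m - f n) = (1 - E n) * E m * (1 - E n)" unfolding 1 using projnD[OF E[of n]] by (simp add: E_def[of m] mult.assoc)
    also have "... = E m - E n" using projnD[OF E[of n]] by (simp add: diff_distribs mn nm)
    finally show ?thesis .
   qed
   ultimately obtain w where w: "slim f w" using slim_of_monotone[of f E e] e(1) by blast
   have wR: "w : R" by (rule R_slim[OF X(1)[OF f(1)] w])
   have wE: "w * E n = f n" for n
   proof -
    have "slim (%m. f (m + n) * E n) (w * E n)" by (intro slim_mult slim_const slim_shift w)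
    hence "slim (%m. f n) (w * E n)" by (simp add: fE)
    thus ?thesis by (rule slim_unique[OF _ slim_const])
   qed
   have "w\<dagger> * w = e"
   proof (rule bop_eqI, rule cinner_eqI, subst (1 2) cinner_commute)
    fix x z
    have "(%n. cinner (app (f n) z) (app (f n) x)) ----> cinner (app w z) (app w x)" by (rule slim_cinner[OF w w])
    moreover have "cinner (app (f n) z) (app (f n) x) = cinner z (app (E n) x)" for n by (simp add: E_def cinner_adj_right)
    moreover have "(%n. cinner z (app (E n) x)) ----> cinner z (app e x)" by (intro tendsto_cinner slimD[OF e(1)]) simp
    ultimately have "cinner (app w z) (app w x) = cinner z (app e x)" using LIMSEQ_unique by simp
    thus "cnj (cinner z (app (w\<dagger> * w) x)) = cnj (cinner z (app e x))" by (simp add: cinner_adj_right)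
   qed
   moreover have "w * p = w" using slim_unique[OF slim_mult_right[OF w, of p]] w X(3)[OF f(1)] by simp
   moreover have "q * w = w" using slim_unique[OF slim_mult_left[OF w, of q]] w X(4)[OF f(1)] by simp
   ultimately have "w : X" using wR e(2) by (simp add: X_def)
   thus ?thesis using wE by (auto simp: rel_def E_def)
  qed
 qed
 then obtain v where vX: "v : X" and max: "ALL w:X. rel v w --> Re (tr (w\<dagger> * w)) = Re (tr (v\<dagger> * v))" by blast
 have v: "v : R" "projn (v\<dagger> * v)" "v * p = v" "q * v = v" using X[OF vX] by auto
 define e where "e = v\<dagger> * v"
 define f where "f = v * v\<dagger>"
 have pe: "p * e = e" using v(3) p by (metis adj_ring(6) projnD(1) e_def mult.assoc)
 have qf: "q * f = f" by (simp add: f_def mult.assoc[symmetric] v(4))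
 have e: "projn e" and f: "projn f" using v(2) partial_isometry(2)[OF v(2)] by (simp_all add: e_def f_def)
 have ve: "v * e = v" "v\<dagger> * f = v\<dagger>" using partial_isometry[OF v(2)] by (simp_all add: e_def f_def)
 have vq: "v\<dagger> * q = v\<dagger>" using v(4) q by (metis adj_ring(6) projnD(1))
 have "v\<dagger> * v = p | v * v\<dagger> = q"
 proof (rule ccontr)
  assume "~ ?thesis"
  hence ne: "p - e ~= 0" "q - f ~= 0" by (auto simp: e_def f_def)
  have RR: "p - e : R" "q - f : R" using p q v by (simp_all add: e_def f_def)
  obtain u where u: "u : R" "u ~= 0" "projn (u\<dagger> * u)" "ALL a. a * (q - f) = 0 --> a * u = 0" "ALL b. (p - e) * b = 0 --> u * b = 0"
   using partial_isometry_link[OF RR(1) ne(1) RR(2) ne(2)] by blast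
  have vu: "v\<dagger> * u = 0" using u(4) by (simp add: right_diff_distrib vq ve)
  hence uv: "u\<dagger> * v = 0" by (metis adj_adj adj_ring(1,6))
  have ue: "u * e = 0" using u(5) pe projnD[OF e] by (simp add: left_diff_distrib)
  have "p * (1 - p) = 0" "e * (1 - p) = 0" using projnD[OF p(2)] projn_le_adj[OF e p(2) pe] by (simp_all add: right_diff_distrib)
  hence "u * (1 - p) = 0" using u(5) by (simp add: left_diff_distrib)
  hence up: "u * p = u" by (simp add: right_diff_distrib)
  have "(1 - q) * (q - f) = 0" using projnD[OF q(2)] by (simp add: diff_distribs qf)
  hence "(1 - q) * u = 0" using u(4) by blast
  hence qu: "q * u = u" by (simp add: left_diff_distrib)
  have w: "(v + u)\<dagger> * (v + u) = e + u\<dagger> * u" by (simp add: distrib_left distrib_right vu uv e_def)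
  have "e * (u\<dagger> * u) = 0" using ue projnD[OF e] by (metis adj_ring(1,6) mult.assoc mult_zero_left)
  hence "projn ((v + u)\<dagger> * (v + u))" unfolding w by (intro projn_add e u)
  hence "v + u : X" using v u up qu by (simp add: X_def distrib_left distrib_right)
  moreover have "rel v (v + u)" using ve(1) ue by (simp add: rel_def e_def[symmetric] distrib_right)
  ultimately have "Re (tr ((v + u)\<dagger> * (v + u))) = Re (tr (v\<dagger> * v))" using max by blast
  hence "Re (tr (u\<dagger> * u)) = 0" unfolding w using v u by (simp add: tr_add e_def)
  moreover have "u\<dagger> * u ~= 0" using u(2) by (simp add: adj_mult_self_eq_0)
  ultimately show False using tr_projn_pos[OF _ u(3)] u(1) by simp
 qed
 with v show ?thesis by blast
qed

text \<open>If comparison exhausts \<open>q\<close> instead of \<open>p\<close>, the initial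
  projection lies below \<open>p\<close> and its trace is at least that of \<open>p\<close>;
  faithfulness makes them equal.\<close>

lemma subequivalent: assumes p: "p : R" "projn p" and q: "q : R" "projn q" and le: "Re (tr p) <= Re (tr q)"
 shows "EX v:R. v\<dagger> * v = p & q * v = v"
proof -
 obtain v where v: "v : R" "projn (v\<dagger> * v)" "v * p = v" "q * v = v" "v\<dagger> * v = p | v * v\<dagger> = q"
  using comparison[OF p q] by blast
 have "v\<dagger> * v = p" if "v * v\<dagger> = q"
 proof (rule sym, rule tr_projn_eq)
  have "(v * p)\<dagger> = v\<dagger>" by (simp only: v(3))
  hence "p * v\<dagger> = v\<dagger>" using projnD[OF p(2)] by simp
  thus "p * (v\<dagger> * v) = v\<dagger> * v" by (simp add: mult.assoc[symmetric])
  show "Re (tr p) <= Re (tr (v\<dagger> * v))" using le that tr_comm[of v "v\<dagger>"] v(1) by simp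
 qed (use v p in auto)
 with v show ?thesis by blast
qed

lemma isometry_sum: assumes B: "finite B" and W: "!!a. a : B ==> W a : R" and q: "!!a. a : B ==> projn (q a)"
  and WW: "!!a b. a : B ==> b : B ==> (W a)\<dagger> * W b = (if a = b then q a else 0)"
 shows "(SUM a:B. W a * (W a)\<dagger>) : R" "projn (SUM a:B. W a * (W a)\<dagger>)"
  "b : B ==> (SUM a:B. W a * (W a)\<dagger>) * W b = W b"
  "Re (tr (SUM a:B. W a * (W a)\<dagger>)) = (SUM a:B. Re (tr (q a)))"
proof -
 define h where "h = (SUM a:B. W a * (W a)\<dagger>)"
 have hW: "h * W b = W b" if "b : B" for b
 proof -
  have "h * W b = (SUM a:B. W a * ((W a)\<dagger> * W b))" by (simp add: h_def sum_distrib_right mult.assoc)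
  also have "... = (SUM a:B. if a = b then W b * q b else 0)" by (intro sum.cong) (simp_all add: WW that)
  also have "... = W b" using partial_isometry(1)[of "W b"] q[OF that] WW[OF that that] that B by simp
  finally show ?thesis .
 qed
 have "h * h = h" by (subst (2 3) h_def) (simp add: sum_distrib_left hW flip: mult.assoc)
 thus "projn (SUM a:B. W a * (W a)\<dagger>)" by (simp add: projn_def flip: h_def) (simp add: h_def adj_sum)
 show "(SUM a:B. W a * (W a)\<dagger>) : R" by (simp add: W)
 show "b : B ==> (SUM a:B. W a * (W a)\<dagger>) * W b = W b" using hW by (simp add: h_def)
 have "tr h = (SUM a:B. tr (q a))" unfolding h_def by (subst tr_sum) (auto intro!: sum.cong simp: W WW tr_comm[of "W _" "(W _)\<dagger>"])
 thus "Re (tr (SUM a:B. W a * (W a)\<dagger>)) = (SUM a:B. Re (tr (q a)))" by (simp add: h_def Re_sum)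
qed

text \<open>Copies of \<open>q\<close> are fitted one after another below what is left of
  \<open>f\<close>; the trace counts the room.\<close>

lemma isometry_family: assumes f: "f : R" "projn f" and q: "q : R" "projn q" and N: "real N * Re (tr q) <= Re (tr f)"
 shows "EX x. (ALL i<N. x i : R & f * x i = x i) & (ALL i<N. ALL j<N. (x i)\<dagger> * x j = (if i = j then q else 0))" using N
proof (induction N)
 case (Suc N)
 hence "real N * Re (tr q) <= Re (tr f)" using tr_projn_ge_0[OF q] by (simp add: distrib_right)
 then obtain x where x: "ALL i<N. x i : R & f * x i = x i" "ALL i<N. ALL j<N. (x i)\<dagger> * x j = (if i = j then q else 0)" using Suc.IH by blast
 define h where "h = (SUM i<N. x i * (x i)\<dagger>)"
 have h: "h : R" "projn h" "!!i. i < N ==> h * x i = x i" "Re (tr h) = real N * Re (tr q)"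
  using isometry_sum[of "{..<N}" x "%_. q"] x q by (auto simp: h_def)
 have fh: "f * h = h" using x(1) by (simp add: h_def sum_distrib_left flip: mult.assoc)
 have f': "projn (f - h)" by (rule projn_diff[OF f(2) h(2) fh])
 obtain y where y: "y : R" "y\<dagger> * y = q" "(f - h) * y = y" using subequivalent[OF q _ f'] Suc.prems f h by (auto simp: tr_diff distrib_right)
 have "f * ((f - h) * y) = (f - h) * y" using projnD[OF f(2)] by (simp add: right_diff_distrib fh flip: mult.assoc)
 hence fy: "f * y = y" by (simp only: y(3))
 have yx: "y\<dagger> * x i = 0" if "i < N" for i
 proof -
  have "y\<dagger> * x i = ((f - h) * y)\<dagger> * x i" by (simp only: y(3))
  also have "... = y\<dagger> * ((f - h) * x i)" using projnD(1)[OF f'] by (simp only: adj_ring(6) mult.assoc)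
  finally show ?thesis using x(1) h(3) that by (simp add: left_diff_distrib)
 qed
 hence "(x i)\<dagger> * y = 0" if "i < N" for i using arg_cong[OF yx[OF that], of adj] by simp
 thus ?case by (intro exI[of _ "x(N := y)"]) (use x y yx fy in "auto simp: less_Suc_eq")
qed simp

subsection \<open>The topology of the 2-norm\<close>

text \<open>The unit is cut into as many full copies of \<open>q\<close> as fit and one remainder.
  Carried along by the partial isometries \<open>v k\<close>, the vector that dominates the trace
  below \<open>q\<close> becomes finitely many vectors that dominate it everywhere. Hence strong
  convergence implies convergence in the 2-norm.\<close>

lemma trace_dominated:
 "EX (K::nat) \<xi>. ALL z:R. (tn z)\<^sup>2 <= 2 * (SUM k<K. (norm (app z (\<xi> k)))\<^sup>2)"
proof (rule dominating_vector)
 fix q \<xi> assume q: "q : R" "projn q" "q ~= 0" "app q \<xi> = \<xi>"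
  and dom: "!!x. x : R ==> (tn (x * q))\<^sup>2 <= 2 * (norm (app x \<xi>))\<^sup>2"
 define N where "N = nat \<lfloor>1 / Re (tr q)\<rfloor>"
 have q0: "Re (tr q) > 0" by (rule tr_projn_pos[OF q(1-3)])
 hence "real N <= 1 / Re (tr q)" "1 / Re (tr q) < real N + 1" by (simp_all add: N_def of_nat_nat)
 hence N: "real N * Re (tr q) <= 1" "1 - real N * Re (tr q) <= Re (tr q)" using q0 by (simp_all add: field_simps)
 obtain x where x: "ALL i<N. x i : R" "ALL i<N. ALL j<N. (x i)\<dagger> * x j = (if i = j then q else 0)"
  using isometry_family[of 1 q N] q N by (auto simp: tr_one)
 define h where "h = (SUM i<N. x i * (x i)\<dagger>)"
 have h: "h : R" "projn h" "Re (tr h) = real N * Re (tr q)" using isometry_sum[of "{..<N}" x "%_. q"] x q by (auto simp: h_def)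
 then obtain y where y: "y : R" "y\<dagger> * y = 1 - h" "q * y = y" using subequivalent[of "1 - h" q] N q by (auto simp: tr_diff tr_one projn_compl)
 define v where "v i = (if i < N then x i else y\<dagger>)" for i
 have vR: "v k : R" for k using x y by (simp add: v_def)
 have vq: "v k * q = v k" for k
 proof (cases "k < N")
  case True
  thus ?thesis using partial_isometry(1)[of "x k"] x q by (simp add: v_def)
 next
  case False
  thus ?thesis using arg_cong[OF y(3), of adj] projnD(1)[OF q(2)] by (simp add: v_def)
 qed
 have one: "1 = (SUM k<Suc N. v k * (v k)\<dagger>)" using y(2) by (simp add: v_def h_def)
 have "(tn z)\<^sup>2 <= 2 * (SUM k<Suc N. (norm (app z (app (v k) \<xi>)))\<^sup>2)" if z: "z : R" for z
 proof -
  have "(tn z)\<^sup>2 = Re (tr (z\<dagger> * z * 1))" using z by (simp add: tn_power2)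
  also have "... = (SUM k<Suc N. Re (tr (z\<dagger> * z * (v k * (v k)\<dagger>))))"
   unfolding one sum_distrib_left using z vR by (subst tr_sum) (auto simp: Re_sum)
  also have "... = (SUM k<Suc N. (tn (z * v k * q))\<^sup>2)"
  proof (rule sum.cong[OF refl])
   fix k
   have "tr ((z\<dagger> * z * v k) * (v k)\<dagger>) = tr ((v k)\<dagger> * (z\<dagger> * z * v k))" by (rule tr_comm) (use z vR in auto)
   thus "Re (tr (z\<dagger> * z * (v k * (v k)\<dagger>))) = (tn (z * v k * q))\<^sup>2" using z vR by (simp add: tn_power2 mult.assoc vq)
  qed
  also have "... <= (SUM k<Suc N. 2 * (norm (app (z * v k) \<xi>))\<^sup>2)" by (intro sum_mono dom) (use z vR in auto)
  finally show ?thesis by (simp add: sum_distrib_left)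
 qed
 thus ?thesis by (intro exI[of _ "Suc N"] exI[of _ "%k. app (v k) \<xi>"]) blast
qed

lemma slim_tn: assumes R: "!!n. X n : R" and X: "slim X x" shows "(%n. tn (X n - x)) ----> 0"
proof -
 have xR: "x : R" by (rule R_slim[OF R X])
 obtain K :: nat and \<xi> where dom: "ALL z:R. (tn z)\<^sup>2 <= 2 * (SUM k<K. (norm (app z (\<xi> k)))\<^sup>2)" using trace_dominated by blast
 have "(%n. 2 * (SUM k<K. (norm (app (X n) (\<xi> k) - app x (\<xi> k)))\<^sup>2)) ---->
   2 * (SUM k<K. (norm (app x (\<xi> k) - app x (\<xi> k)))\<^sup>2)" by (intro tendsto_intros slimD[OF X])
 hence lim: "(%n. 2 * (SUM k<K. (norm (app (X n - x) (\<xi> k)))\<^sup>2)) ----> 0" by simp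
 have "norm ((tn (X n - x))\<^sup>2) <= 2 * (SUM k<K. (norm (app (X n - x) (\<xi> k)))\<^sup>2)" for n
  using bspec[OF dom, of "X n - x"] R xR by (simp only: real_norm_def abs_power2 R_simps)
 hence "(%n. (tn (X n - x))\<^sup>2) ----> 0" by (intro Lim_null_comparison[OF always_eventually lim] allI)
 from tendsto_real_sqrt[OF this] show ?thesis using R xR by simp
qed

lemma bounded_complete: assumes R: "!!n. X n : R" and bd: "!!n. opbound (X n) C"
  and cauchy: "!!e. e > 0 ==> EX M. ALL m>=M. ALL n>=M. tn (X m - X n) < e" shows "EX x:R. slim X x & opbound x C & (%n. tn (X n - x)) ----> 0"
proof -
 obtain x where "x : R" "slim X x" using strongly_convergent[of X, OF R bd cauchy] by blast
 thus ?thesis using slim_opbound[of X x C] bd slim_tn[of X x] R by blast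
qed

lemma tn_limit_unique: assumes "!!n. X n : R" "x : R" "y : R" "(%n. tn (X n - x)) ----> 0" "(%n. tn (X n - y)) ----> 0" shows "x = y"
proof -
 have "(%n. tn (X n - x) + tn (X n - y)) ----> 0 + 0" by (intro tendsto_add assms)
 moreover have "tn (x - y) <= tn (X n - x) + tn (X n - y)" for n using tn_triangle_diff[of x "X n" y] tn_diff_commute[of x "X n"] assms(1-3) by simp
 ultimately have "tn (x - y) <= 0" by (intro LIMSEQ_le_const[of _ 0]) auto
 thus ?thesis using tn_le_0[of "x - y"] assms(2,3) by simp
qed

text \<open>\<open>trace_dominated\<close> bounds the 2-norm by finitely many vectors, at which
  \<open>amplified_bicommutant\<close> approximates simultaneously.\<close>

lemma star_alg_dense: assumes F: "star_alg F" "F \<subseteq> R" and x: "x : R" "!!c. (!!y. y : F ==> c * y = y * c) ==> c * x = x * c" and e: "e > 0"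
 shows "EX y:F. tn (x - y) < e"
proof -
 obtain K :: nat and \<xi> where dom: "ALL z:R. (tn z)\<^sup>2 <= 2 * (SUM k<K. (norm (app z (\<xi> k)))\<^sup>2)" using trace_dominated by blast
 obtain y where y: "y : F" "(SUM k<K. (norm (app (x - y) (\<xi> k)))\<^sup>2) < e\<^sup>2 / 2"
  using amplified_bicommutant[OF F(1) x(2), of "e\<^sup>2 / 2"] e by auto
 have "(tn (x - y))\<^sup>2 < e\<^sup>2" using bspec[OF dom, of "x - y"] x y F by auto
 hence "tn (x - y) < e" using e by (simp add: power2_less_imp_less)
 with y show ?thesis by blast
qed

subsection \<open>Projections of prescribed trace\<close>

text \<open>A nonzero projection splits properly, and one of the two parts has at most half its
  trace.\<close>

lemma small_projn: assumes p: "p : R" "projn p" "p ~= 0" shows "EX r:R. projn r & p * r = r & r ~= 0 & Re (tr r) <= Re (tr p) / 2 ^ n"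
proof (induction n)
 case 0
 show ?case using p by (intro bexI[of _ p]) (auto simp: projnD)
next
 case (Suc n)
 then obtain r where r: "r : R" "projn r" "p * r = r" "r ~= 0" "Re (tr r) <= Re (tr p) / 2 ^ n" by blast
 obtain q where q: "q : R" "projn q" "r * q = q" "q ~= 0" "q ~= r" using R_diffuse[OF r(1,2,4)] by blast
 have rq: "projn (r - q)" "r - q ~= 0" "r * (r - q) = r - q" using q r by (auto intro: projn_diff simp: right_diff_distrib projnD)
 have pq: "p * q = q" and prq: "p * (r - q) = r - q" by (rule projn_le_trans[OF q(3) r(3)], rule projn_le_trans[OF rq(3) r(3)])
 have "Re (tr q) + Re (tr (r - q)) = Re (tr r)" using q r by (simp add: tr_diff)
 then consider "Re (tr q) <= Re (tr r) / 2" | "Re (tr (r - q)) <= Re (tr r) / 2" by linarith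
 thus ?case
 proof cases
  case 1
  thus ?thesis using q pq r(5) by (intro bexI[of _ q]) auto
 next
  case 2
  thus ?thesis using q(1) r(1) rq prq r(5) by (intro bexI[of _ "r - q"]) auto
 qed
qed

text \<open>Among the projections below \<open>p\<close> of trace at most \<open>c\<close>, a
  maximal one has trace \<open>c\<close>: otherwise a small projection below the remainder could be
  added.\<close>

lemma projn_of_trace: assumes p: "p : R" "projn p" and c: "0 <= c" "c <= Re (tr p)" shows "EX r:R. projn r & p * r = r & Re (tr r) = c"
proof -
 define X where "X = {r:R. projn r & p * r = r & Re (tr r) <= c}"
 have "EX r:X. ALL s:X. s * r = r --> Re (tr s) = Re (tr r)"
 proof (rule brezis_browder[where a = 0 and B = c])
  show "0 : X" using c by (simp add: X_def)
  show "x * x = x" if "x : X" for x using that by (simp add: X_def projnD)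
  show "z * x = x" if "y * x = x" "z * y = y" for x y z :: "'h bop" by (rule projn_le_trans[OF that])
  show "Re (tr x) <= Re (tr y)" if "x : X" "y : X" "y * x = x" for x y using that by (intro tr_projn_mono) (auto simp: X_def)
  show "Re (tr x) <= c" if "x : X" for x using that by (simp add: X_def)
  show "EX u:X. ALL n. u * f n = f n" if f: "!!n. f n : X" "!!n. f (Suc n) * f n = f n" for f
  proof -
   obtain r where r: "r : R" "slim f r" "projn r" "!!n. r * f n = f n" "(%n. tr (f n)) ----> tr r"
    by (rule projn_sup[of f]) (use f in "auto simp: X_def")
   have "Re (tr r) <= c" by (rule LIMSEQ_le_const2[OF tendsto_Re[OF r(5)]]) (use f in "auto simp: X_def")
   moreover have "p * r = r" using slim_unique[OF slim_mult_left[OF r(2), of p]] r(2) f(1) by (simp add: X_def)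
   ultimately show ?thesis using r by (auto simp: X_def)
  qed
 qed
 then obtain r where rX: "r : X" and max: "ALL s:X. s * r = r --> Re (tr s) = Re (tr r)" by blast
 have r: "r : R" "projn r" "p * r = r" "Re (tr r) <= c" using rX by (auto simp: X_def)
 have "Re (tr r) = c"
 proof (rule ccontr)
  assume "Re (tr r) ~= c"
  hence d: "Re (tr r) < c" using r by simp
  have pr: "p - r : R" "projn (p - r)" using r p by (auto intro: projn_diff)
  have "p - r ~= 0" using d c by auto
  have "(%n. Re (tr (p - r)) * (1/2) ^ n) ----> Re (tr (p - r)) * 0" by (intro tendsto_mult tendsto_const LIMSEQ_realpow_zero) auto
  hence "\<forall>\<^sub>F n in sequentially. Re (tr (p - r)) * (1/2) ^ n < c - Re (tr r)" using d by (intro order_tendstoD(2)) auto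
  then obtain n where n: "Re (tr (p - r)) * (1/2) ^ n < c - Re (tr r)" by (auto simp: eventually_sequentially)
  obtain s where s: "s : R" "projn s" "(p - r) * s = s" "s ~= 0" "Re (tr s) <= Re (tr (p - r)) / 2 ^ n"
   using small_projn[OF pr `p - r ~= 0`, of n] by blast
  have rp: "r * p = r" by (rule projn_le_adj[OF r(2) p(2) r(3)])
  have "r * s = r * ((p - r) * s)" by (simp only: s(3))
  also have "... = 0" using projnD[OF r(2)] by (simp add: mult.assoc[symmetric] right_diff_distrib rp)
  finally have rs: "r * s = 0" .
  hence sr: "s * r = 0" by (metis adj_ring(1,6) projnD(1) s(2) r(2))
  have ps: "p * s = s" using s(3) rs by (simp add: left_diff_distrib)
  have "Re (tr (r + s)) <= c" using n s r by (simp add: tr_add power_divide)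
  hence "r + s : X" using r s rs ps by (auto simp: X_def projn_add distrib_left)
  moreover have "(r + s) * r = r" using sr projnD[OF r(2)] by (simp add: distrib_right)
  ultimately have "Re (tr (r + s)) = Re (tr r)" using max by blast
  hence "Re (tr s) = 0" using r s by (simp add: tr_add)
  thus False using tr_projn_pos[OF s(1,2,4)] by simp
 qed
 with r show ?thesis by blast
qed

end

section \<open>Finite-dimensional subalgebras\<close>

definition cspan :: "'h::complex_hilbert_space bop set => 'h bop set" where
 "cspan B = {x. EX c. x = (SUM b:B. csc (c b) b)}"

lemma cspan_add: assumes "x : cspan B" "y : cspan B" shows "x + y : cspan B"
proof -
 obtain c d where "x = (SUM b:B. csc (c b) b)" "y = (SUM b:B. csc (d b) b)" using assms unfolding cspan_def by blast
 hence "x + y = (SUM b:B. csc (c b + d b) b)" by (simp add: sum.distrib csc_add_left)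
 thus ?thesis unfolding cspan_def by (intro CollectI exI)
qed

lemma cspan_csc: assumes "x : cspan B" shows "csc a x : cspan B"
proof -
 obtain c where "x = (SUM b:B. csc (c b) b)" using assms unfolding cspan_def by blast
 hence "csc a x = (SUM b:B. csc (a * c b) b)" by (simp add: csc_sum)
 thus ?thesis unfolding cspan_def by (intro CollectI exI)
qed

lemma cspan_insert: assumes "finite B" "b ~: B" shows "x : cspan (insert b B) <-> (EX c. EX y:cspan B. x = csc c b + y)"
proof
 assume "x : cspan (insert b B)"
 then obtain c where c: "x = (SUM b:insert b B. csc (c b) b)" unfolding cspan_def by blast
 have "(SUM b:B. csc (c b) b) : cspan B" unfolding cspan_def by blast
 thus "EX c. EX y:cspan B. x = csc c b + y" using c assms by auto
next
 assume "EX c. EX y:cspan B. x = csc c b + y"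
 then obtain a c where x: "x = csc a b + (SUM b:B. csc (c b) b)" unfolding cspan_def by blast
 have "(SUM b':insert b B. csc ((c(b := a)) b') b') = csc a b + (SUM b':B. csc ((c(b := a)) b') b')" using assms by simp
 also have "(SUM b':B. csc ((c(b := a)) b') b') = (SUM b:B. csc (c b) b)" using assms by (intro sum.cong) auto
 finally show "x : cspan (insert b B)" unfolding cspan_def x by (intro CollectI exI) (rule sym)
qed

context tracial_factor
begin

lemma cspan_R: "B \<subseteq> R ==> x : cspan B ==> x : R" by (auto simp: cspan_def intro!: R_sum R_simps)

text \<open>Gram-Schmidt for the inner product of the trace, one spanning element at a time.\<close>

lemma orthogonal_decomposition: assumes "finite B" "B \<subseteq> R" "x : R" shows "EX y:cspan B. ALL z:cspan B. tr (z\<dagger> * (x - y)) = 0"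
 using assms
proof (induction B arbitrary: x rule: finite_induct)
 case empty
 thus ?case by (auto simp: cspan_def)
next
 case (insert b B)
 hence BR: "B \<subseteq> R" "b : R" by auto
 obtain p where p: "p : cspan B" "ALL z:cspan B. tr (z\<dagger> * (b - p)) = 0" using insert.IH[OF BR] by blast
 obtain y where y: "y : cspan B" "ALL z:cspan B. tr (z\<dagger> * (x - y)) = 0" using insert.IH[OF BR(1) insert.prems(2)] by blast
 have pR: "p : R" and yR: "y : R" using cspan_R[OF BR(1)] p y by auto
 define b' where "b' = b - p"
 have b'R: "b' : R" using pR BR by (simp add: b'_def)
 \<comment> \<open>For \<open>b' = 0\<close> the division yields 0, and the identity that follows
   holds because both sides vanish.\<close>
 define l where "l = tr (b'\<dagger> * (x - y)) / tr (b'\<dagger> * b')"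
 have l: "l * tr (b'\<dagger> * b') = tr (b'\<dagger> * (x - y))" using tr_faithful[OF b'R] by (cases "b' = 0") (auto simp: l_def)
 define y' where "y' = y + csc l b'"
 have "y' = csc l b + (y + csc (- l) p)" by (simp add: y'_def b'_def csc_diff_right csc_minus_left)
 moreover have "y + csc (- l) p : cspan B" by (intro cspan_add cspan_csc y p)
 ultimately have "y' : cspan (insert b B)" using cspan_insert[OF insert.hyps] by blast
 moreover have "tr (z\<dagger> * (x - y')) = 0" if z: "z : cspan (insert b B)" for z
 proof -
  obtain c z0 where z0: "z0 : cspan B" "z = csc c b + z0" using z cspan_insert[OF insert.hyps] by blast
  define z1 where "z1 = csc c p + z0"
  have z1: "z1 : cspan B" unfolding z1_def by (intro cspan_add cspan_csc z0 p)
  have z1R: "z1 : R" using cspan_R[OF BR(1) z1] .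
  have zz: "z = csc c b' + z1" by (simp add: z0 z1_def b'_def csc_diff_right)
  have xy: "x - y' = (x - y) - csc l b'" by (simp add: y'_def)
  have 1: "tr (z1\<dagger> * (x - y)) = 0" "tr (z1\<dagger> * b') = 0" using y(2) p(2) z1 by (auto simp: b'_def)
  have "tr (z1\<dagger> * (x - y')) = 0"
   unfolding xy using 1 z1R b'R yR insert.prems by (simp add: right_diff_distrib[of "z1\<dagger>" "x - y"] tr_diff tr_csc)
  moreover have "tr (b'\<dagger> * (x - y')) = 0"
   unfolding xy using l b'R yR insert.prems by (simp add: right_diff_distrib[of "b'\<dagger>" "x - y"] tr_diff tr_csc)
  ultimately show ?thesis unfolding zz using z1R b'R yR insert.prems by (simp add: distrib_right tr_add tr_csc y'_def)
 qed
 ultimately show ?case by blast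
qed

text \<open>The component \<open>w\<close> of \<open>x\<close> orthogonal to the span satisfies
  \<open>tn w <= tn (X n - x)\<close> for all members \<open>X n\<close> of the span.\<close>

lemma cspan_closed: assumes B: "finite B" "B \<subseteq> R" and X: "!!n. X n : cspan B" and x: "x : R" "(%n. tn (X n - x)) ----> 0"
 shows "x : cspan B"
proof -
 obtain y where y: "y : cspan B" "ALL z:cspan B. tr (z\<dagger> * (x - y)) = 0" using orthogonal_decomposition[OF B x(1)] by blast
 have yR: "y : R" and XR: "!!n. X n : R" using cspan_R[OF B(2)] y X by auto
 define w where "w = x - y"
 have wR: "w : R" using x yR by (simp add: w_def)
 have "tn w <= tn (X n - x)" for n
 proof -
  have "csc (-1) y + X n : cspan B" by (intro cspan_add cspan_csc y X)
  hence "tr ((csc (-1) y + X n)\<dagger> * w) = 0" using y(2) unfolding w_def by blast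
  moreover have "csc (-1) y + X n = X n - y" by (simp add: csc_minus_left)
  moreover have "X n - y = (X n - x) + w" by (simp add: w_def)
  ultimately have "tr (((X n - x) + w)\<dagger> * w) = 0" by metis
  hence "tr ((X n - x)\<dagger> * w) + tr (w\<dagger> * w) = 0" using wR XR x by (simp add: distrib_right tr_add del: adj_ring(4))
  hence "tr (w\<dagger> * w) = - tr ((X n - x)\<dagger> * w)" by (simp add: eq_neg_iff_add_eq_0 add.commute)
  hence "(tn w)\<^sup>2 = cmod (tr ((X n - x)\<dagger> * w))" using tr_self[OF wR] by (metis abs_power2 norm_minus_cancel norm_of_real)
  also have "... <= tn (X n - x) * tn w" by (rule tr_cauchy_schwarz) (use XR x wR in auto)
  finally have "tn w * tn w <= tn (X n - x) * tn w" by (simp add: power2_eq_square)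
  thus ?thesis using wR tn_ge_0[OF wR] XR x by (cases "tn w = 0") (auto simp: mult_le_cancel_right)
 qed
 hence "tn w <= 0" using x(2) by (intro LIMSEQ_le_const[of _ 0]) auto
 hence "x = y" using tn_le_0[OF wR] by (simp add: w_def)
 with y show ?thesis by simp
qed

text \<open>Strong limits are limits in the 2-norm, in which finite-dimensional spans are
  closed.\<close>

lemma finite_dim_salg: assumes G: "star_alg G" "G \<subseteq> R" and B: "finite B" "B \<subseteq> G" "G \<subseteq> cspan B" shows "salg G"
 unfolding salg_def
proof (intro conjI allI impI)
 fix X x assume X: "ALL n. X n : G" "slim X x"
 have XR: "!!n. X n : R" using X G by blast
 have "x : cspan B" by (rule cspan_closed[OF B(1) _ _ R_slim[OF XR X(2)] slim_tn[OF XR X(2)]]) (use B G X in auto)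
 thus "x : G" using B(2) unfolding cspan_def by (auto intro!: star_alg_sum[OF G(1)] star_algD[OF G(1)])
qed (fact G)

lemma psd_tr_eq_0: assumes "z : R" "psd z" "Re (tr z) = 0" shows "z = 0"
proof -
 obtain b where b: "b : R" "b\<dagger> = b" "b * b = z" by (rule psd_sqrt[OF R_salg assms(1,2)])
 hence "tn b = 0" using assms(3) by (simp add: tn_def)
 thus ?thesis using tn_eq_0[OF b(1)] b(3) by simp
qed

text \<open>Subtracting a multiple of \<open>p\<close> makes the trace zero. By minimality the
  spectral projection is then \<open>0\<close> or \<open>p\<close>, so the element is semidefinite,
  and a semidefinite element of trace zero vanishes.\<close>

lemma minimal_projn_scalar: assumes S: "salg S" "S \<subseteq> R" and p: "p : S" "projn p" "p ~= 0"
  and min: "!!e. e : S ==> projn e ==> p * e = e ==> e = 0 | e = p" and x: "x : S" "x\<dagger> = x" "p * x = x" shows "EX t::real. x = t *\<^sub>R p"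
proof -
 define t where "t = Re (tr x) / Re (tr p)"
 define z where "z = x - t *\<^sub>R p"
 have pR: "p : R" and xR: "x : R" using S p x by auto
 have xp: "x * p = x" using x p by (metis adj_ring(6) projnD(1))
 have z: "z : S" "z\<dagger> = z" "z * p = z" "p * z = z" using star_algD[OF salgD(1)[OF S(1)]] p x xp by (simp_all add: z_def projnD diff_distribs)
 have zR: "z : R" using z S by blast
 have t: "Re (tr z) = 0" using tr_projn_pos[OF pR p(2,3)] xR pR by (simp add: z_def t_def tr_diff tr_scaleR)
 have "z = 0"
 proof (rule spectral_projection[OF z(2)])
  fix e assume e: "projn e" "psd (z * e)" "psd (- (z * (1 - e)))" "!!S. salg S ==> z : S ==> e : S"
   "!!q. z * q = z ==> q * z = z ==> e * q = e & q * e = e"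
  have "e = 0 | e = p" by (rule min) (use e z S in auto)
  thus "z = 0"
  proof
   assume "e = 0"
   hence "psd (- z)" using e(3) by simp
   hence "- z = 0" using psd_tr_eq_0[of "- z"] zR t by (simp add: tr_minus)
   thus ?thesis by simp
  next
   assume "e = p"
   thus ?thesis using e(2) z psd_tr_eq_0[of z] zR t by simp
  qed
 qed
 thus ?thesis by (auto simp: z_def)
qed

definition orth_family :: "nat => (nat => 'h bop) => bool" where
 "orth_family n g <-> (ALL j<n. projn (g j) & g j ~= 0) & (ALL i<n. ALL j<n. i ~= j --> g i * g j = 0)"

text \<open>Orthogonal nonzero projections are independent over the reals, and the complex span of
  \<open>B\<close> has real dimension at most \<open>2 * card B\<close>. The bound serves to choose
  a family of maximal size.\<close>

lemma orth_family_bound: assumes B: "finite B" and g: "orth_family n g" "!!j. j < n ==> g j : cspan B" shows "n <= 2 * card B"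
proof -
 let ?T = "B \<union> csc \<i> ` B"
 have "x : span ?T" if "x : cspan B" for x
 proof -
  obtain c where x: "x = (SUM b:B. csc (c b) b)" using `x : cspan B` unfolding cspan_def by blast
  have eq: "csc (c b) b = Re (c b) *\<^sub>R b + Im (c b) *\<^sub>R csc \<i> b" for b
  proof -
   have "c b = of_real (Re (c b)) + of_real (Im (c b)) * \<i>" by (simp add: complex_eq_iff)
   hence "csc (c b) b = csc (of_real (Re (c b)) + of_real (Im (c b)) * \<i>) b" by (rule arg_cong)
   thus ?thesis by (simp add: scaleR_csc csc_add_left)
  qed
  show ?thesis unfolding x
  proof (rule span_sum)
   fix b assume "b : B"
   thus "csc (c b) b : span ?T" unfolding eq by (intro span_add span_scale span_base) auto
  qed
 qed
 hence sub: "g ` {..<n} \<subseteq> span ?T" using g(2) by auto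
 have inj: "inj_on g {..<n}"
 proof (rule inj_onI)
  fix i j assume ij: "i : {..<n}" "j : {..<n}" "g i = g j"
  show "i = j"
  proof (rule ccontr)
   assume "i ~= j"
   hence "g i * g j = 0" using g(1) ij by (auto simp: orth_family_def)
   moreover have "g i * g i = g i" "g i ~= 0" using g(1) ij by (auto simp: orth_family_def projn_def)
   ultimately show False using ij by simp
  qed
 qed
 have "independent (g ` {..<n})"
 proof (rule independent_if_scalars_zero)
  fix f :: "'h bop => real" and x
  assume 0: "(SUM x:g ` {..<n}. f x *\<^sub>R x) = 0" and "x : g ` {..<n}"
  then obtain j where j: "j < n" "x = g j" by auto
  have "(SUM i<n. f (g i) *\<^sub>R g i) = 0" using 0 inj by (simp add: sum.reindex)
  hence "0 = (SUM i<n. f (g i) *\<^sub>R g i) * g j" by simp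
  also have "... = (SUM i<n. f (g i) *\<^sub>R (g i * g j))" by (simp add: sum_distrib_right)
  also have "... = (SUM i<n. if i = j then f (g j) *\<^sub>R g j else 0)" using g(1) j by (intro sum.cong) (auto simp: orth_family_def projn_def)
  also have "... = f (g j) *\<^sub>R g j" using j by simp
  finally show "f x = 0" using g(1) j by (auto simp: orth_family_def)
 qed simp
 hence "card (g ` {..<n}) <= card ?T" using independent_span_bound[of ?T "g ` {..<n}"] sub B by auto
 also have "card ?T <= card B + card (csc \<i> ` B)" by (rule card_Un_le)
 also have "... <= 2 * card B" using card_image_le[OF B, of "csc \<i>"] by simp
 finally show ?thesis using inj by (simp add: card_image)
qed

text \<open>An orthogonal family of maximal size: if its sum were not 1, the complement could be
  added, and a member with a proper subprojection in \<open>S\<close> could be split.\<close>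

lemma minimal_partition: assumes S: "salg S" "S \<subseteq> cspan B" "finite B"
 shows "EX n p. orth_family n p & (ALL k<n. p k : S) & (SUM k<n. p k) = 1 &
  (ALL k<n. ALL e:S. projn e --> p k * e = e --> e = 0 | e = p k)"
proof -
 note S_alg = star_algD[OF salgD(1)[OF S(1)]]
 define Q where "Q n <-> (EX p. orth_family n p & (ALL k<n. p k : S))" for n
 have Q0: "Q 0" by (auto simp: Q_def orth_family_def)
 have "ALL n. Q n --> n < 2 * card B + 1" using orth_family_bound[OF S(3)] S(2) unfolding Q_def by (metis less_Suc_eq_le Suc_eq_plus1 subsetD)
 then obtain n where n: "Q n" "!!m. Q m ==> m <= n" using ex_has_greatest_nat[of Q 0 "%n. n" "2 * card B + 1"] Q0 by auto
 obtain p where p: "orth_family n p" "ALL k<n. p k : S" using n(1) by (auto simp: Q_def)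
 have pp: "projn (p k)" "p k ~= 0" if "k < n" for k using p(1) that by (auto simp: orth_family_def)
 have orth: "p i * p j = 0" if "i < n" "j < n" "i ~= j" for i j using p(1) that by (auto simp: orth_family_def)
 have "(SUM k<n. p k) = 1"
 proof (rule ccontr)
  assume ne: "(SUM k<n. p k) ~= 1"
  define s where "s = (SUM k<n. p k)"
  have s: "projn s" unfolding s_def by (rule projn_sum) (use pp orth in auto)
  have sp: "s * p k = p k" if "k < n" for k unfolding s_def by (rule sum_projn_mult) (use pp orth that in "auto simp: projn_def")
  have ps: "p k * s = p k" if "k < n" for k by (rule projn_le_adj[OF pp(1)[OF that] s sp[OF that]])
  have "s : S" unfolding s_def by (rule star_alg_sum[OF salgD(1)[OF S(1)]]) (use p in auto)
  hence "orth_family (Suc n) (p(n := 1 - s)) & (ALL k<Suc n. (p(n := 1 - s)) k : S)" using ne p S_alg projn_compl[OF s] sp ps pp orth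
   by (auto simp: orth_family_def less_Suc_eq s_def[symmetric] diff_distribs)
  hence "Q (Suc n)" unfolding Q_def by blast
  thus False using n(2) by fastforce
 qed
 moreover have "e = 0 | e = p k" if k: "k < n" and e: "e : S" "projn e" "p k * e = e" for k e
 proof (rule ccontr)
  assume ne: "~ ?thesis"
  have ep: "e * p k = e" by (rule projn_le_adj[OF e(2) pp(1)[OF k] e(3)])
  have f: "projn (p k - e)" "p k - e ~= 0" "p k - e : S" using ne pp(1)[OF k] e p k S_alg by (auto intro: projn_diff)
  have ef: "e * (p k - e) = 0" "(p k - e) * e = 0" using e ep projnD[OF e(2)] by (simp_all add: diff_distribs)
  have e0: "e * p j = 0" "p j * e = 0" if "j < n" "j ~= k" for j
  proof -
   have "e * p j = e * (p k * p j)" by (simp only: mult.assoc[symmetric] ep)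
   thus "e * p j = 0" using orth[of k j] k that by simp
   have "p j * e = (p j * p k) * e" by (simp only: mult.assoc e(3))
   thus "p j * e = 0" using orth[of j k] k that by simp
  qed
  define g where "g = p(k := e, n := p k - e)"
  have g: "g n = p k - e" "g k = e" "!!j. j < n ==> j ~= k ==> g j = p j" using k by (auto simp: g_def)
  have "orth_family (Suc n) g" unfolding orth_family_def
  proof (intro conjI allI impI)
   fix j assume "j < Suc n"
   then consider "j = n" | "j = k" | "j < n" "j ~= k" by linarith
   thus "projn (g j)" "g j ~= 0" using f e ne g pp by (cases; auto)+
  next
   fix i j assume ij: "i < Suc n" "j < Suc n" "i ~= j"
   from ij(1) consider "i = n" | "i = k" | "i < n" "i ~= k" by linarith
   note ci = this
   from ij(2) consider "j = n" | "j = k" | "j < n" "j ~= k" by linarith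
   note cj = this
   show "g i * g j = 0" by (rule ci; rule cj) (use ij g ef e0 orth k in "simp_all add: diff_distribs")
  qed
  moreover have "ALL j<Suc n. g j : S" using f e p k by (auto simp: g_def less_Suc_eq)
  ultimately have "Q (Suc n)" unfolding Q_def by blast
  thus False using n(2) by fastforce
 qed
 ultimately show ?thesis using p by blast
qed

end

context tracial_factor
begin

text \<open>For \<open>z = p * x * q\<close> the products \<open>z\<dagger> * z\<close> and
  \<open>z * z\<dagger>\<close> are multiples of \<open>q\<close> and of \<open>p\<close>. Rescaling
  makes the first equal to \<open>q\<close>; the second is then a nonzero projection, so its factor
  is 1.\<close>

lemma minimal_corner_isometry: assumes G: "star_alg G" "G \<subseteq> R" and p: "p : G" "projn p" "p ~= 0" and q: "q : G" "projn q" "q ~= 0"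
  and sp: "!!x. x : G ==> EX c. p * x * p = csc c p" and sq: "!!x. x : G ==> EX c. q * x * q = csc c q" and x: "x : G" "p * x * q ~= 0"
 shows "EX v:G. v\<dagger> * v = q & v * v\<dagger> = p"
proof -
 define z where "z = p * x * q"
 have zG: "z : G" using x p q by (simp add: z_def star_algD[OF G(1)])
 have pR: "p : R" and qR: "q : R" and zR: "z : R" using p q zG G by auto
 have "z\<dagger> * z = q * (x\<dagger> * p * x) * q"
  by (simp add: z_def projnD[OF p(2)] projnD[OF q(2)] mult.assoc) (metis mult.assoc projnD(2) p(2))
 then obtain c where c: "z\<dagger> * z = csc c q" using sq[of "x\<dagger> * p * x"] x p by (auto simp: star_algD[OF G(1)])
 have "tr (z\<dagger> * z) = c * tr q" using qR by (simp add: c tr_csc)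
 moreover have "tn z > 0" using tn_eq_0[OF zR] tn_ge_0[OF zR] x(2) by (simp add: z_def)
 ultimately have "c * tr q = of_real ((tn z)\<^sup>2)" "tn z > 0" by (simp_all only: tr_self[OF zR])
 moreover have "tr q = of_real (Re (tr q))" "Re (tr q) > 0" using tr_projn tr_projn_pos qR q by auto
 ultimately have "c = of_real ((tn z)\<^sup>2 / Re (tr q))" by (metis nonzero_eq_divide_eq of_real_divide of_real_eq_0_iff less_irrefl)
 moreover define c' where "c' = (tn z)\<^sup>2 / Re (tr q)"
 ultimately have cc: "c = of_real c'" and c': "c' > 0" using `tn z > 0` `Re (tr q) > 0` by auto
 define v where "v = (1 / sqrt c') *\<^sub>R z"
 have "v\<dagger> * v = (1 / c') *\<^sub>R (z\<dagger> * z)" using c' by (simp add: v_def)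
 also have "... = csc (of_real (1 / c') * of_real c') q" by (simp only: c cc scaleR_csc csc_csc)
 also have "of_real (1 / c') * of_real c' = (1::complex)" using c' by simp
 finally have vq: "v\<dagger> * v = q" by simp
 have vG: "v : G" using zG by (simp add: v_def star_algD[OF G(1)])
 have "z * z\<dagger> = p * (x * q * x\<dagger>) * p"
  by (simp add: z_def projnD[OF p(2)] projnD[OF q(2)] mult.assoc) (metis mult.assoc projnD(2) q(2))
 then obtain d where "z * z\<dagger> = csc d p" using sp[of "x * q * x\<dagger>"] x q by (auto simp: star_algD[OF G(1)])
 moreover have "v * v\<dagger> = (1 / c') *\<^sub>R (z * z\<dagger>)" using c' by (simp add: v_def)
 ultimately have "v * v\<dagger> = csc (of_real (1 / c') * d) p" by (simp only: scaleR_csc csc_csc)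
 then obtain d' where d': "v * v\<dagger> = csc d' p" by blast
 have vv: "projn (v * v\<dagger>)" using partial_isometry(2)[of v] vq q by simp
 have "csc (d' * d' - d') p = 0" using projnD(2)[OF vv] projnD(2)[OF p(2)] by (simp add: d' csc_diff_left)
 hence "d' * d' - d' = 0" using p(3) csc_cancel[of "d' * d' - d'" p 0] by auto
 moreover have "d' ~= 0"
 proof
  assume "d' = 0"
  hence "v\<dagger>\<dagger> * v\<dagger> = 0" using d' by simp
  hence "v\<dagger> = 0" by (simp only: adj_mult_self_eq_0)
  thus False using vq q(3) by simp
 qed
 ultimately have "d' = 1" by simp
 thus ?thesis using vG vq d' by auto
qed

text \<open>With \<open>p k = v k (v k)\<^sup>\<dagger>\<close>, the block \<open>p k G p l\<close> is spanned by \<open>v k (v l)\<^sup>\<dagger>\<close> if \<open>k\<close> and \<open>l\<close>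
  have the same representative, and zero otherwise.\<close>

lemma finite_dim_structure:
 assumes G: "star_alg G" "G \<subseteq> R" and B: "finite B" "B \<subseteq> G" "G \<subseteq> cspan B" and f: "f : G" "projn f"
 shows "EX (n::nat) p (r :: nat => nat) v K. (ALL k<n. r k < n & p k : R & projn (p k) & v k : R) &
  (ALL k<n. ALL l<n. (v k)\<dagger> * v l = (if k = l then p (r k) else 0)) &
  K \<subseteq> {..<n} & f = (SUM k:K. v k * (v k)\<dagger>) &
  (ALL x:G. EX c. x = (SUM k<n. SUM j<n. if r k = r j then csc (c k j) (v k * (v j)\<dagger>) else 0))"
proof -
 note G_alg = star_algD[OF G(1)]
 note ff = projnD[OF f(2)]
 \<comment> \<open>Minimal projections are taken in the part of \<open>G\<close> commuting with
   \<open>f\<close>, so that \<open>f\<close> becomes a sum of some of them. Each lies below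
   \<open>f\<close> or below \<open>1 - f\<close>, so compressions of \<open>G\<close> by it commute
   with \<open>f\<close>, and they are scalar as well.\<close>
 define S where "S = G \<inter> {x. x * f = f * x}"
 have S: "salg S" unfolding S_def by (intro salg_Int finite_dim_salg[OF G B] salg_commute1 ff)
 have SG: "S \<subseteq> G" "S \<subseteq> R" using G by (auto simp: S_def)
 obtain n p where p: "orth_family n p" "ALL k<n. p k : S" "(SUM k<n. p k) = 1"
  "ALL k<n. ALL e:S. projn e --> p k * e = e --> e = 0 | e = p k" using minimal_partition[OF S _ B(1)] SG B(3) by blast
 have pp: "projn (p k)" "p k ~= 0" if "k < n" for k using p(1) that by (auto simp: orth_family_def)
 have pS: "p k : S" if "k < n" for k using p(2) that by blast
 hence pG: "p k : G" and pR: "p k : R" and pf: "p k * f = f * p k" if "k < n" for k using that SG by (auto simp: S_def)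
 define K where "K = {k. k < n & f * p k = p k}"
 have fp: "f * p k = (if k : K then p k else 0)" if k: "k < n" for k
 proof -
  have e: "p k * (f * p k) = f * p k" "f * (f * p k) = f * p k" by (metis pf[OF k] mult.assoc projnD(2) pp(1)[OF k], metis ff(2) mult.assoc)
  moreover have "(f * p k)\<dagger> = f * p k" using ff(1) projnD(1)[OF pp(1)[OF k]] pf[OF k] by simp
  ultimately have "f * p k = 0 | f * p k = p k" using p(4) k f(1) pG[OF k] pf[OF k] by (auto simp: S_def G_alg projn_def mult.assoc)
  thus ?thesis using k by (auto simp: K_def)
 qed
 have fsum: "f = (SUM k:K. p k)"
 proof -
  have "f = f * (SUM k<n. p k)" by (simp add: p(3))
  also have "... = (SUM k<n. if k : K then p k else 0)" unfolding sum_distrib_left by (intro sum.cong) (auto simp: fp)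
  also have "... = (SUM k:K. p k)" by (simp add: sum.If_cases) (auto simp: K_def intro!: sum.cong)
  finally show ?thesis .
 qed
 have sc_sa: "EX t::real. p k * x * p k = t *\<^sub>R p k" if k: "k < n" and x: "x : G" "x\<dagger> = x" for k x
 proof (rule minimal_projn_scalar[OF S SG(2) pS[OF k] pp[OF k]])
  have "p k * x * p k * f = f * (p k * x * p k)" using pf[OF k] fp[OF k] by (simp add: mult.assoc) (simp flip: mult.assoc)
  thus "p k * x * p k : S" using x pG[OF k] by (simp add: S_def G_alg)
  show "(p k * x * p k)\<dagger> = p k * x * p k" using x projnD(1)[OF pp(1)[OF k]] by (simp add: mult.assoc)
  show "p k * (p k * x * p k) = p k * x * p k" by (simp add: mult.assoc[symmetric] projnD(2)[OF pp(1)[OF k]])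
 qed (use p(4) k in auto)
 have sc: "EX c. p k * x * p k = csc c (p k)" if k: "k < n" and x: "x : G" for k x
 proof -
  obtain s t :: real where s: "p k * (x + x\<dagger>) * p k = s *\<^sub>R p k" and t: "p k * csc \<i> (x - x\<dagger>) * p k = t *\<^sub>R p k"
   using sc_sa[OF k, of "x + x\<dagger>"] sc_sa[OF k, of "csc \<i> (x - x\<dagger>)"] x
   by (auto simp: G_alg csc_diff_right csc_minus_left add.commute)
  have "2 *\<^sub>R x = (x + x\<dagger>) + csc (- \<i>) (csc \<i> (x - x\<dagger>))" by (simp add: scaleR_2)
  hence "p k * (2 *\<^sub>R x) * p k = p k * (x + x\<dagger>) * p k + csc (- \<i>) (p k * csc \<i> (x - x\<dagger>) * p k)"
   by (simp only: distrib_left distrib_right csc_mult_left csc_mult_right)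
  hence "2 *\<^sub>R (p k * x * p k) = s *\<^sub>R p k + csc (- \<i>) (t *\<^sub>R p k)" by (simp only: s t bop_scaleR_mult)
  hence "2 *\<^sub>R (p k * x * p k) = csc (of_real s + (- \<i>) * of_real t) (p k)" by (simp only: scaleR_csc csc_csc csc_add_left)
  hence "(1/2::real) *\<^sub>R (2 *\<^sub>R (p k * x * p k)) = (1/2::real) *\<^sub>R csc (of_real s + (- \<i>) * of_real t) (p k)" by (rule arg_cong)
  hence "p k * x * p k = csc (of_real (1/2) * (of_real s + (- \<i>) * of_real t)) (p k)" by (simp only: scaleR_csc csc_csc) simp
  thus ?thesis by blast
 qed
 define rel where "rel k j <-> (EX v:G. v\<dagger> * v = p j & v * v\<dagger> = p k)" for k j
 have rel_refl: "rel k k" if "k < n" for k unfolding rel_def using pG[OF that] projnD[OF pp(1)[OF that]] by (intro bexI[of _ "p k"]) auto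
 have rel_sym: "rel j k" if "rel k j" for k j using that unfolding rel_def by (metis G_alg(5) adj_adj)
 have rel_trans: "rel k m" if h: "rel k j" "rel j m" "j < n" for k j m
 proof -
  obtain v w where v: "v : G" "v\<dagger> * v = p j" "v * v\<dagger> = p k" and w: "w : G" "w\<dagger> * w = p m" "w * w\<dagger> = p j"
   using h unfolding rel_def by blast
  have vj: "v * p j = v" using partial_isometry(1)[of v] v(2) pp(1)[OF h(3)] by simp
  have wj: "w\<dagger> * p j = w\<dagger>" using partial_isometry(1)[of "w\<dagger>"] w(3) pp(1)[OF h(3)] by simp
  have "(v * w)\<dagger> * (v * w) = w\<dagger> * (v\<dagger> * v) * w" by (simp add: mult.assoc)
  hence 1: "(v * w)\<dagger> * (v * w) = p m" by (simp only: v(2) wj w(2))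
  have "(v * w) * (v * w)\<dagger> = v * (w * w\<dagger>) * v\<dagger>" by (simp add: mult.assoc)
  hence 2: "(v * w) * (v * w)\<dagger> = p k" by (simp only: w(3) vj v(3))
  show ?thesis unfolding rel_def by (intro bexI[of _ "v * w"] conjI 1 2 G_alg(4) v w)
 qed
 \<comment> \<open>The least equivalent index, a canonical choice for which equivalent indices have
   equal representatives.\<close>
 define r where "r k = (LEAST j. j < n & rel k j)" for k
 have r: "r k < n & rel k (r k)" if "k < n" for k unfolding r_def by (rule LeastI[of _ k]) (use that rel_refl in auto)
 have req: "r k = r j" if "k < n" "j < n" "rel k j" for k j
 proof -
  have "(m < n & rel k m) = (m < n & rel j m)" for m using rel_trans[of k j m] rel_trans[of j k m] rel_sym that by blast
  thus ?thesis by (simp add: r_def)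
 qed
 have "EX v. v : G & v\<dagger> * v = p (r k) & v * v\<dagger> = p k" if "k < n" for k using r[OF that] unfolding rel_def by blast
 then obtain v where v: "!!k. k < n ==> v k : G" "!!k. k < n ==> (v k)\<dagger> * v k = p (r k)" "!!k. k < n ==> v k * (v k)\<dagger> = p k" by metis
 have vr: "v k * p (r k) = v k" if "k < n" for k using partial_isometry(1)[of "v k"] v(2)[OF that] pp(1) r[OF that] by simp
 have rv: "p (r k) * (v k)\<dagger> = (v k)\<dagger>" if "k < n" for k
 proof -
  have "(v k * p (r k))\<dagger> = (v k)\<dagger>" by (simp only: vr[OF that])
  thus ?thesis using projnD(1)[OF pp(1), of "r k"] r[OF that] by simp
 qed
 have span: "EX c. x = (SUM k<n. SUM j<n. if r k = r j then csc (c k j) (v k * (v j)\<dagger>) else 0)" if x: "x : G" for x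
 proof -
  have "EX c. p k * x * p j = (if r k = r j then csc c (v k * (v j)\<dagger>) else 0)" if kj: "k < n" "j < n" for k j
  proof (cases "r k = r j")
   case False
   have "p k * x * p j = 0"
   proof (rule ccontr)
    assume ne: "p k * x * p j ~= 0"
    have "rel k j" unfolding rel_def
     by (rule minimal_corner_isometry[OF G pG[OF kj(1)] pp[OF kj(1)] pG[OF kj(2)] pp[OF kj(2)] sc[OF kj(1)] sc[OF kj(2)] x ne])
    thus False using req kj False by blast
   qed
   thus ?thesis using False by simp
  next
   case True
   have "(v k)\<dagger> * x * v j : G" by (intro G_alg(4) G_alg(5) v kj x)
   then obtain c where c: "p (r k) * ((v k)\<dagger> * x * v j) * p (r k) = csc c (p (r k))" using sc r kj by blast
   have "p k * x * p j = v k * ((v k)\<dagger> * x * v j) * (v j)\<dagger>"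
    by (simp only: v(3)[OF kj(1), symmetric] v(3)[OF kj(2), symmetric] mult.assoc)
   also have "... = (v k * p (r k)) * ((v k)\<dagger> * x * v j) * (p (r j) * (v j)\<dagger>)" by (simp only: vr[OF kj(1)] rv[OF kj(2)])
   also have "... = v k * (p (r k) * ((v k)\<dagger> * x * v j) * p (r k)) * (v j)\<dagger>" by (simp only: mult.assoc True)
   also have "... = csc c (v k * (v j)\<dagger>)" by (simp add: c vr[OF kj(1)])
   finally show ?thesis using True by auto
  qed
  then obtain c where c: "!!k j. k < n ==> j < n ==> p k * x * p j = (if r k = r j then csc (c k j) (v k * (v j)\<dagger>) else 0)" by metis
  have "x = (SUM k<n. p k) * x * (SUM j<n. p j)" by (simp add: p(3))
  also have "... = (SUM k<n. SUM j<n. p k * x * p j)" by (simp add: sum_distribs) (rule sum.swap)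
  also have "... = (SUM k<n. SUM j<n. if r k = r j then csc (c k j) (v k * (v j)\<dagger>) else 0)" by (intro sum.cong refl) (simp add: c)
  finally show ?thesis by blast
 qed
 have "(v k)\<dagger> * v l = 0" if "k < n" "l < n" "k ~= l" for k l
 proof -
  have *: "p k * v k = v k" if "k < n" for k by (simp only: v(3)[OF that, symmetric] mult.assoc v(2)[OF that] vr[OF that])
  have "(v k)\<dagger> * v l = (p k * v k)\<dagger> * (p l * v l)" using * that by simp
  also have "... = (v k)\<dagger> * (p k * p l) * v l" using projnD(1)[OF pp(1)[OF that(1)]] by (simp add: mult.assoc)
  finally show ?thesis using p(1) that by (simp add: orth_family_def)
 qed
 hence "ALL k<n. ALL l<n. (v k)\<dagger> * v l = (if k = l then p (r k) else 0)" using v(2) by simp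
 moreover have "ALL k<n. r k < n & p k : R & projn (p k) & v k : R" using r pR pp(1) v(1) G(2) by blast
 moreover have "K \<subseteq> {..<n}" by (auto simp: K_def)
 moreover have "f = (SUM k:K. v k * (v k)\<dagger>)" unfolding fsum by (intro sum.cong) (auto simp: v(3) K_def)
 ultimately show ?thesis using span by - (rule exI[of _ n], rule exI[of _ p], rule exI[of _ r], rule exI[of _ v], rule exI[of _ K], blast)
qed

end

section \<open>Matrix units in a corner with a prescribed number of equal pieces\<close>

definition mspan :: "nat => (nat => nat => 'h::complex_hilbert_space bop) => 'h bop set" where
 "mspan N M = {z. EX c. z = (SUM a<N. SUM b<N. csc (c a b) (M a b))}"

lemma mspan_add: assumes "x : mspan N M" "y : mspan N M" shows "x + y : mspan N M"
proof -
 obtain c d where "x = (SUM a<N. SUM b<N. csc (c a b) (M a b))" "y = (SUM a<N. SUM b<N. csc (d a b) (M a b))" using assms unfolding mspan_def by blast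
 hence "x + y = (SUM a<N. SUM b<N. csc (c a b + d a b) (M a b))" by (simp add: sum.distrib csc_add_left)
 thus ?thesis unfolding mspan_def by (intro CollectI exI)
qed

lemma mspan_csc: assumes "x : mspan N M" shows "csc t x : mspan N M"
proof -
 obtain c where "x = (SUM a<N. SUM b<N. csc (c a b) (M a b))" using assms unfolding mspan_def by blast
 hence "csc t x = (SUM a<N. SUM b<N. csc (t * c a b) (M a b))" by (simp add: csc_sum)
 thus ?thesis unfolding mspan_def by (intro CollectI exI)
qed

lemma mspan_0: "0 : mspan N M" unfolding mspan_def by (intro CollectI exI[of _ "%_ _. 0"]) simp

lemma mspan_sum: "(!!i. i : A ==> f i : mspan N M) ==> (SUM i:A. f i) : mspan N M"
 by (induction A rule: infinite_finite_induct) (auto intro: mspan_0 mspan_add)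

lemma mspan_base: assumes "a < N" "b < N" shows "M a b : mspan N M"
proof -
 have "(SUM i<N. SUM j<N. csc (if i = a & j = b then 1 else 0) (M i j)) =
  (SUM i<N. if i = a then SUM j<N. if j = b then M i j else 0 else 0)" by (intro sum.cong refl) (simp add: if_distrib[of "%c. csc c _"] cong: if_cong)
 also have "... = M a b" using assms by simp
 finally show ?thesis unfolding mspan_def by (intro CollectI exI) (rule sym)
qed

abbreviation fspan :: "nat => (nat => 'h::complex_hilbert_space bop) => 'h bop set" where
 "fspan D w \<equiv> mspan D (%a b. w a * (w b)\<dagger>)"

context tracial_factor
begin

text \<open>Partial isometries with a common initial projection whose orthogonal ranges fill
  \<open>e\<close>; the products \<open>w a * (w b)\<dagger>\<close> are then matrix units of size
  \<open>D\<close> in the corner of \<open>e\<close>.\<close>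

definition frame :: "'h bop => nat => (nat => 'h bop) => bool" where
 "frame e D w <-> (ALL a<D. w a : R) & (EX g. projn g & (ALL a<D. (w a)\<dagger> * w a = g)) &
   (ALL a<D. ALL b<D. a ~= b --> (w a)\<dagger> * w b = 0) & (SUM a<D. w a * (w a)\<dagger>) = e"

text \<open>The polar part \<open>v\<close> of \<open>e * h\<close> moves a part of \<open>h\<close>
  below \<open>e\<close>, and \<open>subequivalent\<close> moves the rest by \<open>x\<close>. Each
  of \<open>x\<close>, \<open>v - e * h\<close> and \<open>e * h - e\<close> has 2-norm at most
  \<open>tn (h - e)\<close>, whence the factor 3.\<close>

lemma close_partial_isometry: assumes e: "e : R" "projn e" and h: "h : R" "projn h" and le: "Re (tr h) <= Re (tr e)"
 shows "EX u:R. u\<dagger> * u = h & e * u = u & tn (u - e) <= 3 * tn (h - e)"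
proof -
 define y where "y = e * h"
 have ea: "e\<dagger> = e" "e * e = e" and ha: "h\<dagger> = h" "h * h = h" using e h by (simp_all add: projnD)
 have yR: "y : R" using e h by (simp add: y_def)
 have yy: "y\<dagger> * y = h * e * h" by (simp add: y_def ea ha mult.assoc) (simp add: mult.assoc[symmetric] ea)
 have "opbound y 1" using opbound_mult[OF projn_opbound[OF e(2)] projn_opbound[OF h(2)]] by (simp add: y_def)
 hence "psd (1 - y\<dagger> * y)" by (simp add: opbound_psd)
 then obtain v where pv: "polar_part y v" using polar by blast
 note v = polar_partD[OF pv]
 have vR: "v : R" by (rule v(5)[OF R_salg yR])
 define s where "s = v\<dagger> * v"
 have s: "projn s" "s : R" using v(1) vR by (auto simp: s_def projn_def)
 have "(1 - e) * y = 0" by (simp add: y_def left_diff_distrib mult.assoc[symmetric] ea)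
 hence "(1 - e) * v = 0" by (rule v(6))
 hence ev: "e * v = v" by (simp add: left_diff_distrib)
 have "y * (1 - h) = 0" by (simp add: y_def right_diff_distrib mult.assoc ha)
 hence "v * (1 - h) = 0" by (rule v(7))
 hence vh: "v * h = v" by (simp add: right_diff_distrib)
 hence "h * v\<dagger> = v\<dagger>" using ha by (metis adj_ring(6))
 hence hs: "h * s = s" by (simp add: s_def mult.assoc[symmetric])
 have sh: "s * h = s" by (rule projn_le_adj[OF s(1) h(2) hs])
 \<comment> \<open>The squared 2-norm of the part of \<open>h\<close> outside \<open>e\<close>; it
   bounds both the squared distance from \<open>v\<close> to \<open>y\<close> and the trace of the
   remainder \<open>h - s\<close>.\<close>
 define q where "q = Re (tr h) - Re (tr (h * e * h))"
 have q: "q = (tn ((1 - e) * h))\<^sup>2"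
 proof -
  have "((1 - e) * h)\<dagger> * ((1 - e) * h) = h * ((1 - e) * (1 - e)) * h" by (simp add: ea ha mult.assoc)
  also have "(1 - e) * (1 - e) = 1 - e" by (simp add: diff_distribs ea)
  also have "h * (1 - e) * h = h - h * e * h" by (simp add: diff_distribs ha)
  finally show ?thesis using e h by (simp add: q_def tn_power2 tr_diff)
 qed
 have "(1 - e) * h = (1 - e) * (h - e)" by (simp add: diff_distribs ea)
 hence "tn ((1 - e) * h) <= tn (h - e)" using tn_projn_left[of "1 - e" "h - e"] projn_compl[OF e(2)] e h by simp
 hence q_le: "q <= (tn (h - e))\<^sup>2" unfolding q using e h by (intro power_mono) auto
 have P: "psd (s - h * e * h - (v - y)\<dagger> * (v - y))" using v(4) by (simp only: s_def yy)
 have "psd (s - h * e * h)" using psd_add[OF P psd_square[of "v - y"]] by simp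
 hence she: "Re (tr (h * e * h)) <= Re (tr s)" using e h s by (intro tr_psd_mono) auto
 have "Re (tr ((v - y)\<dagger> * (v - y))) <= Re (tr (s - h * e * h))" by (rule tr_psd_mono[OF _ _ P]) (use e h s vR yR in auto)
 moreover have "Re (tr s) <= Re (tr h)" by (rule tr_projn_mono[OF h(1) s(2) h(2) s(1) hs])
 ultimately have "(tn (v - y))\<^sup>2 <= q" using e h s vR yR by (simp add: tn_power2 q_def tr_diff del: adj_ring(4))
 hence vy: "tn (v - y) <= tn (h - e)" using q_le power2_le_imp_le[of "tn (v - y)" "tn (h - e)"] e h by simp
 define f where "f = v * v\<dagger>"
 have f: "projn f" "f : R" "e * f = f" using partial_isometry(2)[of v] s vR ev by (simp_all add: f_def s_def mult.assoc[symmetric])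
 have trf: "tr f = tr s" using tr_comm[of v "v\<dagger>"] vR by (simp add: f_def s_def)
 have hs': "projn (h - s)" "h - s : R" and ef': "projn (e - f)" "e - f : R" using h s hs e f by (auto intro: projn_diff)
 have "Re (tr (h - s)) <= Re (tr (e - f))" using le trf h s e f by (simp add: tr_diff)
 then obtain x where x: "x : R" "x\<dagger> * x = h - s" "(e - f) * x = x" using subequivalent[OF hs'(2,1) ef'(2,1)] by blast
 have ve: "v\<dagger> * e = v\<dagger>" using ev ea by (metis adj_ring(6))
 have vf: "v\<dagger> * f = v\<dagger>" using partial_isometry(3)[of v] s by (simp add: f_def s_def)
 have "v\<dagger> * x = v\<dagger> * ((e - f) * x)" by (simp only: x(3))
 also have "... = 0" by (simp only: mult.assoc[symmetric] right_diff_distrib ve vf) simp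
 finally have vx: "v\<dagger> * x = 0" .
 hence xv: "x\<dagger> * v = 0" by (metis adj_adj adj_ring(1,6))
 have "e * ((e - f) * x) = (e - f) * x" by (simp only: mult.assoc[symmetric] right_diff_distrib ea f(3))
 hence ex: "e * x = x" by (simp only: x(3))
 have uu: "(v + x)\<dagger> * (v + x) = h" by (simp add: distrib_left distrib_right vx xv x(2) s_def[symmetric])
 have "(tn x)\<^sup>2 = Re (tr h) - Re (tr s)" using x h s by (simp add: tn_power2 tr_diff)
 also have "... <= q" using she by (simp add: q_def)
 finally have "(tn x)\<^sup>2 <= (tn (h - e))\<^sup>2" using q_le by simp
 hence xs: "tn x <= tn (h - e)" using power2_le_imp_le[of "tn x" "tn (h - e)"] e h by simp
 have "y - e = e * (h - e)" by (simp add: y_def right_diff_distrib ea)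
 hence ye: "tn (y - e) <= tn (h - e)" using tn_projn_left[OF e, of "h - e"] e h by simp
 have "v + x - e = x + ((v - y) + (y - e))" by simp
 hence "tn (v + x - e) = tn (x + ((v - y) + (y - e)))" by (rule arg_cong)
 also have "... <= tn x + tn ((v - y) + (y - e))" by (rule tn_triangle) (use x vR yR e in auto)
 also have "... <= tn x + (tn (v - y) + tn (y - e))" by (rule add_left_mono, rule tn_triangle) (use vR yR e in auto)
 also have "... <= 3 * tn (h - e)" using xs vy ye by simp
 finally show ?thesis using uu ev ex vR x by (intro bexI[of _ "v + x"]) (auto simp: distrib_left)
qed

text \<open>Each \<open>v k (v k)\<^sup>\<dagger>\<close> with \<open>k \<in> K\<close> is cut into pieces of trace \<open>tr e / D\<close>, compatibly with the
  matrix units \<open>v k (v j)\<^sup>\<dagger>\<close>; at most \<open>D\<close> of the pieces are kept and moved under \<open>e\<close>.\<close>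

lemma frame_from_pieces:
 fixes n :: nat and D :: nat assumes rv: "!!k. k < n ==> r k < n & p k : R & projn (p k) & v k : R"
  and vv: "!!k l. k < n ==> l < n ==> (v k)\<dagger> * v l = (if k = l then p (r k) else 0)"
  and K: "K \<subseteq> {..<n}" and e: "e : R" "projn e" "e ~= 0" and D: "D > 0"
 defines "\<epsilon> \<equiv> tn ((SUM k:K. v k * (v k)\<dagger>) - e)"
 shows "EX w u. frame e D w & u : R & opbound u 1 & tn (u - e) <= 3 * (\<epsilon> + sqrt (real n / real D + \<epsilon>)) &
  (ALL k<n. ALL l<n. r k = r l --> u * (v k * (v l)\<dagger>) * u\<dagger> : fspan D w)"
proof -
 define e' where "e' = (SUM k:K. v k * (v k)\<dagger>)"
 define d where "d = Re (tr e) / real D"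
 have d: "d > 0" "d <= 1 / real D" using D tr_projn_pos[OF e] tr_projn_le_1[OF e(1,2)] by (auto simp: d_def divide_right_mono)
 have Dd: "real D * d = Re (tr e)" using D by (simp add: d_def)
 have finK: "finite K" using K finite_subset by blast
 have Kn: "k < n" if "k : K" for k using K that by auto
 have e'R: "e' : R" and e'p: "projn e'" and e'v: "!!k. k : K ==> e' * v k = v k" and tre': "Re (tr e') = (SUM k:K. Re (tr (p (r k))))"
  using isometry_sum[OF finK, of v "%k. p (r k)"] rv vv Kn by (auto simp: e'_def)
 \<comment> \<open>The number of pieces of trace \<open>d\<close> that fit below \<open>p j\<close>;
   the trace lost by rounding is at most \<open>d\<close>.\<close>
 define N where "N j = nat \<lfloor>Re (tr (p j)) / d\<rfloor>" for j
 have N1: "real (N j) * d <= Re (tr (p j))" and N2: "Re (tr (p j)) <= real (N j) * d + d" if "j < n" for j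
 proof -
  have "Re (tr (p j)) / d >= 0" using tr_projn_ge_0 rv[OF that] d by simp
  hence "real (N j) <= Re (tr (p j)) / d" "Re (tr (p j)) / d <= real (N j) + 1" by (simp_all add: N_def of_nat_nat)
  thus "real (N j) * d <= Re (tr (p j))" "Re (tr (p j)) <= real (N j) * d + d" using d by (simp_all add: field_simps)
 qed
 have "1 / real D <= 1" using D by simp
 hence "d <= 1" using d by linarith
 then obtain q where q: "q : R" "projn q" "Re (tr q) = d" using projn_of_trace[of 1 d] d by (auto simp: tr_one)
 define X where "X j x <-> (ALL i<N j. x i : R & p j * x i = x i) &
  (ALL i<N j. ALL i'<N j. (x i)\<dagger> * x i' = (if i = i' then q else 0))" for j x
 have "EX x. X j x" if "j < n" for j unfolding X_def by (rule isometry_family[OF _ _ q(1,2)]) (use rv N1 q(3) that in auto)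
 then obtain x where X: "!!j. j < n ==> X j (x j)" by metis
 have x: "x j i : R" "p j * x j i = x j i" if "j < n" "i < N j" for j i using X[OF that(1)] that(2) by (auto simp: X_def)
 have xx: "(x j i)\<dagger> * x j i' = (if i = i' then q else 0)" if "j < n" "i < N j" "i' < N j" for j i i'
  using X[OF that(1)] that(2,3) by (auto simp: X_def)
 define A where "A = Sigma K (%k. {..<N (r k)})"
 have finA: "finite A" unfolding A_def using finK by auto
 \<comment> \<open>Only \<open>D\<close> pieces of this trace have room below \<open>e\<close>. If
   there are fewer, the partial isometries \<open>Y\<close> below fill the frame up to
   \<open>D\<close>.\<close>
 define M where "M = min (card A) D"
 have "M <= card A" by (simp add: M_def)
 then obtain B where B: "B \<subseteq> A" "card B = M" and finB: "finite B" by (rule obtain_subset_with_card_n)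
 have BA: "a : A" if "a : B" for a using that B by auto
 define W where "W a = v (fst a) * x (r (fst a)) (snd a)" for a :: "nat \<times> nat"
 have AD: "fst a < n" "r (fst a) < n" "snd a < N (r (fst a))" "fst a : K" if "a : A" for a using that K rv by (auto simp: A_def)
 have WR: "W a : R" if "a : A" for a using AD[OF that] rv x by (simp add: W_def)
 have Wv: "(W a)\<dagger> * v k = (if fst a = k then (x (r (fst a)) (snd a))\<dagger> else 0)" if "a : A" "k < n" for a k
 proof -
  have xp: "(x (r (fst a)) (snd a))\<dagger> * p (r (fst a)) = (x (r (fst a)) (snd a))\<dagger>"
   using arg_cong[OF x(2)[OF AD(2,3)[OF that(1)]], of adj] rv[OF AD(2)[OF that(1)]] by (simp add: projnD)
  have "(W a)\<dagger> * v k = (x (r (fst a)) (snd a))\<dagger> * ((v (fst a))\<dagger> * v k)" by (simp add: W_def mult.assoc)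
  thus ?thesis using vv[OF AD(1)[OF that(1)] that(2)] xp by (cases "fst a = k") auto
 qed
 have WW: "(W a)\<dagger> * W b = (if a = b then q else 0)" if ab: "a : A" "b : A" for a b
 proof -
  have "(W a)\<dagger> * W b = ((W a)\<dagger> * v (fst b)) * x (r (fst b)) (snd b)" by (simp add: W_def mult.assoc)
  also have "... = (if fst a = fst b then (x (r (fst b)) (snd a))\<dagger> * x (r (fst b)) (snd b) else 0)" using Wv[OF ab(1) AD(1)[OF ab(2)]] by simp
  also have "... = (if a = b then q else 0)" using xx AD[OF ab(1)] AD[OF ab(2)] by (auto simp: prod_eq_iff)
  finally show ?thesis .
 qed
 define h where "h = (SUM a:B. W a * (W a)\<dagger>)"
 have hR: "h : R" and hp: "projn h" and hW: "!!a. a : B ==> h * W a = W a" and trh: "Re (tr h) = real M * d"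
  using isometry_sum[OF finB, of W "%_. q"] WR WW BA q B(2) by (auto simp: h_def)
 have e'W: "e' * W a = W a" if "a : A" for a using e'v[OF AD(4)[OF that]] by (simp add: W_def flip: mult.assoc)
 have e'h: "e' * h = h" unfolding h_def sum_distrib_left by (intro sum.cong refl) (use e'W B in "auto simp flip: mult.assoc")
 have "Re (tr h) <= Re (tr e)" using trh Dd d by (simp add: M_def mult_right_mono flip: Dd)
 then obtain u where u: "u : R" "u\<dagger> * u = h" "e * u = u" "tn (u - e) <= 3 * tn (h - e)" using close_partial_isometry[OF e(1,2) hR hp] by blast
 have eps: "tn (e' - e) = \<epsilon>" by (simp add: e'_def \<epsilon>_def)
 \<comment> \<open>If all pieces are kept, only the rounding losses occur, one for each index.
   Otherwise \<open>h\<close> has the trace of \<open>e\<close>, and the loss is the difference of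
   the traces of \<open>e'\<close> and \<open>e\<close>.\<close>
 have "Re (tr (e' - h)) <= real n * d + \<epsilon>"
 proof (cases "card A <= D")
  case True
  have "Re (tr e') <= (SUM k:K. real (N (r k)) * d + d)" unfolding tre' using Kn N2 rv by (intro sum_mono) blast
  also have "... = (SUM k:K. real (N (r k))) * d + real (card K) * d" by (simp add: sum.distrib sum_distrib_right)
  also have "(SUM k:K. real (N (r k))) = real (card A)" unfolding A_def using finK by (simp add: card_SigmaI)
  also have "real (card K) * d <= real n * d" using card_mono[OF _ K] d by (intro mult_right_mono) auto
  finally have "Re (tr e') <= real (card A) * d + real n * d" by simp
  moreover have "\<epsilon> >= 0" using eps[symmetric] e'R e by simp
  ultimately show ?thesis using e'R hR trh True by (simp add: tr_diff M_def)
 next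
  case False
  hence "Re (tr h) = Re (tr e)" using trh Dd by (simp add: M_def)
  hence "Re (tr (e' - h)) = Re (tr (e' - e))" using e'R hR e by (simp add: tr_diff)
  also have "... <= \<epsilon>" using tr_bound[of "e' - e"] complex_Re_le_cmod[of "tr (e' - e)"] e'R e eps by simp
  moreover have "real n * d >= 0" using d by simp
  ultimately show ?thesis by linarith
 qed
 also have "... <= real n / real D + \<epsilon>" using mult_left_mono[OF d(2), of "real n"] by simp
 finally have "(tn (e' - h))\<^sup>2 <= real n / real D + \<epsilon>" using tn_projn[of "e' - h"] projn_diff[OF e'p hp e'h] e'R hR by simp
 hence "tn (e' - h) <= sqrt (real n / real D + \<epsilon>)" by (rule real_le_rsqrt)
 hence "tn (h - e) <= \<epsilon> + sqrt (real n / real D + \<epsilon>)"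
  using tn_triangle_diff[of h e' e] tn_diff_commute[of h e'] hR e'R e eps by simp
 hence ue: "tn (u - e) <= 3 * (\<epsilon> + sqrt (real n / real D + \<epsilon>))" using u(4) by simp
 define U where "U a = u * W a" for a
 have UU: "(U a)\<dagger> * U b = (if a = b then q else 0)" if ab: "a : B" "b : B" for a b
 proof -
  have "(U a)\<dagger> * U b = (W a)\<dagger> * ((u\<dagger> * u) * W b)" by (simp add: U_def mult.assoc)
  also have "... = (W a)\<dagger> * W b" by (simp only: u(2) hW[OF ab(2)])
  finally show ?thesis using WW[OF BA[OF ab(1)] BA[OF ab(2)]] by simp
 qed
 have UR: "U a : R" if "a : B" for a using u(1) WR[OF BA[OF that]] by (simp add: U_def)
 have "u * h = u" using partial_isometry(1)[of u] u(2) hp by simp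
 define f where "f = e - u * u\<dagger>"
 have uu: "projn (u * u\<dagger>)" "e * (u * u\<dagger>) = u * u\<dagger>"
  using partial_isometry(2)[of u] u hp by (simp_all add: mult.assoc[symmetric])
 have fR: "f : R" "projn f" using u e uu by (auto simp: f_def intro: projn_diff)
 have "tr (u * u\<dagger>) = tr h" using tr_comm[of u "u\<dagger>"] u by simp
 hence trf: "Re (tr f) = real (D - M) * d" using e u trh Dd by (simp add: f_def tr_diff M_def of_nat_diff left_diff_distrib)
 obtain Y where Y: "!!i. i < D - M ==> Y i : R" "!!i. i < D - M ==> f * Y i = Y i"
  and YY: "!!i j. i < D - M ==> j < D - M ==> (Y i)\<dagger> * Y j = (if i = j then q else 0)"
  using isometry_family[OF fR q(1,2), of "D - M"] trf q(3) by auto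
 have uf: "u\<dagger> * f = 0"
 proof -
  have "(e * u)\<dagger> = u\<dagger>" by (simp only: u(3))
  hence "u\<dagger> * e = u\<dagger>" using projnD(1)[OF e(2)] by simp
  thus ?thesis using partial_isometry(3)[of u] u(2) hp by (simp add: f_def right_diff_distrib)
 qed
 have UY: "(U a)\<dagger> * Y i = 0" if "i < D - M" for a i
 proof -
  have "(U a)\<dagger> * Y i = (W a)\<dagger> * (u\<dagger> * f) * Y i" using Y(2)[OF that] by (simp add: U_def mult.assoc)
  thus ?thesis by (simp add: uf)
 qed
 have YU: "(Y i)\<dagger> * U a = 0" if "i < D - M" for a i using arg_cong[OF UY[OF that, of a], of adj] by simp
 obtain b where b: "bij_betw b {..<M} B" using ex_bij_betw_nat_finite[OF finB] B(2) by (auto simp: atLeast0LessThan)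
 have bB: "b i : B" if "i < M" for i using b that by (auto simp: bij_betw_def)
 have binj: "b i = b j <-> i = j" if "i < M" "j < M" for i j using b that by (auto simp: bij_betw_def inj_on_def)
 have MD: "M <= D" by (simp add: M_def)
 define w where "w i = (if i < M then U (b i) else Y (i - M))" for i
 have ww: "(w i)\<dagger> * w j = (if i = j then q else 0)" if "i < D" "j < D" for i j using that UU[OF bB bB] YY UY YU binj by (auto simp: w_def)
 have "e * f = f" using projnD[OF e(2)] uu(2) by (simp add: f_def right_diff_distrib)
 hence "e * Y i = Y i" if "i < D - M" for i using Y(2)[OF that] by (metis mult.assoc)
 hence ew: "e * w i = w i" and wR: "w i : R" if "i < D" for i using u(3) UR[OF bB] Y(1) that by (auto simp: w_def U_def simp flip: mult.assoc)
 note ws = isometry_sum[of "{..<D}" w "%_. q", simplified, OF wR q(2) ww]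
 have "e = (SUM i<D. w i * (w i)\<dagger>)" by (rule tr_projn_eq[OF e(1) ws(1) e(2) ws(2)])
   (use ws(4) q(3) Dd ew in "simp_all add: sum_distrib_left flip: mult.assoc")
 hence "frame e D w" unfolding frame_def using ww q(2) wR by (auto intro!: exI[of _ q])
 moreover have "u * (v k * (v l)\<dagger>) * u\<dagger> : fspan D w" if kl: "k < n" "l < n" "r k = r l" for k l
 proof -
  have uv: "u * v k = (SUM i<M. if fst (b i) = k then U (b i) * (x (r (fst (b i))) (snd (b i)))\<dagger> else 0)" if "k < n" for k
  proof -
   have "u * v k = (u * h) * v k" by (simp only: `u * h = u`)
   also have "... = (SUM a:B. U a * ((W a)\<dagger> * v k))" unfolding h_def sum_distribs by (simp add: U_def mult.assoc)
   also have "... = (SUM i<M. U (b i) * ((W (b i))\<dagger> * v k))" by (rule sum.reindex_bij_betw[OF b, symmetric])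
   also have "... = (SUM i<M. if fst (b i) = k then U (b i) * (x (r (fst (b i))) (snd (b i)))\<dagger> else 0)"
    by (intro sum.cong refl) (use Wv[OF BA[OF bB] that] in simp)
   finally show ?thesis .
  qed
  have Uq: "U (b i) * q = U (b i)" if "i < M" for i using partial_isometry(1)[of "U (b i)"] UU[OF bB[OF that] bB[OF that]] q(2) by simp
  have "u * (v k * (v l)\<dagger>) * u\<dagger> = (u * v k) * (u * v l)\<dagger>" by (simp add: mult.assoc)
  also have "... = (SUM i<M. SUM j<M. (if fst (b i) = k then U (b i) * (x (r (fst (b i))) (snd (b i)))\<dagger> else 0) *
    (if fst (b j) = l then U (b j) * (x (r (fst (b j))) (snd (b j)))\<dagger> else 0)\<dagger>)"
   by (simp only: uv[OF kl(1)] uv[OF kl(2)] adj_sum sum_product)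
  also have "... : fspan D w"
  proof (intro mspan_sum)
   fix i j assume ij: "i : {..<M}" "j : {..<M}"
   hence iM: "i < M" and jM: "j < M" by auto
   have A: "b i : A" "b j : A" using bB iM jM B by auto
   show "(if fst (b i) = k then U (b i) * (x (r (fst (b i))) (snd (b i)))\<dagger> else 0) *
    (if fst (b j) = l then U (b j) * (x (r (fst (b j))) (snd (b j)))\<dagger> else 0)\<dagger> : fspan D w"
   proof (cases "fst (b i) = k & fst (b j) = l")
    case True
    have "(U (b i) * (x (r k) (snd (b i)))\<dagger>) * (U (b j) * (x (r l) (snd (b j)))\<dagger>)\<dagger> =
     U (b i) * ((x (r k) (snd (b i)))\<dagger> * x (r k) (snd (b j))) * (U (b j))\<dagger>" by (simp add: kl(3) mult.assoc)
    also have "(x (r k) (snd (b i)))\<dagger> * x (r k) (snd (b j)) = (if snd (b i) = snd (b j) then q else 0)"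
     by (rule xx) (use AD[OF A(1)] AD[OF A(2)] True kl in auto)
    also have "U (b i) * (if snd (b i) = snd (b j) then q else 0) * (U (b j))\<dagger> =
     (if snd (b i) = snd (b j) then w i * (w j)\<dagger> else 0)" using Uq[OF iM] iM jM by (simp add: w_def)
    finally show ?thesis using True iM jM MD by (auto intro: mspan_0 mspan_base[of _ _ _ "%a b. w a * (w b)\<dagger>"])
   qed (auto intro: mspan_0)
  qed
  finally show ?thesis .
 qed
 moreover have "opbound u 1" using projn_psd[OF projn_compl[OF hp]] by (simp add: opbound_psd u(2))
 ultimately show ?thesis using ue u(1) by blast
qed

end

section \<open>Approximation of corners by finite-dimensional subalgebras\<close>

lemma opbound_common: assumes "finite X" shows "EX C>0. ALL x:X. opbound x C" using assms
proof (induction X)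
 case empty
 thus ?case by (intro exI[of _ 1]) auto
next
 case (insert x X)
 then obtain C where C: "C > 0" "ALL x:X. opbound x C" by blast
 obtain D where D: "D > 0" "opbound x D" by (rule opbound_ex)
 have "opbound y (max C D)" if "y : insert x X" for y using that C D opbound_mono[of _ C "max C D"] opbound_mono[of _ D "max C D"] by auto
 thus ?case using C D by (intro exI[of _ "max C D"]) auto
qed

context tracial_factor
begin

text \<open>\<open>f\<close> is the spectral projection of \<open>z = 2 y - 1\<close>. The
  inequalities \<open>(1 - z)\<^sup>2 >= 1 - f\<close> and \<open>(1 + z)\<^sup>2 >= f\<close>,
  traced against \<open>e\<close> and \<open>1 - e\<close>, add up to the estimate.\<close>

lemma near_projection: assumes S: "salg S" "S \<subseteq> R" and y: "y : S" "y\<dagger> = y" and e: "e : R" "projn e"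
 shows "EX f:S. projn f & (tn (f - e))\<^sup>2 <= 4 * (tn (e - y))\<^sup>2"
proof -
 note S_alg = star_algD[OF salgD(1)[OF S(1)]]
 define z where "z = y + y - 1"
 have z: "z : S" "z\<dagger> = z" using y by (simp_all add: z_def S_alg)
 obtain f where f: "projn f" "z * f = f * z" "psd (z * f)" "psd (- (z * (1 - f)))"
  "!!S. salg S ==> z : S ==> f : S" by (rule spectral_projection[OF z(2)]) blast
 have fS: "f : S" by (rule f(5)[OF S(1) z(1)])
 have R: "f : R" "z : R" "y : R" using fS z y S by auto
 have sq: "psd (w * w * g)" if "w\<dagger> = w" "w * g = g * w" "projn g" for w g :: "'h bop"
 proof -
  have "g * (w * u) = w * (g * u)" for u by (simp only: that(2) mult.assoc[symmetric])
  hence "(w * g)\<dagger> * (w * g) = w * w * g" by (simp add: that(1) projnD[OF that(3)] that(2)[symmetric] mult.assoc)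
  thus ?thesis using psd_square[of "w * g"] by simp
 qed
 define g where "g = 1 - f"
 have g: "projn g" "z * g = g * z" using projn_compl[OF f(1)] f(2) by (simp_all add: g_def diff_distribs)
 define A where "A = (1 - z) * (1 - z) - g"
 define B where "B = (1 + z) * (1 + z) - f"
 have "A = (1 - z) * (1 - z) * f + (z * z * g + - (z * g) + - (z * g))" by (simp add: A_def g_def algebra_simps)
 hence A: "psd A" using f g z by (simp only:) (intro psd_add sq; simp add: g_def algebra_simps)
 have "B = (1 + z) * (1 + z) * g + (z * z * f + z * f + z * f)" by (simp add: B_def g_def algebra_simps)
 hence B: "psd B" using f g z by (simp only:) (intro psd_add sq; simp add: algebra_simps)
 have tre: "0 <= Re (tr (h * x))" if "projn h" "h : R" "x : R" "psd x" for h x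
 proof -
  have "tr (h * (x * h)) = tr (h * x)" using tr_comm[of h "x * h"] tr_comm[of x h] that by (simp add: projnD mult.assoc)
  thus ?thesis using tr_psd(1)[of "h * x * h"] psd_sandwich'[of x h] that by (simp add: projnD mult.assoc)
 qed
 have "0 <= Re (tr (e * A)) + Re (tr ((1 - e) * B))" using tre[of e A] tre[of "1 - e" B] A B R e by (simp add: A_def B_def g_def projn_compl)
 also have "... = (tn ((e + e) - (1 + z)))\<^sup>2 - (tn (f - e))\<^sup>2" using R e z(2) f(1) tr_comm[of z e] tr_comm[of f e]
  by (simp add: A_def B_def g_def tn_power2 projnD tr_add tr_diff tr_minus diff_distribs
    distrib_left distrib_right)
 also have "(e + e) - (1 + z) = 2 *\<^sub>R (e - y)" by (simp add: z_def scaleR_2)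
 finally show ?thesis using fS f(1) e R by (intro bexI[of _ f]) (simp_all add: tn_scaleR power_mult_distrib)
qed

text \<open>Otherwise the projection onto the negative part of \<open>C\<^sup>2 - y\<^sup>\<dagger> y\<close> is a counterexample.\<close>

lemma opbound_by_tn: assumes S: "salg S" "S \<subseteq> R" and y: "y : S" and C: "C >= 0" "!!w. w : S ==> tn (y * w) <= C * tn w" shows "opbound y C"
proof -
 note S_alg = star_algD[OF salgD(1)[OF S(1)]]
 define z where "z = C\<^sup>2 *\<^sub>R 1 - y\<dagger> * y"
 have z: "z : S" "z\<dagger> = z" using y by (simp_all add: z_def S_alg)
 obtain p where p: "projn p" "z * p = p * z" "psd (z * p)" "psd (- (z * (1 - p)))"
  "z * p = 0 ==> p = 0" "!!S. salg S ==> z : S ==> p : S"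
  "!!q. z * q = z ==> q * z = z ==> p * q = p & q * p = p" by (rule spectral_projection[OF z(2)]) simp
 define w where "w = 1 - p"
 have pS: "p : S" by (rule p(6)[OF S(1) z(1)])
 have w: "w : S" "projn w" "w\<dagger> = w" "w * w = w" using pS S_alg projn_compl[OF p(1)] projnD[of "1 - p"] by (auto simp only: w_def)
 have zw: "z * w = w * z" by (simp add: w_def diff_distribs p(2))
 have R: "y : R" "w : R" "z : R" using y w z S by auto
 have wzw: "w * z * w = z * w" by (simp only: zw[symmetric] mult.assoc w(4))
 have "w * z * w = C\<^sup>2 *\<^sub>R w - (y * w)\<dagger> * (y * w)" by (simp add: z_def w diff_distribs mult.assoc bop_scaleR_mult)
 hence "Re (tr (z * w)) = C\<^sup>2 * Re (tr w) - (tn (y * w))\<^sup>2" using R by (simp add: wzw tr_diff tr_scaleR tn_power2 del: adj_ring(4))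
 moreover have "(tn (y * w))\<^sup>2 <= (C * tn w)\<^sup>2" using C(2)[OF w(1)] R by (intro power_mono) auto
 hence "(tn (y * w))\<^sup>2 <= C\<^sup>2 * Re (tr w)" using tn_projn[OF R(2) w(2)] by (simp add: power_mult_distrib)
 moreover have n: "psd (- (z * w))" using p(4) by (simp add: w_def)
 hence "Re (tr (- (z * w))) >= 0" using tr_psd R by simp
 ultimately have "Re (tr (- (z * w))) = 0" using R by (simp add: tr_minus)
 hence "- (z * w) = 0" using psd_tr_eq_0[OF _ n] R by simp
 hence "z = z * p" by (simp add: w_def right_diff_distrib)
 hence "psd z" using p(3) by simp
 thus ?thesis using C(1) by (simp add: opbound_psd z_def)
qed

end

text \<open>The last assumption is generation in bicommutant form: what commutes with all
  \<open>F m\<close> commutes with \<open>R\<close>.\<close>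

locale hyperfinite_factor = tracial_factor R tr
 for R :: "'h::complex_hilbert_space bop set" and tr :: "'h bop => complex" +
 fixes F :: "nat => 'h bop set" assumes F_alg: "star_alg (F m)" and F_R: "F m \<subseteq> R" and F_mono: "F m \<subseteq> F (Suc m)"
  and F_fin: "EX B. finite B & B \<subseteq> F m & F m \<subseteq> cspan B"
  and F_gen: "x : R ==> (!!y m. y : F m ==> c * y = y * c) ==> c * x = x * c"
begin

lemma F_mono_le: "m <= k ==> F m \<subseteq> F k" by (rule lift_Suc_mono_le[of F]) (rule F_mono)

lemma F_dense: assumes "x : R" "\<epsilon> > 0" shows "EX m. EX y:F m. tn (x - y) < \<epsilon>"
proof -
 have join: "x : F (max i j) & y : F (max i j)" if "x : F i" "y : F j" for x y i j
  using that F_mono_le[of i "max i j"] F_mono_le[of j "max i j"] by auto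
 have "star_alg (\<Union>m. F m)" unfolding star_alg_def
 proof (intro conjI ballI allI)
  fix x y assume "x : (\<Union>m. F m)" "y : (\<Union>m. F m)"
  then obtain i j where "x : F i" "y : F j" by blast
  hence "x : F (max i j)" "y : F (max i j)" using join by auto
  thus "x + y : (\<Union>m. F m)" "x * y : (\<Union>m. F m)" using star_algD(3,4)[OF F_alg[of "max i j"], of x y] by blast+
 next
  fix x c assume "x : (\<Union>m. F m)"
  then obtain i where "x : F i" by blast
  hence "x\<dagger> : F i" "csc c x : F i" using star_algD(5,6)[OF F_alg[of i]] by auto
  thus "x\<dagger> : (\<Union>m. F m)" "csc c x : (\<Union>m. F m)" by auto
 next
  show "1 : (\<Union>m. F m)" using star_algD(1)[OF F_alg] by blast
 qed
 moreover have "(\<Union>m. F m) \<subseteq> R" using F_R by auto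
 ultimately have "EX y:(\<Union>m. F m). tn (x - y) < \<epsilon>"
 proof (rule star_alg_dense[OF _ _ assms(1) _ assms(2)])
  fix c assume "!!y. y : (\<Union>m. F m) ==> c * y = y * c"
  thus "c * x = x * c" by (intro F_gen[OF assms(1)]) blast
 qed
 thus ?thesis by blast
qed

lemma F_dense_family: assumes "finite X" "X \<subseteq> R" "\<epsilon> > 0" shows "EX m. ALL x:X. EX y:F m. tn (x - y) < \<epsilon>" using assms(1,2)
proof (induction X)
 case (insert x X)
 then obtain m where m: "ALL x:X. EX y:F m. tn (x - y) < \<epsilon>" by auto
 obtain k where k: "EX y:F k. tn (x - y) < \<epsilon>" using F_dense[of x \<epsilon>] insert.prems assms(3) by auto
 have "F m \<subseteq> F (max m k)" "F k \<subseteq> F (max m k)" by (simp_all add: F_mono_le)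
 hence "ALL x:insert x X. EX y:F (max m k). tn (x - y) < \<epsilon>" using m k by blast
 thus ?case by (rule exI)
qed auto

text \<open>One \<open>F m\<close> approximates \<open>e\<close> and \<open>X\<close>; a projection
  \<open>f\<close> near \<open>e\<close> is found in it, its blocks are recut into pieces of trace
  \<open>tr e / D\<close> and moved below \<open>e\<close> by some \<open>u\<close> close to
  \<open>e\<close>. Recutting costs at most \<open>n / D\<close>, so every large \<open>D\<close>
  works; this is what later allows prescribed sizes.\<close>

lemma corner_matrix_approximation:
 assumes e: "e : R" "projn e" "e ~= 0" and X: "finite X" "!!x. x : X ==> x : R & e * x = x & x * e = x" and eps: "\<epsilon> > 0"
 shows "EX D0. ALL D>=D0. EX w. frame e D w & (ALL x:X. EX z:fspan D w. tn (x - z) < \<epsilon>)"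
proof -
 obtain C where C: "C > 0" "ALL x:X. opbound x C" using opbound_common[OF X(1)] by blast
 \<comment> \<open>One error enters through a square root, so \<open>e\<close> and \<open>X\<close>
   are approximated to order \<open>\<eta>\<^sup>2\<close>. The total is
   \<open>(1 + 24 * C) * \<eta>\<close>: one term \<open>\<eta>\<close> and two terms
   \<open>C * (12 * \<eta>)\<close>.\<close>
 define \<eta> where "\<eta> = min 1 (\<epsilon> / (2 * (1 + 24 * C)))"
 have "\<eta> <= \<epsilon> / (2 * (1 + 24 * C))" by (simp add: \<eta>_def)
 hence "(1 + 24 * C) * \<eta> <= \<epsilon> / 2" using C by (simp add: field_simps)
 hence \<eta>: "\<eta> > 0" "\<eta> <= 1" "(1 + 24 * C) * \<eta> < \<epsilon>" using C eps by (auto simp: \<eta>_def)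
 have \<eta>2: "\<eta>\<^sup>2 > 0" "\<eta>\<^sup>2 <= \<eta>" using \<eta> by (auto simp: power2_eq_square mult_left_le)
 obtain m where m: "ALL x:insert e X. EX y:F m. tn (x - y) < \<eta>\<^sup>2"
  using F_dense_family[of "insert e X" "\<eta>\<^sup>2"] X e \<eta>2 by auto
 then obtain y' where y': "y' : F m" "tn (e - y') < \<eta>\<^sup>2" by auto
 define y where "y = (1/2) *\<^sub>R (y' + y'\<dagger>)"
 have y'R: "y' : R" using y' F_R by auto
 have y: "y : F m" "y\<dagger> = y" using y' star_algD[OF F_alg] by (auto simp: y_def add.commute)
 have "e - y = (1/2) *\<^sub>R ((e - y') + (e - y')\<dagger>)"
  using projnD(1)[OF e(2)] by (simp add: y_def algebra_simps scaleR_half_double flip: scaleR_add_left)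
 hence "tn (e - y) = (1/2) * tn ((e - y') + (e - y')\<dagger>)" using e y'R by (simp only:) (simp add: tn_scaleR del: adj_ring)
 also have "... <= (1/2) * (tn (e - y') + tn ((e - y')\<dagger>))" using e y'R tn_triangle[of "e - y'" "(e - y')\<dagger>"] by simp
 also have "... = tn (e - y')" using e y'R tn_adj[of "e - y'"] by simp
 finally have ey: "tn (e - y) < \<eta>\<^sup>2" using y' by simp
 obtain B where B: "finite B" "B \<subseteq> F m" "F m \<subseteq> cspan B" using F_fin by blast
 obtain f where f: "f : F m" "projn f" "(tn (f - e))\<^sup>2 <= 4 * (tn (e - y))\<^sup>2"
  using near_projection[OF finite_dim_salg[OF F_alg F_R B] F_R y e(1,2)] by blast
 obtain n :: nat and p r v K where v: "ALL k<n. r k < n & p k : R & projn (p k) & v k : R"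
   "ALL k<n. ALL l<n. (v k)\<dagger> * v l = (if k = l then p (r k) else 0)" and K: "K \<subseteq> {..<n}" "f = (SUM k:K. v k * (v k)\<dagger>)"
  and sp: "ALL x:F m. EX c. x = (SUM k<n. SUM j<n. if r k = r j then csc (c k j) (v k * (v j)\<dagger>) else 0)"
  using finite_dim_structure[OF F_alg F_R B f(1,2)] by blast
 define \<delta> where "\<delta> = tn (f - e)"
 have yR: "y : R" using y F_R by auto
 have "(tn (e - y))\<^sup>2 <= (\<eta>\<^sup>2)\<^sup>2" using ey e yR by (intro power_mono) auto
 hence "\<delta>\<^sup>2 <= (2 * \<eta>\<^sup>2)\<^sup>2" using f(3) unfolding \<delta>_def by (simp add: power_mult_distrib)
 hence \<delta>: "\<delta> <= 2 * \<eta>\<^sup>2" by (rule power2_le_imp_le) (use \<eta>2 in simp)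
 \<comment> \<open>Makes \<open>real n / real D\<close> at most \<open>\<eta>\<^sup>2\<close>; the
   summand 1 keeps \<open>D\<close> positive.\<close>
 define D0 where "D0 = nat \<lceil>real n / \<eta>\<^sup>2\<rceil> + 1"
 show ?thesis
 proof (intro exI[of _ D0] allI impI)
  fix D assume D: "D0 <= D"
  hence D0: "D > 0" by (simp add: D0_def)
  have "real n / \<eta>\<^sup>2 <= real D" using D real_nat_ceiling_ge[of "real n / \<eta>\<^sup>2"] unfolding D0_def by linarith
  hence nD: "real n / real D <= \<eta>\<^sup>2" using \<eta>2 D0 by (simp add: field_simps)
  obtain w u where w: "frame e D w" and u: "u : R" "opbound u 1" "tn (u - e) <= 3 * (\<delta> + sqrt (real n / real D + \<delta>))"
   "ALL k<n. ALL l<n. r k = r l --> u * (v k * (v l)\<dagger>) * u\<dagger> : fspan D w"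
   using frame_from_pieces[OF _ _ K(1) e D0, of r p v] v unfolding \<delta>_def K(2) by blast
  have "real n / real D + \<delta> <= 4 * \<eta>\<^sup>2" using nD \<delta> \<eta>2(1) by linarith
  hence "real n / real D + \<delta> <= (2 * \<eta>)\<^sup>2" by (simp add: power_mult_distrib)
  hence "sqrt (real n / real D + \<delta>) <= 2 * \<eta>" using \<eta>(1) by (intro real_le_lsqrt) auto
  hence "3 * (\<delta> + sqrt (real n / real D + \<delta>)) <= 3 * (2 * \<eta> + 2 * \<eta>)" using \<delta> \<eta>2(2) by (intro mult_left_mono add_mono) auto
  hence ue: "tn (u - e) <= 12 * \<eta>" using u(3) by simp
  have "EX z:fspan D w. tn (x - z) < \<epsilon>" if x: "x : X" for x
  proof -
   obtain g where g: "g : F m" "tn (x - g) < \<eta>\<^sup>2" using m x by auto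
   obtain c where c: "g = (SUM k<n. SUM j<n. if r k = r j then csc (c k j) (v k * (v j)\<dagger>) else 0)" using sp g by blast
   have R: "x : R" "g : R" using X(2)[OF x] g F_R by auto
   have "u * g * u\<dagger> = (SUM k<n. SUM j<n. if r k = r j then csc (c k j) (u * (v k * (v j)\<dagger>) * u\<dagger>) else 0)"
    unfolding c sum_distribs by (intro sum.cong refl) (simp add: csc_mult_right)
   also have "... : fspan D w" by (intro mspan_sum) (use u(4) in "auto intro: mspan_0 mspan_csc")
   finally have z: "u * g * u\<dagger> : fspan D w" .
   have ua: "opbound (u\<dagger>) 1" by (rule opbound_adj[OF u(2)])
   have eq: "x - u * g * u\<dagger> = u * (x - g) * u\<dagger> + ((e - u) * x * u\<dagger> + x * (e - u\<dagger>))"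
    using X(2)[OF x] by (simp add: diff_distribs mult.assoc)
   have 1: "tn (u * (x - g) * u\<dagger>) <= tn (x - g)"
    using tn_mult_right[OF _ ua, of "u * (x - g)"] tn_mult_left[OF u(1,2), of "x - g"] u(1) R by simp
   have xb: "opbound x C" using C x by blast
   have "tn ((e - u) * x * u\<dagger>) <= tn ((e - u) * x)" using tn_mult_right[OF _ ua, of "(e - u) * x"] u(1) R e by simp
   also have "... <= C * tn (e - u)" using tn_mult_right[OF R(1) xb, of "e - u"] u(1) e by simp
   finally have 2: "tn ((e - u) * x * u\<dagger>) <= C * tn (u - e)" using tn_diff_commute[OF e(1) u(1)] by simp
   have "(e - u)\<dagger> = e - u\<dagger>" using projnD(1)[OF e(2)] by simp
   hence "tn (e - u\<dagger>) = tn (u - e)" using tn_adj[of "e - u"] tn_diff_commute[OF e(1) u(1)] e u by simp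
   hence 3: "tn (x * (e - u\<dagger>)) <= C * tn (u - e)" using tn_mult_left[OF R(1) xb, of "e - u\<dagger>"] u(1) e by simp
   have "tn (x - u * g * u\<dagger>) <= tn (u * (x - g) * u\<dagger>) + tn ((e - u) * x * u\<dagger> + x * (e - u\<dagger>))"
    unfolding eq by (rule tn_triangle) (use R u e in auto)
   also have "tn ((e - u) * x * u\<dagger> + x * (e - u\<dagger>)) <= tn ((e - u) * x * u\<dagger>) + tn (x * (e - u\<dagger>))"
    by (rule tn_triangle) (use R u e in auto)
   finally have "tn (x - u * g * u\<dagger>) <= \<eta>\<^sup>2 + 2 * (C * tn (u - e))" using 1 2 3 g(2) by linarith
   also have "... <= \<eta> + 2 * (C * (12 * \<eta>))" using \<eta>2 ue C(1) by (intro add_mono mult_left_mono) auto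
   also have "... = (1 + 24 * C) * \<eta>" by (simp add: algebra_simps)
   also have "... < \<epsilon>" by (rule \<eta>(3))
   finally show ?thesis using z by blast
  qed
  thus "EX w. frame e D w & (ALL x:X. EX z:fspan D w. tn (x - z) < \<epsilon>)" using w by blast
 qed
qed

end

section \<open>Pairs of indices, and matrix units with their coarsenings\<close>

lemma index_eq: "a < N ==> b < N ==> a + N * c = b + N * d <-> a = b & c = (d::nat)"
 by (metis add_left_cancel mod_less mod_mult_self2 mult_cancel1 not_less_zero)

lemma index_less: "a < N ==> c < K ==> a + N * c < N * (K::nat)"
proof -
 assume *: "a < N" "c < K"
 have "N * Suc c <= N * K" using * by (intro mult_le_mono2) auto
 thus ?thesis using * by simp
qed

lemma index_div: "x < N * K ==> x div N < (K::nat)" "x < N * K ==> x mod N < N" by (simp add: less_mult_imp_div_less mult.commute) (cases N; simp)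

lemma index_divmod: assumes "a < N" shows "(a + N * c) div N = (c::nat)" "(a + N * c) mod N = a" using assms gr_implies_not0[OF assms] by simp_all

lemma sum_index: "(SUM x<N * K. f x) = (SUM c<K. SUM a<N. f (a + N * (c::nat)))"
proof -
 have "(SUM x<N * K. f x) = (SUM c<K. sum f {c * N..<c * N + N})" by (simp add: sum.nat_group mult.commute)
 moreover have "sum f {c * N..<c * N + N} = (SUM a<N. f (a + N * c))" for c
  using sum.shift_bounds_nat_ivl[of f 0 "c * N" N] by (simp add: atLeast0LessThan mult.commute add.commute)
 ultimately show ?thesis by simp
qed

definition munits :: "nat => (nat => nat => 'h::complex_hilbert_space bop) => bool" where
 "munits N M <-> (ALL a<N. ALL b<N. (M a b)\<dagger> = M b a) &
   (ALL a<N. ALL b<N. ALL c<N. ALL d<N. M a b * M c d = (if b = c then M a d else 0)) & (SUM a<N. M a a) = 1"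

lemma munitsD: assumes "munits N M" shows "a < N ==> b < N ==> (M a b)\<dagger> = M b a"
  "a < N ==> b < N ==> c < N ==> d < N ==> M a b * M c d = (if b = c then M a d else 0)"
  "(SUM a<N. M a a) = 1" using assms by (auto simp: munits_def)

lemma mspan_cong: "(!!a b. a < N ==> b < N ==> M a b = M' a b) ==> mspan N M = mspan N M'" by (simp add: mspan_def)

lemma mspan_least: assumes "!!a b. a < N ==> b < N ==> M a b : S" and S: "0 : S" "!!x y. x : S ==> y : S ==> x + y : S"
  "!!c x. x : S ==> csc c x : S" shows "mspan N M \<subseteq> S"
proof
 fix x assume "x : mspan N M"
 then obtain c where x: "x = (SUM a<N. SUM b<N. csc (c a b) (M a b))" by (auto simp: mspan_def)
 have sm: "(SUM i:A. f i) : S" if "!!i. i : A ==> f i : S" for A :: "nat set" and f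
  using that by (induction A rule: infinite_finite_induct) (auto intro: S)
 show "x : S" unfolding x by (intro sm S assms(1)) auto
qed

lemma mspan_mono: assumes "!!a b. a < N ==> b < N ==> M a b : mspan N' M'" shows "mspan N M \<subseteq> mspan N' M'"
 by (rule mspan_least) (auto intro: assms mspan_0 mspan_add mspan_csc)

lemma mspan_star_alg: assumes M: "munits N M" shows "star_alg (mspan N M)" unfolding star_alg_def
proof (intro conjI ballI allI)
 show "1 : mspan N M" unfolding munitsD(3)[OF M, symmetric] by (intro mspan_sum mspan_base) auto
next
 fix x y assume xy: "x : mspan N M" "y : mspan N M"
 show "x + y : mspan N M" using xy by (rule mspan_add)
 obtain c d where x: "x = (SUM a<N. SUM b<N. csc (c a b) (M a b))" and y: "y = (SUM a<N. SUM b<N. csc (d a b) (M a b))"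
  using xy by (auto simp: mspan_def)
 have "csc (c a b) (M a b) * csc (d a' b') (M a' b') : mspan N M" if "a < N" "b < N" "a' < N" "b' < N" for a b a' b'
  using that munitsD(2)[OF M] by (auto intro!: mspan_csc mspan_base mspan_0)
 thus "x * y : mspan N M" unfolding x y sum_distribs by (intro mspan_sum) auto
next
 fix x t assume xs: "x : mspan N M"
 show "csc t x : mspan N M" using xs by (rule mspan_csc)
 obtain c where x: "x = (SUM a<N. SUM b<N. csc (c a b) (M a b))" using xs by (auto simp: mspan_def)
 have "(csc (c a b) (M a b))\<dagger> : mspan N M" if "a < N" "b < N" for a b using that munitsD(1)[OF M] by (simp add: mspan_csc mspan_base)
 thus "x\<dagger> : mspan N M" unfolding x adj_sum by (intro mspan_sum) auto
qed

lemma munits_commute: assumes "!!a b. a < N ==> b < N ==> c * M a b = M a b * c" "x : mspan N M" shows "c * x = x * c"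
proof -
 have "mspan N M \<subseteq> {x. c * x = x * c}" by (rule mspan_least) (auto simp: assms(1) distrib_left distrib_right csc_mult_left csc_mult_right)
 with assms(2) show ?thesis by auto
qed

definition coarse :: "nat => nat => (nat => nat => 'h::complex_hilbert_space bop) => nat => nat => 'h bop" where
 "coarse N K M a b = (SUM c<K. M (a + N * c) (b + N * c))"

lemma coarse_coarse: "coarse N K (coarse (N * K) L M) = coarse N (K * L) M"
 by (intro ext) (simp add: coarse_def sum_index sum.swap[of _ "{..<L}"] algebra_simps)

lemma coarse_cong: "(!!x y. x < N * K ==> y < N * K ==> M x y = M' x y) ==> a < N ==> b < N ==> coarse N K M a b = coarse N K M' a b"
 unfolding coarse_def by (intro sum.cong refl) (auto intro!: index_less)

lemma coarse_mult: assumes M: "munits (N * K) M" and ab: "a < N" "b < N" "a' < N" "b' < N" "c < K" "d < K"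
 shows "coarse N K M a b * M (a' + N * c) (b' + N * d) = (if b = a' then M (a + N * c) (b' + N * d) else 0)"
  "M (a' + N * c) (b' + N * d) * coarse N K M a b = (if b' = a then M (a' + N * c) (b + N * d) else 0)"
proof -
 have "coarse N K M a b * M (a' + N * c) (b' + N * d) =
  (SUM k<K. if k = c then (if b = a' then M (a + N * c) (b' + N * d) else 0) else 0)" unfolding coarse_def sum_distrib_right
  by (intro sum.cong refl) (use ab in "simp add: munitsD(2)[OF M] index_less index_eq")
 thus "coarse N K M a b * M (a' + N * c) (b' + N * d) = (if b = a' then M (a + N * c) (b' + N * d) else 0)" using ab by simp
 have "M (a' + N * c) (b' + N * d) * coarse N K M a b =
  (SUM k<K. if k = d then (if b' = a then M (a' + N * c) (b + N * d) else 0) else 0)" unfolding coarse_def sum_distrib_left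
  by (intro sum.cong refl) (use ab in "auto simp add: munitsD(2)[OF M] index_less index_eq")
 thus "M (a' + N * c) (b' + N * d) * coarse N K M a b = (if b' = a then M (a' + N * c) (b + N * d) else 0)" using ab by simp
qed

lemma munits_coarse: assumes M: "munits (N * K) M" shows "munits N (coarse N K M)" unfolding munits_def
proof (intro conjI allI impI)
 fix a b assume ab: "a < N" "b < N"
 thus "(coarse N K M a b)\<dagger> = coarse N K M b a" unfolding coarse_def adj_sum by (intro sum.cong refl) (simp add: munitsD(1)[OF M] index_less)
next
 fix a b c d assume "a < N" "b < N" "c < N" "d < N"
 thus "coarse N K M a b * coarse N K M c d = (if b = c then coarse N K M a d else 0)"
  unfolding coarse_def[of N K M c d] sum_distrib_left by (simp add: coarse_mult[OF M]) (simp add: coarse_def)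
next
 have "(SUM a<N. coarse N K M a a) = (SUM x<N * K. M x x)" unfolding coarse_def sum_index by (rule sum.swap)
 thus "(SUM a<N. coarse N K M a a) = 1" using munitsD(3)[OF M] by simp
qed

lemma coarse_mspan: assumes "a < N" "b < N" shows "coarse N K M a b : mspan (N * K) M"
 unfolding coarse_def using assms by (intro mspan_sum mspan_base index_less) auto

text \<open>If \<open>coarse N K\<close> is the embedding of \<open>N \<times> N\<close> matrices into \<open>N K \<times> N K\<close> matrices, \<open>cofactor N\<close>
  gives the matrix units of its relative commutant.\<close>

definition cofactor :: "nat => (nat => nat => 'h::complex_hilbert_space bop) => nat => nat => 'h bop" where
 "cofactor N M i j = (SUM a<N. M (a + N * i) (a + N * j))"

lemma munits_cofactor: assumes M: "munits (N * K) M" shows "munits K (cofactor N M)" unfolding munits_def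
proof (intro conjI allI impI)
 fix a b assume ab: "a < K" "b < K"
 thus "(cofactor N M a b)\<dagger> = cofactor N M b a" unfolding cofactor_def adj_sum by (intro sum.cong refl) (simp add: munitsD(1)[OF M] index_less)
next
 fix a b c d assume *: "a < K" "b < K" "c < K" "d < K"
 have "cofactor N M a b * cofactor N M c d = (SUM i<N. SUM j<N. if j = i then (if b = c then M (i + N * a) (i + N * d) else 0) else 0)"
  unfolding cofactor_def sum_product by (intro sum.cong refl) (use * in "auto simp add: munitsD(2)[OF M] index_less index_eq")
 thus "cofactor N M a b * cofactor N M c d = (if b = c then cofactor N M a d else 0)" by (simp add: cofactor_def)
next
 show "(SUM a<K. cofactor N M a a) = 1" using munitsD(3)[OF M] by (simp add: cofactor_def sum_index)
qed

lemma coarse_cofactor: assumes M: "munits (N * K) M" and ab: "a < N" "b < N" "i < K" "j < K"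
 shows "coarse N K M a b * cofactor N M i j = M (a + N * i) (b + N * j)"
  "cofactor N M i j * coarse N K M a b = M (a + N * i) (b + N * j)" using ab by (simp_all add: cofactor_def sum_distribs coarse_mult[OF M])

lemma cofactor_mspan: assumes "i < K" "j < K" shows "cofactor N M i j : mspan (N * K) M"
 unfolding cofactor_def using assms by (intro mspan_sum mspan_base index_less) auto

section \<open>Commuting systems of matrix units\<close>

definition msystem :: "(nat => nat) => (nat => nat => nat => 'h::complex_hilbert_space bop) => bool" where
 "msystem d E <-> (ALL t. munits (d t) (E t)) &
  (ALL s t. s ~= t --> (ALL a<d s. ALL b<d s. ALL i<d t. ALL j<d t. E s a b * E t i j = E t i j * E s a b))"

text \<open>Matrix units of the tensor product of the first \<open>m\<close> positions. An index is
  read in mixed radix, the position \<open>t\<close> owning the digit of base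
  \<open>d t\<close>.\<close>

primrec mprod :: "(nat => nat) => (nat => nat => nat => 'h::complex_hilbert_space bop) => nat => nat => nat => 'h bop" where
 "mprod d E 0 = (%a b. 1)"
| "mprod d E (Suc m) = (%a b. mprod d E m (a mod (PROD t<m. d t)) (b mod (PROD t<m. d t)) *
   E m (a div (PROD t<m. d t)) (b div (PROD t<m. d t)))"

abbreviation msize :: "(nat => nat) => nat => nat" where "msize d m \<equiv> PROD t<m. d t"

lemma mprod_commute: assumes "!!t i j. t < m ==> i < d t ==> j < d t ==> c * E t i j = E t i j * c" "a < msize d m" "b < msize d m"
 shows "c * mprod d E m a b = mprod d E m a b * c" using assms
proof (induction m arbitrary: a b)
 case (Suc m)
 have *: "a mod msize d m < msize d m" "b mod msize d m < msize d m" "a div msize d m < d m" "b div msize d m < d m"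
  using Suc.prems index_div[of _ "msize d m" "d m"] by (simp_all add: mult.commute)
 have 1: "c * mprod d E m (a mod msize d m) (b mod msize d m) = mprod d E m (a mod msize d m) (b mod msize d m) * c"
  by (rule Suc.IH) (use Suc.prems(1) * in auto)
 have 2: "c * E m (a div msize d m) (b div msize d m) = E m (a div msize d m) (b div msize d m) * c" using Suc.prems(1)[of m] * by simp
 show ?case using 1 2 by (simp add: mult.assoc[symmetric]) (simp add: mult.assoc)
qed simp

lemma munits_product: assumes M: "munits N M" and E: "munits K E"
  and c: "!!a b i j. a < N ==> b < N ==> i < K ==> j < K ==> M a b * E i j = E i j * M a b"
 shows "munits (N * K) (%x y. M (x mod N) (y mod N) * E (x div N) (y div N))" unfolding munits_def
proof (intro conjI allI impI)
 fix x y assume xy: "x < N * K" "y < N * K"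
 note i = index_div[OF xy(1)] index_div[OF xy(2)]
 show "(M (x mod N) (y mod N) * E (x div N) (y div N))\<dagger> = M (y mod N) (x mod N) * E (y div N) (x div N)"
  using i by (simp add: munitsD(1)[OF M] munitsD(1)[OF E] c)
 fix x' y' assume xy': "x' < N * K" "y' < N * K"
 note i' = index_div[OF xy'(1)] index_div[OF xy'(2)]
 have "M (x mod N) (y mod N) * E (x div N) (y div N) * (M (x' mod N) (y' mod N) * E (x' div N) (y' div N)) =
  (M (x mod N) (y mod N) * M (x' mod N) (y' mod N)) * (E (x div N) (y div N) * E (x' div N) (y' div N))"
  using c[OF i'(2,4) i(1,3)] by (metis (no_types, lifting) mult.assoc)
 also have "... = (if y = x' then M (x mod N) (y' mod N) * E (x div N) (y' div N) else 0)"
  using i i' by (auto simp: munitsD(2)[OF M] munitsD(2)[OF E]) (metis mod_mult_div_eq)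
 finally show "M (x mod N) (y mod N) * E (x div N) (y div N) * (M (x' mod N) (y' mod N) * E (x' div N) (y' div N)) =
  (if y = x' then M (x mod N) (y' mod N) * E (x div N) (y' div N) else 0)" .
next
 have "(SUM x<N * K. M (x mod N) (x mod N) * E (x div N) (x div N)) = (SUM c<K. SUM a<N. M a a * E c c)"
  unfolding sum_index by (intro sum.cong refl) auto
 also have "... = 1" by (simp add: sum_distrib_right[symmetric] munitsD(3)[OF M] munitsD(3)[OF E])
 finally show "(SUM x<N * K. M (x mod N) (x mod N) * E (x div N) (x div N)) = 1" .
qed

lemma msystem_mprod_commute: assumes E: "msystem d E" and "a < msize d m" "b < msize d m" "m <= t" "i < d t" "j < d t"
 shows "E t i j * mprod d E m a b = mprod d E m a b * E t i j" by (rule mprod_commute) (use assms in "auto simp: msystem_def")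

lemma munits_mprod: assumes E: "msystem d E" shows "munits (msize d m) (mprod d E m)"
proof (induction m)
 case 0
 thus ?case by (simp add: munits_def)
next
 case (Suc m)
 have "munits (d m) (E m)" using E by (simp add: msystem_def)
 thus ?case using munits_product[OF Suc, of "d m" "E m"] msystem_mprod_commute[OF E, of _ m _ m] by (simp add: mult.commute[of _ "d m"])
qed

lemma coarse_mprod: assumes E: "munits (d m) (E m)" and "a < msize d m" "b < msize d m"
 shows "coarse (msize d m) (d m) (mprod d E (Suc m)) a b = mprod d E m a b"
 using assms by (simp add: coarse_def index_divmod sum_distrib_left[symmetric] munitsD(3))

lemma mprod_mono: assumes E: "msystem d E" shows "m <= k ==> mspan (msize d m) (mprod d E m) \<subseteq> mspan (msize d k) (mprod d E k)"
proof (induction k rule: dec_induct)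
 case (step k)
 have "mspan (msize d k) (mprod d E k) \<subseteq> mspan (msize d (Suc k)) (mprod d E (Suc k))"
 proof (rule mspan_mono)
  fix a b assume ab: "a < msize d k" "b < msize d k"
  have "munits (d k) (E k)" using E by (simp add: msystem_def)
  hence "mprod d E k a b = coarse (msize d k) (d k) (mprod d E (Suc k)) a b" using ab by (simp only: coarse_mprod)
  also have "... : mspan (msize d (Suc k)) (mprod d E (Suc k))" using coarse_mspan[OF ab, of "d k"] by (simp only: prod.lessThan_Suc)
  finally show "mprod d E k a b : mspan (msize d (Suc k)) (mprod d E (Suc k))" .
 qed
 with step show ?case by blast
qed simp

context tracial_factor
begin

lemma mspan_R: "(!!a b. a < N ==> b < N ==> M a b : R) ==> mspan N M \<subseteq> R" by (rule mspan_least) auto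

lemma mspan_salg: assumes M: "munits N M" "!!a b. a < N ==> b < N ==> M a b : R" shows "salg (mspan N M)"
proof (rule finite_dim_salg)
 show "mspan N M \<subseteq> R" by (rule mspan_R[OF M(2)])
 let ?B = "(%(a, b). M a b) ` ({..<N} \<times> {..<N})"
 show "?B \<subseteq> mspan N M" by (auto intro: mspan_base)
 have "b : cspan ?B" if "b : ?B" for b
 proof -
  have "b = (SUM x:?B. csc (if x = b then 1 else 0) x)" using that by (simp add: if_distrib[of "%c. csc c _"] cong: if_cong)
  thus ?thesis unfolding cspan_def by (intro CollectI exI)
 qed
 thus "mspan N M \<subseteq> cspan ?B"
 proof (intro mspan_least cspan_add cspan_csc)
  show "0 : cspan ?B" unfolding cspan_def by (intro CollectI exI[of _ "%_. 0"]) simp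
 qed auto
qed (use mspan_star_alg[OF M(1)] in auto)

text \<open>Cyclicity of the trace makes the diagonal values equal and the others zero; the diagonal
  values add up to \<open>tr c\<close>.\<close>

lemma tr_munits: assumes M: "munits N M" "!!a b. a < N ==> b < N ==> M a b : R" and c: "c : R" "!!a b. a < N ==> b < N ==> c * M a b = M a b * c"
  and ab: "a < N" "b < N" shows "tr (c * M a b) = (if a = b then tr c / of_nat N else 0)"
proof -
 have 1: "tr (c * M i j) = (if i = j then tr (c * M k k) else 0)" if "i < N" "j < N" "k < N" for i j k
 proof -
  have "tr (c * M i j) = tr ((c * M i k) * M k j)" using that by (simp add: mult.assoc munitsD(2)[OF M(1)])
  also have "... = tr (M k j * (c * M i k))" using that c M by (intro tr_comm) auto
  also have "M k j * (c * M i k) = c * (M k j * M i k)" using c(2)[OF that(3,2)] by (simp add: mult.assoc[symmetric])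
  finally show ?thesis using that by (simp add: munitsD(2)[OF M(1)])
 qed
 have "tr c = tr (SUM i<N. c * M i i)" by (simp add: sum_distrib_left[symmetric] munitsD(3)[OF M(1)])
 also have "... = (SUM i<N. tr (c * M i i))" using c M by (intro tr_sum) auto
 also have "... = (SUM i<N. tr (c * M a a))" by (intro sum.cong refl) (use 1[OF _ _ ab(1)] in simp)
 finally have "tr c = of_nat N * tr (c * M a a)" by simp
 thus ?thesis using 1[of a b a] ab by (simp add: field_simps)
qed

end

section \<open>Refinement of matrix units, up to a system that generates \<open>R\<close>\<close>

context tracial_factor
begin

definition munits_in :: "nat => (nat => nat => 'h bop) => bool" where
 "munits_in N M <-> munits N M & (ALL a<N. ALL b<N. M a b : R)"

lemma munits_inD: "munits_in N M ==> munits N M" "munits_in N M ==> a < N ==> b < N ==> M a b : R" by (auto simp: munits_in_def)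

text \<open>The frame of the corner of \<open>M 0 0\<close> is carried to the other diagonal corners
  by \<open>M a 0\<close>; the index \<open>a + N * c\<close> stands for the pair of
  \<open>a\<close> and \<open>c\<close>.\<close>

lemma frame_refine: assumes M: "munits_in N M" "N > 0" and w: "frame (M 0 0) K w"
 defines "M' \<equiv> (%x y. M (x mod N) 0 * (w (x div N) * (w (y div N))\<dagger>) * M 0 (y mod N))"
 shows "munits_in (N * K) M'" "!!a b. a < N ==> b < N ==> M a b = coarse N K M' a b"
proof -
 note m = munitsD[OF munits_inD(1)[OF M(1)]] and mR = munits_inD(2)[OF M(1)]
 obtain g where g: "projn g" "!!a. a < K ==> (w a)\<dagger> * w a = g" and wR: "!!a. a < K ==> w a : R"
  and w0: "!!a b. a < K ==> b < K ==> a ~= b ==> (w a)\<dagger> * w b = 0" and ws: "(SUM a<K. w a * (w a)\<dagger>) = M 0 0"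
  using w unfolding frame_def by metis
 have ww: "(w a)\<dagger> * w b = (if a = b then g else 0)" if "a < K" "b < K" for a b using that g w0 by auto
 have wg: "w a * g = w a" if "a < K" for a using partial_isometry(1)[of "w a"] g that by simp
 hence gw: "g * (w a)\<dagger> = (w a)\<dagger>" if "a < K" for a
 proof -
  have "(w a * g)\<dagger> = (w a)\<dagger>" by (simp only: wg[OF that])
  thus ?thesis by (simp add: projnD(1)[OF g(1)])
 qed
 have ew: "M 0 0 * w a = w a" if "a < K" for a
 proof -
  have "M 0 0 * w a = (SUM b<K. w b * ((w b)\<dagger> * w a))" by (simp only: ws[symmetric] sum_distrib_right mult.assoc)
  also have "... = (SUM b<K. if b = a then w b * g else 0)" by (intro sum.cong refl) (use ww that in simp)
  finally show ?thesis using that wg by simp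
 qed
 have mult: "M' x y * M' x' y' = (if y = x' then M' x y' else 0)" if "x < N * K" "y < N * K" "x' < N * K" "y' < N * K" for x y x' y'
 proof -
  note i = index_div[OF that(1)] index_div[OF that(2)] index_div[OF that(3)] index_div[OF that(4)]
  have yx: "y = x' <-> y mod N = x' mod N & y div N = x' div N" by (metis mod_mult_div_eq)
  have "M' x y * M' x' y' = M (x mod N) 0 * w (x div N) * ((w (y div N))\<dagger> * ((M 0 (y mod N) * M (x' mod N) 0) * w (x' div N))) * (w (y' div N))\<dagger> * M 0 (y' mod N)"
   by (simp add: M'_def mult.assoc)
  also have "... = (if y = x' then M (x mod N) 0 * w (x div N) * g * (w (y' div N))\<dagger> * M 0 (y' mod N) else 0)"
   unfolding yx using i M(2) by (simp add: m ew ww)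
  also have "... = (if y = x' then M' x y' else 0)" using wg[OF i(1)] by (simp add: M'_def mult.assoc gw[OF i(7)])
  finally show ?thesis .
 qed
 have adj: "(M' x y)\<dagger> = M' y x" if "x < N * K" "y < N * K" for x y
  using index_div[OF that(1)] index_div[OF that(2)] M(2) by (simp add: M'_def m mult.assoc)
 show co: "M a b = coarse N K M' a b" if "a < N" "b < N" for a b
 proof -
  have "coarse N K M' a b = M a 0 * (SUM c<K. w c * (w c)\<dagger>) * M 0 b" using that by (simp add: coarse_def M'_def index_divmod sum_distribs)
  thus ?thesis using that M(2) by (simp add: ws m)
 qed
 have "(SUM x<N * K. M' x x) = (SUM a<N. coarse N K M' a a)" by (simp add: sum_index coarse_def sum.swap[of _ "{..<N}"])
 also have "... = (SUM a<N. M a a)" by (intro sum.cong refl) (simp add: co)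
 finally have "(SUM x<N * K. M' x x) = 1" by (simp add: m)
 moreover have "M' x y : R" if "x < N * K" "y < N * K" for x y using index_div[OF that(1)] index_div[OF that(2)] M(2) mR wR by (simp add: M'_def)
 ultimately show "munits_in (N * K) M'" using mult adj by (simp add: munits_in_def munits_def)
qed

end

context hyperfinite_factor
begin

text \<open>Each \<open>x\<close> is described by the elements \<open>M 0 a * x * M b 0\<close> of
  one corner. They are approximated there within \<open>\<delta>\<close>, and the
  \<open>N\<^sup>2\<close> errors add up to \<open>\<epsilon>\<close>.\<close>

lemma refine_approximation: assumes M: "munits_in N M" "N > 0" and X: "finite X" "X \<subseteq> R" and eps: "\<epsilon> > 0"
 shows "EX K0. ALL K>=K0. EX M'. munits_in (N * K) M' & (ALL a<N. ALL b<N. M a b = coarse N K M' a b) &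
  (ALL x:X. EX z:mspan (N * K) M'. tn (x - z) < \<epsilon>)"
proof -
 note m = munitsD[OF munits_inD(1)[OF M(1)]] and mR = munits_inD(2)[OF M(1)]
 define e where "e = M 0 0"
 have e: "e : R" "projn e" using M(2) mR m by (auto simp: e_def projn_def)
 have e0: "e ~= 0"
 proof
  assume "e = 0"
  hence "M a a = 0" if "a < N" for a using m(2)[of a 0 0 a] m(2)[of a 0 0 0] that M(2) by (simp add: e_def)
  hence "(SUM a<N. M a a) = 0" by simp
  thus False using m(3) tn_one tn_zero by auto
 qed
 define Y where "Y = (%(x, a, b). M 0 a * x * M b 0) ` (X \<times> {..<N} \<times> {..<N})"
 define \<delta> where "\<delta> = \<epsilon> / (real N)\<^sup>2"
 have \<delta>: "\<delta> > 0" using eps M(2) by (simp add: \<delta>_def)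
 have Y: "finite Y" "y : R & e * y = y & y * e = y" if "y : Y" for y
  using that X M(2) mR by (auto simp: Y_def e_def mult.assoc m) (simp_all add: mult.assoc[symmetric] m)
 have "finite Y" using X by (simp add: Y_def)
 then obtain K0 where K0: "ALL K>=K0. EX w. frame e K w & (ALL y:Y. EX z:fspan K w. tn (y - z) < \<delta>)"
  using corner_matrix_approximation[OF e e0 _ Y(2) \<delta>] by blast
 show ?thesis
 proof (intro exI[of _ K0] allI impI)
  fix K assume "K0 <= K"
  then obtain w where w: "frame e K w" "ALL y:Y. EX z:fspan K w. tn (y - z) < \<delta>" using K0 by blast
  define M' where "M' x y = M (x mod N) 0 * (w (x div N) * (w (y div N))\<dagger>) * M 0 (y mod N)" for x y
  note M' = frame_refine[OF M w(1)[unfolded e_def], folded M'_def]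
  have wR: "w a : R" if "a < K" for a using w(1) that by (auto simp: frame_def)
  have ap: "EX z:mspan (N * K) M'. tn (x - z) < \<epsilon>" if x: "x : X" for x
  proof -
   have xR: "x : R" using x X by auto
   have "EX z:fspan K w. tn (M 0 a * x * M b 0 - z) < \<delta>" if "a < N" "b < N" for a b using w(2) x that by (force simp: Y_def)
   then obtain z where z: "!!a b. a < N ==> b < N ==> z a b : fspan K w & tn (M 0 a * x * M b 0 - z a b) < \<delta>" by metis
   have zR: "z a b : R" if "a < N" "b < N" for a b using z[OF that] mspan_R[of K "%a b. w a * (w b)\<dagger>"] wR by auto
   have in_span: "M a 0 * z * M 0 b : mspan (N * K) M'" if ab: "a < N" "b < N" and z: "z : fspan K w" for a b z
   proof -
    obtain c where c: "z = (SUM i<K. SUM j<K. csc (c i j) (w i * (w j)\<dagger>))" using z by (auto simp: mspan_def)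
    have "M a 0 * z * M 0 b = (SUM i<K. SUM j<K. csc (c i j) (M' (a + N * i) (b + N * j)))"
     using ab unfolding c sum_distribs by (simp add: M'_def index_divmod csc_mult_right)
    also have "... : mspan (N * K) M'" by (intro mspan_sum mspan_csc mspan_base index_less ab) auto
    finally show ?thesis .
   qed
   define y where "y = (SUM a<N. SUM b<N. M a 0 * z a b * M 0 b)"
   have yS: "y : mspan (N * K) M'" unfolding y_def by (intro mspan_sum in_span) (use z in auto)
   have "(SUM a<N. M a a) * x * (SUM b<N. M b b) = (SUM a<N. SUM b<N. M a a * x * M b b)" by (simp only: sum_distribs) (rule sum.swap)
   hence "x = (SUM a<N. SUM b<N. M a a * x * M b b)" by (simp add: m)
   also have "... = (SUM a<N. SUM b<N. M a 0 * (M 0 a * x * M b 0) * M 0 b)"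
   proof (intro sum.cong refl)
    fix a b assume "a : {..<N}" "b : {..<N}"
    hence "M a 0 * M 0 a = M a a" "M b 0 * M 0 b = M b b" using m(2) M(2) by auto
    thus "M a a * x * M b b = M a 0 * (M 0 a * x * M b 0) * M 0 b" by (metis (no_types, lifting) mult.assoc)
   qed
   finally have "x - y = (SUM a<N. SUM b<N. M a 0 * (M 0 a * x * M b 0) * M 0 b) - (SUM a<N. SUM b<N. M a 0 * z a b * M 0 b)" by (simp only: y_def)
   also have "... = (SUM a<N. SUM b<N. M a 0 * (M 0 a * x * M b 0 - z a b) * M 0 b)" by (simp only: sum_subtractf[symmetric] diff_distribs)
   finally have xy: "x - y = (SUM a<N. SUM b<N. M a 0 * (M 0 a * x * M b 0 - z a b) * M 0 b)" .
   have ob: "opbound (M a b) 1" if "a < N" "b < N" for a b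
   proof -
    have "projn (M b b)" using that by (simp add: projn_def m)
    hence "psd (1 - M b b)" by (intro projn_psd projn_compl)
    thus ?thesis using that by (simp add: opbound_psd m)
   qed
   have t: "tn (M a 0 * (M 0 a * x * M b 0 - z a b) * M 0 b) < \<delta>" if ab: "a < N" "b < N" for a b
   proof -
    have "tn (M a 0 * (M 0 a * x * M b 0 - z a b) * M 0 b) <= tn (M a 0 * (M 0 a * x * M b 0 - z a b))"
     using tn_mult_right[of "M 0 b" 1 "M a 0 * (M 0 a * x * M b 0 - z a b)"] ab M(2) mR xR zR ob by simp
    also have "... <= tn (M 0 a * x * M b 0 - z a b)" using tn_mult_left[of "M a 0" 1 "M 0 a * x * M b 0 - z a b"] ab M(2) mR xR zR ob by simp
    finally show ?thesis using z[OF ab] by simp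
   qed
   have TR: "M a 0 * (M 0 a * x * M b 0 - z a b) * M 0 b : R" if "a < N" "b < N" for a b using that M(2) mR xR zR by simp
   have "tn (x - y) <= (SUM a<N. tn (SUM b<N. M a 0 * (M 0 a * x * M b 0 - z a b) * M 0 b))" unfolding xy using TR by (intro tn_sum R_sum) auto
   also have "... <= (SUM a<N. SUM b<N. tn (M a 0 * (M 0 a * x * M b 0 - z a b) * M 0 b))" using TR by (intro sum_mono tn_sum) auto
   also have "... < (SUM a<N. SUM b<N. \<delta>)" using M(2) t by (intro sum_strict_mono) auto
   also have "... = \<epsilon>" using M(2) by (simp add: \<delta>_def power2_eq_square)
   finally show ?thesis using yS by blast
  qed
  thus "EX M'. munits_in (N * K) M' & (ALL a<N. ALL b<N. M a b = coarse N K M' a b) &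
   (ALL x:X. EX z:mspan (N * K) M'. tn (x - z) < \<epsilon>)" using M' ap by blast
 qed
qed


text \<open>The matrix units of size \<open>\<Prod>t<m. d t\<close> are found at stages \<open>m s\<close>; in between they are
  obtained by coarsening.\<close>

theorem uhf: assumes d: "!!t. d t >= 1" and inf: "infinite {t. d t >= 2}" shows "EX E. msystem d E & (ALL t. ALL a<d t. ALL b<d t. E t a b : R) &
  (ALL x:R. ALL \<epsilon>>0. EX m. EX y:mspan (msize d m) (mprod d E m). tn (x - y) < \<epsilon>)"
proof -
 obtain B where B: "!!m. finite (B m)" "!!m. B m \<subseteq> F m" "!!m. F m \<subseteq> cspan (B m)" using F_fin by metis
 define X where "X s = (UN k<=s. B k)" for s :: nat
 have X: "finite (X s)" "X s \<subseteq> R" for s using B(1) unfolding X_def by (auto, meson B(2) F_R subsetD)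
 define P where "P m k = (PROD t:{m..<k}. d t)" for m k
 have P_mult: "P i j * P j k = P i k" if "i <= j" "j <= k" for i j k unfolding P_def using that by (rule prod.atLeastLessThan_concat)
 have P0: "P 0 m = msize d m" for m by (simp add: P_def atLeast0LessThan)
 have P_pos: "P i j > 0" for i j unfolding P_def by (intro prod_pos) (simp add: d[unfolded One_nat_def Suc_le_eq])
 \<comment> \<open>Since infinitely many sizes are at least 2, skipping ahead far enough passes the
   threshold of \<open>refine_approximation\<close>.\<close>
 have P_big: "EX k>m. P m k >= K" for m K
 proof (induction K)
  case 0
  thus ?case by auto
 next
  case (Suc K)
  then obtain k where k: "k > m" "P m k >= K" by blast
  obtain t where t: "t >= k" "d t >= 2" using inf unfolding infinite_nat_iff_unbounded_le by auto
  have "P m (Suc t) = P m k * P k (Suc t)" using P_mult[of m k "Suc t"] k t by simp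
  moreover have "P k (Suc t) = P k t * d t" using t by (simp add: P_def)
  moreover have "P k t * d t >= 1 * 2" using t P_pos[of k t] by (intro mult_le_mono) auto
  ultimately have "P m (Suc t) >= P m k * 2" by simp
  hence "P m (Suc t) >= Suc K" using k P_pos[of m k] by linarith
  thus ?case using k t by (intro exI[of _ "Suc t"]) auto
 qed
 \<comment> \<open>A stage is a position \<open>m\<close> with matrix units for the first
   \<open>m\<close> sizes. A link refines them and approximates spanning sets of \<open>F 0\<close>
   up to \<open>F s\<close> with error \<open>1 / (s + 1)\<close>.\<close>
 define good where "good s = (%(m, M). munits_in (P 0 m) M & s <= m)" for s
 define link where "link s = (%(m, M) (m', M'). m < m' & (ALL a<P 0 m. ALL b<P 0 m. M a b = coarse (P 0 m) (P m m') M' a b) &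
  (ALL x:X s. EX z:mspan (P 0 m') M'. tn (x - z) < 1 / real (Suc s)))" for s
 have "EX S. ALL s. good s (S s) & link s (S s) (S (Suc s))"
 proof (rule dependent_nat_choice)
  have "good 0 (0, %_ _. 1)" by (simp add: good_def munits_in_def munits_def P_def)
  thus "EX x. good 0 x" by blast
 next
  fix S s assume "good s S"
  then obtain m M where S: "S = (m, M)" "munits_in (P 0 m) M" "s <= m" by (auto simp: good_def)
  obtain K0 where K0: "ALL K>=K0. EX M'. munits_in (P 0 m * K) M' & (ALL a<P 0 m. ALL b<P 0 m. M a b = coarse (P 0 m) K M' a b) &
   (ALL x:X s. EX z:mspan (P 0 m * K) M'. tn (x - z) < 1 / real (Suc s))" using refine_approximation[OF S(2) P_pos X, of "1 / real (Suc s)" s] by auto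
  obtain m' where m': "m' > m" "P m m' >= K0" using P_big by blast
  obtain M' where "munits_in (P 0 m * P m m') M'" "ALL a<P 0 m. ALL b<P 0 m. M a b = coarse (P 0 m) (P m m') M' a b"
   "ALL x:X s. EX z:mspan (P 0 m * P m m') M'. tn (x - z) < 1 / real (Suc s)" using K0 m'(2) by blast
  moreover have "P 0 m * P m m' = P 0 m'" using m' by (intro P_mult) auto
  ultimately have "good (Suc s) (m', M') & link s S (m', M')" using S m' by (simp add: good_def link_def)
  thus "EX S'. good (Suc s) S' & link s S S'" by blast
 qed
 then obtain S where S: "!!s. good s (S s)" "!!s. link s (S s) (S (Suc s))" by blast
 define m where "m s = fst (S s)" for s
 define V where "V s = snd (S s)" for s
 have V: "munits_in (P 0 (m s)) (V s)" "s <= m s" "m s < m (Suc s)"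
  "a < P 0 (m s) ==> b < P 0 (m s) ==> V s a b = coarse (P 0 (m s)) (P (m s) (m (Suc s))) (V (Suc s)) a b"
  "x : X s ==> EX z:mspan (P 0 (m (Suc s))) (V (Suc s)). tn (x - z) < 1 / real (Suc s)" for s a b x
  using S(1)[of s] S(2)[of s] by (auto simp: good_def link_def m_def V_def split: prod.splits)
 \<comment> \<open>By \<open>VV\<close> below, every stage reaching position \<open>t\<close> gives
   the same units at level \<open>t\<close>; stage \<open>t\<close> reaches it because
   \<open>t <= m t\<close>.\<close>
 define U where "U t = coarse (P 0 t) (P t (m t)) (V t)" for t
 have mm: "m i <= m j" if "i <= j" for i j using lift_Suc_mono_le[of m i j] V(3) that less_imp_le by blast
 have VV: "coarse (P 0 n) (P n (m i)) (V i) a b = coarse (P 0 n) (P n (m j)) (V j) a b"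
  if "i <= j" "n <= m i" "a < P 0 n" "b < P 0 n" for i j n a b using that(1)
 proof (induction j rule: dec_induct)
  case (step j)
  have ts: "n <= m j" "m j <= m (Suc j)" using mm[OF step(1)] that(2) V(3)[of j] by auto
  have "coarse (P 0 n) (P n (m j)) (V j) a b =
   coarse (P 0 n) (P n (m j)) (coarse (P 0 n * P n (m j)) (P (m j) (m (Suc j))) (V (Suc j))) a b"
   by (rule coarse_cong) (use that ts V(4) in "auto simp: P_mult")
  also have "... = coarse (P 0 n) (P n (m (Suc j))) (V (Suc j)) a b" unfolding coarse_coarse using ts by (simp add: P_mult)
  finally show ?case using step by simp
 qed simp
 have PV: "P 0 t * P t (m t) = P 0 (m t)" for t using V(2) by (intro P_mult) auto
 have UR: "munits_in (P 0 t) (U t)" for t unfolding munits_in_def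
 proof (intro conjI allI impI)
  show "munits (P 0 t) (U t)" unfolding U_def by (rule munits_coarse) (use munits_inD(1)[OF V(1)[of t]] in "simp only: PV")
  fix a b assume "a < P 0 t" "b < P 0 t"
  thus "U t a b : R" unfolding U_def coarse_def by (intro R_sum munits_inD(2)[OF V(1)[of t]]) (auto simp: PV[symmetric] intro!: index_less)
 qed
 have Uc: "U t a b = coarse (P 0 t) (d t) (U (Suc t)) a b" if "a < P 0 t" "b < P 0 t" for t a b
 proof -
  have s: "P 0 t * d t = P 0 (Suc t)" by (simp add: P_def)
  have t: "Suc t <= m (Suc t)" by (rule V(2))
  have "P t (Suc t) = d t" by (simp add: P_def)
  hence dP: "d t * P (Suc t) (m (Suc t)) = P t (m (Suc t))" using P_mult[of t "Suc t" "m (Suc t)"] t by simp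
  have "coarse (P 0 t) (d t) (U (Suc t)) = coarse (P 0 t) (d t * P (Suc t) (m (Suc t))) (V (Suc t))"
   unfolding U_def s[symmetric] coarse_coarse by (rule refl)
  thus ?thesis using VV[of t "Suc t" t a b] V(2) that by (simp add: dP U_def[of t])
 qed
 \<comment> \<open>The units of the single position \<open>t\<close> are those of the relative
   commutant of level \<open>t\<close> in level \<open>t + 1\<close>.\<close>
 define E where "E t = cofactor (P 0 t) (U (Suc t))" for t
 have P_Suc: "P 0 (Suc t) = P 0 t * d t" for t by (simp add: P_def)
 have US: "munits (P 0 t * d t) (U (Suc t))" for t using munits_inD(1)[OF UR, of "Suc t"] by (simp only: P_Suc)
 have prodE: "U t (x mod P 0 t) (y mod P 0 t) * E t (x div P 0 t) (y div P 0 t) = U (Suc t) x y"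
  "E t (x div P 0 t) (y div P 0 t) * U t (x mod P 0 t) (y mod P 0 t) = U (Suc t) x y" if "x < P 0 (Suc t)" "y < P 0 (Suc t)" for t x y
 proof -
  note i = index_div[of x "P 0 t" "d t"] index_div[of y "P 0 t" "d t"]
  have "x < P 0 t * d t" "y < P 0 t * d t" using that by (simp_all only: P_Suc)
  note i = i(1,2)[OF this(1)] i(3,4)[OF this(2)]
  show "U t (x mod P 0 t) (y mod P 0 t) * E t (x div P 0 t) (y div P 0 t) = U (Suc t) x y"
   "E t (x div P 0 t) (y div P 0 t) * U t (x mod P 0 t) (y mod P 0 t) = U (Suc t) x y"
   using coarse_cofactor[OF US, of "x mod P 0 t" t "y mod P 0 t" "x div P 0 t" "y div P 0 t"] i Uc by (simp_all add: E_def)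
 qed
 have EU: "E t i j * U t a b = U t a b * E t i j" if "a < P 0 t" "b < P 0 t" "i < d t" "j < d t" for t a b i j
  using prodE[of "a + P 0 t * i" t "b + P 0 t * j"] that by (simp add: index_divmod P_Suc index_less)
 have ER: "E t i j : R" if "i < d t" "j < d t" for t i j unfolding E_def cofactor_def using that
  by (intro R_sum munits_inD(2)[OF UR]) (auto simp: P_Suc intro!: index_less)
 have Umono: "mspan (P 0 s) (U s) \<subseteq> mspan (P 0 t) (U t)" if "s <= t" for s t using that
 proof (induction t rule: dec_induct)
  case (step t)
  have "mspan (P 0 t) (U t) \<subseteq> mspan (P 0 (Suc t)) (U (Suc t))" unfolding P_Suc using Uc by (intro mspan_mono) (simp add: coarse_mspan)
  with step show ?case by blast
 qed simp
 have EE: "E s a b * E t i j = E t i j * E s a b" if st: "s < t" and ab: "a < d s" "b < d s" "i < d t" "j < d t" for s t a b i j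
 proof -
  have "E s a b : mspan (P 0 (Suc s)) (U (Suc s))" unfolding E_def P_Suc by (rule cofactor_mspan[OF ab(1,2)])
  hence "E s a b : mspan (P 0 t) (U t)" using Umono[of "Suc s" t] st by auto
  hence "E t i j * E s a b = E s a b * E t i j" by (rule munits_commute[rotated]) (rule EU[OF _ _ ab(3,4)])
  thus ?thesis by simp
 qed
 have sys: "msystem d E" unfolding msystem_def
 proof (intro conjI allI impI)
  show "munits (d t) (E t)" for t unfolding E_def by (rule munits_cofactor[OF US])
  fix s t a b i j assume "s ~= t" "a < d s" "b < d s" "i < d t" "j < d t"
  thus "E s a b * E t i j = E t i j * E s a b" using EE[of s t a b i j] EE[of t s i j a b] by (cases "s < t") auto
 qed
 have mU: "mprod d E t a b = U t a b" if "a < P 0 t" "b < P 0 t" for t a b using that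
 proof (induction t arbitrary: a b)
  case 0
  have "U 0 0 0 = 1" using munitsD(3)[OF munits_inD(1)[OF UR[of 0]]] by (simp add: P_def)
  thus ?case using 0 by (simp add: P_def)
 next
  case (Suc t)
  have "a < P 0 t * d t" "b < P 0 t * d t" using Suc.prems by (simp_all only: P_Suc)
  hence "mprod d E t (a mod P 0 t) (b mod P 0 t) = U t (a mod P 0 t) (b mod P 0 t)" using index_div by (intro Suc.IH) auto
  thus ?case using prodE(1)[OF Suc.prems] by (simp add: P0)
 qed
 have dense: "EX k. EX y:mspan (msize d k) (mprod d E k). tn (x - y) < \<epsilon>" if x: "x : R" and eps: "\<epsilon> > 0" for x \<epsilon>
 proof -
  obtain k y where y: "y : F k" "tn (x - y) < \<epsilon> / 2" using F_dense[OF x, of "\<epsilon> / 2"] eps by auto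
  obtain c where c: "y = (SUM b:B k. csc (c b) b)" using B(3) y(1) by (auto simp: cspan_def)
  define C where "C = (SUM b:B k. cmod (c b)) + 1"
  have C: "C > 0" by (simp add: C_def sum_nonneg add_nonneg_pos)
  obtain s where s: "2 * C / \<epsilon> < real s" using reals_Archimedean2 by blast
  \<comment> \<open>A successor, because stage \<open>Suc j\<close> is the one that approximates
    \<open>X j\<close>; being larger than \<open>s\<close> it brings the total error
    \<open>C / q\<close> below \<open>\<epsilon> / 2\<close>.\<close>
  define q where "q = Suc (max s k)"
  have "b : X (max s k)" if "b : B k" for b using that by (auto simp: X_def)
  hence "EX z:mspan (P 0 (m q)) (V q). tn (b - z) < 1 / real q" if "b : B k" for b unfolding q_def using V(5) that by blast
  then obtain z where z: "!!b. b : B k ==> z b : mspan (P 0 (m q)) (V q)"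
   "!!b. b : B k ==> tn (b - z b) < 1 / real q" by metis
  define w where "w = (SUM b:B k. csc (c b) (z b))"
  have VU: "V q a b = U (m q) a b" if "a < P 0 (m q)" "b < P 0 (m q)" for a b
   using VV[OF V(2) order_refl that] by (simp add: U_def) (simp add: coarse_def P_def)
  have zR: "z b : R" if "b : B k" for b using z(1)[OF that] mspan_R[of "P 0 (m q)" "V q"] munits_inD(2)[OF V(1)] by blast
  have BR: "b : R" if "b : B k" for b using that B(2) F_R by blast
  have "w : mspan (P 0 (m q)) (V q)" unfolding w_def by (intro mspan_sum mspan_csc z)
  hence wU: "w : mspan (msize d (m q)) (mprod d E (m q))" using mspan_cong[of "P 0 (m q)" "V q" "mprod d E (m q)"] VU mU by (simp add: P0)
  have "y - w = (SUM b:B k. csc (c b) (b - z b))" by (simp add: c w_def csc_diff_right sum_subtractf)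
  hence "tn (y - w) <= (SUM b:B k. tn (csc (c b) (b - z b)))" using zR BR by (simp only:) (intro tn_sum, simp)
  also have "... = (SUM b:B k. cmod (c b) * tn (b - z b))" using zR BR by (intro sum.cong refl) (simp add: tn_csc)
  also have "... <= (SUM b:B k. cmod (c b) * (1 / real q))" by (rule sum_mono) (rule mult_left_mono[OF less_imp_le[OF z(2)] norm_ge_zero])
  also have "... <= C * (1 / real q)" unfolding sum_distrib_right[symmetric] by (intro mult_right_mono) (auto simp: C_def)
  also have "... < \<epsilon> / 2"
  proof -
   have "2 * C / \<epsilon> < real q" "real q > 0" using s by (simp_all add: q_def)
   thus ?thesis using eps C by (simp add: field_simps)
  qed
  finally have "tn (y - w) < \<epsilon> / 2" .
  moreover have "w : R" "y : R" using y F_R zR BR by (auto simp: w_def)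
  ultimately have "tn (x - w) < \<epsilon>" using tn_triangle_diff[OF x, of y w] y(2) by simp
  with wU show ?thesis by blast
 qed
 show ?thesis using sys ER dense by blast
qed

end

section \<open>Endomorphisms determined by the images of the matrix units\<close>

context tracial_factor
begin

lemma tr_slim: assumes "!!n. X n : R" "slim X x" shows "(%n. tr (X n)) ----> tr x"
proof -
 have xR: "x : R" by (rule R_slim[OF assms])
 have "(%n. tr (X n) - tr x) ----> 0"
 proof (rule Lim_null_comparison[OF _ slim_tn[OF assms]])
  show "\<forall>\<^sub>F n in sequentially. cmod (tr (X n) - tr x) <= tn (X n - x)"
   using tr_bound[of "X _ - x"] assms(1) xR by (intro always_eventually allI) (simp add: tr_diff)
 qed
 thus ?thesis by (rule LIM_zero_cancel)
qed

lemma tn_slim_le: assumes "!!n. X n : R" "slim X x" "!!n. tn (X n) <= C" shows "tn x <= C"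
proof (rule LIMSEQ_le_const)
 have xR: "x : R" by (rule R_slim[OF assms(1,2)])
 show "(%n. tn (X n - x) + C) ----> C" using tendsto_add[OF slim_tn[OF assms(1,2)] tendsto_const[of C]] by simp
 have "tn x <= tn (X n - x) + C" for n using tn_triangle_diff[OF xR assms(1)[of n], of 0] tn_diff_commute[OF xR assms(1)[of n]] assms(3)[of n] by simp
 thus "EX N. ALL n>=N. tn x <= tn (X n - x) + C" by blast
qed

lemma tn_small: "x : R ==> (!!e. e > 0 ==> tn x < e) ==> x = 0" using tn_le_0[of x] by (meson less_irrefl not_less)

text \<open>The expectation onto the span of \<open>M\<close>, followed by \<open>M a b \<mapsto> M' a b\<close>.\<close>

definition transfer :: "nat => (nat => nat => 'h bop) => (nat => nat => 'h bop) => 'h bop => 'h bop" where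
 "transfer N M M' x = (SUM a<N. SUM b<N. csc (of_nat N * tr (M b a * x)) (M' a b))"

lemma tr_munits_product: assumes M: "munits_in N M" and "a < N" "b < N" "c < N" "d < N"
 shows "tr (M b a * M c d) = (if a = c & b = d then 1 / of_nat N else 0)" using assms(2-5) tr_munits[OF munits_inD[OF M], of 1 b d]
 by (cases "b = d") (auto simp: munitsD(2)[OF munits_inD(1)[OF M]] tr_one)

lemma mspan_in: "munits_in N M ==> x : mspan N M ==> x : R" using mspan_R[of N M] munits_inD(2)[of N M] by blast

lemma transfer_R: assumes "munits_in N M'" shows "transfer N M M' x : R"
 unfolding transfer_def using munits_inD(2)[OF assms] by (intro R_sum R_simps) auto

lemma transfer_mspan: "transfer N M M' x : mspan N M'" unfolding transfer_def mspan_def by (intro CollectI exI) (rule refl)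

lemma transfer_add: "munits_in N M ==> x : R ==> y : R ==> transfer N M M' (x + y) = transfer N M M' x + transfer N M M' y"
 unfolding transfer_def sum.distrib[symmetric] csc_add_left[symmetric] by (intro sum.cong refl) (auto simp: distrib_left tr_add munits_inD)

lemma transfer_csc: "munits_in N M ==> x : R ==> transfer N M M' (csc t x) = csc t (transfer N M M' x)" unfolding transfer_def csc_sum csc_csc
 by (intro sum.cong refl) (auto simp: tr_csc munits_inD mult_ac)

lemma transfer_0: "munits_in N M ==> transfer N M M' 0 = 0" using transfer_csc[of N M 0 M' 0] by simp

lemma transfer_sum: assumes M: "munits_in N M" shows "(!!i. i : A ==> f i : R) ==> transfer N M M' (SUM i:A. f i) = (SUM i:A. transfer N M M' (f i))"
proof (induction A rule: infinite_finite_induct)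
 case (insert i A)
 thus ?case using transfer_add[OF M, of "f i" "sum f A" M'] by simp
qed (simp_all add: transfer_0 M)

lemma transfer_base: assumes M: "munits_in N M" and "c < N" "d < N" shows "transfer N M M' (M c d) = M' c d"
proof -
 have "complex_of_nat N ~= 0" using assms by auto
 hence "csc (of_nat N * tr (M b a * M c d)) (M' a b) = (if b = d then if a = c then M' c d else 0 else 0)" if "a < N" "b < N" for a b
  using tr_munits_product[OF M that assms(2,3)] by auto
 hence "transfer N M M' (M c d) = (SUM a<N. SUM b<N. if b = d then if a = c then M' c d else 0 else 0)"
  unfolding transfer_def by (intro sum.cong refl) auto
 thus ?thesis using assms by simp
qed

lemma transfer_mspan_eq: assumes M: "munits_in N M" "munits_in N M'" and L: "L : R \<rightarrow> R" "!!x y. x : R ==> y : R ==> L (x + y) = L x + L y"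
  "!!c x. x : R ==> L (csc c x) = csc c (L x)" "!!a b. a < N ==> b < N ==> L (M a b) = M' a b" and x: "x : mspan N M" shows "transfer N M M' x = L x"
proof -
 have L0: "L 0 = 0" using L(3)[of 0 0] by simp
 have "mspan N M \<subseteq> {x : R. transfer N M M' x = L x}"
 proof (rule mspan_least)
  show "0 : {x : R. transfer N M M' x = L x}" using L0 by (simp add: transfer_0 M)
 qed (use munits_inD(2)[OF M(1)] transfer_base[OF M(1)] transfer_add[OF M(1)] transfer_csc[OF M(1)] L in auto)
 with x show ?thesis by auto
qed

text \<open>The expectation is a module map over the span of \<open>M\<close>, which is why only one
  factor has to lie in the span.\<close>

lemma transfer_mult: assumes M: "munits_in N M" "munits_in N M'" and x: "x : R" and w: "w : mspan N M"
 shows "transfer N M M' (x * w) = transfer N M M' x * transfer N M M' w"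
proof -
 have base: "transfer N M M' (x * M c d) = transfer N M M' x * M' c d" if "c < N" "d < N" for c d
 proof -
  have "transfer N M M' x * M' c d = (SUM a<N. SUM b<N. csc (of_nat N * tr (M b a * x)) (if b = c then M' a d else 0))"
   unfolding transfer_def sum_distrib_right by (intro sum.cong refl) (use that in "simp add: munitsD(2)[OF munits_inD(1)[OF M(2)]]")
  also have "... = (SUM a<N. csc (of_nat N * tr (M c a * x)) (M' a d))" using that by (simp add: if_distrib[of "csc _"] cong: if_cong)
  also have "... = (SUM a<N. SUM b<N. csc (if b = d then of_nat N * tr (M c a * x) else 0) (M' a b))"
   using that by (simp add: if_distrib[of "%z. csc z _"] cong: if_cong)
  also have "... = transfer N M M' (x * M c d)" unfolding transfer_def
  proof (intro sum.cong refl arg_cong2[of _ _ _ _ csc])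
   fix a b assume ab: "a : {..<N}" "b : {..<N}"
   have "tr (M b a * (x * M c d)) = tr (M c d * (M b a * x))"
    using tr_comm[of "M b a * x" "M c d"] ab that x munits_inD(2)[OF M(1)] by (simp add: mult.assoc)
   also have "M c d * (M b a * x) = (if b = d then M c a * x else 0)"
    using ab that by (simp add: mult.assoc[symmetric] munitsD(2)[OF munits_inD(1)[OF M(1)]])
   finally show "(if b = d then of_nat N * tr (M c a * x) else 0) = of_nat N * tr (M b a * (x * M c d))" by simp
  qed
  finally show ?thesis by simp
 qed
 have "mspan N M \<subseteq> {w : R. transfer N M M' (x * w) = transfer N M M' x * transfer N M M' w}"
 proof (rule mspan_least)
  show "0 : {w : R. transfer N M M' (x * w) = transfer N M M' x * transfer N M M' w}" by (simp add: transfer_0 M)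
 qed (use munits_inD(2)[OF M(1)] transfer_base[OF M(1)] transfer_add[OF M(1)] transfer_csc[OF M(1)] x base in "auto simp: distrib_left")
 with w show ?thesis by auto
qed

lemma transfer_adj: assumes M: "munits_in N M" "munits_in N M'" and x: "x : R" shows "(transfer N M M' x)\<dagger> = transfer N M M' (x\<dagger>)"
proof -
 have "(transfer N M M' x)\<dagger> = (SUM a<N. SUM b<N. csc (cnj (of_nat N * tr (M b a * x))) (M' b a))"
  unfolding transfer_def adj_sum by (intro sum.cong refl) (simp add: munitsD(1)[OF munits_inD(1)[OF M(2)]])
 also have "... = (SUM b<N. SUM a<N. csc (cnj (of_nat N * tr (M b a * x))) (M' b a))" by (rule sum.swap)
 also have "... = transfer N M M' (x\<dagger>)" unfolding transfer_def
 proof (intro sum.cong refl arg_cong2[of _ _ _ _ csc])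
  fix b a assume ab: "b : {..<N}" "a : {..<N}"
  have "tr (M a b * x\<dagger>) = tr ((x * M b a)\<dagger>)" using ab by (simp add: munitsD(1)[OF munits_inD(1)[OF M(1)]])
  also have "... = cnj (tr (M b a * x))" using tr_adj[of "x * M b a"] tr_comm[of x "M b a"] x ab munits_inD(2)[OF M(1)] by simp
  finally show "cnj (of_nat N * tr (M b a * x)) = of_nat N * tr (M a b * x\<dagger>)" by simp
 qed
 finally show ?thesis .
qed

lemma tr_sum2: "(!!a b. a < N ==> b < N ==> f a b : R) ==> tr (SUM a<N. SUM b<N. f a b) = (SUM a<N. SUM b<(N::nat). tr (f a b))"
 by (subst tr_sum) (auto intro!: sum.cong tr_sum R_sum)

text \<open>The trace of \<open>c\<close> times a unit of \<open>M'\<close> is the product of the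
  traces. With \<open>c = 1\<close> the trace is preserved; general \<open>c\<close> gives traces of
  products with images of the endomorphism.\<close>

lemma tr_transfer: assumes M: "munits_in N M" "munits_in N M'" and x: "x : R" and c: "c : R" "!!a b. a < N ==> b < N ==> c * M' a b = M' a b * c"
 shows "tr (c * transfer N M M' x) = tr c * tr x"
proof -
 have "tr (c * transfer N M M' x) = (SUM a<N. SUM b<N. of_nat N * tr (M b a * x) * tr (c * M' a b))"
  unfolding transfer_def sum_distrib_left using c(1) munits_inD(2)[OF M(2)] by (subst tr_sum2) (auto simp: tr_csc)
 also have "... = (SUM a<N. SUM b<N. if b = a then tr c * tr (M a a * x) else 0)"
  by (intro sum.cong refl) (auto simp: tr_munits[OF munits_inD[OF M(2)] c])
 also have "... = tr c * (SUM a<N. tr (M a a * x))" by (simp add: sum_distrib_left)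
 also have "(SUM a<N. tr (M a a * x)) = tr (SUM a<N. M a a * x)" using x munits_inD(2)[OF M(1)] by (intro tr_sum[symmetric]) auto
 also have "(SUM a<N. M a a * x) = x" by (simp add: sum_distrib_right[symmetric] munitsD(3)[OF munits_inD(1)[OF M(1)]])
 finally show ?thesis .
qed

lemma tn_transfer_mspan: assumes M: "munits_in N M" "munits_in N M'" and w: "w : mspan N M" shows "tn (transfer N M M' w) = tn w"
proof -
 have wR: "w : R" by (rule mspan_in[OF M(1) w])
 have "(transfer N M M' w)\<dagger> * transfer N M M' w = transfer N M M' (w\<dagger> * w)"
  using transfer_mult[OF M _ w, of "w\<dagger>"] transfer_adj[OF M wR] wR by simp
 hence "tr ((transfer N M M' w)\<dagger> * transfer N M M' w) = tr (w\<dagger> * w)"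
  using tr_transfer[OF M, of "w\<dagger> * w" 1] wR by (simp add: tr_one)
 thus ?thesis by (simp add: tn_def)
qed

lemma transfer_inverse: assumes M: "munits_in N M" "munits_in N M'" and w: "w : mspan N M'" shows "transfer N M M' (transfer N M' M w) = w"
proof -
 have "mspan N M' \<subseteq> {z : R. transfer N M M' (transfer N M' M z) = z}"
  by (rule mspan_least) (use munits_inD(2)[OF M(2)] in "auto simp: transfer_0 transfer_base M transfer_add transfer_csc transfer_R")
 thus ?thesis using w by auto
qed

text \<open>For the image \<open>y\<close> of \<open>x\<close> and its preimage \<open>w\<close> in
  the span, \<open>(tn y)\<^sup>2\<close> is the modulus of \<open>tr (x\<dagger> * w)\<close> and
  \<open>tn w = tn y\<close>; Cauchy-Schwarz gives the bound.\<close>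

lemma tn_transfer: assumes M: "munits_in N M" "munits_in N M'" and x: "x : R" shows "tn (transfer N M M' x) <= tn x"
proof -
 define y where "y = transfer N M M' x"
 define w where "w = transfer N M' M y"
 have y: "y : mspan N M'" "y : R" and w: "w : mspan N M" "w : R" using transfer_mspan transfer_R M by (auto simp: y_def w_def)
 have tw: "transfer N M M' w = y" unfolding w_def by (rule transfer_inverse[OF M y(1)])
 have "y\<dagger> * y = transfer N M M' (x\<dagger> * w)"
  using transfer_mult[OF M _ w(1), of "x\<dagger>"] transfer_adj[OF M x] x by (simp add: tw y_def)
 hence "tr (y\<dagger> * y) = tr (x\<dagger> * w)" using tr_transfer[OF M, of "x\<dagger> * w" 1] x w by (simp add: tr_one)
 hence "(tn y)\<^sup>2 = cmod (tr (x\<dagger> * w))" using tr_self[OF y(2)] by (metis norm_of_real abs_power2)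
 also have "... <= tn x * tn w" by (rule tr_cauchy_schwarz[OF x w(2)])
 also have "tn w = tn y" using tn_transfer_mspan[OF M w(1)] tw by simp
 finally have "tn y * tn y <= tn x * tn y" by (simp add: power2_eq_square)
 thus ?thesis using tn_ge_0[OF y(2)] tn_ge_0[OF x] by (cases "tn y = 0") (auto simp: y_def mult_le_cancel_right)
qed

text \<open>\<open>opbound_by_tn\<close> asks only for 2-norms of products with elements of the
  span, where \<open>transfer\<close> is multiplicative and contractive.\<close>

lemma opbound_transfer: assumes M: "munits_in N M" "munits_in N M'" and x: "x : R" "opbound x C" shows "opbound (transfer N M M' x) C"
proof (rule opbound_by_tn)
 show "salg (mspan N M')" by (rule mspan_salg[OF munits_inD[OF M(2)]])
 show "mspan N M' \<subseteq> R" by (rule mspan_R[OF munits_inD(2)[OF M(2)]])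
 show "transfer N M M' x : mspan N M'" by (rule transfer_mspan)
 show "C >= 0" using x(2) by (simp add: opbound_def)
 fix w' assume w'R: "w' : mspan N M'"
 define w where "w = transfer N M' M w'"
 have w: "w : mspan N M" "w : R" using transfer_mspan transfer_R[OF M(1)] by (auto simp: w_def)
 have tw: "transfer N M M' w = w'" unfolding w_def by (rule transfer_inverse[OF M w'R])
 have "tn (transfer N M M' x * w') = tn (transfer N M M' (x * w))" using transfer_mult[OF M x(1) w(1)] tw by simp
 also have "... <= tn (x * w)" using w x by (intro tn_transfer[OF M]) auto
 also have "... <= C * tn w" by (rule tn_mult_left[OF x w(2)])
 also have "tn w = tn w'" using tn_transfer_mspan[OF M w(1)] tw by simp
 finally show "tn (transfer N M M' x * w') <= C * tn w'" .
qed

definition msystem_in :: "(nat => nat) => (nat => nat => nat => 'h bop) => bool" where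
 "msystem_in d G <-> msystem d G & (ALL t. ALL a<d t. ALL b<d t. G t a b : R)"

lemma mprod_in: assumes G: "msystem_in d G" shows "munits_in (msize d m) (mprod d G m)"
proof -
 have "mprod d G m a b : R" if "a < msize d m" "b < msize d m" for a b using that
 proof (induction m arbitrary: a b)
  case (Suc m)
  hence "a < msize d m * d m" "b < msize d m * d m" by simp_all
  thus ?case using Suc.IH[of "a mod msize d m" "b mod msize d m"] index_div[of a "msize d m" "d m"] index_div[of b "msize d m" "d m"] G
   by (simp add: msystem_in_def)
 qed simp
 thus ?thesis using munits_mprod[of d G m] G by (auto simp: munits_in_def msystem_in_def)
qed

text \<open>In both systems the units of one level are coarsenings of those of the next, by the same
  formula, so the maps of later stages extend that of stage \<open>m\<close> from its span.\<close>

lemma transfer_Suc: assumes E: "msystem_in d E" and G: "msystem_in d G" and "m <= k" and x: "x : mspan (msize d m) (mprod d E m)"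
 shows "transfer (msize d k) (mprod d E k) (mprod d G k) x = transfer (msize d m) (mprod d E m) (mprod d G m) x" using assms(3)
proof (induction k rule: dec_induct)
 case (step k)
 note S = mprod_in[OF E, of "Suc k"] mprod_in[OF G, of "Suc k"]
 have xk: "x : mspan (msize d k) (mprod d E k)" using mprod_mono[of d E m k] E x step(1) by (auto simp: msystem_in_def)
 have "transfer (msize d k) (mprod d E k) (mprod d G k) x = transfer (msize d (Suc k)) (mprod d E (Suc k)) (mprod d G (Suc k)) x"
 proof (rule transfer_mspan_eq[OF mprod_in[OF E] mprod_in[OF G] _ _ _ _ xk])
  show "transfer (msize d (Suc k)) (mprod d E (Suc k)) (mprod d G (Suc k)) : R \<rightarrow> R" using transfer_R[OF S(2)] by blast
  fix a b assume ab: "a < msize d k" "b < msize d k"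
  have co: "mprod d H k a b = coarse (msize d k) (d k) (mprod d H (Suc k)) a b" if "msystem_in d H" for H
   using that ab by (intro coarse_mprod[symmetric]) (auto simp: msystem_in_def msystem_def)
  have less: "a + msize d k * c < msize d (Suc k)" "b + msize d k * c < msize d (Suc k)" if "c < d k" for c
   using that ab index_less[of _ "msize d k" c "d k"] by auto
  show "transfer (msize d (Suc k)) (mprod d E (Suc k)) (mprod d G (Suc k)) (mprod d E k a b) = mprod d G k a b" unfolding co[OF E] co[OF G] coarse_def
   by (subst transfer_sum[OF S(1)])
    (use less in "auto simp del: mprod.simps prod.lessThan_Suc simp: transfer_base[OF S(1)] munits_inD(2)[OF S(1)]")
 qed (use transfer_add[OF S(1)] transfer_csc[OF S(1)] in auto)
 with step show ?case by simp
qed simp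

end

locale uhf_factor = tracial_factor R tr
 for R :: "'h::complex_hilbert_space bop set" and tr :: "'h bop => complex" +
 fixes d :: "nat => nat" and E :: "nat => nat => nat => 'h bop" assumes E_sys: "msystem_in d E"
  and E_dense: "x : R ==> \<epsilon> > 0 ==> EX m. EX y:mspan (msize d m) (mprod d E m). tn (x - y) < \<epsilon>"

locale uhf_embedding = uhf_factor R tr d E
 for R :: "'h::complex_hilbert_space bop set" and tr :: "'h bop => complex" and d E +
 fixes G :: "nat => nat => nat => 'h bop" assumes G_sys: "msystem_in d G"
begin

lemmas EG = mprod_in[OF E_sys] mprod_in[OF G_sys]

definition step :: "nat => 'h bop => 'h bop" where
 "step m = transfer (msize d m) (mprod d E m) (mprod d G m)"

abbreviation Q :: "nat => 'h bop set" where "Q m \<equiv> mspan (msize d m) (mprod d E m)"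

text \<open>For \<open>x\<close> in \<open>R\<close> the limit exists by \<open>emb_slim\<close>;
  elsewhere the value is arbitrary.\<close>

definition emb :: "'h bop => 'h bop" where
 "emb x = (SOME y. slim (%m. step m x) y)"

lemma Q_R: "Q m \<subseteq> R" by (rule mspan_R[OF munits_inD(2)[OF EG(1)]])

lemma step_R: "step m x : R" unfolding step_def by (rule transfer_R[OF EG(2)])

text \<open>On the dense union of the spans the maps \<open>step m\<close> are eventually constant.
  They are contractive in the 2-norm and keep the operator bound of \<open>x\<close>, so bounded
  completeness applies.\<close>

lemma emb_slim: assumes x: "x : R" shows "slim (%m. step m x) (emb x)"
proof -
 obtain C where C: "C > 0" "opbound x C" by (rule opbound_ex)
 have "EX M. ALL m>=M. ALL n>=M. tn (step m x - step n x) < e" if e: "e > 0" for e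
 proof -
  obtain M y where y: "y : Q M" "tn (x - y) < e / 2" using E_dense[OF x, of "e / 2"] e by auto
  have yR: "y : R" using y Q_R by auto
  have *: "tn (step m x - step M y) < e / 2" if "m >= M" for m
  proof -
   have "step m x - step m y = step m (x - y)" using transfer_add[OF EG(1), of "x - y" y] x yR by (simp add: step_def)
   moreover have "step m y = step M y" unfolding step_def by (rule transfer_Suc[OF E_sys G_sys that y(1)])
   ultimately have "tn (step m x - step M y) <= tn (x - y)" using tn_transfer[OF EG, of "x - y"] x yR by (simp add: step_def)
   thus ?thesis using y by simp
  qed
  have "tn (step m x - step n x) < e" if "m >= M" "n >= M" for m n
   using tn_triangle_diff[OF step_R[of m x] step_R[of M y] step_R[of n x]] *[OF that(1)] *[OF that(2)]
    tn_diff_commute[OF step_R[of n x] step_R[of M y]] by simp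
  thus ?thesis by blast
 qed
 then obtain y where "slim (%m. step m x) y" using bounded_complete[of "%m. step m x" C] step_R opbound_transfer[OF EG x C(2)]
  by (auto simp: step_def)
 thus ?thesis unfolding emb_def by (rule someI)
qed

lemma emb_R [simp]: "x : R ==> emb x : R" using R_slim[OF step_R emb_slim] .

lemma emb_eqI: "x : R ==> slim (%m. step m x) y ==> emb x = y" using slim_unique[OF emb_slim] .

lemma emb_Q: assumes "x : Q m" shows "emb x = step m x"
proof -
 have "x : R" using assms Q_R by auto
 moreover have "step (k + m) x = step m x" for k unfolding step_def by (rule transfer_Suc[OF E_sys G_sys _ assms]) simp
 ultimately have "slim (%k. step m x) (emb x)" using slim_shift[OF emb_slim, of x m] by simp
 thus ?thesis using slim_unique slim_const by blast
qed

lemma emb_add: "x : R ==> y : R ==> emb (x + y) = emb x + emb y"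
 using slim_add[OF emb_slim emb_slim, of x y] by (intro emb_eqI) (simp_all add: step_def transfer_add[OF EG(1)])

lemma emb_csc: "x : R ==> emb (csc c x) = csc c (emb x)"
 using slim_csc[OF emb_slim, of x c] by (intro emb_eqI) (simp_all add: step_def transfer_csc[OF EG(1)])

lemma emb_zero [simp]: "emb 0 = 0" using emb_csc[of 0 0] by simp

lemma emb_diff: "x : R ==> y : R ==> emb (x - y) = emb x - emb y" using emb_add[of "x - y" y] by simp

lemma emb_sum: "(!!i. i : A ==> f i : R) ==> emb (SUM i:A. f i) = (SUM i:A. emb (f i))"
 by (induction A rule: infinite_finite_induct) (auto simp: emb_add)

lemma emb_adj: "x : R ==> emb (x\<dagger>) = (emb x)\<dagger>" by (rule slim_adj_eq[OF emb_slim emb_slim, symmetric])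
  (simp_all add: step_def transfer_adj[OF EG])

text \<open>A unit at one position is the cofactor of consecutive products, on whose units
  \<open>emb\<close> is explicit.\<close>

lemma emb_unit: assumes "i < d t" "j < d t" shows "emb (E t i j) = G t i j"
proof -
 have cof: "H t i j = cofactor (msize d t) (mprod d H (Suc t)) i j" if H: "msystem_in d H" for H
 proof -
  have "H t i j = (SUM a<msize d t. mprod d H t a a) * H t i j" by (simp add: munitsD(3)[OF munits_inD(1)[OF mprod_in[OF H]]])
  also have "... = cofactor (msize d t) (mprod d H (Suc t)) i j"
   unfolding cofactor_def sum_distrib_right by (intro sum.cong refl) (simp add: index_divmod)
  finally show ?thesis .
 qed
 have b: "emb (mprod d E (Suc t) x y) = mprod d G (Suc t) x y" if "x < msize d (Suc t)" "y < msize d (Suc t)" for x y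
  using emb_Q[OF mspan_base[OF that]] transfer_base[OF EG(1) that] by (simp only: step_def)
 have less: "a + msize d t * k < msize d (Suc t)" if "a < msize d t" "k < d t" for a k using index_less[OF that] by simp
 show ?thesis unfolding cof[OF E_sys] cof[OF G_sys] cofactor_def
  by (subst emb_sum) (use munits_inD(2)[OF mprod_in[OF E_sys, of "Suc t"]] b less assms in "auto simp del: mprod.simps prod.lessThan_Suc")
qed

lemma emb_one: "emb 1 = 1"
proof -
 have "(1 :: 'h bop) : Q 0" using mspan_star_alg[OF munits_inD(1)[OF EG(1)]] by (rule star_algD(1))
 hence "emb 1 = step 0 1" by (rule emb_Q)
 thus ?thesis by (simp add: step_def transfer_def tr_one)
qed

lemma tn_emb_le: "x : R ==> tn (emb x) <= tn x" by (rule tn_slim_le[OF step_R emb_slim]) (auto simp: step_def tn_transfer[OF EG])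

text \<open>The stages are multiplicative only for second factors in the spans. The other second
  factors are reached by density, where \<open>C\<close> and \<open>D\<close> bound the left factors
  \<open>x\<close> and \<open>emb x\<close>.\<close>

lemma emb_mult: assumes x: "x : R" and y: "y : R" shows "emb (x * y) = emb x * emb y"
proof -
 have Q: "emb (x * w) = emb x * emb w" if w: "w : Q m" for w m
 proof (rule slim_unique)
  have wR: "w : R" using w Q_R by auto
  show "slim (%k. step (k + m) (x * w)) (emb (x * w))" using wR x by (intro slim_shift emb_slim) auto
  have "w : Q (k + m)" for k using w mprod_mono[of d E m "k + m"] E_sys by (auto simp: msystem_in_def)
  hence "step (k + m) (x * w) = step (k + m) x * step (k + m) w" for k unfolding step_def by (intro transfer_mult[OF EG x])
  thus "slim (%k. step (k + m) (x * w)) (emb x * emb w)"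
   using slim_mult[OF slim_shift[OF emb_slim[OF x], of m] slim_shift[OF emb_slim[OF wR], of m]] by simp
 qed
 obtain C where C: "C > 0" "opbound x C" by (rule opbound_ex)
 obtain D where D: "D > 0" "opbound (emb x) D" by (rule opbound_ex)
 have small: "tn (emb (x * y) - emb x * emb y) < e" if e: "e > 0" for e
 proof -
  obtain m w where w: "w : Q m" "tn (y - w) < e / (C + D)" using E_dense[OF y, of "e / (C + D)"] C D e by auto
  have wR: "w : R" using w Q_R by auto
  have "emb (x * y) - emb x * emb y = emb (x * (y - w)) - emb x * emb (y - w)" using Q[OF w(1)] x y wR by (simp add: right_diff_distrib emb_diff)
  hence "tn (emb (x * y) - emb x * emb y) <= tn (emb (x * (y - w))) + tn (emb x * emb (y - w))" using x y wR by (simp only:) (intro tn_diff_le, auto)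
  also have "tn (emb (x * (y - w))) <= tn (x * (y - w))" using x y wR by (intro tn_emb_le) auto
  also have "... <= C * tn (y - w)" using tn_mult_left[OF x C(2), of "y - w"] y wR by simp
  also have "tn (emb x * emb (y - w)) <= D * tn (emb (y - w))" using tn_mult_left[OF _ D(2), of "emb (y - w)"] x y wR by simp
  also have "... <= D * tn (y - w)" using D y wR by (intro mult_left_mono tn_emb_le) auto
  finally have "tn (emb (x * y) - emb x * emb y) <= (C + D) * tn (y - w)" by (simp add: distrib_right)
  also have "... < e" using w(2) C D by (simp add: field_simps)
  finally show ?thesis .
 qed
 thus ?thesis using x y tn_small[of "emb (x * y) - emb x * emb y"] by simp
qed

lemma emb_commute: assumes c: "!!t i j. i < d t ==> j < d t ==> c * G t i j = G t i j * c" and x: "x : R" shows "c * emb x = emb x * c"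
proof -
 have "c * step m x = step m x * c" for m unfolding step_def by (rule munits_commute[OF _ transfer_mspan]) (use c in "auto intro: mprod_commute")
 thus ?thesis using slim_unique[OF slim_mult[OF slim_const emb_slim[OF x], of c]] slim_mult[OF emb_slim[OF x] slim_const, of c] by simp
qed

lemma tr_emb: assumes c: "c : R" "!!t i j. i < d t ==> j < d t ==> c * G t i j = G t i j * c" and x: "x : R" shows "tr (c * emb x) = tr c * tr x"
proof (rule LIMSEQ_unique)
 show "(%m. tr (c * step m x)) ----> tr (c * emb x)" using tr_slim[OF _ slim_mult[OF slim_const emb_slim[OF x], of c]] c(1) step_R by simp
 have "tr (c * step m x) = tr c * tr x" for m unfolding step_def by (rule tr_transfer[OF EG x c(1)]) (use c(2) in "auto intro: mprod_commute")
 thus "(%m. tr (c * step m x)) ----> tr c * tr x" by simp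
qed

end

context uhf_factor
begin

text \<open>The construction with \<open>G = E\<close>: the resulting map fixes the dense spans and
  is contractive, so it is the identity, and it is the limit of the expectations.\<close>

lemma expectation_slim: assumes x: "x : R" shows "slim (%m. transfer (msize d m) (mprod d E m) (mprod d E m) x) x"
proof -
 interpret I: uhf_embedding R tr d E E by unfold_locales (rule E_sys)
 have Q: "I.emb w = w" if w: "w : I.Q m" for w m using transfer_mspan_eq[OF I.EG, of "%x. x" m w] w I.emb_Q[OF w] by (simp add: I.step_def)
 have small: "tn (I.emb x - x) < e" if e: "e > 0" for e
 proof -
  obtain m w where w: "w : I.Q m" "tn (x - w) < e / 2" using E_dense[OF x, of "e / 2"] e by auto
  have wR: "w : R" using w I.Q_R by auto
  have "I.emb x - x = I.emb (x - w) - (x - w)" using Q[OF w(1)] x wR by (simp add: I.emb_diff)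
  hence "tn (I.emb x - x) <= tn (I.emb (x - w)) + tn (x - w)" using x wR by (simp only:) (intro tn_diff_le, auto)
  also have "tn (I.emb (x - w)) <= tn (x - w)" using x wR by (intro I.tn_emb_le) auto
  finally show ?thesis using w(2) by simp
 qed
 hence "I.emb x = x" using x tn_small[of "I.emb x - x"] by simp
 thus ?thesis using I.emb_slim[OF x] by (simp add: I.step_def)
qed

end

section \<open>The endomorphism and the corners of the summands\<close>

text \<open>Position \<open>t0\<close> carries the matrices of size \<open>\<Sum>i<n. a i * p i\<close>, indexed by \<open>\<kappa> i x b\<close>, which contain
  the algebra \<open>A\<close> with multiplicities \<open>p i\<close>; the bijections \<open>\<beta> i\<close> describe the endomorphism on the
  corner of a minimal projection in the \<open>i\<close>-th summand.  The positions \<open>\<mu> x\<close> serve to tell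
  the summands apart.\<close>

locale endo_data = uhf_factor R tr d E
 for R :: "'h::complex_hilbert_space bop set" and tr :: "'h bop => complex" and d E +
 fixes n :: nat and a p :: "nat => nat" and \<kappa> :: "nat => nat => nat => nat" and t0 :: nat
  and \<beta> :: "nat => nat => nat" and \<mu> :: "nat => nat" assumes a_pos: "i < n ==> a i > 0" and p_pos: "i < n ==> p i > 0"
  and \<kappa>_less: "i < n ==> x < a i ==> b < p i ==> \<kappa> i x b < d t0"
  and \<kappa>_eq: "i < n ==> x < a i ==> b < p i ==> j < n ==> y < a j ==> c < p j ==>
   \<kappa> i x b = \<kappa> j y c <-> i = j & x = y & b = c" and \<kappa>_surj: "k < d t0 ==> EX i<n. EX x<a i. EX b<p i. k = \<kappa> i x b"
  and \<beta>_bij: "i < n ==> bij (\<beta> i)" and d_\<beta>: "i < n ==> d t = (if \<beta> i t = t0 then p i else d (\<beta> i t))"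
  and \<mu>_inj: "inj \<mu>" and d_\<mu>: "d (\<mu> x) = 2" and \<mu>_t0: "\<mu> x ~= t0" and \<beta>_\<mu>: "i < n ==> \<beta> i (\<mu> x) = \<mu> (n * x + i)"
  and n_pos: "n > 0"
begin

lemma E_units: "munits (d t) (E t)" using E_sys by (auto simp: msystem_in_def msystem_def)

lemma Em: "i < d t ==> j < d t ==> (E t i j)\<dagger> = E t j i"
  "i < d t ==> j < d t ==> k < d t ==> l < d t ==> E t i j * E t k l = (if j = k then E t i l else 0)"
  "(SUM i<d t. E t i i) = 1" "i < d t ==> j < d t ==> E t i j : R"
  "s ~= t ==> k < d s ==> l < d s ==> i < d t ==> j < d t ==> E s k l * E t i j = E t i j * E s k l"
 using E_sys by (auto simp: msystem_in_def msystem_def munitsD[OF E_units])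

lemma tr_E: "i < d t ==> j < d t ==> tr (E t i j) = (if i = j then 1 / of_nat (d t) else 0)"
 using tr_munits[OF E_units Em(4), of t 1 i j] by (simp add: tr_one)

definition e :: "nat => nat => nat => 'h bop" where
 "e i x y = (SUM b<p i. E t0 (\<kappa> i x b) (\<kappa> i y b))"

lemma e_R [simp]: "i < n ==> x < a i ==> y < a i ==> e i x y : R" unfolding e_def by (intro R_sum Em(4) \<kappa>_less) auto

lemma e_adj: "i < n ==> x < a i ==> y < a i ==> (e i x y)\<dagger> = e i y x"
 unfolding e_def adj_sum by (intro sum.cong refl) (simp add: Em(1) \<kappa>_less)

lemma e_mult_E: assumes "i < n" "x < a i" "y < a i" "j < n" "z < a j" "b < p j" "k < d t0"
 shows "e i x y * E t0 (\<kappa> j z b) k = (if i = j & y = z then E t0 (\<kappa> i x b) k else 0)"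
  "E t0 k (\<kappa> j z b) * e i x y = (if i = j & x = z then E t0 k (\<kappa> i y b) else 0)"
proof -
 have "e i x y * E t0 (\<kappa> j z b) k = (SUM c<p i. if c = b then (if i = j & y = z then E t0 (\<kappa> i x b) k else 0) else 0)"
  unfolding e_def sum_distrib_right by (intro sum.cong refl) (use assms in "auto simp: Em(2) \<kappa>_less \<kappa>_eq")
 thus "e i x y * E t0 (\<kappa> j z b) k = (if i = j & y = z then E t0 (\<kappa> i x b) k else 0)" using assms by auto
 have "E t0 k (\<kappa> j z b) * e i x y = (SUM c<p i. if c = b then (if i = j & x = z then E t0 k (\<kappa> i y b) else 0) else 0)"
  unfolding e_def sum_distrib_left by (intro sum.cong refl) (use assms in "auto simp: Em(2) \<kappa>_less \<kappa>_eq")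
 thus "E t0 k (\<kappa> j z b) * e i x y = (if i = j & x = z then E t0 k (\<kappa> i y b) else 0)" using assms by auto
qed

lemma e_mult: assumes "i < n" "x < a i" "y < a i" "j < n" "z < a j" "w < a j" shows "e i x y * e j z w = (if i = j & y = z then e i x w else 0)"
proof -
 have "e i x y * e j z w = (SUM b<p j. if i = j & y = z then E t0 (\<kappa> i x b) (\<kappa> j w b) else 0)"
  unfolding e_def[of j] sum_distrib_left by (intro sum.cong refl) (use assms in "auto simp: e_mult_E \<kappa>_less")
 thus ?thesis by (auto simp: e_def[of _ x w])
qed

lemma e_sum: "(SUM i<n. SUM x<a i. e i x x) = 1"
proof -
 let ?S = "Sigma {..<n} (%i. {..<a i} \<times> {..<p i})"
 have "(%(i, x, b). \<kappa> i x b) ` ?S = {..<d t0}" using \<kappa>_less \<kappa>_surj by force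
 moreover have "inj_on (%(i, x, b). \<kappa> i x b) ?S" using \<kappa>_eq by (auto simp: inj_on_def)
 ultimately have bij: "bij_betw (%(i, x, b). \<kappa> i x b) ?S {..<d t0}" by (simp add: bij_betw_def)
 have "(SUM i<n. SUM x<a i. e i x x) = (SUM (i, x, b):?S. E t0 (\<kappa> i x b) (\<kappa> i x b))"
  by (simp add: e_def sum.Sigma sum.cartesian_product)
 also have "... = (SUM k<d t0. E t0 k k)" using sum.reindex_bij_betw[OF bij, of "%k. E t0 k k"] by (simp add: case_prod_unfold)
 finally show ?thesis by (simp add: Em(3))
qed

lemma e_commute: "i < n ==> x < a i ==> y < a i ==> t ~= t0 ==> k < d t ==> l < d t ==> e i x y * E t k l = E t k l * e i x y"
 unfolding e_def sum_distribs by (intro sum.cong refl Em(5)) (auto simp: \<kappa>_less)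

lemma tr_e: assumes "i < n" "x < a i" "y < a i" shows "tr (e i x y) = (if x = y then of_nat (p i) / of_nat (d t0) else 0)"
proof -
 have "tr (e i x y) = (SUM b<p i. tr (E t0 (\<kappa> i x b) (\<kappa> i y b)))"
  unfolding e_def using assms by (intro tr_sum Em(4)) (auto simp: \<kappa>_less)
 also have "... = (SUM b<p i. if x = y then 1 / of_nat (d t0) else 0)"
  by (intro sum.cong refl) (use assms in "simp add: tr_E \<kappa>_less \<kappa>_eq")
 finally show ?thesis by simp
qed

abbreviation f :: "nat => 'h bop" where "f i \<equiv> e i 0 0"

lemma f_simps [simp]: "i < n ==> f i : R" "i < n ==> f i * f i = f i" "i < n ==> (f i)\<dagger> = f i" by (simp_all add: a_pos e_mult e_adj)

lemma f_projn: "i < n ==> projn (f i)" by (simp add: projn_def)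

text \<open>Copies of \<open>h i\<close>, an element of the corner of \<open>f i\<close>, along the
  diagonal of the \<open>i\<close>-th summand. By \<open>e_amp\<close> the result commutes with
  every \<open>e i x y\<close>, and by \<open>amp_mult\<close> products are computed in the
  corners.\<close>

definition amp :: "(nat => 'h bop) => 'h bop" where
 "amp h = (SUM i<n. SUM x<a i. e i x 0 * h i * e i 0 x)"

definition corner :: "(nat => 'h bop) => bool" where
 "corner h <-> (ALL i<n. h i : R & f i * h i = h i & h i * f i = h i)"

lemma cornerD: "corner h ==> i < n ==> h i : R" "corner h ==> i < n ==> f i * h i = h i" "corner h ==> i < n ==> h i * f i = h i"
 by (auto simp: corner_def)

lemma amp_R: "corner h ==> amp h : R" unfolding amp_def by (intro R_sum R_simps) (auto simp: cornerD a_pos)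

lemma e_amp: assumes h: "corner h" and i: "i < n" "x < a i" "y < a i"
 shows "e i x y * amp h = e i x 0 * h i * e i 0 y" "amp h * e i x y = e i x 0 * h i * e i 0 y"
proof -
 have 1: "e i x y * (e j z 0 * h j * e j 0 z) = (if j = i then if z = y then e i x 0 * h i * e i 0 y else 0 else 0)"
  if "j < n" "z < a j" for j z using that i a_pos by (simp add: mult.assoc[symmetric] e_mult)
 have "e i x y * amp h = (SUM j<n. SUM z<a j. if j = i then if z = y then e i x 0 * h i * e i 0 y else 0 else 0)"
  unfolding amp_def sum_distrib_left by (intro sum.cong refl) (simp add: 1)
 also have "... = (SUM j<n. if j = i then SUM z<a i. if z = y then e i x 0 * h i * e i 0 y else 0 else 0)" by (intro sum.cong refl) auto
 finally show "e i x y * amp h = e i x 0 * h i * e i 0 y" using i by simp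
 have 2: "(e j z 0 * h j * e j 0 z) * e i x y = (if j = i then if z = x then e i x 0 * h i * e i 0 y else 0 else 0)"
  if "j < n" "z < a j" for j z using that i a_pos by (simp add: mult.assoc e_mult)
 have "amp h * e i x y = (SUM j<n. SUM z<a j. if j = i then if z = x then e i x 0 * h i * e i 0 y else 0 else 0)"
  unfolding amp_def sum_distrib_right by (intro sum.cong refl) (simp add: 2)
 also have "... = (SUM j<n. if j = i then SUM z<a i. if z = x then e i x 0 * h i * e i 0 y else 0 else 0)" by (intro sum.cong refl) auto
 finally show "amp h * e i x y = e i x 0 * h i * e i 0 y" using i by simp
qed

lemma f_amp: "corner h ==> i < n ==> f i * amp h = h i" by (simp add: e_amp a_pos cornerD)

lemma amp_mult: assumes h: "corner h" and h': "corner h'" shows "amp h * amp h' = amp (%i. h i * h' i)"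
proof -
 have "amp h * (e i x 0 * h' i * e i 0 x) = e i x 0 * (h i * h' i) * e i 0 x" if i: "i < n" "x < a i" for i x
 proof -
  have "amp h * (e i x 0 * h' i * e i 0 x) = (amp h * e i x 0) * h' i * e i 0 x" by (simp only: mult.assoc)
  also have "amp h * e i x 0 = e i x 0 * h i * f i" by (rule e_amp(2)[OF h]) (use i a_pos in auto)
  also have "... * h' i * e i 0 x = e i x 0 * (h i * (f i * h' i)) * e i 0 x" by (simp only: mult.assoc)
  finally show ?thesis using cornerD(2)[OF h' i(1)] by simp
 qed
 thus ?thesis unfolding amp_def[of h'] amp_def[of "%i. h i * h' i"] sum_distrib_left by (intro sum.cong refl) auto
qed

lemma amp_adj: "(amp h)\<dagger> = amp (%i. (h i)\<dagger>)" unfolding amp_def adj_sum by (intro sum.cong refl) (simp add: e_adj a_pos mult.assoc)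

lemma amp_sum: "amp (%i. SUM b:B. h b i) = (SUM b:B. amp (h b))" unfolding amp_def sum_distribs sum.swap[of _ B] by (simp add: sum.swap[of _ B])

lemma amp_f: "amp f = 1"
proof -
 have "amp f = (SUM i<n. SUM x<a i. e i x x)" unfolding amp_def by (intro sum.cong refl) (simp add: e_mult a_pos)
 thus ?thesis by (simp add: e_sum)
qed

lemma amp_cong: "(!!i. i < n ==> h i = h' i) ==> amp h = amp h'" by (simp add: amp_def)

text \<open>The image of position \<open>t\<close> in the corner of \<open>f i\<close>. At
  \<open>t0\<close> only a block of size \<open>p i\<close> lies below \<open>f i\<close>; units at
  other positions commute with \<open>f i\<close> and are cut down by it.\<close>

definition H :: "nat => nat => nat => nat => 'h bop" where
 "H i t b c = (if \<beta> i t = t0 then E t0 (\<kappa> i 0 b) (\<kappa> i 0 c) else f i * E (\<beta> i t) b c)"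

lemma d_\<beta>': "i < n ==> \<beta> i t = t0 ==> d t = p i" "i < n ==> \<beta> i t ~= t0 ==> d (\<beta> i t) = d t" using d_\<beta>[of i t] by auto

lemma f_commute: "i < n ==> t ~= t0 ==> k < d t ==> l < d t ==> f i * E t k l = E t k l * f i" by (rule e_commute) (auto simp: a_pos)

lemma H_corner: assumes "b < d t" "c < d t" shows "corner (%i. H i t b c)" unfolding corner_def
proof (intro allI impI conjI)
 fix i assume i: "i < n"
 show "H i t b c : R" using i assms d_\<beta>'[of i t] by (cases "\<beta> i t = t0") (simp_all add: H_def Em(4) \<kappa>_less a_pos)
 show "f i * H i t b c = H i t b c"
  using i assms d_\<beta>'[of i t] by (cases "\<beta> i t = t0") (simp_all add: H_def e_mult_E \<kappa>_less a_pos mult.assoc[symmetric])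
 show "H i t b c * f i = H i t b c"
 proof (cases "\<beta> i t = t0")
  case False
  thus ?thesis using i assms d_\<beta>'[of i t] f_commute[of i "\<beta> i t" b c] by (simp add: H_def mult.assoc)
 qed (use i assms d_\<beta>'[of i t] in "simp add: H_def e_mult_E \<kappa>_less a_pos")
qed

lemma fE_mult: assumes "i < n" "t ~= t0" "k < d t" "l < d t" shows "f i * (E t k l * (f i * y)) = f i * (E t k l * y)"
proof -
 have "f i * (E t k l * (f i * y)) = f i * ((f i * E t k l) * y)" by (simp only: f_commute[OF assms] mult.assoc)
 also have "... = (f i * f i) * (E t k l * y)" by (simp only: mult.assoc)
 finally show ?thesis using assms(1) by simp
qed

lemma H_mult: assumes "i < n" "b < d t" "c < d t" "b' < d t" "c' < d t" shows "H i t b c * H i t b' c' = (if c = b' then H i t b c' else 0)"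
 using assms d_\<beta>'[of i t] by (cases "\<beta> i t = t0") (simp_all add: H_def Em(2) \<kappa>_less \<kappa>_eq a_pos fE_mult mult.assoc)

lemma H_adj: assumes "i < n" "b < d t" "c < d t" shows "(H i t b c)\<dagger> = H i t c b"
 using assms d_\<beta>'[of i t] f_commute[of i "\<beta> i t" c b] by (cases "\<beta> i t = t0") (simp_all add: H_def Em(1) \<kappa>_less a_pos)

lemma H_sum: assumes "i < n" shows "(SUM b<d t. H i t b b) = f i"
proof (cases "\<beta> i t = t0")
 case True
 thus ?thesis using d_\<beta>'[of i t] assms by (simp add: H_def e_def)
next
 case False
 thus ?thesis using d_\<beta>'(2)[of i t] Em(3)[of "\<beta> i t"] assms by (simp add: H_def sum_distrib_left[symmetric])
qed

lemma H_commute: assumes i: "i < n" and st: "s ~= t" and b: "b < d s" "c < d s" "b' < d t" "c' < d t"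
 shows "H i s b c * H i t b' c' = H i t b' c' * H i s b c"
proof -
 have ne: "\<beta> i s ~= \<beta> i t" using \<beta>_bij[OF i] st by (auto simp: bij_def inj_eq)
 have fE0: "f i * E t0 (\<kappa> i 0 b) (\<kappa> i 0 c) = E t0 (\<kappa> i 0 b) (\<kappa> i 0 c)" "E t0 (\<kappa> i 0 b) (\<kappa> i 0 c) * f i = E t0 (\<kappa> i 0 b) (\<kappa> i 0 c)"
  if "b < p i" "c < p i" for b c using that i by (auto simp: e_mult_E \<kappa>_less a_pos)
 have mixed: "E t0 (\<kappa> i 0 b) (\<kappa> i 0 c) * (f i * E u k l) = (f i * E u k l) * E t0 (\<kappa> i 0 b) (\<kappa> i 0 c)"
  if "b < p i" "c < p i" "u ~= t0" "k < d u" "l < d u" for b c u k l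
 proof -
  have "E t0 (\<kappa> i 0 b) (\<kappa> i 0 c) * (f i * E u k l) = E t0 (\<kappa> i 0 b) (\<kappa> i 0 c) * E u k l"
   by (simp add: mult.assoc[symmetric] fE0 that)
  also have "... = E u k l * (f i * E t0 (\<kappa> i 0 b) (\<kappa> i 0 c))" using that i by (simp add: fE0 Em(5)[of t0 u] \<kappa>_less a_pos)
  finally show ?thesis using f_commute[OF i that(3-5)] by (simp add: mult.assoc[symmetric])
 qed
 show ?thesis
 proof (cases "\<beta> i s = t0 | \<beta> i t = t0")
  case True
  thus ?thesis using mixed[of b c "\<beta> i t" b' c'] mixed[of b' c' "\<beta> i s" b c] ne b d_\<beta>'[OF i] by (auto simp: H_def)
 next
  case False
  thus ?thesis using ne b d_\<beta>'[OF i] by (simp add: H_def fE_mult i Em(5)[of "\<beta> i s" "\<beta> i t"] mult.assoc)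
 qed
qed

definition G :: "nat => nat => nat => 'h bop" where
 "G t b c = amp (%i. H i t b c)"

lemma G_msystem: "msystem_in d G" unfolding msystem_in_def msystem_def munits_def
proof (intro conjI allI impI)
 fix t b c assume bc: "b < d t" "c < d t"
 show "G t b c : R" unfolding G_def by (rule amp_R[OF H_corner[OF bc]])
 show "(G t b c)\<dagger> = G t c b" unfolding G_def amp_adj by (rule amp_cong) (simp add: H_adj bc)
 fix b' c' assume bc': "b' < d t" "c' < d t"
 have "G t b c * G t b' c' = amp (%i. H i t b c * H i t b' c')" unfolding G_def by (rule amp_mult[OF H_corner[OF bc] H_corner[OF bc']])
 also have "... = amp (%i. if c = b' then H i t b c' else 0)" by (rule amp_cong) (simp add: H_mult bc bc')
 also have "... = (if c = b' then G t b c' else 0)" by (simp add: G_def amp_def)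
 finally show "G t b c * G t b' c' = (if c = b' then G t b c' else 0)" .
next
 fix t
 have "(SUM b<d t. G t b b) = amp (%i. SUM b<d t. H i t b b)" unfolding G_def amp_sum by (rule refl)
 also have "... = amp f" by (rule amp_cong) (rule H_sum)
 finally show "(SUM b<d t. G t b b) = 1" by (simp add: amp_f)
next
 fix s t b c b' c' assume *: "s ~= t" "b < d s" "c < d s" "b' < d t" "c' < d t"
 have "G s b c * G t b' c' = amp (%i. H i s b c * H i t b' c')" unfolding G_def by (rule amp_mult) (use H_corner * in auto)
 also have "... = amp (%i. H i t b' c' * H i s b c)" by (rule amp_cong) (use H_commute * in auto)
 also have "... = G t b' c' * G s b c" unfolding G_def by (rule amp_mult[symmetric]) (use H_corner * in auto)
 finally show "G s b c * G t b' c' = G t b' c' * G s b c" .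
qed

end

sublocale endo_data \<subseteq> uhf_embedding R tr d E G by unfold_locales (rule G_msystem)

context endo_data
begin

lemma e_emb: "i < n ==> x < a i ==> y < a i ==> z : R ==> e i x y * emb z = emb z * e i x y"
 by (rule emb_commute) (simp_all add: G_def e_amp H_corner)

lemma tr_e_emb: assumes "i < n" "x < a i" "y < a i" "z : R" shows "tr (e i x y * emb z) = (if x = y then of_nat (p i) / of_nat (d t0) * tr z else 0)"
 using tr_emb[of "e i x y" z] assms by (simp add: tr_e G_def e_amp H_corner)

lemma d_t0_pos: "d t0 > 0"
proof -
 have "\<kappa> 0 0 0 < d t0" using n_pos by (intro \<kappa>_less) (auto simp: a_pos p_pos)
 thus ?thesis by simp
qed

abbreviation weight :: "nat => real" where "weight i \<equiv> real (p i) / real (d t0)"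

lemma weight_pos: "i < n ==> weight i > 0" using p_pos d_t0_pos by simp

lemma f_emb: "i < n ==> z : R ==> f i * emb z = emb z * f i" by (rule e_emb) (auto simp: a_pos)

lemma f_emb_mult: assumes "i < n" "y : R" "z : R" shows "(f i * emb y) * (f i * emb z) = f i * emb (y * z)"
proof -
 have "(f i * emb y) * (f i * emb z) = emb y * ((f i * f i) * emb z)" by (simp only: f_emb[OF assms(1,2)] mult.assoc)
 also have "... = f i * (emb y * emb z)" using f_emb[OF assms(1,2)] assms by (simp add: mult.assoc[symmetric])
 finally show ?thesis using assms by (simp add: emb_mult)
qed

text \<open>The trace of a product of \<open>f i\<close> with an image is the product of traces, so
  the map multiplies the 2-norm by a positive constant. This makes it injective and its image closed
  under bounded limits.\<close>

lemma tn_f_emb: assumes i: "i < n" and z: "z : R" shows "tn (f i * emb z) = sqrt (weight i) * tn z"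
proof -
 have "(f i * emb z)\<dagger> * (f i * emb z) = (f i * emb (z\<dagger>)) * (f i * emb z)"
  using i z f_emb[OF i, of "z\<dagger>"] by (simp add: emb_adj)
 also have "... = f i * emb (z\<dagger> * z)" using i z by (simp add: f_emb_mult)
 finally have "tr ((f i * emb z)\<dagger> * (f i * emb z)) = of_real (weight i) * tr (z\<dagger> * z)"
  using i z by (simp only:) (simp add: tr_e_emb a_pos)
 hence "Re (tr ((f i * emb z)\<dagger> * (f i * emb z))) = weight i * Re (tr (z\<dagger> * z))"
  by (simp only: times_complex.sel Re_complex_of_real Im_complex_of_real mult_zero_left diff_zero)
 thus ?thesis by (simp only: tn_def real_sqrt_mult)
qed

lemma f_emb_0: "i < n ==> z : R ==> f i * emb z = 0 ==> z = 0" using tn_f_emb[of i z] weight_pos[of i] tn_eq_0[of z]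
 by (metis less_irrefl mult_eq_0_iff real_sqrt_eq_zero_cancel_iff tn_zero)

definition fS :: "nat => 'h bop set" where "fS i = {f i * emb z | z. z : R}"

lemma fS_add: "x : fS i ==> y : fS i ==> x + y : fS i" unfolding fS_def by (clarify, rule_tac x = "z + za" in exI) (simp add: emb_add distrib_left)

lemma fS_csc: "x : fS i ==> csc c x : fS i" unfolding fS_def by (clarify, rule_tac x = "csc c z" in exI) (simp add: emb_csc csc_mult_right)

lemma fS_mult: "i < n ==> x : fS i ==> y : fS i ==> x * y : fS i" unfolding fS_def by (clarify, rule_tac x = "z * za" in exI) (simp add: f_emb_mult)

lemma fS_0: "0 : fS i" unfolding fS_def by (intro CollectI exI[of _ 0]) simp

lemma fS_H: assumes "i < n" "b < d t" "c < d t" shows "H i t b c : fS i"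
proof -
 have "f i * emb (E t b c) = H i t b c" using assms by (simp add: emb_unit G_def f_amp H_corner)
 thus ?thesis using assms unfolding fS_def by (metis (mono_tags, lifting) Em(4) mem_Collect_eq)
qed

lemma fS_E: assumes i: "i < n" and t: "t ~= t0" "k < d t" "l < d t" shows "f i * E t k l : fS i"
proof -
 obtain u where u: "\<beta> i u = t" using \<beta>_bij[OF i] by (metis bij_pointE)
 thus ?thesis using fS_H[OF i, of k u l] d_\<beta>'(2)[OF i, of u] t by (simp add: H_def)
qed

lemma fS_E0: assumes i: "i < n" and k: "k < d t0" "l < d t0" shows "f i * E t0 k l * f i : fS i"
proof -
 obtain u where u: "\<beta> i u = t0" using \<beta>_bij[OF i] by (metis bij_pointE)
 obtain j x b where j: "j < n" "x < a j" "b < p j" "k = \<kappa> j x b" using \<kappa>_surj[OF k(1)] by blast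
 obtain j' x' b' where j': "j' < n" "x' < a j'" "b' < p j'" "l = \<kappa> j' x' b'" using \<kappa>_surj[OF k(2)] by blast
 have 1: "f i * E t0 k l = (if i = j & x = 0 then E t0 (\<kappa> i 0 b) l else 0)" using e_mult_E(1)[of i 0 0 j x b l] i j k a_pos by auto
 have 2: "E t0 (\<kappa> i 0 b) l * f i = (if i = j' & x' = 0 then E t0 (\<kappa> i 0 b) (\<kappa> i 0 b') else 0)" if "i = j"
  using e_mult_E(2)[of i 0 0 j' x' b' "\<kappa> i 0 b"] i j j' k a_pos that by (auto simp: \<kappa>_less)
 have "E t0 (\<kappa> i 0 b) (\<kappa> i 0 b') : fS i" if "i = j" "i = j'"
  using fS_H[OF i, of b u b'] d_\<beta>'(1)[OF i u] j j' that u by (simp add: H_def)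
 thus ?thesis using 1 2 by (auto simp: fS_0)
qed

text \<open>\<open>f i\<close> commutes with the units at positions other than \<open>t0\<close>, so
  the compression of a product of units splits over the positions. Each factor is a unit
  \<open>H\<close> of the corner or zero, because \<open>\<beta> i\<close> is onto.\<close>

lemma fS_Q: assumes i: "i < n" and w: "w : Q m" shows "f i * w * f i : fS i"
proof -
 have base: "f i * mprod d E m x y * f i : fS i" if "x < msize d m" "y < msize d m" for x y using that
 proof (induction m arbitrary: x y)
  case 0
  have "f i * emb 1 = f i" by (simp add: emb_one)
  hence "f i : fS i" unfolding fS_def by (metis (mono_tags, lifting) R_simps(1) mem_Collect_eq)
  thus ?case using i by simp
 next
  case (Suc m)
  let ?X = "mprod d E m (x mod msize d m) (y mod msize d m)" and ?Y = "E m (x div msize d m) (y div msize d m)"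
  have less: "x mod msize d m < msize d m" "y mod msize d m < msize d m" "x div msize d m < d m" "y div msize d m < d m"
   using Suc.prems index_div[of x "msize d m" "d m"] index_div[of y "msize d m" "d m"] by simp_all
  have IH: "f i * ?X * f i : fS i" by (rule Suc.IH[OF less(1,2)])
  show ?case
  proof (cases "m = t0")
   case True
   have "f i * ?X = ?X * f i" by (rule mprod_commute[OF _ less(1,2)]) (use True i in "auto intro: f_commute")
   hence "f i * (?X * ?Y) * f i = (f i * f i) * (?X * ?Y) * f i" using i by simp
   also have "... = f i * (?X * f i) * (?Y * f i)" using `f i * ?X = ?X * f i` by (metis (no_types, lifting) mult.assoc)
   also have "... = (f i * ?X * f i) * (f i * ?Y * f i)" using f_simps(2)[OF i] by (metis (no_types, lifting) mult.assoc)
   finally show ?thesis using fS_mult[OF i IH fS_E0[OF i]] less True by simp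
  next
   case False
   have fy: "f i * ?Y = ?Y * f i" by (rule f_commute[OF i False less(3,4)])
   have "f i * (?X * ?Y) * f i = f i * ?X * (?Y * (f i * f i))" using i by (simp add: mult.assoc)
   also have "... = (f i * ?X * f i) * (f i * ?Y)" using fy by (metis (no_types, lifting) mult.assoc)
   finally show ?thesis using fS_mult[OF i IH fS_E[OF i False less(3,4)]] by simp
  qed
 qed
 have "Q m \<subseteq> {w. f i * w * f i : fS i}" by (rule mspan_least) (auto simp: base fS_0 distrib_left distrib_right intro: fS_add fS_csc)
 with w show ?thesis by auto
qed

text \<open>Compressed expectations of \<open>y\<close> have the form
  \<open>f i * emb (z m)\<close>. As this map only scales the 2-norm, the \<open>z m\<close> are
  bounded and Cauchy like the expectations, and their limit is the required
  \<open>z\<close>.\<close>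

lemma corner_emb: assumes i: "i < n" and y: "y : R" "f i * y = y" "y * f i = y" shows "EX z:R. y = f i * emb z"
proof -
 define w where "w m = transfer (msize d m) (mprod d E m) (mprod d E m) y" for m
 have wQ: "w m : Q m" and wR: "w m : R" for m using transfer_mspan transfer_R[OF mprod_in[OF E_sys]] by (auto simp: w_def)
 have ws: "slim w y" unfolding w_def by (rule expectation_slim[OF y(1)])
 have "EX z. ALL m. z m : R & f i * w m * f i = f i * emb (z m)" using fS_Q[OF i wQ] unfolding fS_def by (intro choice) blast
 then obtain z where z: "!!m. z m : R" "!!m. f i * w m * f i = f i * emb (z m)" by blast
 obtain C where C: "C > 0" "opbound y C" by (rule opbound_ex)
 have wb: "opbound (w m) C" for m unfolding w_def by (rule opbound_transfer[OF mprod_in[OF E_sys] mprod_in[OF E_sys] y(1) C(2)])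
 have fwf: "opbound (f i * w m * f i) C" for m
  using opbound_mult[OF opbound_mult[OF projn_opbound[OF f_projn[OF i]] wb] projn_opbound[OF f_projn[OF i]]] by simp
 have sw: "sqrt (weight i) > 0" using weight_pos[OF i] by simp
 \<comment> \<open>The operator bound is carried back through 2-norms of products; the factor
   \<open>sqrt (weight i)\<close> cancels.\<close>
 have zb: "opbound (z m) C" for m
 proof (rule opbound_by_tn[OF R_salg subset_refl z(1)])
  fix v assume v: "v : R"
  have "sqrt (weight i) * tn (z m * v) = tn ((f i * emb (z m)) * (f i * emb v))" using i v z(1)[of m] by (simp add: f_emb_mult tn_f_emb)
  also have "... <= C * tn (f i * emb v)" using tn_mult_left[OF _ fwf, of m "f i * emb v"] i v z(1)[of m] unfolding z(2) by simp
  also have "... = sqrt (weight i) * (C * tn v)" using i v by (simp add: tn_f_emb)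
  finally show "tn (z m * v) <= C * tn v" using sw by (simp only: mult_le_cancel_left_pos)
 qed (use C in simp)
 have wy: "(%m. tn (w m - y)) ----> 0" by (rule slim_tn[OF wR ws])
 have zz: "sqrt (weight i) * tn (z m - z k) <= tn (w m - w k)" for m k
 proof -
  have "sqrt (weight i) * tn (z m - z k) = tn (f i * emb (z m) - f i * emb (z k))"
   using i z(1) tn_f_emb[OF i, of "z m - z k"] by (simp add: emb_diff right_diff_distrib)
  also have "... = tn (f i * (w m - w k) * f i)" by (simp add: z(2)[symmetric] diff_distribs)
  also have "... <= tn (f i * (w m - w k))" using i wR by (intro tn_projn_right f_projn) auto
  also have "... <= tn (w m - w k)" using i wR by (intro tn_projn_left f_projn) auto
  finally show ?thesis .
 qed
 have "EX M. ALL m>=M. ALL k>=M. tn (z m - z k) < \<epsilon>" if \<epsilon>: "\<epsilon> > 0" for \<epsilon>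
 proof -
  have "\<forall>\<^sub>F m in sequentially. tn (w m - y) < sqrt (weight i) * \<epsilon> / 2"
   using wy sw \<epsilon> by (intro order_tendstoD(2)[of _ 0]) auto
  then obtain M where M: "ALL m>=M. tn (w m - y) < sqrt (weight i) * \<epsilon> / 2" by (auto simp: eventually_sequentially)
  have "tn (z m - z k) < \<epsilon>" if "m >= M" "k >= M" for m k
  proof -
   have "tn (w m - w k) <= tn (w m - y) + tn (w k - y)" using tn_triangle_diff[OF wR y(1) wR, of m k] tn_diff_commute[OF y(1) wR] by simp
   also have "... < sqrt (weight i) * \<epsilon>" using M[rule_format, OF that(1)] M[rule_format, OF that(2)] by simp
   finally have "sqrt (weight i) * tn (z m - z k) < sqrt (weight i) * \<epsilon>" by (rule order.strict_trans1[OF zz])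
   thus ?thesis by (simp only: mult_less_cancel_left_pos[OF sw])
  qed
  thus ?thesis by blast
 qed
 then obtain z' where z': "z' : R" "(%m. tn (z m - z')) ----> 0" using bounded_complete[of z C, OF z(1) zb] by blast
 have "(%m. sqrt (weight i) * tn (z m - z')) ----> 0" using tendsto_mult_left[OF z'(2), of "sqrt (weight i)"] by simp
 moreover have "tn (f i * emb (z m) - f i * emb z') = sqrt (weight i) * tn (z m - z')" for m
  using i z(1) z'(1) tn_f_emb[OF i, of "z m - z'"] by (simp add: emb_diff right_diff_distrib)
 ultimately have 1: "(%m. tn (f i * emb (z m) - f i * emb z')) ----> 0" by simp
 have "slim (%m. f i * w m * f i) (f i * y * f i)" by (intro slim_mult slim_const ws)
 hence 2: "(%m. tn (f i * emb (z m) - y)) ----> 0" using slim_tn[of "%m. f i * w m * f i" y] i z(1) y by (simp add: z(2))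
 have "y = f i * emb z'" by (rule tn_limit_unique[OF _ y(1) _ 2 1]) (use i z(1) z'(1) in auto)
 thus ?thesis using z'(1) by blast
qed

section \<open>Signs at the positions \<open>\<mu> x\<close> and the relative commutants\<close>

definition \<sigma> :: "nat => 'h bop" where "\<sigma> x = E (\<mu> x) 0 0 - E (\<mu> x) 1 1"

lemma \<sigma>: "\<sigma> x : R" "\<sigma> x * \<sigma> x = 1" "opbound (\<sigma> x) 1"
proof -
 have 1: "E (\<mu> x) 0 0 + E (\<mu> x) 1 1 = 1" using Em(3)[of "\<mu> x"] by (simp add: d_\<mu> numeral_2_eq_2)
 show "\<sigma> x : R" by (simp add: \<sigma>_def Em(4) d_\<mu>)
 show 2: "\<sigma> x * \<sigma> x = 1" using 1 by (simp add: \<sigma>_def diff_distribs Em(2) d_\<mu>)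
 have "(\<sigma> x)\<dagger> = \<sigma> x" by (simp add: \<sigma>_def Em(1) d_\<mu>)
 thus "opbound (\<sigma> x) 1" using 2 psd_square[of 0] by (simp add: opbound_psd)
qed

lemma \<sigma>_Q: assumes "m <= \<mu> x" "w : Q m" shows "\<sigma> x * w = w * \<sigma> x"
proof (rule munits_commute[OF _ assms(2)])
 fix b c assume bc: "b < msize d m" "c < msize d m"
 have "E (\<mu> x) k k * mprod d E m b c = mprod d E m b c * E (\<mu> x) k k" if "k < 2" for k
  using msystem_mprod_commute[of d E b m c "\<mu> x" k k] E_sys bc assms(1) that by (simp add: msystem_in_def d_\<mu>)
 thus "\<sigma> x * mprod d E m b c = mprod d E m b c * \<sigma> x" by (simp add: \<sigma>_def diff_distribs)
qed

lemma tr_\<sigma>: assumes c: "c : R" "!!k l. k < 2 ==> l < 2 ==> c * E (\<mu> x) k l = E (\<mu> x) k l * c" shows "tr (c * \<sigma> x) = 0"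
proof -
 have *: "tr (c * E (\<mu> x) k k) = tr c / 2" if "k < 2" for k
  using tr_munits[OF E_units Em(4) c(1), of "\<mu> x" k k] c(2) that by (simp add: d_\<mu>)
 show ?thesis using c(1) by (simp add: \<sigma>_def right_diff_distrib tr_diff Em(4) d_\<mu> *)
qed

text \<open>\<open>A\<close> and \<open>B\<close> are approximated from finitely many positions. Far
  out \<open>\<sigma> u\<close> commutes with the approximants, and \<open>\<sigma> v\<close> has
  trace zero against everything from the other positions. The tolerance for \<open>B\<close> depends
  on the bound \<open>D\<close> of the approximant of \<open>A\<close>.\<close>

lemma \<sigma>_mixing: assumes A: "A : R" and B: "B : R" and eps: "\<epsilon> > 0"
 shows "EX N. ALL u>=N. ALL v>=N. u ~= v --> cmod (tr (A * \<sigma> u * B * \<sigma> v)) < \<epsilon>"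
proof -
 obtain C where C: "C > 0" "opbound B C" by (rule opbound_ex)
 obtain m A' where A': "A' : Q m" "tn (A - A') < \<epsilon> / (2 * C)" using E_dense[OF A, of "\<epsilon> / (2 * C)"] eps C by auto
 obtain D where D: "D > 0" "opbound A' D" by (rule opbound_ex)
 obtain k B' where B': "B' : Q k" "tn (B - B') < \<epsilon> / (2 * D)" using E_dense[OF B, of "\<epsilon> / (2 * D)"] eps D by auto
 define K where "K = max m k"
 have E1: "msystem d E" using E_sys by (simp add: msystem_in_def)
 have K: "A' : Q K" "B' : Q K" using A'(1) B'(1) mprod_mono[OF E1, of m K] mprod_mono[OF E1, of k K] by (auto simp: K_def)
 have AB: "A' : R" "B' : R" using K Q_R by auto
 have "finite (\<mu> -` {..<K})" using \<mu>_inj by (intro finite_vimageI) auto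
 then obtain N where N: "\<mu> -` {..<K} \<subseteq> {..<N}" using finite_nat_iff_bounded by blast
 have big: "\<mu> u >= K" if "u >= N" for u using N that by (meson lessThan_iff not_le subsetD vimageI)
 have "cmod (tr (A * \<sigma> u * B * \<sigma> v)) < \<epsilon>" if uv: "u >= N" "v >= N" "u ~= v" for u v
 proof -
  have "tr (A' * \<sigma> u * B' * \<sigma> v) = tr ((A' * B' * \<sigma> u) * \<sigma> v)"
   using \<sigma>_Q[OF big[OF uv(1)] K(2)] by (simp add: mult.assoc)
  also have "... = 0"
  proof (rule tr_\<sigma>)
   fix k l :: nat assume kl: "k < 2" "l < 2"
   have EQ: "E (\<mu> v) k l * w = w * E (\<mu> v) k l" if "w : Q K" for w
    by (rule munits_commute[OF _ that]) (use msystem_mprod_commute[OF E1 _ _ big[OF uv(2)]] kl in "auto simp: d_\<mu>")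
   have ne: "\<mu> u ~= \<mu> v" using uv(3) \<mu>_inj by (simp add: inj_eq)
   have E\<sigma>: "\<sigma> u * E (\<mu> v) k l = E (\<mu> v) k l * \<sigma> u"
    using Em(5)[OF ne] kl by (simp add: \<sigma>_def diff_distribs d_\<mu>)
   have "A' * B' : Q K" using star_algD(4)[OF mspan_star_alg[OF munits_mprod[OF E1]] K] .
   hence "E (\<mu> v) k l * (A' * B') * \<sigma> u = A' * B' * E (\<mu> v) k l * \<sigma> u" by (simp only: EQ)
   also have "... = A' * B' * (\<sigma> u * E (\<mu> v) k l)" by (simp only: E\<sigma> mult.assoc)
   finally show "A' * B' * \<sigma> u * E (\<mu> v) k l = E (\<mu> v) k l * (A' * B' * \<sigma> u)" by (simp only: mult.assoc)
  qed (use AB \<sigma> in auto)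
  finally have "A * \<sigma> u * B * \<sigma> v = (A - A') * (\<sigma> u * B * \<sigma> v) + (A' * \<sigma> u) * (B - B') * \<sigma> v + A' * \<sigma> u * B' * \<sigma> v"
   and 0: "tr (A' * \<sigma> u * B' * \<sigma> v) = 0" by (simp_all add: diff_distribs mult.assoc)
  hence "tr (A * \<sigma> u * B * \<sigma> v) = tr ((A - A') * (\<sigma> u * B * \<sigma> v)) + tr ((A' * \<sigma> u) * (B - B') * \<sigma> v)"
   using A B AB \<sigma>(1) by (simp only: tr_add R_simps) simp
  hence "cmod (tr (A * \<sigma> u * B * \<sigma> v)) <= tn ((A - A') * (\<sigma> u * B * \<sigma> v)) + tn ((A' * \<sigma> u) * (B - B') * \<sigma> v)"
   using A B AB \<sigma>(1) by (simp only:) (intro norm_triangle_le add_mono tr_bound R_simps, auto)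
  also have "tn ((A - A') * (\<sigma> u * B * \<sigma> v)) <= C * tn (A - A')"
   using tn_mult_right[OF _ opbound_mult[OF opbound_mult[OF \<sigma>(3) C(2)] \<sigma>(3)], of u v "A - A'"] A B AB \<sigma>(1) by simp
  also have "tn ((A' * \<sigma> u) * (B - B') * \<sigma> v) <= tn ((A' * \<sigma> u) * (B - B'))"
   using tn_mult_right[OF \<sigma>(1) \<sigma>(3), of "(A' * \<sigma> u) * (B - B')" v] A B AB \<sigma>(1) by simp
  also have "... <= D * tn (B - B')" using tn_mult_left[OF _ opbound_mult[OF D(2) \<sigma>(3)], of u "B - B'"] A B AB \<sigma>(1) by simp
  also have "C * tn (A - A') + D * tn (B - B') < \<epsilon> / 2 + \<epsilon> / 2"
   using A'(2) B'(2) C(1) D(1) by (intro add_strict_mono) (simp_all add: field_simps)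
  finally show ?thesis by simp
 qed
 thus ?thesis by blast
qed

text \<open>The coefficients in \<open>emb_pow_\<sigma>\<close>. The base-\<open>n\<close> digits of
  \<open>c\<close> record the summands met by the successive applications; the last digit belongs to
  the units that stand outside \<open>emb\<close>.\<close>

primrec Z :: "nat => nat => 'h bop" where
 "Z 0 = (%c. 1)"
| "Z (Suc k) = (%c. emb (Z k (c div n)) * (SUM x<a (c mod n). e (c mod n) x x))"

lemma Z_R: "Z k c : R" by (induction k arbitrary: c) (auto intro!: R_sum R_simps e_R mod_less_divisor n_pos)

text \<open>In summand \<open>i\<close> the position \<open>\<mu> x\<close> goes to
  \<open>\<mu> (n * x + i)\<close>, so one sign spreads to a different position for each
  summand.\<close>

lemma emb_\<sigma>: "emb (\<sigma> x) = (SUM i<n. (SUM y<a i. e i y y) * \<sigma> (n * x + i))"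
proof -
 have h: "H i (\<mu> x) b b = f i * E (\<mu> (n * x + i)) b b" if "i < n" for i b using that \<mu>_t0 by (simp add: H_def \<beta>_\<mu>)
 have G: "G (\<mu> x) b b = (SUM i<n. (SUM y<a i. e i y y) * E (\<mu> (n * x + i)) b b)" if b: "b < 2" for b unfolding G_def amp_def sum_distrib_right
 proof (intro sum.cong refl)
  fix i y assume iy: "i : {..<n}" "y : {..<a i}"
  hence "e i y 0 * H i (\<mu> x) b b * e i 0 y = e i y 0 * (E (\<mu> (n * x + i)) b b * e i 0 y)"
   using a_pos by (simp add: h mult.assoc[symmetric] e_mult)
  also have "E (\<mu> (n * x + i)) b b * e i 0 y = e i 0 y * E (\<mu> (n * x + i)) b b"
   using iy a_pos b \<mu>_t0 by (intro e_commute[symmetric]) (auto simp: d_\<mu>)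
  finally show "e i y 0 * H i (\<mu> x) b b * e i 0 y = e i y y * E (\<mu> (n * x + i)) b b"
   using iy a_pos by (simp add: mult.assoc[symmetric] e_mult)
 qed
 have "emb (\<sigma> x) = G (\<mu> x) 0 0 - G (\<mu> x) 1 1" by (simp add: \<sigma>_def emb_diff Em(4) d_\<mu> emb_unit)
 thus ?thesis by (simp add: G \<sigma>_def right_diff_distrib sum_subtractf)
qed

lemma emb_pow_R: "x : R ==> (emb ^^ k) x : R" by (induction k) auto

lemma emb_pow_\<sigma>: "(emb ^^ k) (\<sigma> x) = (SUM c<n ^ k. Z k c * \<sigma> (n ^ k * x + c))"
proof (induction k)
 case (Suc k)
 have "(emb ^^ Suc k) (\<sigma> x) = (SUM c<n ^ k. emb (Z k c) * emb (\<sigma> (n ^ k * x + c)))"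
  using Z_R \<sigma>(1) by (simp add: Suc emb_sum emb_mult)
 also have "... = (SUM c<n ^ k. SUM i<n. Z (Suc k) (i + n * c) * \<sigma> (n ^ Suc k * x + (i + n * c)))"
  unfolding emb_\<sigma> sum_distrib_left by (intro sum.cong refl) (simp add: index_divmod algebra_simps)
 also have "... = (SUM c<n * n ^ k. Z (Suc k) c * \<sigma> (n ^ Suc k * x + c))" by (simp only: sum_index)
 finally show ?case by simp
qed simp

text \<open>\<open>f i\<close> passes the image of \<open>emb\<close> and meets the units of summand
  \<open>c mod n\<close>, to which it is orthogonal.\<close>

lemma f_Z: assumes "i < n" "c mod n ~= i" shows "f i * Z (Suc k) c = 0"
proof -
 have cn: "c mod n < n" using n_pos by simp
 have "f i * Z (Suc k) c = emb (Z k (c div n)) * (SUM x<a (c mod n). f i * e (c mod n) x x)"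
  using f_emb[OF assms(1) Z_R] by (simp add: mult.assoc[symmetric] sum_distrib_left)
 also have "(SUM x<a (c mod n). f i * e (c mod n) x x) = 0" by (rule sum.neutral) (use assms cn in "simp add: e_mult a_pos")
 finally show ?thesis by simp
qed

text \<open>The image \<open>S x\<close> of a sign has square 1 and commutes with \<open>w\<close>,
  so \<open>w\<dagger> * w\<close> equals \<open>w\<dagger> * S x * w * S x\<close>. Next to
  \<open>f i\<close> and \<open>f j\<close> the two occurrences of \<open>S x\<close> consist of
  signs at positions with last digits \<open>i\<close> and \<open>j\<close>, hence at different
  positions. By \<open>\<sigma>_mixing\<close> the trace tends to 0 as \<open>x\<close> grows, but
  it does not depend on \<open>x\<close>.\<close>

lemma off_diagonal_zero: assumes ij: "i < n" "j < n" "i ~= j" and w: "w : R" "f i * w = w" "w * f j = w"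
  and c: "!!l. l : R ==> w * (emb ^^ Suc k) l = (emb ^^ Suc k) l * w" shows "w = 0"
proof -
 define S where "S x = (emb ^^ Suc k) (\<sigma> x)" for x
 have SR: "S x : R" for x unfolding S_def by (rule emb_pow_R[OF \<sigma>(1)])
 have SS: "S x * S x = 1" for x
 proof -
  have 1: "(emb ^^ k') (x * y) = (emb ^^ k') x * (emb ^^ k') y" if "x : R" "y : R" for k' x y
   using that by (induction k') (auto simp: emb_mult emb_pow_R)
  have 2: "(emb ^^ k') 1 = 1" for k' by (induction k') (auto simp: emb_one)
  show ?thesis unfolding S_def 1[OF \<sigma>(1) \<sigma>(1), symmetric] \<sigma>(2) 2 by (rule refl)
 qed
 have fS: "f i * S x = (SUM c<n ^ Suc k. f i * Z (Suc k) c * \<sigma> (n ^ Suc k * x + c))" for i x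
  unfolding S_def emb_pow_\<sigma> sum_distrib_left by (simp only: mult.assoc)
 define T where "T x c c' = (w\<dagger> * f i * Z (Suc k) c) * \<sigma> (n ^ Suc k * x + c) * (w * f j * Z (Suc k) c') * \<sigma> (n ^ Suc k * x + c')" for x c c'
 have TR: "T x c c' : R" for x c c' unfolding T_def using w ij Z_R \<sigma>(1) by (intro R_simps) (auto simp del: Z.simps)
 \<comment> \<open>The unit \<open>S x * S x\<close> is inserted and one factor is moved past
   \<open>w\<close>, so that one occurrence stands next to \<open>f i\<close> and the other next to
   \<open>f j\<close>.\<close>
 have ww: "w\<dagger> * w = w\<dagger> * (f i * S x) * w * (f j * S x)" for x
 proof -
  have "w\<dagger> * w = w\<dagger> * (f i * w) * (S x * S x)" using SS w by simp
  also have "... = w\<dagger> * f i * (w * S x) * S x" by (simp only: mult.assoc)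
  also have "w * S x = S x * (w * f j)" using c[OF \<sigma>(1)[of x]] w(3) unfolding S_def by simp
  finally show ?thesis by (simp only: mult.assoc)
 qed
 have expand: "w\<dagger> * w = (SUM c<n ^ Suc k. SUM c'<n ^ Suc k. T x c c')" for x
 proof -
  let ?A = "%c. w\<dagger> * (f i * Z (Suc k) c * \<sigma> (n ^ Suc k * x + c)) * w"
  let ?B = "%c. f j * Z (Suc k) c * \<sigma> (n ^ Suc k * x + c)"
  have "w\<dagger> * w = (SUM c<n ^ Suc k. ?A c) * (SUM c<n ^ Suc k. ?B c)"
   unfolding ww[of x] fS by (simp only: sum_distrib_left[of "w\<dagger>"] sum_distrib_right[of _ _ w])
  also have "... = (SUM c<n ^ Suc k. SUM c'<n ^ Suc k. ?A c * ?B c')" by (rule sum_product)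
  also have "... = (SUM c<n ^ Suc k. SUM c'<n ^ Suc k. T x c c')" by (simp only: T_def mult.assoc)
  finally show ?thesis .
 qed
 have lim: "(%x. tr (T x c c')) ----> 0" for c c'
 proof (cases "c mod n = i & c' mod n = j")
  case True
  hence cc: "c ~= c'" using ij by auto
  show ?thesis
  proof (rule LIMSEQ_I)
   fix r :: real assume "r > 0"
   then obtain N where N: "ALL u>=N. ALL v>=N. u ~= v -->
    cmod (tr ((w\<dagger> * f i * Z (Suc k) c) * \<sigma> u * (w * f j * Z (Suc k) c') * \<sigma> v)) < r"
    using \<sigma>_mixing[of "w\<dagger> * f i * Z (Suc k) c" "w * f j * Z (Suc k) c'" r] w(1) ij Z_R by (auto simp del: Z.simps)
   have "n ^ Suc k * x + c >= N" if "x >= N" for x c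
   proof -
    have "1 * x <= n ^ Suc k * x" using n_pos by (intro mult_le_mono1) (simp add: Suc_le_eq del: power_Suc)
    thus ?thesis using that by linarith
   qed
   thus "EX N. ALL x>=N. norm (tr (T x c c') - 0) < r" using N cc by (intro exI[of _ N]) (simp add: T_def del: power_Suc Z.simps)
  qed
 next
  case False
  have z: "f i * Z (Suc k) c = 0 | f j * Z (Suc k) c' = 0" using f_Z ij False by blast
  have "T x c c' = w\<dagger> * (f i * Z (Suc k) c) * \<sigma> (n ^ Suc k * x + c) * w * (f j * Z (Suc k) c') * \<sigma> (n ^ Suc k * x + c')" for x
   unfolding T_def by (simp only: mult.assoc)
  hence "T x c c' = 0" for x using z by (auto simp del: Z.simps)
  thus ?thesis by simp
 qed
 have "(%x. SUM c<n ^ Suc k. SUM c'<n ^ Suc k. tr (T x c c')) ----> 0" by (rule tendsto_null_sum)+ (rule lim)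
 moreover have "(SUM c<n ^ Suc k. SUM c'<n ^ Suc k. tr (T x c c')) = tr (w\<dagger> * w)" for x
  unfolding expand[of x] by (rule tr_sum2[symmetric]) (rule TR)
 ultimately have "tr (w\<dagger> * w) = 0" by (simp add: LIMSEQ_const_iff)
 thus ?thesis by (rule tr_faithful[OF w(1)])
qed

definition rc :: "nat => 'h bop set" where
 "rc k = {y : R. ALL l:R. y * (emb ^^ k) l = (emb ^^ k) l * y}"

text \<open>Peels off one copy of \<open>A\<close>. Blocks of \<open>y\<close> between different
  summands vanish by \<open>off_diagonal_zero\<close>. Within a summand \<open>corner_emb\<close>
  writes each block as \<open>f i * emb z\<close>, and injectivity of this map turns commutation
  with the image of \<open>emb ^^ Suc k\<close> into commutation of \<open>z\<close> with that of
  \<open>emb ^^ k\<close>.\<close>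

lemma rc_Suc:
 "y : rc (Suc k) <-> (EX z. (ALL i<n. ALL x<a i. ALL x'<a i. z i x x' : rc k) &
  y = (SUM i<n. SUM x<a i. SUM x'<a i. e i x x' * emb (z i x x')))"
proof
 assume y: "y : rc (Suc k)"
 hence yR: "y : R" and yc: "!!l. l : R ==> y * (emb ^^ Suc k) l = (emb ^^ Suc k) l * y" by (auto simp: rc_def)
 have blockc: "(e i 0 x * y * e j x' 0) * (emb ^^ Suc k) l = (emb ^^ Suc k) l * (e i 0 x * y * e j x' 0)"
  if "i < n" "x < a i" "j < n" "x' < a j" "l : R" for i x j x' l
 proof -
  define L where "L = (emb ^^ Suc k) l"
  have LL: "L = emb ((emb ^^ k) l)" by (simp add: L_def)
  have "(emb ^^ k) l : R" by (rule emb_pow_R[OF that(5)])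
  hence 1: "e i 0 x * L = L * e i 0 x" "e j x' 0 * L = L * e j x' 0" using that a_pos by (auto simp: LL intro!: e_emb)
  have 2: "y * L = L * y" using yc[OF that(5)] by (simp add: L_def)
  have "(e i 0 x * y * e j x' 0) * L = (e i 0 x * (y * L)) * e j x' 0" using 1(2) by (simp add: mult.assoc)
  also have "... = (e i 0 x * L) * y * e j x' 0" by (simp only: 2 mult.assoc)
  also have "... = (L * e i 0 x) * y * e j x' 0" by (simp only: 1(1))
  finally show ?thesis by (simp only: mult.assoc L_def)
 qed
 have off: "e i 0 x * y * e j x' 0 = 0" if "i < n" "x < a i" "j < n" "x' < a j" "i ~= j" for i x j x'
 proof (rule off_diagonal_zero[OF that(1,3,5)])
  show "e i 0 x * y * e j x' 0 : R" using that yR a_pos by simp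
  show "f i * (e i 0 x * y * e j x' 0) = e i 0 x * y * e j x' 0" using that a_pos by (simp add: mult.assoc[symmetric] e_mult)
  show "e i 0 x * y * e j x' 0 * f j = e i 0 x * y * e j x' 0" using that a_pos by (simp add: mult.assoc e_mult)
 qed (rule blockc[OF that(1-4)])
 have "EX z. z : rc k & e i 0 x * y * e i x' 0 = f i * emb z" if i: "i < n" "x < a i" "x' < a i" for i x x'
 proof -
  have "EX z:R. e i 0 x * y * e i x' 0 = f i * emb z"
  proof (rule corner_emb[OF i(1)])
   show "e i 0 x * y * e i x' 0 : R" using i yR a_pos by simp
  qed (use i a_pos in "simp_all add: mult.assoc[symmetric] e_mult, simp add: mult.assoc e_mult")
  then obtain z where z: "z : R" "e i 0 x * y * e i x' 0 = f i * emb z" by blast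
  have "z * (emb ^^ k) l = (emb ^^ k) l * z" if l: "l : R" for l
  proof -
   define L where "L = (emb ^^ k) l"
   have LR: "L : R" unfolding L_def by (rule emb_pow_R[OF l])
   have "(f i * emb z) * emb L = emb L * (f i * emb z)" using blockc[OF i(1,2,1,3) l] by (simp add: z(2) L_def)
   hence "f i * emb (z * L) = f i * emb (L * z)" using f_emb[OF i(1) LR] LR z(1) by (simp add: emb_mult mult.assoc[symmetric])
   hence "f i * emb (z * L - L * z) = 0" using LR z(1) by (simp add: emb_diff right_diff_distrib)
   hence "z * L - L * z = 0" using f_emb_0[OF i(1), of "z * L - L * z"] LR z(1) by simp
   thus ?thesis by (simp add: L_def)
  qed
  thus ?thesis using z by (auto simp: rc_def)
 qed
 then obtain z where z: "!!i x x'. i < n ==> x < a i ==> x' < a i ==> z i x x' : rc k & e i 0 x * y * e i x' 0 = f i * emb (z i x x')" by metis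
 have blk: "e i x x * y * e j x' x' = (if j = i then e i x x' * emb (z i x x') else 0)" if "i < n" "x < a i" "j < n" "x' < a j" for i x j x'
 proof -
  have "e i x x * y * e j x' x' = e i x 0 * (e i 0 x * y * e j x' 0) * e j 0 x'"
  proof -
   have "e i x 0 * e i 0 x = e i x x" "e j x' 0 * e j 0 x' = e j x' x'" using that a_pos by (simp_all add: e_mult)
   thus ?thesis by (metis (no_types, lifting) mult.assoc)
  qed
  also have "... = (if j = i then e i x x' * emb (z i x x') else 0)"
  proof (cases "j = i")
   case True
   have zR: "z i x x' : R" using z[of i x x'] that True by (auto simp: rc_def)
   have "e i x 0 * (f i * emb (z i x x')) * e i 0 x' = e i x 0 * f i * e i 0 x' * emb (z i x x')"
    using e_emb[of i 0 x' "z i x x'"] that True a_pos zR by (simp add: mult.assoc)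
   thus ?thesis using z[of i x x'] that True a_pos by (simp add: e_mult)
  qed (use off that in simp)
  finally show ?thesis .
 qed
 define W where "W = (SUM j<n. SUM x'<a j. e j x' x')"
 have "y = (SUM i<n. SUM x<a i. e i x x) * y * W" by (simp add: e_sum W_def)
 also have "... = (SUM i<n. SUM x<a i. e i x x * y * W)" by (simp only: sum_distrib_right)
 also have "... = (SUM i<n. SUM x<a i. SUM j<n. SUM x'<a j. e i x x * y * e j x' x')" by (simp only: W_def sum_distrib_left)
 also have "... = (SUM i<n. SUM x<a i. SUM j<n. if j = i then SUM x'<a i. e i x x' * emb (z i x x') else 0)" by (intro sum.cong refl) (simp add: blk)
 also have "... = (SUM i<n. SUM x<a i. SUM x'<a i. e i x x' * emb (z i x x'))" by simp
 finally show "EX z. (ALL i<n. ALL x<a i. ALL x'<a i. z i x x' : rc k) & y = (SUM i<n. SUM x<a i. SUM x'<a i. e i x x' * emb (z i x x'))"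
  using z by blast
next
 assume "EX z. (ALL i<n. ALL x<a i. ALL x'<a i. z i x x' : rc k) & y = (SUM i<n. SUM x<a i. SUM x'<a i. e i x x' * emb (z i x x'))"
 then obtain z where z: "!!i x x'. i < n ==> x < a i ==> x' < a i ==> z i x x' : rc k"
  and y: "y = (SUM i<n. SUM x<a i. SUM x'<a i. e i x x' * emb (z i x x'))" by blast
 have yR: "y : R" unfolding y using z by (intro R_sum R_simps emb_R) (auto simp: rc_def)
 moreover have "y * (emb ^^ Suc k) l = (emb ^^ Suc k) l * y" if l: "l : R" for l
 proof -
  define L where "L = (emb ^^ k) l"
  have LR: "L : R" unfolding L_def by (rule emb_pow_R[OF l])
  have "e i x x' * emb (z i x x') * emb L = emb L * (e i x x' * emb (z i x x'))" if "i < n" "x < a i" "x' < a i" for i x x'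
  proof -
   have zz: "z i x x' : R" "z i x x' * L = L * z i x x'" using z[OF that] l by (auto simp: rc_def L_def)
   have "e i x x' * emb (z i x x') * emb L = e i x x' * emb (L * z i x x')" using zz LR by (simp add: mult.assoc emb_mult[symmetric])
   also have "... = (e i x x' * emb L) * emb (z i x x')" using zz LR by (simp add: emb_mult mult.assoc)
   finally show ?thesis using e_emb[OF that LR] by (simp add: mult.assoc)
  qed
  thus ?thesis unfolding y sum_distribs by (intro sum.cong refl) (simp add: L_def)
 qed
 ultimately show "y : rc (Suc k)" by (simp add: rc_def)
qed

lemma rc_0: "y : rc 0 <-> (EX c. y = csc c 1)"
proof
 assume "y : rc 0"
 thus "EX c. y = csc c 1" by (intro R_center) (auto simp: rc_def)
qed (auto simp: rc_def csc_mult_right)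

end

section \<open>The choice of the sizes and of the bijections\<close>

context hyperfinite_factor
begin

text \<open>Positions are indexed by \<open>nat \<times> nat + rat\<close> and then enumerated.
  Countably many positions of each size \<open>p r\<close> and of size \<open>q\<close> allow a
  shift. The positions of size 2 are indexed by rationals because
  \<open>x \<mapsto> n * x + i\<close> has to be a bijection; \<open>\<mu>\<close> runs through the
  natural numbers among them.\<close>

lemma endo_data_ex:
 fixes n :: nat and a p :: "nat => nat" assumes n: "n > 0" and a: "!!i. i < n ==> a i > 0" and p: "!!i. i < n ==> p i > 0"
 shows "EX d E \<kappa> t0 \<beta> \<mu>. endo_data R tr d E n a p \<kappa> t0 \<beta> \<mu> & d t0 = (SUM i<n. a i * p i)"
proof -
 define q where "q = (SUM i<n. a i * p i)"
 have "a 0 * p 0 <= q" unfolding q_def using n by (intro member_le_sum) auto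
 hence q: "q > 0" using a[OF n] p[OF n] by (metis nat_0_less_mult_iff not_gr_zero not_le)
 \<comment> \<open>Pairs with first component above \<open>n\<close> get the trivial size 1; they
   only complete the index type.\<close>
 define dT :: "nat \<times> nat + rat => nat" where
  "dT = (%Inl (r, j) => if r < n then p r else if r = n then q else 1 | Inr x => 2)"
 \<comment> \<open>One position of size \<open>p i\<close> goes to \<open>Inl (n, 0)\<close>, which
   will be \<open>t0\<close>. The remaining positions of size \<open>p i\<close> move down to take
   its place, and those of size \<open>q\<close> move up to vacate
   \<open>Inl (n, 0)\<close>.\<close>
 define \<beta>T :: "nat => nat \<times> nat + rat => nat \<times> nat + rat" where "\<beta>T i = (%Inl (r, j) => if r = i then (case j of 0 => Inl (n, 0) | Suc j' => Inl (i, j'))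
   else if r = n then Inl (n, Suc j) else Inl (r, j) | Inr x => Inr (of_nat n * x + of_nat i))" for i :: nat
 define \<gamma>T :: "nat => nat \<times> nat + rat => nat \<times> nat + rat" where "\<gamma>T i = (%Inl (r, j) => if r = i then Inl (i, Suc j)
   else if r = n then (case j of 0 => Inl (i, 0) | Suc j' => Inl (n, j')) else Inl (r, j) | Inr x => Inr ((x - of_nat i) / of_nat n))" for i :: nat
 have \<gamma>\<beta>: "\<gamma>T i (\<beta>T i t) = t" and \<beta>\<gamma>: "\<beta>T i (\<gamma>T i t) = t" if "i < n" for i and t :: "nat \<times> nat + rat"
  using that n by (auto simp: \<beta>T_def \<gamma>T_def split: sum.splits prod.splits nat.splits if_splits)
 have d\<beta>T: "dT t = (if \<beta>T i t = Inl (n, 0) then p i else dT (\<beta>T i t))" if "i < n" for i and t :: "nat \<times> nat + rat"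
  using that by (auto simp: \<beta>T_def dT_def split: sum.splits prod.splits nat.splits if_splits)
 have "infinite (UNIV :: (nat \<times> nat + rat) set)" using infinite_UNIV_char_0[where 'a = rat] by (simp add: finite_Plus_UNIV_iff)
 then obtain enc :: "nat \<times> nat + rat => nat" where enc: "bij enc" using countableE_infinite[of "UNIV :: (nat \<times> nat + rat) set"] by blast
 define dec where "dec = inv_into UNIV enc"
 have ed [simp]: "enc (dec t) = t" "dec (enc u) = u" for t u using enc by (simp_all add: dec_def bij_is_surj surj_f_inv_f bij_is_inj)
 define d where "d t = dT (dec t)" for t
 define \<beta> where "\<beta> i t = enc (\<beta>T i (dec t))" for i t
 define \<mu> where "\<mu> x = enc (Inr (of_nat x))" for x
 define t0 where "t0 = enc (Inl (n, 0))"
 have enc_eq: "enc u = enc v <-> u = v" for u v using enc by (simp add: bij_is_inj inj_eq)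
 have \<beta>_bij: "bij (\<beta> i)" if "i < n" for i
  by (rule o_bij[of "%t. enc (\<gamma>T i (dec t))"]) (auto simp: fun_eq_iff \<beta>_def \<gamma>\<beta> \<beta>\<gamma> that)
 have \<mu>_inj: "inj \<mu>" by (auto simp: inj_def \<mu>_def enc_eq)
 have d\<mu>: "d (\<mu> x) = 2" for x by (simp add: d_def \<mu>_def dT_def)
 have dt0: "d t0 = q" by (simp add: d_def t0_def dT_def)
 have "range \<mu> \<subseteq> {t. d t >= 2}" using d\<mu> by auto
 hence inf: "infinite {t. d t >= 2}" using range_inj_infinite[OF \<mu>_inj] finite_subset by blast
 have d1: "d t >= 1" for t using p q by (auto simp: d_def dT_def Suc_le_eq split: sum.splits prod.splits)
 obtain E where E: "msystem d E" "ALL t. ALL a<d t. ALL b<d t. E t a b : R"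
  "ALL x:R. ALL \<epsilon>>0. EX m. EX y:mspan (msize d m) (mprod d E m). tn (x - y) < \<epsilon>" using uhf[OF d1 inf] by blast
 define S where "S = Sigma {..<n} (%i. {..<a i} \<times> {..<p i})"
 have "finite S" "card S = q" by (simp_all add: S_def q_def)
 then obtain h where h: "bij_betw h S {..<q}" using ex_bij_betw_finite_nat[of S] by (auto simp: atLeast0LessThan)
 have "endo_data R tr d E n a p (%i x b. h (i, x, b)) t0 \<beta> \<mu>"
 proof unfold_locales
  show "msystem_in d E" using E by (simp add: msystem_in_def)
  show "h (i, x, b) < d t0" if "i < n" "x < a i" "b < p i" for i x b using h that by (auto simp: bij_betw_def S_def dt0)
  show "h (i, x, b) = h (j, y, c) <-> i = j & x = y & b = c"
   if "i < n" "x < a i" "b < p i" "j < n" "y < a j" "c < p j" for i x b j y c using h that by (auto simp: bij_betw_def S_def inj_on_def)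
  show "EX i<n. EX x<a i. EX b<p i. k = h (i, x, b)" if "k < d t0" for k
  proof -
   have "k : h ` S" using h that by (simp add: bij_betw_def dt0)
   thus ?thesis by (auto simp: S_def)
  qed
  show "d t = (if \<beta> i t = t0 then p i else d (\<beta> i t))" if "i < n" for i t
   using d\<beta>T[OF that, of "dec t"] by (simp add: d_def \<beta>_def t0_def enc_eq)
  show "\<beta> i (\<mu> x) = \<mu> (n * x + i)" for i x by (simp add: \<beta>_def \<mu>_def \<beta>T_def)
 qed (use E n a p \<beta>_bij \<mu>_inj d\<mu> in "auto simp: \<mu>_def t0_def enc_eq")
 thus ?thesis using dt0 unfolding q_def by blast
qed

end

section \<open>Coordinates of the relative commutants: words in matrix units\<close>

lemma sum_if_const: "(SUM x:A. if P then g x else 0) = (if P then SUM x:A. g x else 0)" by simp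

lemma sum_triple_delta:
 fixes i n :: nat and a :: "nat => nat" assumes "i < n" "x < a i" "y < a i"
 shows "(SUM j<n. SUM x'<a j. SUM y'<a j. if j = i & x' = x & y' = y then z else 0) = (z::'b::comm_monoid_add)"
proof -
 have "(SUM x'<a j. SUM y'<a j. if j = i & x' = x & y' = y then z else 0) = (if j = i then z else 0)" for j
 proof (cases "j = i")
  case True
  have "(SUM x'<a i. SUM y'<a i. if x' = x & y' = y then z else 0) = (SUM x'<a i. if x' = x then SUM y'<a i. if y' = y then z else 0 else 0)"
   by (intro sum.cong refl) auto
  with True show ?thesis using assms by simp
 qed simp
 thus ?thesis using assms by simp
qed

context endo_data
begin

text \<open>The algebra \<open>A\<close> as a subalgebra of \<open>R\<close>, and \<open>x\<^sub>1 \<Phi>(x\<^sub>2) \<Phi>\<^sup>2(x\<^sub>3) \<dots>\<close>, the image of an elementary tensor.\<close>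

definition iota :: "(nat => nat => nat => complex) => 'h bop" where
 "iota A = (SUM i<n. SUM x<a i. SUM y<a i. csc (A i x y) (e i x y))"

lemma iota_R: "iota A : R" unfolding iota_def by (intro R_sum R_simps e_R) auto

lemma iota_add: "iota (%i x y. A i x y + B i x y) = iota A + iota B" by (simp add: iota_def csc_add_left sum.distrib)

lemma iota_csc: "iota (%i x y. c * A i x y) = csc c (iota A)" by (simp add: iota_def csc_sum)

lemma iota_adj: "(iota A)\<dagger> = iota (%i x y. cnj (A i y x))"
proof -
 have "(iota A)\<dagger> = (SUM i<n. SUM x<a i. SUM y<a i. csc (cnj (A i x y)) (e i y x))"
  unfolding iota_def adj_sum by (intro sum.cong refl) (simp add: e_adj)
 also have "... = iota (%i x y. cnj (A i y x))" unfolding iota_def by (intro sum.cong refl sum.swap)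
 finally show ?thesis .
qed

lemma iota_one: "iota (%i x y. if x = y then 1 else 0) = 1" by (simp add: iota_def if_distrib[of "%c. csc c _"] e_sum cong: if_cong)

lemma iota_mult: "iota A * iota B = iota (%i x y. SUM z<a i. A i x z * B i z y)"
proof -
 have 1: "e i x y * iota B = (SUM w<a i. csc (B i y w) (e i x w))" if "i < n" "x < a i" "y < a i" for i x y
 proof -
  have "e i x y * iota B = (SUM j<n. SUM z<a j. SUM w<a j. if j = i then if z = y then csc (B i y w) (e i x w) else 0 else 0)"
   unfolding iota_def sum_distrib_left by (intro sum.cong refl) (use that in "auto simp: e_mult")
  also have "... = (SUM j<n. if j = i then SUM z<a i. if z = y then SUM w<a i. csc (B i y w) (e i x w) else 0 else 0)"
   by (intro sum.cong refl) (auto simp: sum_if_const)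
  finally show ?thesis using that by (simp add: sum_if_const)
 qed
 have "iota A * iota B = (SUM i<n. SUM x<a i. SUM y<a i. csc (A i x y) (e i x y * iota B))"
  unfolding iota_def[of A] sum_distrib_right by (simp add: csc_mult_left)
 also have "... = (SUM i<n. SUM x<a i. SUM y<a i. SUM w<a i. csc (A i x y * B i y w) (e i x w))" by (intro sum.cong refl) (simp add: 1 csc_sum)
 also have "... = (SUM i<n. SUM x<a i. SUM w<a i. SUM y<a i. csc (A i x y * B i y w) (e i x w))" by (intro sum.cong refl sum.swap)
 finally show ?thesis by (simp add: iota_def csc_sum_left)
qed

lemma iota_commute: "z : R ==> iota A * emb z = emb z * iota A" unfolding iota_def sum_distribs by (intro sum.cong refl) (simp add: e_emb)

lemma tr_iota_emb: "z : R ==> tr (iota A * emb z) = (SUM i<n. of_real (weight i) * (SUM x<a i. A i x x)) * tr z"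
proof -
 assume z: "z : R"
 have "tr (iota A * emb z) = (SUM i<n. SUM x<a i. SUM y<a i. A i x y * tr (e i x y * emb z))"
  unfolding iota_def sum_distrib_right csc_mult_left using z by (subst tr_sum, (auto intro!: R_sum)[1], intro sum.cong refl)+ (simp add: tr_csc)
 also have "... = (SUM i<n. SUM x<a i. of_real (weight i) * A i x x * tr z)"
  by (intro sum.cong refl) (use z in "simp add: tr_e_emb if_distrib cong: if_cong")
 finally show ?thesis by (simp add: sum_distribs mult.assoc)
qed

primrec tensor :: "(nat => nat => nat => complex) list => 'h bop" where
 "tensor [] = 1"
| "tensor (A # u) = iota A * emb (tensor u)"

lemma tensor_R [simp]: "tensor u : R" by (induction u) (auto simp: iota_R)

definition munit :: "nat \<times> nat \<times> nat => nat => nat => nat => complex" where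
 "munit = (%(i, x, y) j z w. if j = i & z = x & w = y then 1 else 0)"

definition letters :: "(nat \<times> nat \<times> nat) set" where
 "letters = Sigma {..<n} (%i. {..<a i} \<times> {..<a i})"

lemma sum_letters: "(SUM l:letters. g l) = (SUM i<n. SUM x<a i. SUM y<a i. g (i, x, y))"
 by (simp add: letters_def sum.Sigma sum.cartesian_product case_prod_unfold)

lemma finite_letters [simp]: "finite letters" by (simp add: letters_def)

lemma iota_munit: assumes "(i, x, y) : letters" shows "iota (munit (i, x, y)) = e i x y"
proof -
 have "iota (munit (i, x, y)) = (SUM j<n. SUM z<a j. SUM w<a j. if j = i & z = x & w = y then e i x y else 0)"
  unfolding iota_def munit_def by (intro sum.cong refl) auto
 thus ?thesis using sum_triple_delta[of i n x a y] assms by (simp add: letters_def)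
qed

abbreviation words :: "nat => (nat \<times> nat \<times> nat) list set" where
 "words k \<equiv> {u. set u \<subseteq> letters & length u = k}"

lemma finite_words: "finite (words k)" by (rule finite_lists_length_eq) simp

lemma sum_words_Suc: "(SUM u:words (Suc k). g u) = (SUM l:letters. SUM u:words k. g (l # u))"
proof -
 have "words (Suc k) = (%(l, u). l # u) ` (letters \<times> words k)" by (auto simp: length_Suc_conv image_iff)
 moreover have "inj_on (%(l, u). l # u) (letters \<times> words k)" by (auto simp: inj_on_def)
 ultimately have "(SUM u:words (Suc k). g u) = (SUM (l, u):letters \<times> words k. g (l # u))" by (simp add: sum.reindex case_prod_unfold)
 thus ?thesis by (simp add: sum.cartesian_product)
qed

text \<open>Induction along \<open>rc_Suc\<close>: the first letter is a matrix unit of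
  \<open>A\<close>, the others come from the expansion of the coefficient \<open>z\<close> in
  \<open>rc k\<close>.\<close>

lemma rc_words: "y : rc k <-> (EX c. y = (SUM u:words k. csc (c u) (tensor (map munit u))))"
proof (induction k arbitrary: y)
 case 0
 have "words 0 = {[]}" by auto
 thus ?case by (auto simp: rc_0)
next
 case (Suc k)
 have eq: "(SUM i<n. SUM x<a i. SUM x'<a i. e i x x' * emb (SUM u:words k. csc (c (i, x, x') u) (tensor (map munit u)))) =
  (SUM u:words (Suc k). csc (c (hd u) (tl u)) (tensor (map munit u)))" for c
 proof -
  have "(SUM u:words (Suc k). csc (c (hd u) (tl u)) (tensor (map munit u))) =
   (SUM l:letters. SUM u:words k. csc (c l u) (iota (munit l) * emb (tensor (map munit u))))" by (simp add: sum_words_Suc)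
  also have "... = (SUM l:letters. iota (munit l) * emb (SUM u:words k. csc (c l u) (tensor (map munit u))))"
   by (intro sum.cong refl) (simp add: emb_sum emb_csc sum_distrib_left csc_mult_right)
  also have "... = (SUM i<n. SUM x<a i. SUM x'<a i. e i x x' * emb (SUM u:words k. csc (c (i, x, x') u) (tensor (map munit u))))"
   unfolding sum_letters by (intro sum.cong refl) (simp add: iota_munit letters_def)
  finally show ?thesis by simp
 qed
 show ?case
 proof
  assume "y : rc (Suc k)"
  then obtain z where z: "ALL i<n. ALL x<a i. ALL x'<a i. z i x x' : rc k"
   and y: "y = (SUM i<n. SUM x<a i. SUM x'<a i. e i x x' * emb (z i x x'))" using rc_Suc by blast
  have "EX c. ALL l:letters. z (fst l) (fst (snd l)) (snd (snd l)) = (SUM u:words k. csc (c l u) (tensor (map munit u)))"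
   using z Suc.IH by (intro bchoice) (auto simp: letters_def)
  then obtain c where c: "!!i x x'. i < n ==> x < a i ==> x' < a i ==> z i x x' = (SUM u:words k. csc (c (i, x, x') u) (tensor (map munit u)))"
   by (force simp: letters_def)
  have "y = (SUM i<n. SUM x<a i. SUM x'<a i. e i x x' * emb (SUM u:words k. csc (c (i, x, x') u) (tensor (map munit u))))"
   unfolding y by (intro sum.cong refl) (simp add: c)
  thus "EX c. y = (SUM u:words (Suc k). csc (c u) (tensor (map munit u)))" unfolding eq[of c] by (rule exI[of _ "%u. c (hd u) (tl u)"])
 next
  assume "EX c. y = (SUM u:words (Suc k). csc (c u) (tensor (map munit u)))"
  then obtain c where c: "y = (SUM u:words (Suc k). csc (c u) (tensor (map munit u)))" by blast
  have "y = (SUM i<n. SUM x<a i. SUM x'<a i. e i x x' * emb (SUM u:words k. csc (c ((i, x, x') # u)) (tensor (map munit u))))"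
   unfolding c eq[of "%l v. c (l # v)"] by (intro sum.cong refl) (auto simp: length_Suc_conv)
  thus "y : rc (Suc k)" using Suc.IH unfolding rc_Suc
   by (intro exI[of _ "%i x x'. SUM u:words k. csc (c ((i, x, x') # u)) (tensor (map munit u))"]) auto
 qed
qed

text \<open>Compression by \<open>e i 0 x\<close> and \<open>e i y 0\<close> isolates the terms with
  first letter \<open>(i, x, y)\<close>, and injectivity of \<open>f i * emb z\<close> in
  \<open>z\<close> leaves a relation between shorter words.\<close>

lemma tensor_independent: assumes "(SUM u:words k. csc (c u) (tensor (map munit u))) = 0" "u : words k" shows "c u = 0" using assms
proof (induction k arbitrary: c u)
 case 0
 have "words 0 = {[]}" by auto
 hence "csc (c []) (1 :: 'h bop) = csc 0 1" using 0 by simp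
 moreover have "(1 :: 'h bop) ~= 0" using tn_one tn_zero by (metis zero_neq_one)
 ultimately have "c [] = 0" using csc_cancel[of "c []" 1 0] by (cases "c [] = 0") auto
 thus ?case using 0 by simp
next
 case (Suc k)
 define z where "z l = (SUM u:words k. csc (c (l # u)) (tensor (map munit u)))" for l
 have zR: "z l : R" for l unfolding z_def by (intro R_sum R_simps) auto
 have 0: "(SUM l:letters. iota (munit l) * emb (z l)) = 0"
  using Suc.prems(1) by (simp add: sum_words_Suc z_def emb_sum emb_csc sum_distrib_left csc_mult_right)
 obtain i x y v where u: "u = (i, x, y) # v" "i < n" "x < a i" "y < a i" "v : words k" using Suc.prems(2) by (auto simp: length_Suc_conv letters_def)
 have "f i * emb (z (i, x, y)) = (SUM j<n. SUM x'<a j. SUM y'<a j. e i 0 x * (e j x' y' * emb (z (j, x', y'))) * e i y 0)"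
 proof -
  have "e i 0 x * (e j x' y' * emb (z (j, x', y'))) * e i y 0 =
   (if j = i & x' = x & y' = y then f i * emb (z (i, x, y)) else 0)"
   if "j < n" "x' < a j" "y' < a j" for j x' y'
  proof -
   have "e i 0 x * (e j x' y' * emb (z (j, x', y'))) * e i y 0 = ((e i 0 x * e j x' y') * e i y 0) * emb (z (j, x', y'))"
    using e_emb[of i y 0 "z (j, x', y')"] u a_pos zR by (simp add: mult.assoc)
   thus ?thesis using that u a_pos by (auto simp: e_mult)
  qed
  thus ?thesis using u by (simp add: sum_triple_delta)
 qed
 also have "... = e i 0 x * (SUM l:letters. iota (munit l) * emb (z l)) * e i y 0"
  unfolding sum_letters sum_distribs by (intro sum.cong refl) (simp add: iota_munit letters_def)
 finally have "f i * emb (z (i, x, y)) = 0" by (simp add: 0)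
 hence "z (i, x, y) = 0" by (rule f_emb_0[OF u(2) zR])
 thus ?case using Suc.IH[of "%u. c ((i, x, y) # u)" v] u by (simp add: z_def)
qed

end

section \<open>Formal combinations and the ring structure of the free power\<close>

lemma star_iso_inverse: assumes h: "h : star_iso A B"
  and cl: "!!x y. x : carrier A ==> y : carrier A ==> x \<otimes>\<^bsub>A\<^esub> y : carrier A & x \<oplus>\<^bsub>A\<^esub> y : carrier A"
   "\<one>\<^bsub>A\<^esub> : carrier A" "!!c x. x : carrier A ==> c \<odot>\<^bsub>A\<^esub> x : carrier A & star A x : carrier A"
 shows "inv_into (carrier A) h : star_iso B A"
proof -
 let ?g = "inv_into (carrier A) h"
 have h': "h : star_hom A B" "bij_betw h (carrier A) (carrier B)" using h by (auto simp: star_iso_def)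
 have gh: "?g (h x) = x" if "x : carrier A" for x by (rule bij_betw_inv_into_left[OF h'(2) that])
 have surj: "EX x:carrier A. y = h x" if "y : carrier B" for y using h'(2) that by (auto simp: bij_betw_def)
 have hr: "!!x y. x : carrier A ==> y : carrier A ==> h (x \<otimes>\<^bsub>A\<^esub> y) = h x \<otimes>\<^bsub>B\<^esub> h y"
  "!!x y. x : carrier A ==> y : carrier A ==> h (x \<oplus>\<^bsub>A\<^esub> y) = h x \<oplus>\<^bsub>B\<^esub> h y" "h \<one>\<^bsub>A\<^esub> = \<one>\<^bsub>B\<^esub>"
  "!!c x. x : carrier A ==> h (c \<odot>\<^bsub>A\<^esub> x) = c \<odot>\<^bsub>B\<^esub> h x" "!!x. x : carrier A ==> h (star A x) = star B (h x)"
  using h'(1) by (auto simp: star_hom_def Ring.ring_hom_def)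
 have "?g : Ring.ring_hom B A"
 proof (rule ring_hom_memI)
  fix x assume "x : carrier B"
  thus "?g x : carrier A" using surj gh by force
 next
  fix x y assume "x : carrier B" "y : carrier B"
  then obtain u v where u: "u : carrier A" "x = h u" and v: "v : carrier A" "y = h v" using surj by blast
  show "?g (x \<otimes>\<^bsub>B\<^esub> y) = ?g x \<otimes>\<^bsub>A\<^esub> ?g y"
   using u v gh[OF conjunct1[OF cl(1)[OF u(1) v(1)]]] by (simp add: gh hr)
  show "?g (x \<oplus>\<^bsub>B\<^esub> y) = ?g x \<oplus>\<^bsub>A\<^esub> ?g y"
   using u v gh[OF conjunct2[OF cl(1)[OF u(1) v(1)]]] by (simp add: gh hr)
 next
  show "?g \<one>\<^bsub>B\<^esub> = \<one>\<^bsub>A\<^esub>" using gh[OF cl(2)] by (simp add: hr)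
 qed
 moreover have "?g (c \<odot>\<^bsub>B\<^esub> x) = c \<odot>\<^bsub>A\<^esub> ?g x & ?g (star B x) = star A (?g x)" if x: "x : carrier B" for c x
 proof -
  obtain u where u: "u : carrier A" "x = h u" using surj x by blast
  show ?thesis using u gh[OF conjunct1[OF cl(3)[OF u(1), of c]]] gh[OF conjunct2[OF cl(3)[OF u(1)]]] by (simp add: gh hr)
 qed
 moreover have "bij_betw ?g (carrier B) (carrier A)" by (rule bij_betw_inv_into[OF h'(2)])
 ultimately show ?thesis by (simp add: star_iso_def star_hom_def)
qed

text \<open>Instantiated with complex numbers, to test identities in \<open>free_power\<close>, and
  with operators, to evaluate formal tensors.\<close>

locale scaling =
 fixes sc :: "complex => 'v::ab_group_add => 'v"
 assumes sc_add_right: "sc c (x + y) = sc c x + sc c y" and sc_add_left: "sc (c + d) x = sc c x + sc d x"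
  and sc_sc: "sc c (sc d x) = sc (c * d) x" and sc_one: "sc 1 x = x"
begin

lemma sc_zero [simp]: "sc 0 x = 0" "sc c 0 = 0" using sc_add_left[of 0 0 x] sc_add_right[of c 0 0] by simp_all

lemma sc_sum: "sc c (SUM i:A. g i) = (SUM i:A. sc c (g i))" by (induction A rule: infinite_finite_induct) (auto simp: sc_add_right)

lemma sc_sum_left: "sc (SUM i:A. g i) x = (SUM i:A. sc (g i) x)" by (induction A rule: infinite_finite_induct) (auto simp: sc_add_left)

text \<open>The linear extension of \<open>\<phi>\<close> from generators, evaluated at the formal
  combination \<open>f\<close>.\<close>

definition pair :: "('b => complex) => ('b => 'v) => 'v" where
 "pair f \<phi> = (SUM u | f u ~= 0. sc (f u) (\<phi> u))"

lemma pair_superset: "finite U ==> {u. f u ~= 0} \<subseteq> U ==> pair f \<phi> = (SUM u:U. sc (f u) (\<phi> u))"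
 unfolding pair_def by (rule sum.mono_neutral_left) auto

lemma pair_cong: "(!!u. f u ~= 0 ==> \<phi> u = \<psi> u) ==> pair f \<phi> = pair f \<psi>" unfolding pair_def by (rule sum.cong) auto

lemma pair_add: assumes "finite {u. f u ~= 0}" "finite {u. g u ~= 0}" shows "pair (%w. f w + g w) \<phi> = pair f \<phi> + pair g \<phi>"
proof -
 let ?U = "{u. f u ~= 0} \<union> {u. g u ~= 0}"
 have "pair (%w. f w + g w) \<phi> = (SUM u:?U. sc (f u + g u) (\<phi> u))" by (rule pair_superset) (use assms in auto)
 also have "... = (SUM u:?U. sc (f u) (\<phi> u)) + (SUM u:?U. sc (g u) (\<phi> u))" by (simp add: sc_add_left sum.distrib)
 also have "(SUM u:?U. sc (f u) (\<phi> u)) = pair f \<phi>" by (rule pair_superset[symmetric]) (use assms in auto)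
 also have "(SUM u:?U. sc (g u) (\<phi> u)) = pair g \<phi>" by (rule pair_superset[symmetric]) (use assms in auto)
 finally show ?thesis .
qed

lemma pair_diff: assumes "finite {u. f u ~= 0}" "finite {u. g u ~= 0}" shows "pair (%w. f w - g w) \<phi> = pair f \<phi> - pair g \<phi>"
proof -
 have "finite {u. f u - g u ~= 0}" by (rule finite_subset[of _ "{u. f u ~= 0} \<union> {u. g u ~= 0}"]) (use assms in auto)
 from pair_add[OF this assms(2), of \<phi>] show ?thesis by simp
qed

lemma pair_scale: "finite {u. f u ~= 0} ==> pair (%w. c * f w) \<phi> = sc c (pair f \<phi>)"
 by (subst pair_superset[of "{u. f u ~= 0}"]) (auto simp: pair_def sc_sum sc_sc)

lemma pair_free_gen: "pair (free_gen u) \<phi> = \<phi> u" by (simp add: pair_def free_gen_def sc_one)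

lemma pair_right_add: "pair f (%u. \<phi> u + \<psi> u) = pair f \<phi> + pair f \<psi>" by (simp add: pair_def sc_add_right sum.distrib)

text \<open>A product coefficient sums over a fibre of \<open>m\<close>; summation over all values
  of \<open>m\<close> removes the fibres.\<close>

lemma pair_mult: assumes f: "finite {u. f u ~= 0}" and g: "finite {u. g u ~= 0}"
 shows "pair (%w. SUM (u, v) : {(u, v). f u ~= 0 & g v ~= 0 & m u v = w}. f u * g v) \<phi> =
  pair f (%u. pair g (%v. \<phi> (m u v)))"
proof -
 let ?U = "{u. f u ~= 0}" and ?V = "{u. g u ~= 0}"
 let ?X = "(%(u, v). m u v) ` (?U \<times> ?V)"
 have conv: "(SUM (u, v) : {(u, v). f u ~= 0 & g v ~= 0 & m u v = w}. f u * g v) =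
  (SUM u:?U. SUM v:?V. if m u v = w then f u * g v else 0)" for w
 proof -
  have "(SUM (u, v) : {(u, v). f u ~= 0 & g v ~= 0 & m u v = w}. f u * g v) =
   (SUM x:?U \<times> ?V. if m (fst x) (snd x) = w then f (fst x) * g (snd x) else 0)"
   by (rule sum.mono_neutral_cong_left) (use f g in "auto split: if_splits")
  thus ?thesis by (simp add: sum.cartesian_product case_prod_unfold)
 qed
 have supp: "{w. (SUM u:?U. SUM v:?V. if m u v = w then f u * g v else 0) ~= 0} \<subseteq> ?X"
 proof
  fix w assume "w : {w. (SUM u:?U. SUM v:?V. if m u v = w then f u * g v else 0) ~= 0}"
  then obtain u where u: "u : ?U" "(SUM v:?V. if m u v = w then f u * g v else 0) ~= 0" by (auto elim: sum.not_neutral_contains_not_neutral)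
  then obtain v where "v : ?V" "(if m u v = w then f u * g v else 0) ~= 0" by (auto elim: sum.not_neutral_contains_not_neutral)
  with u(1) show "w : ?X" by (auto simp: image_iff split: if_splits)
 qed
 have fin: "finite ?X" using f g by auto
 have "pair (%w. SUM (u, v) : {(u, v). f u ~= 0 & g v ~= 0 & m u v = w}. f u * g v) \<phi> =
  (SUM w:?X. sc (SUM u:?U. SUM v:?V. if m u v = w then f u * g v else 0) (\<phi> w))" unfolding conv by (rule pair_superset[OF fin supp])
 also have "... = (SUM w:?X. SUM u:?U. SUM v:?V. if w = m u v then sc (f u * g v) (\<phi> (m u v)) else 0)"
  unfolding sc_sum_left by (intro sum.cong refl) auto
 also have "... = (SUM u:?U. SUM v:?V. SUM w:?X. if w = m u v then sc (f u * g v) (\<phi> (m u v)) else 0)"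
  by (subst sum.swap) (intro sum.cong refl sum.swap)
 also have "... = (SUM u:?U. SUM v:?V. sc (f u * g v) (\<phi> (m u v)))" by (intro sum.cong refl) (use fin in auto)
 finally show ?thesis by (simp add: pair_def sc_sum sc_sc)
qed

lemma pair_star: assumes f: "finite {u. f u ~= 0}"
 shows "pair (%w. SUM u : {u. f u ~= 0 & s u = w}. cnj (f u)) \<phi> = pair (%u. cnj (f u)) (%u. \<phi> (s u))"
proof -
 let ?U = "{u. f u ~= 0}"
 have conv: "(SUM u : {u. f u ~= 0 & s u = w}. cnj (f u)) = (SUM u:?U. if s u = w then cnj (f u) else 0)" for w
  by (rule sum.mono_neutral_cong_left) (use f in auto)
 have supp: "{w. (SUM u:?U. if s u = w then cnj (f u) else 0) ~= 0} \<subseteq> s ` ?U"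
  by (auto elim!: sum.not_neutral_contains_not_neutral split: if_splits)
 have "pair (%w. SUM u : {u. f u ~= 0 & s u = w}. cnj (f u)) \<phi> = (SUM w:s ` ?U. sc (SUM u:?U. if s u = w then cnj (f u) else 0) (\<phi> w))"
  unfolding conv by (rule pair_superset[OF _ supp]) (use f in auto)
 also have "... = (SUM w:s ` ?U. SUM u:?U. if w = s u then sc (cnj (f u)) (\<phi> (s u)) else 0)" unfolding sc_sum_left by (intro sum.cong refl) auto
 also have "... = (SUM u:?U. SUM w:s ` ?U. if w = s u then sc (cnj (f u)) (\<phi> (s u)) else 0)" by (rule sum.swap)
 also have "... = (SUM u:?U. sc (cnj (f u)) (\<phi> (s u)))" by (intro sum.cong refl) (use f in auto)
 finally show ?thesis by (simp add: pair_def)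
qed

end

interpretation cx: scaling "(*) :: complex => complex => complex" by unfold_locales (auto simp: algebra_simps)

interpretation bp: scaling "csc :: complex => 'h::complex_hilbert_space bop => 'h bop"
 by unfold_locales (auto simp: csc_add_right csc_add_left csc_csc)

lemma fp_simps:
 "carrier (free_power k A) = {f. finite {u. f u ~= 0} & (ALL u. f u ~= 0 --> length u = k & set u \<subseteq> carrier A)}"
 "f \<oplus>\<^bsub>free_power k A\<^esub> g = (%w. f w + g w)" "\<zero>\<^bsub>free_power k A\<^esub> = (%w. 0)"
 "\<one>\<^bsub>free_power k A\<^esub> = free_gen (replicate k \<one>\<^bsub>A\<^esub>)" "c \<odot>\<^bsub>free_power k A\<^esub> f = (%w. c * f w)"
 "f \<otimes>\<^bsub>free_power k A\<^esub> g = (%w. SUM (u, v) : {(u, v). f u ~= 0 & g v ~= 0 & map2 (monoid.mult A) u v = w}. f u * g v)"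
 "star (free_power k A) f = (%w. SUM u : {u. f u ~= 0 & map (star A) u = w}. cnj (f u))" by (simp_all add: free_power_def free_gen_def fun_eq_iff)

lemma fp_carrierD: assumes "f : carrier (free_power k A)"
 shows "finite {u. f u ~= 0}" "f u ~= 0 ==> length u = k" "f u ~= 0 ==> set u \<subseteq> carrier A" using assms by (auto simp: fp_simps)

lemma free_gen_carrier: "length u = k ==> set u \<subseteq> carrier A ==> free_gen u : carrier (free_power k A)" by (auto simp: fp_simps free_gen_def)

lemma fp_add_carrier: assumes "f : carrier (free_power k A)" "g : carrier (free_power k A)" shows "(%w. f w + g w) : carrier (free_power k A)"
proof -
 have "finite {u. f u + g u ~= 0}" by (rule finite_subset[of _ "{u. f u ~= 0} \<union> {u. g u ~= 0}"]) (use assms in "auto simp: fp_simps")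
 moreover have "length u = k & set u \<subseteq> carrier A" if "f u + g u ~= 0" for u using that assms by (cases "f u = 0") (auto simp: fp_simps)
 ultimately show ?thesis by (simp add: fp_simps)
qed

lemma fp_smult_carrier: "f : carrier (free_power k A) ==> (%w. c * f w) : carrier (free_power k A)"
 by (auto simp: fp_simps elim: finite_subset[rotated])

lemma cx_pair_delta: assumes "finite {u. f u ~= 0}" shows "cx.pair f (%u. if u = w then 1 else 0) = f w"
 using assms by (auto simp: cx.pair_def if_distrib cong: if_cong)

lemma fp_mult_pair: "f : carrier (free_power k A) ==> g : carrier (free_power k A) ==>
  finite {u. (f \<otimes>\<^bsub>free_power k A\<^esub> g) u ~= 0}"
proof -
 assume fg: "f : carrier (free_power k A)" "g : carrier (free_power k A)"
 have "{w. (f \<otimes>\<^bsub>free_power k A\<^esub> g) w ~= 0} \<subseteq> (%(u, v). map2 (monoid.mult A) u v) ` ({u. f u ~= 0} \<times> {u. g u ~= 0})"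
  by (auto simp: fp_simps(6) image_iff elim!: sum.not_neutral_contains_not_neutral)
 thus ?thesis by (rule finite_subset) (use fg in "auto simp: fp_simps(1)")
qed

context monoid
begin

lemma map2_closed: "length u = length v ==> set u \<subseteq> carrier G ==> set v \<subseteq> carrier G ==> set (map2 (\<otimes>) u v) \<subseteq> carrier G"
 by (induction u v rule: list_induct2) auto

lemma map2_assoc: "length u = length v ==> length v = length w ==> set u \<subseteq> carrier G ==> set v \<subseteq> carrier G ==> set w \<subseteq> carrier G ==>
  map2 (\<otimes>) (map2 (\<otimes>) u v) w = map2 (\<otimes>) u (map2 (\<otimes>) v w)" by (induction u v w rule: list_induct3) (auto simp: m_assoc)

lemma map2_one: "set u \<subseteq> carrier G ==> length u = k ==> map2 (\<otimes>) (replicate k \<one>) u = u"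
  "set u \<subseteq> carrier G ==> length u = k ==> map2 (\<otimes>) u (replicate k \<one>) = u"
 by (induction u arbitrary: k) (auto simp: Suc_length_conv)

end

lemma fp_mult_carrier:
 fixes A :: "('a, 'm) star_algebra_scheme" assumes A: "monoid A" and f: "f : carrier (free_power k A)" and g: "g : carrier (free_power k A)"
 shows "f \<otimes>\<^bsub>free_power k A\<^esub> g : carrier (free_power k A)"
proof -
 have "length w = k & set w \<subseteq> carrier A" if w: "(f \<otimes>\<^bsub>free_power k A\<^esub> g) w ~= 0" for w
 proof -
  obtain u v where "f u ~= 0" "g v ~= 0" "w = map2 (monoid.mult A) u v"
   using w by (auto simp: fp_simps(6) elim!: sum.not_neutral_contains_not_neutral)
  thus ?thesis using fp_carrierD[OF f] fp_carrierD[OF g] monoid.map2_closed[OF A, of u v] by simp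
 qed
 thus ?thesis using fp_mult_pair[OF f g] by (simp add: fp_simps(1))
qed

lemma fp_pair_mult: assumes "f : carrier (free_power k A)" "g : carrier (free_power k A)"
 shows "cx.pair (f \<otimes>\<^bsub>free_power k A\<^esub> g) \<phi> = cx.pair f (%u. cx.pair g (%v. \<phi> (map2 (monoid.mult A) u v)))"
  "bp.pair (f \<otimes>\<^bsub>free_power k A\<^esub> g) \<psi> = bp.pair f (%u. bp.pair g (%v. \<psi> (map2 (monoid.mult A) u v)))"
 unfolding fp_simps(6) by (rule cx.pair_mult bp.pair_mult; rule fp_carrierD(1)[OF assms(1)] fp_carrierD(1)[OF assms(2)])+

text \<open>Linear extensions separate formal combinations, so identities for the convolution
  product reduce to identities for \<open>map2\<close> on words.\<close>

lemma fp_eqI: assumes "f : carrier (free_power k A)" "g : carrier (free_power k A)" "!!\<phi>. cx.pair f \<phi> = cx.pair g \<phi>" shows "f = g"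
 using cx_pair_delta[OF fp_carrierD(1)[OF assms(1)]] cx_pair_delta[OF fp_carrierD(1)[OF assms(2)]] assms(3) by (intro ext) metis

lemma fp_ring:
 fixes A :: "('a, 'm) star_algebra_scheme" assumes A: "monoid A" shows "ring (free_power k A)"
proof (rule ringI)
 let ?P = "free_power k A"
 note mc = fp_mult_carrier[OF A] and fin = fp_carrierD(1)
 have oc: "\<one>\<^bsub>?P\<^esub> : carrier ?P" using monoid.one_closed[OF A] by (simp add: fp_simps(4) free_gen_carrier set_replicate_conv_if)
 show "abelian_group ?P"
 proof (rule abelian_groupI)
  fix f assume f: "f : carrier ?P"
  have "(%w. - 1 * f w) : carrier ?P" by (rule fp_smult_carrier[OF f])
  thus "EX y:carrier ?P. y \<oplus>\<^bsub>?P\<^esub> f = \<zero>\<^bsub>?P\<^esub>"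
   by (intro bexI[of _ "%w. - 1 * f w"]) (simp_all add: fp_simps(2,3))
 qed (use fp_add_carrier in "auto simp: fp_simps(2,3) add_ac intro: fp_smult_carrier[of _ k A 0, simplified]",
   auto simp: fp_simps)
 show "monoid ?P"
 proof (rule monoidI)
  fix f g h assume f: "f : carrier ?P" and g: "g : carrier ?P" and h: "h : carrier ?P"
  show "f \<otimes>\<^bsub>?P\<^esub> g \<otimes>\<^bsub>?P\<^esub> h = f \<otimes>\<^bsub>?P\<^esub> (g \<otimes>\<^bsub>?P\<^esub> h)"
  proof (rule fp_eqI[of _ k A])
   fix \<phi>
   show "cx.pair (f \<otimes>\<^bsub>?P\<^esub> g \<otimes>\<^bsub>?P\<^esub> h) \<phi> = cx.pair (f \<otimes>\<^bsub>?P\<^esub> (g \<otimes>\<^bsub>?P\<^esub> h)) \<phi>"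
    unfolding fp_pair_mult(1)[OF mc[OF f g] h] fp_pair_mult(1)[OF f g] fp_pair_mult(1)[OF f mc[OF g h]] fp_pair_mult(1)[OF g h]
    using fp_carrierD(2,3)[OF f] fp_carrierD(2,3)[OF g] fp_carrierD(2,3)[OF h]
    by (intro cx.pair_cong arg_cong[of _ _ \<phi>]) (simp add: monoid.map2_assoc[OF A])
  qed (intro mc f g h)+
 next
  fix f assume f: "f : carrier ?P"
  show "\<one>\<^bsub>?P\<^esub> \<otimes>\<^bsub>?P\<^esub> f = f"
  proof (rule fp_eqI[of _ k A])
   fix \<phi>
   show "cx.pair (\<one>\<^bsub>?P\<^esub> \<otimes>\<^bsub>?P\<^esub> f) \<phi> = cx.pair f \<phi>"
    unfolding fp_pair_mult(1)[OF oc f] unfolding fp_simps(4) cx.pair_free_gen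
    using fp_carrierD(2,3)[OF f] by (intro cx.pair_cong arg_cong[of _ _ \<phi>]) (simp add: monoid.map2_one[OF A])
  qed (intro mc oc f)+
  show "f \<otimes>\<^bsub>?P\<^esub> \<one>\<^bsub>?P\<^esub> = f"
  proof (rule fp_eqI[of _ k A])
   fix \<phi>
   show "cx.pair (f \<otimes>\<^bsub>?P\<^esub> \<one>\<^bsub>?P\<^esub>) \<phi> = cx.pair f \<phi>"
    unfolding fp_pair_mult(1)[OF f oc] unfolding fp_simps(4) cx.pair_free_gen
    using fp_carrierD(2,3)[OF f] by (intro cx.pair_cong arg_cong[of _ _ \<phi>]) (simp add: monoid.map2_one[OF A])
  qed (intro mc oc f)+
 qed (use mc oc in auto)
 fix f g h assume f: "f : carrier ?P" and g: "g : carrier ?P" and h: "h : carrier ?P"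
 have ac: "f \<oplus>\<^bsub>?P\<^esub> g : carrier ?P" if "f : carrier ?P" "g : carrier ?P" for f g
  using fp_add_carrier[OF that] by (simp add: fp_simps(2))
 have pa: "cx.pair (f \<oplus>\<^bsub>?P\<^esub> g) \<phi> = cx.pair f \<phi> + cx.pair g \<phi>" if "f : carrier ?P" "g : carrier ?P" for f g \<phi>
  unfolding fp_simps(2) by (rule cx.pair_add[OF fin[OF that(1)] fin[OF that(2)]])
 show "(f \<oplus>\<^bsub>?P\<^esub> g) \<otimes>\<^bsub>?P\<^esub> h = f \<otimes>\<^bsub>?P\<^esub> h \<oplus>\<^bsub>?P\<^esub> g \<otimes>\<^bsub>?P\<^esub> h"
  by (rule fp_eqI[of _ k A])
   (use f g h in "simp_all add: mc ac pa fp_pair_mult(1)")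
 show "h \<otimes>\<^bsub>?P\<^esub> (f \<oplus>\<^bsub>?P\<^esub> g) = h \<otimes>\<^bsub>?P\<^esub> f \<oplus>\<^bsub>?P\<^esub> h \<otimes>\<^bsub>?P\<^esub> g"
  by (rule fp_eqI[of _ k A])
   (use f g h in "simp_all add: mc ac pa fp_pair_mult(1) cx.pair_right_add")
qed

section \<open>Evaluation of formal tensors in \<open>R\<close>\<close>

abbreviation (input) "MM \<equiv> multimatrix_algebra"
abbreviation (input) "OA \<equiv> operator_algebra"

lemma multimatrix_simps:
 "carrier (MM n a) = (\<Pi>\<^sub>E i\<in>{..<n}. carrier_mat (a i) (a i))"
 "X \<otimes>\<^bsub>MM n a\<^esub> Y = (\<lambda>i\<in>{..<n}. X i * Y i)" "\<one>\<^bsub>MM n a\<^esub> = (\<lambda>i\<in>{..<n}. 1\<^sub>m (a i))"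
 "X \<oplus>\<^bsub>MM n a\<^esub> Y = (\<lambda>i\<in>{..<n}. X i + Y i)"
 "c \<odot>\<^bsub>MM n a\<^esub> X = (\<lambda>i\<in>{..<n}. c \<cdot>\<^sub>m X i)" "star (MM n a) X = (\<lambda>i\<in>{..<n}. mat_adjoint (X i))"
 by (simp_all add: multimatrix_algebra_def)

lemma mat_adjoint_index:
 assumes "M : carrier_mat m m" shows "mat_adjoint M : carrier_mat m m" "p < m ==> q < m ==> mat_adjoint M $$ (p, q) = cnj (M $$ (q, p))"
 using assms by (auto simp: mat_adjoint_def mat_of_rows_def)

lemma multimatrix_closed: assumes "X : carrier (MM n a)" "Y : carrier (MM n a)" shows "X \<otimes>\<^bsub>MM n a\<^esub> Y : carrier (MM n a)"
  "X \<oplus>\<^bsub>MM n a\<^esub> Y : carrier (MM n a)"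
  "c \<odot>\<^bsub>MM n a\<^esub> X : carrier (MM n a)"
  "star (MM n a) X : carrier (MM n a)"
 using assms by (auto simp: multimatrix_simps PiE_iff extensional_def intro: mult_carrier_mat add_carrier_mat mat_adjoint_index(1))

lemma multimatrix_one: "\<one>\<^bsub>MM n a\<^esub> : carrier (MM n a)" by (auto simp: multimatrix_simps)

lemma multimatrix_monoid: "monoid (MM n a)"
proof (rule monoidI)
 fix X Y Z assume X: "X : carrier (MM n a)" and Y: "Y : carrier (MM n a)" and Z: "Z : carrier (MM n a)"
 show "X \<otimes>\<^bsub>MM n a\<^esub> Y \<otimes>\<^bsub>MM n a\<^esub> Z =
  X \<otimes>\<^bsub>MM n a\<^esub> (Y \<otimes>\<^bsub>MM n a\<^esub> Z)"
  using X Y Z by (auto simp: multimatrix_simps PiE_iff intro!: restrict_ext assoc_mult_mat)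
next
 fix X assume X: "X : carrier (MM n a)"
 show "\<one>\<^bsub>MM n a\<^esub> \<otimes>\<^bsub>MM n a\<^esub> X = X"
 proof (rule ext)
  fix i show "(\<one>\<^bsub>MM n a\<^esub> \<otimes>\<^bsub>MM n a\<^esub> X) i = X i"
   using X left_mult_one_mat[of "X i" "a i" "a i"] by (cases "i < n") (auto simp: multimatrix_simps PiE_iff extensional_def)
 qed
 show "X \<otimes>\<^bsub>MM n a\<^esub> \<one>\<^bsub>MM n a\<^esub> = X"
 proof (rule ext)
  fix i show "(X \<otimes>\<^bsub>MM n a\<^esub> \<one>\<^bsub>MM n a\<^esub>) i = X i"
   using X right_mult_one_mat[of "X i" "a i" "a i"] by (cases "i < n") (auto simp: multimatrix_simps PiE_iff extensional_def)
 qed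
qed (auto simp: multimatrix_closed multimatrix_one)

lemma OA_simps:
 "app x \<otimes>\<^bsub>OA M\<^esub> app y = app (x * y)" "app x \<oplus>\<^bsub>OA M\<^esub> app y = app (x + y)"
 "\<one>\<^bsub>OA M\<^esub> = app 1" "\<zero>\<^bsub>OA M\<^esub> = app 0" "c \<odot>\<^bsub>OA M\<^esub> app x = app (csc c x)"
 "star (OA M) (app x) = app (x\<dagger>)" "carrier (OA M) = M" by (simp_all add: operator_algebra_def fun_eq_iff app_adj)

lemma OA_ring: assumes S: "star_alg S" shows "ring (OA (app ` S))"
proof (rule ringI)
 note s = star_algD[OF S]
 show "abelian_group (OA (app ` S))"
 proof (rule abelian_groupI)
  fix x assume "x : carrier (OA (app ` S))"
  then obtain y where "y : S" "x = app y" by (auto simp: OA_simps)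
  thus "EX y:carrier (OA (app ` S)). y \<oplus>\<^bsub>OA (app ` S)\<^esub> x = \<zero>\<^bsub>OA (app ` S)\<^esub>"
   using s(7) by (intro bexI[of _ "app (- y)"]) (auto simp: OA_simps)
 qed (auto simp: OA_simps s add_ac)
 show "monoid (OA (app ` S))" by (rule monoidI) (auto simp: OA_simps s mult.assoc)
qed (auto simp: OA_simps distrib_left distrib_right)

context endo_data
begin

abbreviation AA :: "(nat => complex mat) star_algebra" where "AA \<equiv> MM n a"

definition \<iota> :: "(nat => complex mat) => 'h bop" where "\<iota> X = iota (%i x y. X i $$ (x, y))"

lemma iota_cong: "(!!i x y. i < n ==> x < a i ==> y < a i ==> B i x y = C i x y) ==> iota B = iota C" unfolding iota_def by (intro sum.cong refl) auto

lemma \<iota>_hom: assumes "X : carrier AA" "Y : carrier AA"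
 shows "\<iota> (X \<otimes>\<^bsub>AA\<^esub> Y) = \<iota> X * \<iota> Y" "\<iota> (X \<oplus>\<^bsub>AA\<^esub> Y) = \<iota> X + \<iota> Y" "\<iota> (c \<odot>\<^bsub>AA\<^esub> X) = csc c (\<iota> X)"
  "\<iota> (star AA X) = (\<iota> X)\<dagger>"
proof -
 have c: "X i : carrier_mat (a i) (a i)" "Y i : carrier_mat (a i) (a i)" if "i < n" for i using assms that by (auto simp: multimatrix_simps PiE_iff)
 have d: "dim_row (X i) = a i" "dim_col (X i) = a i" "dim_row (Y i) = a i" "dim_col (Y i) = a i" if "i < n" for i using c[OF that] by auto
 show "\<iota> (X \<otimes>\<^bsub>AA\<^esub> Y) = \<iota> X * \<iota> Y"
  unfolding \<iota>_def iota_mult by (rule iota_cong) (use d in "simp add: multimatrix_simps scalar_prod_def atLeast0LessThan")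
 show "\<iota> (X \<oplus>\<^bsub>AA\<^esub> Y) = \<iota> X + \<iota> Y"
  unfolding \<iota>_def iota_add[symmetric] by (rule iota_cong) (use d in "simp add: multimatrix_simps")
 show "\<iota> (c \<odot>\<^bsub>AA\<^esub> X) = csc c (\<iota> X)"
  unfolding \<iota>_def iota_csc[symmetric] by (rule iota_cong) (use d in "simp add: multimatrix_simps")
 show "\<iota> (star AA X) = (\<iota> X)\<dagger>"
  unfolding \<iota>_def iota_adj by (rule iota_cong) (simp add: multimatrix_simps mat_adjoint_index(2)[OF c(1)])
qed

lemma \<iota>_one: "\<iota> \<one>\<^bsub>AA\<^esub> = 1" unfolding iota_one[symmetric] \<iota>_def by (rule iota_cong) (simp add: multimatrix_simps)

lemma \<iota>_R [simp]: "\<iota> X : R" by (simp add: \<iota>_def iota_R)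

primrec tens :: "(nat => complex mat) list => 'h bop" where
 "tens [] = 1"
| "tens (X # u) = \<iota> X * emb (tens u)"

lemma tens_R [simp]: "tens u : R" by (induction u) auto

lemma \<iota>_commute: "z : R ==> \<iota> X * emb z = emb z * \<iota> X" unfolding \<iota>_def by (rule iota_commute)

text \<open>\<open>\<iota>\<close> commutes with the image of \<open>emb\<close>, so the factors of
  the two products can be interleaved.\<close>

lemma tens_mult:
 "length u = length v ==> set u \<subseteq> carrier AA ==> set v \<subseteq> carrier AA ==> tens (map2 (monoid.mult AA) u v) = tens u * tens v"
proof (induction u v rule: list_induct2)
 case (Cons X u Y v)
 have "\<iota> X * emb (tens u) * (\<iota> Y * emb (tens v)) = \<iota> X * (emb (tens u) * \<iota> Y) * emb (tens v)" by (simp only: mult.assoc)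
 also have "... = \<iota> X * (\<iota> Y * emb (tens u)) * emb (tens v)" by (simp only: \<iota>_commute[OF tens_R])
 also have "... = (\<iota> X * \<iota> Y) * emb (tens u * tens v)" by (simp add: emb_mult mult.assoc)
 finally show ?case using Cons by (simp add: \<iota>_hom)
qed simp

lemma tens_star: "set u \<subseteq> carrier AA ==> tens (map (star AA) u) = (tens u)\<dagger>"
proof (induction u)
 case (Cons X u)
 hence X: "X : carrier AA" by simp
 have "(tens (X # u))\<dagger> = emb ((tens u)\<dagger>) * (\<iota> X)\<dagger>" by (simp add: emb_adj)
 also have "... = \<iota> (star AA X) * emb (tens (map (star AA) u))"
  using Cons \<iota>_commute[of "(tens u)\<dagger>" "star AA X"] by (simp add: \<iota>_hom(4)[OF X X])
 finally show ?case by simp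
qed simp

lemma tens_one: "tens (replicate k \<one>\<^bsub>AA\<^esub>) = 1" by (induction k) (simp_all add: \<iota>_one emb_one)

lemma tens_update_add: "j < length u ==> X : carrier AA ==> Y : carrier AA ==>
  tens (u[j := X \<oplus>\<^bsub>AA\<^esub> Y]) = tens (u[j := X]) + tens (u[j := Y])"
proof (induction u arbitrary: j)
 case (Cons Z u)
 thus ?case by (cases j) (simp_all add: \<iota>_hom distrib_right distrib_left emb_add)
qed simp

lemma tens_update_csc: "j < length u ==> X : carrier AA ==> tens (u[j := c \<odot>\<^bsub>AA\<^esub> X]) = csc c (tens (u[j := X]))"
proof (induction u arbitrary: j)
 case (Cons Z u)
 thus ?case by (cases j) (simp_all add: \<iota>_hom emb_csc)
qed simp

lemma rc_star_alg: "star_alg (rc k)"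
proof -
 have adj: "(emb ^^ k) (l\<dagger>) = ((emb ^^ k) l)\<dagger>" if "l : R" for l using that by (induction k) (auto simp: emb_adj emb_pow_R)
 show ?thesis unfolding star_alg_def
 proof (intro conjI ballI allI)
  fix x y assume "x : rc k" "y : rc k"
  hence x: "x : R" "!!l. l : R ==> x * (emb ^^ k) l = (emb ^^ k) l * x" and y: "y : R" "!!l. l : R ==> y * (emb ^^ k) l = (emb ^^ k) l * y"
   by (auto simp: rc_def)
  show "x + y : rc k" using x y by (simp add: rc_def distrib_left distrib_right)
  have "x * y * (emb ^^ k) l = (emb ^^ k) l * (x * y)" if "l : R" for l
  proof -
   have "x * y * (emb ^^ k) l = x * (emb ^^ k) l * y" by (simp only: mult.assoc y(2)[OF that])
   thus ?thesis by (simp only: x(2)[OF that] mult.assoc)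
  qed
  thus "x * y : rc k" using x y by (simp add: rc_def)
 next
  fix x c assume "x : rc k"
  hence x: "x : R" "!!l. l : R ==> x * (emb ^^ k) l = (emb ^^ k) l * x" by (auto simp: rc_def)
  show "csc c x : rc k" using x by (simp add: rc_def csc_mult_right)
  have "x\<dagger> * (emb ^^ k) l = (emb ^^ k) l * x\<dagger>" if l: "l : R" for l
  proof -
   have "(x * (emb ^^ k) (l\<dagger>))\<dagger> = ((emb ^^ k) (l\<dagger>) * x)\<dagger>" using x(2)[of "l\<dagger>"] l by simp
   thus ?thesis using adj[OF l] by simp
  qed
  thus "x\<dagger> : rc k" using x by (simp add: rc_def)
 qed (simp add: rc_def)
qed

lemma tens_rc: "tens u : rc (length u)"
proof (induction u)
 case (Cons X u)
 have "tens (X # u) = (SUM i<n. SUM x<a i. SUM x'<a i. e i x x' * emb (csc (X i $$ (x, x')) (tens u)))"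
  unfolding tens.simps \<iota>_def iota_def sum_distrib_right by (intro sum.cong refl) (simp add: emb_csc csc_mult_right)
 moreover have "csc (X i $$ (x, x')) (tens u) : rc (length u)" for i x x' by (rule star_algD(6)[OF rc_star_alg Cons])
 ultimately show ?case unfolding length_Cons rc_Suc by (intro exI[of _ "%i x x'. csc (X i $$ (x, x')) (tens u)"] conjI allI impI)
qed (simp add: rc_def)

definition mat_unit :: "nat \<times> nat \<times> nat => nat => complex mat" where
 "mat_unit l = (\<lambda>i\<in>{..<n}. Matrix.mat (a i) (a i) (%(p, q). if (i, p, q) = l then 1 else 0))"

lemma mat_unit_carrier [simp]: "mat_unit l : carrier AA" by (simp add: mat_unit_def multimatrix_simps)

lemma tens_mat_unit: "tens (map mat_unit u) = tensor (map munit u)"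
proof (induction u)
 case (Cons l u)
 have "\<iota> (mat_unit l) = iota (munit l)" unfolding \<iota>_def by (rule iota_cong) (auto simp: mat_unit_def munit_def split: prod.splits)
 with Cons show ?case by simp
qed simp

text \<open>Its kernel will turn out to be the ideal of the multilinear relations.\<close>

definition evl :: "((nat => complex mat) list => complex) => 'h bop" where
 "evl q = bp.pair q tens"

abbreviation P :: "nat => ((nat => complex mat) list => complex) star_algebra" where "P k \<equiv> free_power k AA"

lemma evl_mult: assumes "q : carrier (P k)" "g : carrier (P k)" shows "evl (q \<otimes>\<^bsub>P k\<^esub> g) = evl q * evl g"
proof -
 have "evl (q \<otimes>\<^bsub>P k\<^esub> g) = bp.pair q (%u. bp.pair g (%v. tens u * tens v))" unfolding evl_def fp_pair_mult(2)[OF assms]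
  using fp_carrierD(2,3)[OF assms(1)] fp_carrierD(2,3)[OF assms(2)] by (intro bp.pair_cong tens_mult) auto
 also have "... = evl q * evl g"
  unfolding evl_def bp.pair_def sum_distrib_right by (intro sum.cong refl) (simp add: sum_distrib_left csc_sum mult.commute)
 finally show ?thesis .
qed

lemma evl_add: "q : carrier (P k) ==> g : carrier (P k) ==> evl (%w. q w + g w) = evl q + evl g"
 unfolding evl_def by (rule bp.pair_add) (auto dest: fp_carrierD(1))

lemma evl_scale: "q : carrier (P k) ==> evl (%w. c * q w) = csc c (evl q)" unfolding evl_def by (rule bp.pair_scale) (auto dest: fp_carrierD(1))

lemma evl_star: assumes "q : carrier (P k)" shows "evl (star (P k) q) = (evl q)\<dagger>"
proof -
 have "evl (star (P k) q) = bp.pair (%u. cnj (q u)) (%u. (tens u)\<dagger>)" unfolding evl_def fp_simps(7) bp.pair_star[OF fp_carrierD(1)[OF assms]]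
  using fp_carrierD(3)[OF assms] by (intro bp.pair_cong tens_star) auto
 thus ?thesis by (simp add: evl_def bp.pair_def adj_sum)
qed

lemma evl_one: "evl \<one>\<^bsub>P k\<^esub> = 1" by (simp add: evl_def fp_simps(4) bp.pair_free_gen tens_one)

lemma evl_rc: assumes "q : carrier (P k)" shows "evl q : rc k"
proof -
 have "tens u : rc k" if "q u ~= 0" for u using fp_carrierD(2)[OF assms that] tens_rc[of u] by simp
 thus ?thesis unfolding evl_def bp.pair_def by (intro star_alg_sum[OF rc_star_alg] star_algD(6)[OF rc_star_alg]) auto
qed

lemma combination: assumes "finite U" "!!v. v : U ==> g v : carrier (P k)"
 shows "(%w. SUM v:U. c v * g v w) : carrier (P k) & evl (%w. SUM v:U. c v * g v w) = (SUM v:U. csc (c v) (evl (g v)))" using assms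
proof (induction U rule: finite_induct)
 case empty
 thus ?case by (simp add: fp_simps evl_def bp.pair_def)
next
 case (insert x U)
 thus ?case using fp_add_carrier[OF fp_smult_carrier[of "g x" k AA "c x"], of "%w. SUM v:U. c v * g v w"]
   evl_add[OF fp_smult_carrier[of "g x" k AA "c x"], of "%w. SUM v:U. c v * g v w"] evl_scale[of "g x" k "c x"] by simp
qed

lemma word_gen: "u : words k ==> free_gen (map mat_unit u) : carrier (P k)" by (intro free_gen_carrier) auto

lemma evl_free_gen: "evl (free_gen u) = tens u" by (simp add: evl_def bp.pair_free_gen)

lemma evl_surj: assumes "y : rc k" shows "EX q:carrier (P k). evl q = y"
proof -
 obtain c where c: "y = (SUM u:words k. csc (c u) (tensor (map munit u)))" using rc_words assms by blast
 have "(%w. SUM v:words k. c v * free_gen (map mat_unit v) w) : carrier (P k) &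
  evl (%w. SUM v:words k. c v * free_gen (map mat_unit v) w) = y"
  using combination[of "words k" "%v. free_gen (map mat_unit v)" k c, OF finite_words word_gen] unfolding c evl_free_gen tens_mat_unit .
 thus ?thesis by blast
qed

lemma evl_ring_hom: "ring_hom_ring (P k) (OA (app ` rc k)) (%q. app (evl q))"
proof (rule ring_hom_ringI)
 show "ring (P k)" by (rule fp_ring[OF multimatrix_monoid])
 show "ring (OA (app ` rc k))" by (rule OA_ring[OF rc_star_alg])
next
 fix q g assume qg: "q : carrier (P k)" "g : carrier (P k)"
 show "app (evl q) : carrier (OA (app ` rc k))" using evl_rc[OF qg(1)] by (simp add: OA_simps(7))
 show "app (evl (q \<otimes>\<^bsub>P k\<^esub> g)) = app (evl q) \<otimes>\<^bsub>OA (app ` rc k)\<^esub> app (evl g)"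
  by (simp only: evl_mult[OF qg] OA_simps)
 show "app (evl (q \<oplus>\<^bsub>P k\<^esub> g)) = app (evl q) \<oplus>\<^bsub>OA (app ` rc k)\<^esub> app (evl g)"
  by (simp only: fp_simps(2) evl_add[OF qg] OA_simps)
next
 show "app (evl \<one>\<^bsub>P k\<^esub>) = \<one>\<^bsub>OA (app ` rc k)\<^esub>" by (simp only: evl_one OA_simps)
qed

lemma kernel_eq: "a_kernel (P k) (OA (app ` rc k)) (%q. app (evl q)) = {q : carrier (P k). evl q = 0}"
 unfolding a_kernel_def' OA_simps app_inject by (rule refl)

end

section \<open>The kernel of the evaluation and the tensor power\<close>

lemma UN_eqI: "q : S ==> (!!g. g : S ==> F g = C) ==> (UN g:S. F g) = C" by auto

context endo_data
begin

abbreviation J :: "nat => ((nat => complex mat) list => complex) set" where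
 "J k \<equiv> genideal (P k) (multilinear_relations k AA)"

lemma P_ring: "ring (P k)" by (rule fp_ring[OF multimatrix_monoid])

lemma set_list_update: "set u \<subseteq> carrier AA ==> X : carrier AA ==> set (u[j := X]) \<subseteq> carrier AA"
 by (meson order_trans insert_subset set_update_subset_insert)

lemma diff_carrier: "q : carrier (P k) ==> g : carrier (P k) ==> (%w. q w - g w) : carrier (P k)"
 using fp_add_carrier[of q k AA "%w. - 1 * g w"] fp_smult_carrier[of g k AA "- 1"] by simp

lemma evl_diff: "q : carrier (P k) ==> g : carrier (P k) ==> evl (%w. q w - g w) = evl q - evl g"
 unfolding evl_def by (rule bp.pair_diff) (auto dest: fp_carrierD(1))

lemma relations_kernel: assumes "g : multilinear_relations k AA" shows "g : carrier (P k) & evl g = 0"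
proof -
 have gen: "free_gen (u[j := X]) : carrier (P k)" if "length u = k" "set u \<subseteq> carrier AA" "X : carrier AA" for u j X
  using that set_list_update by (intro free_gen_carrier) auto
 consider (add) u j X Y where "g = (%w. free_gen (u[j := X \<oplus>\<^bsub>AA\<^esub> Y]) w - free_gen (u[j := X]) w - free_gen (u[j := Y]) w)"
   "length u = k" "set u \<subseteq> carrier AA" "j < k" "X : carrier AA" "Y : carrier AA"
  | (smult) u j c X where "g = (%w. free_gen (u[j := c \<odot>\<^bsub>AA\<^esub> X]) w - c * free_gen (u[j := X]) w)"
   "length u = k" "set u \<subseteq> carrier AA" "j < k" "X : carrier AA" using assms unfolding multilinear_relations_def by blast
 thus ?thesis
 proof cases
  case add
  note XY = multimatrix_closed(2)[OF add(5,6)]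
  note c = gen[OF add(2,3) XY, of j] gen[OF add(2,3,5), of j] gen[OF add(2,3,6), of j]
  show ?thesis unfolding add(1) using diff_carrier[OF diff_carrier[OF c(1,2)] c(3)] evl_diff[OF diff_carrier[OF c(1,2)] c(3)] evl_diff[OF c(1,2)]
   by (simp add: evl_free_gen tens_update_add add)
 next
  case smult
  note cX = multimatrix_closed(3)[OF smult(5,5)]
  note c = gen[OF smult(2,3) cX, of j] fp_smult_carrier[OF gen[OF smult(2,3,5), of j]]
  show ?thesis unfolding smult(1) using diff_carrier[OF c] evl_diff[OF c] evl_scale[OF gen[OF smult(2,3,5), of j]]
   by (simp add: evl_free_gen tens_update_csc smult)
 qed
qed

lemma J_ideal: "ideal (J k) (P k)" using relations_kernel by (intro ring.genideal_ideal[OF P_ring]) auto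

lemma J_kernel: "J k \<subseteq> {q : carrier (P k). evl q = 0}"
proof (rule ring.genideal_minimal[OF P_ring])
 show "ideal {q : carrier (P k). evl q = 0} (P k)" using ring_hom_ring.kernel_is_ideal[OF evl_ring_hom, of k] unfolding kernel_eq .
qed (use relations_kernel in auto)

lemma J_relation: "g : multilinear_relations k AA ==> g : J k"
 using ring.genideal_self[OF P_ring, of "multilinear_relations k AA" k] relations_kernel by auto

lemma J_add: "q : J k ==> g : J k ==> (%w. q w + g w) : J k"
 using additive_subgroup.a_closed[OF ideal.axioms(1)[OF J_ideal], of q k g] by (simp add: fp_simps(2))

lemma J_zero: "(%w. 0) : J k" using additive_subgroup.zero_closed[OF ideal.axioms(1)[OF J_ideal], of k] by (simp add: fp_simps(3))

text \<open>An ideal absorbs ring products, and a scalar multiple of \<open>q\<close> is the product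
  of \<open>q\<close> with a scalar multiple of the unit.\<close>

lemma J_scale: assumes q: "q : J k" shows "(%w. c * q w) : J k"
proof -
 let ?o = "\<one>\<^bsub>P k\<^esub>"
 have qc: "q : carrier (P k)" using J_kernel q by auto
 have oc: "?o : carrier (P k)" using ring.ring_simprules(6)[OF P_ring] .
 have "(%w. c * ?o w) \<otimes>\<^bsub>P k\<^esub> q = (%w. c * q w)"
 proof (rule fp_eqI[of _ k AA])
  show "(%w. c * ?o w) \<otimes>\<^bsub>P k\<^esub> q : carrier (P k)" by (rule fp_mult_carrier[OF multimatrix_monoid fp_smult_carrier[OF oc] qc])
  show "(%w. c * q w) : carrier (P k)" by (rule fp_smult_carrier[OF qc])
  fix \<phi>
  have "cx.pair ((%w. c * ?o w) \<otimes>\<^bsub>P k\<^esub> q) \<phi> = c * cx.pair q (%v. \<phi> (map2 (monoid.mult AA) (replicate k \<one>\<^bsub>AA\<^esub>) v))"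
   unfolding fp_pair_mult(1)[OF fp_smult_carrier[OF oc] qc] cx.pair_scale[OF fp_carrierD(1)[OF oc]] unfolding fp_simps(4) cx.pair_free_gen ..
  also have "cx.pair q (%v. \<phi> (map2 (monoid.mult AA) (replicate k \<one>\<^bsub>AA\<^esub>) v)) = cx.pair q \<phi>"
   using fp_carrierD(2,3)[OF qc] by (intro cx.pair_cong arg_cong[of _ _ \<phi>]) (simp add: monoid.map2_one[OF multimatrix_monoid])
  finally show "cx.pair ((%w. c * ?o w) \<otimes>\<^bsub>P k\<^esub> q) \<phi> = cx.pair (%w. c * q w) \<phi>"
   using cx.pair_scale[OF fp_carrierD(1)[OF qc]] by simp
 qed
 thus ?thesis using ideal.I_l_closed[OF J_ideal q fp_smult_carrier[OF oc, of c]] by simp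
qed

text \<open>Combinations of words in matrix units modulo \<open>J k\<close>. By
  \<open>spanned_gen\<close> all generators are of this form, which bounds the quotient from
  above.\<close>

definition spanned :: "nat => ((nat => complex mat) list => complex) set" where
 "spanned k = {%w. g w + (SUM v:words k. c v * free_gen (map mat_unit v) w) | g c. g : J k}"

lemma spanned_add: assumes "q : spanned k" "g : spanned k" shows "(%w. q w + g w) : spanned k"
proof -
 obtain q' c where q: "q' : J k" "q = (%w. q' w + (SUM v:words k. c v * free_gen (map mat_unit v) w))" using assms(1) unfolding spanned_def by blast
 obtain g' d where g: "g' : J k" "g = (%w. g' w + (SUM v:words k. d v * free_gen (map mat_unit v) w))" using assms(2) unfolding spanned_def by blast
 have "(%w. q w + g w) = (%w. (q' w + g' w) + (SUM v:words k. (c v + d v) * free_gen (map mat_unit v) w))"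
  unfolding q(2) g(2) by (simp add: distrib_right sum.distrib add_ac)
 thus ?thesis using J_add[OF q(1) g(1)] unfolding spanned_def by (intro CollectI exI[of _ "%w. q' w + g' w"] exI[of _ "%v. c v + d v"]) simp
qed

lemma spanned_scale: assumes "q : spanned k" shows "(%w. t * q w) : spanned k"
proof -
 obtain q' c where q: "q' : J k" "q = (%w. q' w + (SUM v:words k. c v * free_gen (map mat_unit v) w))" using assms unfolding spanned_def by blast
 have "(%w. t * q w) = (%w. t * q' w + (SUM v:words k. (t * c v) * free_gen (map mat_unit v) w))"
  unfolding q(2) by (simp add: distrib_left sum_distrib_left mult.assoc)
 thus ?thesis using J_scale[OF q(1), of t] unfolding spanned_def by (intro CollectI exI[of _ "%w. t * q' w"] exI[of _ "%v. t * c v"]) simp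
qed

lemma spanned_J: "q : J k ==> q : spanned k" unfolding spanned_def by (intro CollectI exI[of _ q] exI[of _ "%v. 0"]) simp

lemma spanned_word: assumes "v : words k" shows "free_gen (map mat_unit v) : spanned k"
proof -
 have "(SUM v':words k. (if v' = v then 1 else 0) * free_gen (map mat_unit v') w) = free_gen (map mat_unit v) w" for w
 proof -
  have "(SUM v':words k. (if v' = v then 1 else 0) * free_gen (map mat_unit v') w) =
   (SUM v':words k. if v' = v then free_gen (map mat_unit v) w else 0)" by (intro sum.cong refl) auto
  thus ?thesis using assms finite_words[of k] by simp
 qed
 thus ?thesis unfolding spanned_def by (intro CollectI exI[of _ "%w. 0"] exI[of _ "%v'. if v' = v then 1 else 0"]) (simp add: J_zero)
qed

text \<open>Restriction to the entries in \<open>L\<close>. Adding one entry at a time leads from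
  zero to \<open>X\<close> by single applications of the additivity and scaling relations.\<close>

definition mat_part :: "(nat \<times> nat \<times> nat) set => (nat => complex mat) => nat => complex mat" where
 "mat_part L X = (\<lambda>i\<in>{..<n}. Matrix.mat (a i) (a i) (%(x, y). if (i, x, y) : L then X i $$ (x, y) else 0))"

lemma mat_part: assumes X: "X : carrier AA" shows "mat_part L X : carrier AA" "mat_part {} X = 0 \<odot>\<^bsub>AA\<^esub> X" "mat_part letters X = X"
  "(i, x, y) ~: L ==> mat_part (insert (i, x, y) L) X = mat_part L X \<oplus>\<^bsub>AA\<^esub> (X i $$ (x, y) \<odot>\<^bsub>AA\<^esub> mat_unit (i, x, y))"
proof -
 have d: "dim_row (X i) = a i" "dim_col (X i) = a i" if "i < n" for i using X that by (auto simp: multimatrix_simps PiE_iff)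
 show "mat_part L X : carrier AA" by (simp add: mat_part_def multimatrix_simps)
 show "mat_part {} X = 0 \<odot>\<^bsub>AA\<^esub> X" by (auto simp: mat_part_def multimatrix_simps d intro!: restrict_ext eq_matI)
 show "mat_part letters X = X"
 proof (rule ext)
  fix j show "mat_part letters X j = X j"
   using X d[of j] by (cases "j < n") (auto simp: mat_part_def letters_def multimatrix_simps PiE_iff extensional_def intro!: eq_matI)
 qed
 assume "(i, x, y) ~: L"
 thus "mat_part (insert (i, x, y) L) X = mat_part L X \<oplus>\<^bsub>AA\<^esub> (X i $$ (x, y) \<odot>\<^bsub>AA\<^esub> mat_unit (i, x, y))"
  by (auto simp: mat_part_def mat_unit_def multimatrix_simps d intro!: restrict_ext eq_matI)
qed

text \<open>Induction on the number \<open>j\<close> of leading entries that may fail to be matrix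
  units: the last of these is expanded by multilinearity, and each term falls under the induction
  hypothesis.\<close>

lemma spanned_gen: assumes "length u = k" "set u \<subseteq> carrier AA" shows "free_gen u : spanned k"
proof -
 have "free_gen u : spanned k"
  if "length u = k" "set u \<subseteq> carrier AA" "!!i. i < k ==> j <= i ==> u ! i : mat_unit ` letters" for u j using that
 proof (induction j arbitrary: u)
  case 0
  hence "set u \<subseteq> mat_unit ` letters" by (auto simp: set_conv_nth)
  hence "u : lists (mat_unit ` letters)" by auto
  then obtain v where "u = map mat_unit v" "v : lists letters" unfolding lists_image by blast
  thus ?case using 0 by (auto intro: spanned_word)
 next
  case (Suc j)
  show ?case
  proof (cases "j < k")
   case False
   thus ?thesis using Suc by auto
  next
   case True
   define X where "X = u ! j"
   have X: "X : carrier AA" using Suc.prems True by (auto simp: X_def set_conv_nth)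
   have upd: "free_gen (u[j := mat_unit l]) : spanned k" if "l : letters" for l
    using Suc.prems that set_list_update[OF Suc.prems(2), of "mat_unit l" j] True by (intro Suc.IH) (auto simp: nth_list_update)
   have "free_gen (u[j := mat_part L X]) : spanned k" if "finite L" "L \<subseteq> letters" for L using that
   proof (induction L rule: finite_induct)
    case empty
    \<comment> \<open>The relation for the scalar 0 puts a generator with a zero entry into
      \<open>J k\<close>.\<close>
    have "(%w. free_gen (u[j := 0 \<odot>\<^bsub>AA\<^esub> X]) w - 0 * free_gen (u[j := X]) w) : J k" unfolding multilinear_relations_def
     by (rule J_relation[unfolded multilinear_relations_def]) (use Suc.prems X True in blast)
    thus ?case by (simp add: mat_part(2)[OF X] spanned_J)
   next
    case (insert l L)
    obtain i x y where l: "l = (i, x, y)" by (cases l)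
    let ?Y = "mat_part L X" and ?c = "X i $$ (x, y)"
    let ?Z = "?c \<odot>\<^bsub>AA\<^esub> mat_unit l"
    have Y: "?Y : carrier AA" by (rule mat_part(1)[OF X])
    have Z: "?Z : carrier AA" by (rule multimatrix_closed(3)[OF mat_unit_carrier mat_unit_carrier])
    have r1: "(%w. free_gen (u[j := ?Y \<oplus>\<^bsub>AA\<^esub> ?Z]) w - free_gen (u[j := ?Y]) w - free_gen (u[j := ?Z]) w) : spanned k"
     by (intro spanned_J J_relation) (unfold multilinear_relations_def, use Suc.prems Y Z True in blast)
    have r2: "(%w. free_gen (u[j := ?Z]) w - ?c * free_gen (u[j := mat_unit l]) w) : spanned k"
     by (intro spanned_J J_relation) (unfold multilinear_relations_def, use Suc.prems mat_unit_carrier True in blast)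
    have "mat_part (insert l L) X = ?Y \<oplus>\<^bsub>AA\<^esub> ?Z" unfolding l by (rule mat_part(4)[OF X]) (use insert l in auto)
    moreover have "free_gen (u[j := ?Y]) : spanned k" "free_gen (u[j := mat_unit l]) : spanned k" using insert upd by auto
    ultimately show ?case
     using spanned_add[OF spanned_add[OF r1 r2] spanned_add[OF _ spanned_scale[OF _, of "free_gen (u[j := mat_unit l])" k ?c]], of "free_gen (u[j := ?Y])"]
     by simp
   qed
   from this[OF finite_letters subset_refl] show ?thesis by (simp add: mat_part(3)[OF X]) (simp add: X_def)
  qed
 qed
 from this[of u k] assms show ?thesis by auto
qed

text \<open>Modulo \<open>J k\<close> an element of the kernel is a combination of words. Their
  values are independent by \<open>tensor_independent\<close>, so the coefficients vanish.\<close>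

lemma kernel_J: "{q : carrier (P k). evl q = 0} = J k"
proof
 show "{q : carrier (P k). evl q = 0} \<subseteq> J k"
 proof
  fix q assume "q : {q : carrier (P k). evl q = 0}"
  hence q: "q : carrier (P k)" "evl q = 0" by auto
  have "(%w. SUM u:U. q u * free_gen u w) : spanned k" if "finite U" "U \<subseteq> {u. q u ~= 0}" for U using that
  proof (induction U rule: finite_induct)
   case empty
   thus ?case using spanned_J[OF J_zero] by simp
  next
   case (insert u U)
   have "free_gen u : spanned k" using fp_carrierD(2,3)[OF q(1), of u] insert by (intro spanned_gen) auto
   thus ?case using insert spanned_add[OF spanned_scale[of "free_gen u" k "q u"], of "%w. SUM u:U. q u * free_gen u w"] by simp
  qed
  from this[OF fp_carrierD(1)[OF q(1)] subset_refl]
  have "(%w. SUM u | q u ~= 0. q u * free_gen u w) : spanned k" .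
  moreover have "(SUM u | q u ~= 0. q u * free_gen u w) = q w" for w
  proof -
   have "(SUM u | q u ~= 0. q u * free_gen u w) = (SUM u | q u ~= 0. if u = w then q w else 0)" by (intro sum.cong refl) (auto simp: free_gen_def)
   thus ?thesis using fp_carrierD(1)[OF q(1)] by simp
  qed
  ultimately have "q : spanned k" by simp
  then obtain g c where g: "g : J k" "q = (%w. g w + (SUM v:words k. c v * free_gen (map mat_unit v) w))" unfolding spanned_def by blast
  note co = combination[of "words k" "%v. free_gen (map mat_unit v)" k c, OF finite_words word_gen]
  have gk: "g : carrier (P k)" "evl g = 0" using J_kernel g(1) by auto
  have "evl q = evl g + evl (%w. SUM v:words k. c v * free_gen (map mat_unit v) w)" unfolding g(2) by (rule evl_add[OF gk(1)]) (use co in blast)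
  hence "(SUM v:words k. csc (c v) (tensor (map munit v))) = 0" using co q(2) gk(2) by (simp add: evl_free_gen tens_mat_unit)
  hence "c v = 0" if "v : words k" for v using tensor_independent that by blast
  hence "q = g" unfolding g(2) by (intro ext) (simp add: sum.neutral)
  thus "q : J k" using g(1) by simp
 qed
qed (rule J_kernel)

lemma tensor_power_iso:
 "star_isomorphic (OA (app ` rc k)) (tensor_power k AA)"
proof -
 let ?T = "tensor_power k AA" and ?B = "OA (app ` rc k)" and ?h = "%q. app (evl q)"
 interpret h: ring_hom_ring "P k" ?B ?h by (rule evl_ring_hom)
 have K: "a_kernel (P k) ?B ?h = J k" by (simp only: kernel_eq kernel_J)
 define \<theta> where "\<theta> X = the_elem (?h ` X)" for X
 have surj: "?h ` carrier (P k) = carrier ?B" using evl_rc evl_surj by (force simp: OA_simps(7))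
 have iso: "\<theta> : ring_iso (P k Quot J k) ?B" using h.FactRing_iso_set[OF surj] unfolding K \<theta>_def by simp
 have coset: "J k +>\<^bsub>P k\<^esub> q = {g : carrier (P k). evl g = evl q}" if q: "q : carrier (P k)" for q
  using h.rcos_eq_homeq[OF q] unfolding K by (auto simp: app_inject)
 have \<theta>c: "\<theta> (J k +>\<^bsub>P k\<^esub> q) = ?h q" if "q : carrier (P k)" for q
  using h.the_elem_simp[OF that] unfolding K \<theta>_def .
 have cosE: "EX q:carrier (P k). X = J k +>\<^bsub>P k\<^esub> q" if "X : carrier (P k Quot J k)" for X
  using h.quot_mem[of X] that unfolding K by blast
 have cosI: "J k +>\<^bsub>P k\<^esub> q : carrier (P k Quot J k)" if "q : carrier (P k)" for q
  using that by (auto simp: FactRing_def A_RCOSETS_def RCOSETS_def a_r_coset_def)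
 have star_c: "star (P k) q : carrier (P k)" if q: "q : carrier (P k)" for q
 proof -
  have supp: "EX u. q u ~= 0 & w = map (star AA) u" if "star (P k) q w ~= 0" for w
   using that by (auto simp: fp_simps(7) elim!: sum.not_neutral_contains_not_neutral)
  have "{w. star (P k) q w ~= 0} \<subseteq> map (star AA) ` {u. q u ~= 0}" using supp by blast
  hence "finite {w. star (P k) q w ~= 0}" using fp_carrierD(1)[OF q] finite_surj by blast
  moreover have "length w = k & set w \<subseteq> carrier AA" if "star (P k) q w ~= 0" for w
  proof -
   obtain u where u: "q u ~= 0" "w = map (star AA) u" using supp `star (P k) q w ~= 0` by blast
   thus ?thesis using fp_carrierD(2,3)[OF q u(1)] multimatrix_closed(4) by auto
  qed
  ultimately show ?thesis by (simp add: fp_simps(1))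
 qed
 \<comment> \<open>The operation on cosets is a union over representatives. All of them give the
   same coset, because a coset consists of the elements with a common value of
   \<open>evl\<close>.\<close>
 have smult: "c \<odot>\<^bsub>?T\<^esub> (J k +>\<^bsub>P k\<^esub> q) = J k +>\<^bsub>P k\<^esub> (%w. c * q w)" if q: "q : carrier (P k)" for c q
 proof -
  have "J k +>\<^bsub>P k\<^esub> (%w. c * g w) = J k +>\<^bsub>P k\<^esub> (%w. c * q w)" if "g : J k +>\<^bsub>P k\<^esub> q" for g
   using that q by (auto simp: coset fp_smult_carrier evl_scale)
  moreover have "q : J k +>\<^bsub>P k\<^esub> q" using q by (simp add: coset)
  ultimately have "(UN g:J k +>\<^bsub>P k\<^esub> q. J k +>\<^bsub>P k\<^esub> (%w. c * g w)) = J k +>\<^bsub>P k\<^esub> (%w. c * q w)" by (rule UN_eqI[rotated])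
  thus ?thesis by (simp add: tensor_power_def star_quot_def fp_simps(5))
 qed
 have starq: "star (?T) (J k +>\<^bsub>P k\<^esub> q) = J k +>\<^bsub>P k\<^esub> star (P k) q" if q: "q : carrier (P k)" for q
 proof -
  have "J k +>\<^bsub>P k\<^esub> star (P k) g = J k +>\<^bsub>P k\<^esub> star (P k) q" if "g : J k +>\<^bsub>P k\<^esub> q" for g
   using that q by (auto simp: coset star_c evl_star)
  moreover have "q : J k +>\<^bsub>P k\<^esub> q" using q by (simp add: coset)
  ultimately have "(UN g:J k +>\<^bsub>P k\<^esub> q. J k +>\<^bsub>P k\<^esub> star (P k) g) = J k +>\<^bsub>P k\<^esub> star (P k) q" by (rule UN_eqI[rotated])
  thus ?thesis by (simp add: tensor_power_def star_quot_def)
 qed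
 have fields: "carrier (?T) = carrier (P k Quot J k)" "monoid.mult (?T) = monoid.mult (P k Quot J k)"
  "add (?T) = add (P k Quot J k)" "\<one>\<^bsub>?T\<^esub> = \<one>\<^bsub>P k Quot J k\<^esub>" by (simp_all add: tensor_power_def star_quot_def)
 have "\<theta> : star_iso (?T) ?B" unfolding star_iso_def star_hom_def
 proof (intro CollectI conjI allI ballI)
  show "\<theta> : Ring.ring_hom (?T) ?B" using iso by (auto simp: ring_iso_def Ring.ring_hom_def fields)
  show "bij_betw \<theta> (carrier (?T)) (carrier ?B)" using iso by (simp add: ring_iso_def fields)
 next
  fix c X assume "X : carrier (?T)"
  then obtain q where q: "q : carrier (P k)" "X = J k +>\<^bsub>P k\<^esub> q" using cosE by (auto simp: fields)
  show "\<theta> (c \<odot>\<^bsub>?T\<^esub> X) = c \<odot>\<^bsub>?B\<^esub> \<theta> X"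
   unfolding q(2) smult[OF q(1)] \<theta>c[OF q(1)] \<theta>c[OF fp_smult_carrier[OF q(1)]] evl_scale[OF q(1)] OA_simps ..
 next
  fix X assume "X : carrier (?T)"
  then obtain q where q: "q : carrier (P k)" "X = J k +>\<^bsub>P k\<^esub> q" using cosE by (auto simp: fields)
  show "\<theta> (star (?T) X) = star ?B (\<theta> X)"
   unfolding q(2) starq[OF q(1)] \<theta>c[OF q(1)] \<theta>c[OF star_c[OF q(1)]] evl_star[OF q(1)] OA_simps ..
 qed
 hence "inv_into (carrier (?T)) \<theta> : star_iso ?B (?T)"
 proof (rule star_iso_inverse)
  have Q: "ring (P k Quot J k)" by (rule ideal.quotient_is_ring[OF J_ideal])
  show "\<one>\<^bsub>?T\<^esub> : carrier (?T)" unfolding fields by (rule ring.ring_simprules(6)[OF Q])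
  fix X Y assume "X : carrier (?T)" "Y : carrier (?T)"
  thus "X \<otimes>\<^bsub>?T\<^esub> Y : carrier (?T) & X \<oplus>\<^bsub>?T\<^esub> Y : carrier (?T)"
   unfolding fields using ring.ring_simprules(1,5)[OF Q] by blast
 next
  fix c X assume "X : carrier (?T)"
  then obtain q where q: "q : carrier (P k)" "X = J k +>\<^bsub>P k\<^esub> q" using cosE by (auto simp: fields)
  thus "c \<odot>\<^bsub>?T\<^esub> X : carrier (?T) & star (?T) X : carrier (?T)"
   using cosI[OF fp_smult_carrier[OF q(1)], of c] cosI[OF star_c[OF q(1)]] by (simp add: smult starq fields)
 qed
 thus ?thesis by (auto simp: star_isomorphic_def)
qed

text \<open>The isomorphism is the inverse of \<open>\<iota>\<close> and leads to the matrices
  themselves rather than to their one-fold tensor power, so that the trace can be read off.\<close>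

lemma first_commutant_iso:
 "EX \<theta>:star_iso (OA (app ` rc 1)) AA. ALL y:rc 1. tr y = multimatrix_trace n weight (\<theta> (app y))"
proof -
 let ?B = "OA (app ` rc 1)"
 define g where "g X = app (\<iota> X)" for X
 have \<iota>_rc: "\<iota> X : rc 1" for X using tens_rc[of "[X]"] by (simp add: emb_one)
 note \<iota>_rc' = \<iota>_rc[unfolded One_nat_def]
 have inj: "X = Y" if X: "X : carrier AA" and Y: "Y : carrier AA" and eq: "\<iota> X = \<iota> Y" for X Y
 proof (rule ext)
  fix i
  have "X i $$ (x, y) = Y i $$ (x, y)" if "i < n" "x < a i" "y < a i" for x y
  proof -
   have co: "e i 0 x * \<iota> X * e i y 0 = csc (X i $$ (x, y)) (f i)" for X
   proof -
    have "e i 0 x * \<iota> X * e i y 0 = (SUM j<n. SUM x'<a j. SUM y'<a j. csc (X j $$ (x', y')) (e i 0 x * e j x' y' * e i y 0))"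
     unfolding \<iota>_def iota_def sum_distribs by (simp add: csc_mult_right)
    also have "... = (SUM j<n. SUM x'<a j. SUM y'<a j. if j = i & x' = x & y' = y then csc (X i $$ (x, y)) (f i) else 0)"
     by (intro sum.cong refl) (use that a_pos in "auto simp: e_mult")
    finally show ?thesis using sum_triple_delta[of i n x a y] that by simp
   qed
   have "csc (X i $$ (x, y) - Y i $$ (x, y)) (f i) = 0" using co[of X] co[of Y] eq by (simp add: csc_diff_left)
   moreover have "(1 :: 'h bop) ~= 0" using tn_one tn_zero by (metis zero_neq_one)
   hence "f i ~= 0" using f_emb_0[OF that(1), of 1] by (auto simp: emb_one)
   ultimately show ?thesis using csc_cancel[of "X i $$ (x, y) - Y i $$ (x, y)" "f i" 0] by (cases "X i $$ (x, y) = Y i $$ (x, y)") auto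
  qed
  moreover have "X i : carrier_mat (a i) (a i)" "Y i : carrier_mat (a i) (a i)" if "i < n" using X Y that by (auto simp: multimatrix_simps PiE_iff)
  ultimately have "X i = Y i" if i: "i < n" using i by (intro eq_matI) auto
  thus "X i = Y i" using X Y by (cases "i < n") (auto simp: multimatrix_simps PiE_iff extensional_def)
 qed
 have surj: "EX X:carrier AA. y = \<iota> X" if y: "y : rc 1" for y
 proof -
  obtain z where z: "ALL i<n. ALL x<a i. ALL x'<a i. z i x x' : rc 0" "y = (SUM i<n. SUM x<a i. SUM x'<a i. e i x x' * emb (z i x x'))"
   using y unfolding One_nat_def rc_Suc by blast
  have "ALL i x x'. EX c. i < n & x < a i & x' < a i --> z i x x' = csc c 1" using z(1) rc_0 by blast
  then obtain c where c: "!!i x x'. i < n ==> x < a i ==> x' < a i ==> z i x x' = csc (c i x x') 1" by metis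
  let ?X = "\<lambda>i\<in>{..<n}. Matrix.mat (a i) (a i) (%(x, y). c i x y)"
  have "y = iota c" unfolding z(2) iota_def by (intro sum.cong refl) (simp add: c emb_csc emb_one csc_mult_right)
  also have "... = \<iota> ?X" unfolding \<iota>_def by (rule iota_cong) simp
  finally show ?thesis by (intro bexI[of _ ?X]) (simp_all add: multimatrix_simps)
 qed
 have "g : star_iso AA ?B" unfolding star_iso_def star_hom_def
 proof (intro CollectI conjI allI ballI)
  show "g : Ring.ring_hom AA ?B" by (rule ring_hom_memI) (auto simp: g_def OA_simps \<iota>_hom(1,2) \<iota>_one \<iota>_rc')
  show "bij_betw g (carrier AA) (carrier ?B)"
   unfolding bij_betw_def using inj surj \<iota>_rc by (force simp: inj_on_def g_def app_inject OA_simps(7))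
 next
  fix c X assume "X : carrier AA"
  thus "g (c \<odot>\<^bsub>AA\<^esub> X) = c \<odot>\<^bsub>?B\<^esub> g X" by (simp add: g_def OA_simps \<iota>_hom(3))
 next
  fix X assume "X : carrier AA"
  thus "g (star AA X) = star ?B (g X)" by (simp add: g_def OA_simps \<iota>_hom(4))
 qed
 moreover hence "inv_into (carrier AA) g : star_iso ?B AA" by (rule star_iso_inverse) (auto simp: multimatrix_closed multimatrix_one)
 moreover have "tr y = multimatrix_trace n weight (inv_into (carrier AA) g (app y))" if "g : star_iso AA ?B" and y: "y : rc 1" for y
 proof -
  obtain X where X: "X : carrier AA" "y = \<iota> X" using surj[OF y] by blast
  have "inv_into (carrier AA) g (app y) = X" using X inj by (simp add: g_def[symmetric]) (intro inv_into_f_f, auto simp: inj_on_def g_def app_inject)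
  moreover have "tr y = (SUM i<n. of_real (weight i) * (SUM x<a i. X i $$ (x, x)))"
   using tr_iota_emb[of 1 "%i x y. X i $$ (x, y)"] by (simp add: X(2) \<iota>_def emb_one tr_one)
  moreover have "dim_row (X i) = a i" if "i < n" for i using X(1) that by (auto simp: multimatrix_simps PiE_iff)
  ultimately show ?thesis by (simp add: multimatrix_trace_def mat_trace_def)
 qed
 ultimately show ?thesis by blast
qed

end

section \<open>Translation of the hypotheses and the conclusion\<close>

lemma projn_le_of_psd: assumes "projn p" "projn q" "psd (q - p)" shows "q * p = p"
proof -
 have q: "q\<dagger> = q" "q * q = q" "p\<dagger> = p" "p * p = p" using assms by (auto simp: projn_def)
 have q': "p * (p * z) = p * z" "q * (q * z) = q * z" for z by (simp_all add: mult.assoc[symmetric] q)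
 have "psd ((1 - q)\<dagger> * (q - p) * (1 - q))" by (rule psd_sandwich[OF assms(3)])
 moreover have "(1 - q)\<dagger> * (q - p) * (1 - q) = - ((p * (1 - q))\<dagger> * (p * (1 - q)))" by (simp add: q q' diff_distribs mult.assoc)
 ultimately have "psd (- ((p * (1 - q))\<dagger> * (p * (1 - q))))" by (simp only:)
 hence "(p * (1 - q))\<dagger> * (p * (1 - q)) = 0" by (intro psd_antisym psd_square)
 hence "p * (1 - q) = 0" by (simp only: adj_mult_self_eq_0)
 hence "p * q = p" by (simp add: right_diff_distrib)
 hence "(p * q)\<dagger> = p\<dagger>" by simp
 thus ?thesis by (simp add: q)
qed

text \<open>The common denominator is the product of all denominators.\<close>

lemma rational_weights:
 fixes s :: "nat => real" assumes "ALL i<n. s i : \<rat>" "ALL i<n. s i > 0"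
 shows "EX q>0. EX p. ALL i<n. p i > 0 & s i = real (p i) / real (q :: nat)"
proof -
 have "EX m k. k > (0::nat) & m > (0::nat) & s i = real m / real k" if "i < n" for i
 proof -
  have "s i : \<rat>" using assms(1) that by simp
  then obtain m k :: nat where "k ~= 0" "\<bar>s i\<bar> = real m / real k" "coprime m k" by (rule Rats_abs_nat_div_natE)
  moreover have "s i > 0" using assms(2) that by simp
  ultimately show ?thesis by (intro exI[of _ m] exI[of _ k]) (auto intro!: Nat.gr0I)
 qed
 then obtain m k where mk: "!!i. i < n ==> k i > (0::nat) & m i > (0::nat) & s i = real (m i) / real (k i)" by metis
 define q where "q = (PROD i<n. k i)"
 define p where "p i = m i * (PROD j:{..<n} - {i}. k j)" for i
 have "p i > 0 & s i = real (p i) / real q" if i: "i < n" for i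
 proof -
  have pos: "(PROD j:{..<n} - {i}. k j) > 0" using mk by (intro prod_pos) auto
  have "q = k i * (PROD j:{..<n} - {i}. k j)" unfolding q_def using i by (intro prod.remove) auto
  thus ?thesis using mk[OF i] pos by (simp add: p_def)
 qed
 moreover have "q > 0" unfolding q_def using mk by (intro prod_pos) auto
 ultimately show ?thesis by blast
qed

abbreviation bops :: "('h::complex_hilbert_space => 'h) set => 'h bop set" where
 "bops M \<equiv> {x. app x : M}"

lemma app_bops: "M \<subseteq> bounded_operators ==> app ` bops M = M" by (auto simp: image_iff) (metis Bop_inverse subsetD)

lemma app_eqs:
 "(%v. app x v + app y v) = app (x + y)" "app x \<circ> app y = app (x * y)" "(%v. c *\<^sub>C app x v) = app (csc c x)"
 "id = app 1" "(%v. 0) = app 0" "op_adjoint (app x) = app (x\<dagger>)" by (auto simp: fun_eq_iff app_adj)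

lemma app_commute: "app x \<circ> app y = app y \<circ> app x <-> x * y = y * x" by (simp only: app_eqs app_inject)

lemma commutant_app: "app c : commutant N <-> (ALL y:N. app c \<circ> y = y \<circ> app c)" using app[of c] by (auto simp: relative_commutant_def)

text \<open>The clause with analytic content is normality: the strong limit of an increasing
  sequence of projections is its supremum in \<open>M\<close>, and the supremum of the traces is
  their limit.\<close>

lemma hyperfinite_factor_ex:
 fixes M :: "('h::complex_hilbert_space => 'h) set" assumes "II1_factor M" "hyperfinite M" "canonical_trace M \<tau>"
 shows "EX F. hyperfinite_factor (bops M) (%x. \<tau> (app x)) F"
proof -
 have vn: "M \<subseteq> bounded_operators" "!!x. x : M ==> op_adjoint x : M" "commutant (commutant M) = M"
  and center: "relative_commutant M M = {(%v. c *\<^sub>C v) | c. True}" and nomin: "~ minimal_projection M p" for p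
  using assms(1) unfolding II1_factor_def factor_def von_neumann_algebra_def by blast+
 note t = assms(3)[unfolded canonical_trace_def]
 have t_add: "\<tau> (%v. x v + y v) = \<tau> x + \<tau> y" if "x : M" "y : M" for x y using t that by blast
 have t_csc: "\<tau> (%v. c *\<^sub>C x v) = c * \<tau> x" if "x : M" for c x using t that by blast
 have t_comm: "\<tau> (x \<circ> y) = \<tau> (y \<circ> x)" if "x : M" "y : M" for x y using t that by blast
 have t_pos: "Im (\<tau> (op_adjoint x \<circ> x)) = 0" "Re (\<tau> (op_adjoint x \<circ> x)) >= 0" if "x : M" for x using t that by blast+
 have t_one: "\<tau> id = 1" using t by blast
 have t_faithful: "x = (%v. 0)" if "x : M" "\<tau> (op_adjoint x \<circ> x) = 0" for x using t that by blast
 have t_normal: "normal_functional M \<tau>" using t by blast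
 have bic: "x : bops M" if "!!c. (!!y. y : bops M ==> c * y = y * c) ==> c * x = x * c" for x
 proof -
  have "app x \<circ> y = y \<circ> app x" if y: "y : commutant M" for y
  proof -
   obtain c where c: "y = app c" using y Bop_inverse[of y] by (metis (no_types, lifting) mem_Collect_eq relative_commutant_def)
   have "c * z = z * c" if "z : bops M" for z using y that unfolding c commutant_app app_commute[symmetric] by blast
   hence "c * x = x * c" by (rule `!!c. (!!y. y : bops M ==> c * y = y * c) ==> c * x = x * c`)
   thus ?thesis unfolding c app_commute by simp
  qed
  hence "app x : commutant (commutant M)" unfolding commutant_app by blast
  thus ?thesis using vn(3) by simp
 qed
 have one: "1 : bops M" by (rule bic) simp
 have trp: "Im (\<tau> (app p)) = 0" "Re (\<tau> (app p)) >= 0" if "projn p" "p : bops M" for p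
  using t_pos[of "app p"] that by (simp_all add: app_eqs projn_def)
 have alg: "x - y : bops M" if xy: "x : bops M" "y : bops M" for x y
 proof (rule bic)
  fix c assume h: "!!z. z : bops M ==> c * z = z * c"
  show "c * (x - y) = (x - y) * c" using h[OF xy(1)] h[OF xy(2)] by (simp add: diff_distribs)
 qed
 have t_diff: "\<tau> (app (x - y)) = \<tau> (app x) - \<tau> (app y)" if "x : bops M" "y : bops M" for x y
  using t_add[of "app (x - y)" "app y"] alg[OF that] that by (simp add: app_eqs)
 interpret tracial_factor "bops M" "%x. \<tau> (app x)"
 proof
  show "x\<dagger> : bops M" if "x : bops M" for x using vn(2) that by (simp add: app_adj)
  show "x : bops M" if h: "!!c. (!!y. y : bops M ==> c * y = y * c) ==> c * x = x * c" for x
  proof (rule bic)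
   fix c assume "!!y. y : bops M ==> c * y = y * c"
   thus "c * x = x * c" by (rule h)
  qed
  show "EX c. z = csc c 1" if z: "z : bops M" "!!y. y : bops M ==> z * y = y * z" for z
  proof -
   have "app z \<circ> y = y \<circ> app z" if y: "y : M" for y
   proof -
    have "y : app ` bops M" unfolding app_bops[OF vn(1)] by (rule y)
    then obtain u where "y = app u" "u : bops M" by (rule imageE)
    thus ?thesis using z(2) by (simp add: app_commute)
   qed
   hence "app z : relative_commutant M M" using z(1) by (simp add: relative_commutant_def)
   then obtain c where "app z = (%v. c *\<^sub>C v)" unfolding center by blast
   hence "app z = app (csc c 1)" by (simp add: fun_eq_iff)
   thus ?thesis by (auto simp: app_inject)
  qed
  show "EX q:bops M. projn q & p * q = q & q ~= 0 & q ~= p" if p: "p : bops M" "projn p" "p ~= 0" for p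
  proof -
   have "app p : projections M" using p by (simp add: projections_def app_eqs projn_def)
   moreover have "app p ~= (%v. 0)" using p(3) by (simp add: app_eqs app_inject)
   ultimately obtain r where r: "r : projections M" "app p \<circ> r = r" "r ~= (%v. 0)" "r ~= app p"
    using nomin[of "app p"] unfolding minimal_projection_def by blast
   then obtain q where q: "r = app q" "q : bops M" using app_bops[OF vn(1)] unfolding projections_def by blast
   thus ?thesis using r by (intro bexI[of _ q]) (auto simp: projections_def app_eqs app_inject projn_def)
  qed
  show "\<tau> (app (x + y)) = \<tau> (app x) + \<tau> (app y)" if "x : bops M" "y : bops M" for x y
   using t_add that by (simp add: app_eqs(1)[symmetric])
  show "\<tau> (app (csc c x)) = c * \<tau> (app x)" if "x : bops M" for c x using t_csc that by (simp add: app_eqs(3)[symmetric])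
  show "\<tau> (app (x * y)) = \<tau> (app (y * x))" if "x : bops M" "y : bops M" for x y
   using t_comm[of "app x" "app y"] that by (simp add: app_eqs(2))
  show "Im (\<tau> (app (x\<dagger> * x))) = 0" "0 <= Re (\<tau> (app (x\<dagger> * x)))" if "x : bops M" for x
   using t_pos[of "app x"] that by (simp_all add: app_eqs)
  show "\<tau> (app 1) = 1" using t_one by (simp add: app_eqs)
  show "x = 0" if "x : bops M" "\<tau> (app (x\<dagger> * x)) = 0" for x using t_faithful[of "app x"] that by (simp add: app_eqs app_inject)
 next
  fix P p assume P: "!!n. P n : bops M" "!!n. projn (P n)" "!!n. psd (P (Suc n) - P n)" and p: "slim P p" "p : bops M"
  have le: "P (Suc n) * P n = P n" for n by (rule projn_le_of_psd[OF P(2,2,3)])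
  have pp: "projn p" using projn_slim[of P, OF P(2) le] p(1) slim_unique by blast
  have op: "op_le (app x) (app y)" if "psd (y - x)" for x y using psdD[OF that] by (auto simp: op_le_def cinner_diff_right)
  have mono: "psd (P m - P n)" if "n <= m" for n m by (intro projn_psd projn_diff P(2) projn_seq_le[of P, OF P(2) le that])
  have lim: "(%n. Re (cinner v (app (P n) v))) ----> Re (cinner v (app p v))" for v by (intro tendsto_Re tendsto_cinner tendsto_const slimD[OF p(1)])
  have inc: "Re (cinner v (app (P n) v)) <= Re (cinner v (app (P m) v))" if "n <= m" for n m v using op[OF mono[OF that]] by (simp add: op_le_def)
  let ?D = "range (%n. app (P n))"
  have sup: "is_supremum_in M ?D (app p)" unfolding is_supremum_in_def
  proof (intro conjI ballI impI)
   show "app p : self_adjoint_elements M" using p(2) pp by (simp add: self_adjoint_elements_def app_eqs projn_def)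
   fix d assume "d : ?D"
   then obtain n where n: "d = app (P n)" by blast
   show "op_le d (app p)" unfolding n op_le_def by (intro allI LIMSEQ_le_const[OF lim]) (use inc in blast)
  next
   fix y assume "ALL d:?D. op_le d y"
   hence "Re (cinner v (app (P n) v)) <= Re (cinner v (y v))" for n v by (auto simp: op_le_def)
   thus "op_le (app p) y" unfolding op_le_def by (intro allI LIMSEQ_le_const2[OF lim]) auto
  qed
  have dir: "ALL d:?D. ALL d':?D. EX g:?D. op_le d g & op_le d' g"
  proof (intro ballI)
   fix d d' assume "d : ?D" "d' : ?D"
   then obtain i j where "d = app (P i)" "d' = app (P j)" by blast
   thus "EX g:?D. op_le d g & op_le d' g" using op[OF mono[of i "max i j"]] op[OF mono[of j "max i j"]] by (intro bexI[of _ "app (P (max i j))"]) auto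
  qed
  have sa: "?D \<subseteq> self_adjoint_elements M" using P(1,2) by (auto simp: self_adjoint_elements_def app_eqs projn_def)
  have "Re (\<tau> (app p)) = (SUP d\<in>?D. Re (\<tau> d))"
   using t_normal[unfolded normal_functional_def, rule_format, of ?D "app p"] sup dir sa by blast
  hence SUP: "Re (\<tau> (app p)) = (SUP n. Re (\<tau> (app (P n))))" by (simp add: image_image)
  have tmono: "Re (\<tau> (app (P n))) <= Re (\<tau> (app (P m)))" if "n <= m" for n m
   using trp(2)[OF projn_diff[OF P(2,2) projn_seq_le[of P, OF P(2) le that]] alg[OF P(1,1)]] t_diff[OF P(1,1), of m n] by simp
  have bd: "Re (\<tau> (app (P n))) <= 1" for n
   using trp(2)[OF projn_compl[OF P(2)[of n]] alg[OF one P(1)]] t_diff[OF one P(1), of n] t_one by (simp add: app_eqs)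
  have "(%n. Re (\<tau> (app (P n)))) ----> Re (\<tau> (app p))"
   unfolding SUP by (rule LIMSEQ_incseq_SUP) (use bd tmono in "auto simp: incseq_def intro!: bdd_aboveI[of _ 1]")
  hence "(%n. complex_of_real (Re (\<tau> (app (P n))))) ----> complex_of_real (Re (\<tau> (app p)))" by (rule tendsto_of_real)
  moreover have "complex_of_real (Re (\<tau> (app q))) = \<tau> (app q)" if "projn q" "q : bops M" for q
   using trp(1)[OF that] by (simp add: complex_eq_iff)
  ultimately show "(%n. \<tau> (app (P n))) ----> \<tau> (app p)" using P pp p(2) by simp
 qed
 obtain F where F: "!!m. finite_dim_star_subalgebra (F m)" "!!m. F m \<subseteq> F (Suc m)" "M = commutant (commutant (\<Union>m. F m))"
  using assms(2) unfolding hyperfinite_def by blast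
 have Fb: "F m \<subseteq> bounded_operators" for m using F(1)[of m] by (simp add: finite_dim_star_subalgebra_def)
 have "hyperfinite_factor (bops M) (%x. \<tau> (app x)) (%m. bops (F m))"
 proof
  fix m
  have Fm: "id : F m" "!!x y. x : F m ==> y : F m ==> x \<circ> y : F m & (%v. x v + y v) : F m"
   "!!x. x : F m ==> op_adjoint x : F m" "!!x c. x : F m ==> (%v. c *\<^sub>C x v) : F m"
   using F(1)[of m] unfolding finite_dim_star_subalgebra_def by blast+
  show "star_alg (bops (F m))" unfolding star_alg_def
  proof (intro conjI ballI allI)
   show "1 : bops (F m)" using Fm(1) by (simp only: app_eqs mem_Collect_eq)
   fix x assume x: "x : bops (F m)"
   hence x': "app x : F m" by simp
   show "x\<dagger> : bops (F m)" using Fm(3)[OF x'] by (simp only: app_eqs mem_Collect_eq)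
   show "csc c x : bops (F m)" for c using Fm(4)[OF x'] by (simp only: app_eqs mem_Collect_eq)
   fix y assume "y : bops (F m)"
   hence y': "app y : F m" by simp
   show "x + y : bops (F m)" "x * y : bops (F m)" using Fm(2)[OF x' y'] by (simp_all only: app_eqs mem_Collect_eq)
  qed
  show "bops (F m) \<subseteq> bops M"
  proof
   fix x assume x: "x : bops (F m)"
   have "app x \<circ> y = y \<circ> app x" if y: "y : commutant (\<Union>m. F m)" for y using y x by (auto simp: relative_commutant_def)
   hence "app x : commutant (commutant (\<Union>m. F m))" unfolding commutant_app by blast
   thus "x : bops M" using F(3) by simp
  qed
  show "bops (F m) \<subseteq> bops (F (Suc m))" using F(2) by blast
  obtain B where B: "finite B" "B \<subseteq> F m" "!!x. x : F m ==> EX c. x = (%v. SUM b:B. c b *\<^sub>C b v)"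
   using F(1)[of m] unfolding finite_dim_star_subalgebra_def by blast
  have inj: "inj app" by (simp add: inj_def app_inject)
  have appB: "app ` bops B = B" by (rule app_bops) (use B(2) Fb in blast)
  have "bops (F m) \<subseteq> cspan (bops B)"
  proof
   fix x assume "x : bops (F m)"
   then obtain c where c: "app x = (%v. SUM b:B. c b *\<^sub>C b v)" using B(3)[of "app x"] by auto
   have "app x v = app (SUM b:bops B. csc (c (app b)) b) v" for v
   proof -
    have "app x v = (SUM b:app ` bops B. c b *\<^sub>C b v)" by (simp only: c appB)
    also have "... = (SUM b:bops B. c (app b) *\<^sub>C app b v)" by (rule sum.reindex_cong[OF inj_on_subset[OF inj subset_UNIV] refl]) simp
    finally show ?thesis by (simp add: app_sum_left)
   qed
   hence "x = (SUM b:bops B. csc (c (app b)) b)" by (rule bop_eqI)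
   thus "x : cspan (bops B)" unfolding cspan_def by (intro CollectI exI[of _ "%b. c (app b)"])
  qed
  moreover have "finite (bops B)" using finite_vimageI[OF B(1) inj] by (simp add: vimage_def)
  ultimately show "EX B. finite B & B \<subseteq> bops (F m) & bops (F m) \<subseteq> cspan B" using B(2) by (intro exI[of _ "bops B"]) auto
 next
  fix x c assume x: "x : bops M" and c: "!!y m. y : bops (F m) ==> c * y = y * c"
  have "app c \<circ> y = y \<circ> app c" if y: "y : (\<Union>m. F m)" for y
  proof -
   obtain m where m: "y : F m" using y by blast
   then obtain z where "y = app z" "z : bops (F m)" using app_bops[OF Fb, of m] by blast
   thus ?thesis using c by (simp add: app_commute)
  qed
  hence "app c : commutant (\<Union>m. F m)" unfolding commutant_app by blast
  moreover have "ALL y:commutant (\<Union>m. F m). app x \<circ> y = y \<circ> app x" using x F(3) commutant_app by blast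
  ultimately have "app x \<circ> app c = app c \<circ> app x" by (rule bspec[rotated])
  thus "c * x = x * c" by (simp add: app_commute)
 qed
 thus ?thesis by blast
qed

theorem theorem1:
  fixes n :: nat and a :: "nat \<Rightarrow> nat" and s :: "nat \<Rightarrow> real"
    and R :: "('h::complex_hilbert_space \<Rightarrow> 'h) set"
    and \<tau> :: "('h \<Rightarrow> 'h) \<Rightarrow> complex"
  assumes "n \<ge> 1"
    and "\<forall>i<n. a i \<ge> 1"
    and "is_trace_vector n a s"
    and "\<forall>i<n. s i \<in> \<rat>"
    and "II1_factor R"
    and "hyperfinite R"
    and "canonical_trace R \<tau>"
  shows "\<exists>\<Phi> \<in> star_hom (operator_algebra R) (operator_algebra R).
    (\<forall>k\<ge>1. star_isomorphic
        (operator_algebra (relative_commutant ((\<Phi> ^^ k) ` R) R))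
        (tensor_power k (multimatrix_algebra n a))) \<and>
    (\<exists>\<theta> \<in> star_iso (operator_algebra (relative_commutant (\<Phi> ` R) R)) (multimatrix_algebra n a).
        \<forall>x \<in> relative_commutant (\<Phi> ` R) R. \<tau> x = multimatrix_trace n s (\<theta> x))"
proof -
 have spos: "ALL i<n. s i > 0" and ssum: "(SUM i<n. real (a i) * s i) = 1" using assms(3) by (auto simp: is_trace_vector_def)
 obtain q p where q: "q > 0" and p: "!!i. i < n ==> p i > 0 & s i = real (p i) / real q" using rational_weights[OF assms(4) spos] by blast
 \<comment> \<open>The normalization of the trace vector makes \<open>q\<close> exactly the size in
   which \<open>A\<close> embeds unitally with multiplicities \<open>p i\<close>.\<close>
 have "real q = real q * (SUM i<n. real (a i) * s i)" using ssum by simp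
 also have "... = (SUM i<n. real (a i * p i))" unfolding sum_distrib_left by (intro sum.cong refl) (use p q in auto)
 finally have qs: "q = (SUM i<n. a i * p i)" by (simp only: of_nat_sum[symmetric] of_nat_eq_iff)
 obtain F where "hyperfinite_factor (bops R) (%x. \<tau> (app x)) F" using hyperfinite_factor_ex[OF assms(5-7)] by blast
 then interpret hyperfinite_factor "bops R" "%x. \<tau> (app x)" F .
 have n: "n > 0" and ap: "!!i. i < n ==> a i > 0" and pp: "!!i. i < n ==> p i > 0" using assms(1,2) p by (auto simp: Suc_le_eq)
 obtain d E \<kappa> t0 \<beta> \<mu> where D: "endo_data (bops R) (%x. \<tau> (app x)) d E n a p \<kappa> t0 \<beta> \<mu>" "d t0 = (SUM i<n. a i * p i)"
  using endo_data_ex[of n a p, OF n ap pp] by blast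
 interpret D: endo_data "bops R" "%x. \<tau> (app x)" d E n a p \<kappa> t0 \<beta> \<mu> by (rule D(1))
 have Rb: "app ` bops R = R" using assms(5) by (intro app_bops) (simp add: II1_factor_def factor_def von_neumann_algebra_def)
 \<comment> \<open>\<open>Bop\<close> passes from functions to the type of operators, on which
   \<open>emb\<close> is defined.\<close>
 define \<Phi> where "\<Phi> T = app (D.emb (Bop T))" for T
 have \<Phi>: "\<Phi> (app x) = app (D.emb x)" for x by (simp add: \<Phi>_def app_inverse)
 have \<Phi>k: "(\<Phi> ^^ k) (app x) = app ((D.emb ^^ k) x)" for k x by (induction k) (simp_all add: \<Phi>)
 have RE: "EX x:bops R. T = app x" if "T : R" for T using that Rb by blast
 have rc: "relative_commutant ((\<Phi> ^^ k) ` R) R = app ` D.rc k" for k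
 proof
  show "relative_commutant ((\<Phi> ^^ k) ` R) R \<subseteq> app ` D.rc k"
  proof
   fix T assume T: "T : relative_commutant ((\<Phi> ^^ k) ` R) R"
   then obtain x where x: "x : bops R" "T = app x" using RE by (auto simp: relative_commutant_def)
   have "x * (D.emb ^^ k) l = (D.emb ^^ k) l * x" if l: "l : bops R" for l
    using T l unfolding x(2) relative_commutant_def app_commute[symmetric] \<Phi>k[symmetric] by blast
   thus "T : app ` D.rc k" using x by (auto simp: D.rc_def)
  qed
  show "app ` D.rc k \<subseteq> relative_commutant ((\<Phi> ^^ k) ` R) R"
  proof
   fix T assume "T : app ` D.rc k"
   then obtain x where x: "T = app x" "x : D.rc k" by blast
   have "T \<circ> (\<Phi> ^^ k) S = (\<Phi> ^^ k) S \<circ> T" if "S : R" for S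
   proof -
    obtain l where l: "l : bops R" "S = app l" using RE[OF `S : R`] by blast
    thus ?thesis using x(2) by (simp add: x(1) \<Phi>k app_commute D.rc_def)
   qed
   thus "T : relative_commutant ((\<Phi> ^^ k) ` R) R" using x by (auto simp: relative_commutant_def D.rc_def)
  qed
 qed
 have hom: "\<Phi> : star_hom (OA R) (OA R)" unfolding star_hom_def
 proof (intro CollectI conjI allI ballI)
  show "\<Phi> : Ring.ring_hom (OA R) (OA R)"
  proof (rule ring_hom_memI)
   fix S assume "S : carrier (OA R)"
   then obtain x where x: "x : bops R" "S = app x" using RE by (auto simp: OA_simps(7))
   show "\<Phi> S : carrier (OA R)" using D.emb_R[OF x(1)] by (simp add: x(2) \<Phi> OA_simps(7))
  next
   fix S T assume "S : carrier (OA R)" "T : carrier (OA R)"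
   then obtain x y where x: "x : bops R" "S = app x" and y: "y : bops R" "T = app y" using RE by (metis OA_simps(7))
   show "\<Phi> (S \<otimes>\<^bsub>OA R\<^esub> T) = \<Phi> S \<otimes>\<^bsub>OA R\<^esub> \<Phi> T"
    by (simp only: x(2) y(2) OA_simps \<Phi> D.emb_mult[OF x(1) y(1)])
   show "\<Phi> (S \<oplus>\<^bsub>OA R\<^esub> T) = \<Phi> S \<oplus>\<^bsub>OA R\<^esub> \<Phi> T"
    by (simp only: x(2) y(2) OA_simps \<Phi> D.emb_add[OF x(1) y(1)])
  next
   show "\<Phi> \<one>\<^bsub>OA R\<^esub> = \<one>\<^bsub>OA R\<^esub>" by (simp only: OA_simps \<Phi> D.emb_one)
  qed
 next
  fix c S assume "S : carrier (OA R)"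
  then obtain x where x: "x : bops R" "S = app x" using RE by (auto simp: OA_simps(7))
  show "\<Phi> (c \<odot>\<^bsub>OA R\<^esub> S) = c \<odot>\<^bsub>OA R\<^esub> \<Phi> S" by (simp only: x(2) OA_simps \<Phi> D.emb_csc[OF x(1)])
 next
  fix S assume "S : carrier (OA R)"
  then obtain x where x: "x : bops R" "S = app x" using RE by (auto simp: OA_simps(7))
  show "\<Phi> (star (OA R) S) = star (OA R) (\<Phi> S)" by (simp only: x(2) OA_simps \<Phi> D.emb_adj[OF x(1)])
 qed
 obtain \<theta> where \<theta>: "\<theta> : star_iso (OA (app ` D.rc 1)) (MM n a)"
  "ALL y:D.rc 1. \<tau> (app y) = multimatrix_trace n D.weight (\<theta> (app y))" using D.first_commutant_iso by blast
 have rc1: "relative_commutant (\<Phi> ` R) R = app ` D.rc 1" using rc[of 1] by simp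
 \<comment> \<open>Both weights are \<open>p i / q\<close>, as \<open>d t0 = q\<close>.\<close>
 have "multimatrix_trace n D.weight X = multimatrix_trace n s X" for X
  unfolding multimatrix_trace_def by (intro sum.cong refl) (use p D(2) qs in auto)
 hence "ALL x : relative_commutant (\<Phi> ` R) R. \<tau> x = multimatrix_trace n s (\<theta> x)" using \<theta>(2) unfolding rc1 by auto
 thus ?thesis using hom D.tensor_power_iso \<theta>(1)[folded rc1] unfolding rc
  by (intro bexI[of _ \<Phi>] conjI allI impI bexI[of _ \<theta>]) (simp_all add: rc)
qed

end
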